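(* Let $H$ be a real self-adjoint operator in $\mathcal H$. Suppose $H$ has an eigenvalue $\lambda_0$ of finite multiplicity $n\ge 2$ which is embedded in the continuous spectrum of $H$ and isolated in $\sigma_{pp}(H)$, with corresponding eigenspace contained in $\bigcap_{s\ge 0}\mathcal H_s$. Let $k\ge 1$ be an integer and suppose that $\overline H=H+P_0$ satisfies the $C^k$ limiting absorption hypothesis near $\lambda_0$ with threshold $s_1\ge 0$. Fix $s>s_1$, let $\delta_1>0$ be the corresponding number in that hypothesis, and let $X_s$ be a perturbation space. Suppose: (a) the multiplicity of the continuous spectrum of $H$ in $(\lambda_0-\delta_1,\lambda_0+\delta_1)$ is $m<\infty$; (b) there exists a real vector $\psi_1\in\operatorname{Ran}P_0$ such that the complex linear span of $\{W\psi_1: W\in X_s\}$ is dense in $\mathcal H_s$. Then there exist a $C^k$ manifold $\mathcal M\subset X_s$ of codimension $\nu:=m+n-1$, a neighborhood $\mathcal O$ of $0\in X_s$ and a $\delta>0$ such that if $W\in\mathcal M\cap\mathcal O$ then $H+W$ has an embedded eigenvalue $\lambda_1(W)\in(\lambda_0-\delta,\lambda_0+\delta)$, where $\lambda_1$ is the function associated with $\psi_1$ described in the context.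
   Context: Setting. $\mathcal H$ is a complex Hilbert space with an antiunitary involution $C$: $C$ is conjugate-linear, $C^2=I$ and $\langle Cf,Cg\rangle=\overline{\langle f,g\rangle}$. A vector $f$ is real if $Cf=f$; an operator $T$ is real if $TC=CT$. A scale of Hilbert spaces $\mathcal H_s$, $s\in\mathbb R$, is given with $\mathcal H_0=\mathcal H$; the dual of $\mathcal H_s$ is $\mathcal H_{-s}$ via the inner product of $\mathcal H$ (the pairing is also written $\langle\cdot,\cdot\rangle$); $\mathcal H_s$ is continuously embedded in $\mathcal H_t$ for $s\ge t$, and dense in it for $s>t$; $\|f\|_{\mathcal H}\le\|f\|_{\mathcal H_s}$ for $s>0$; and $C:\mathcal H_s\to\mathcal H_s$ is bounded for every $s$. $\mathcal L(X,Y)$ denotes bounded linear operators. $\sigma_{pp}(H)$ is the set of eigenvalues of $H$. The continuous spectrum $\sigma_c(H)$ is the spectrum of $H$ restricted to the orthogonal complement of the closed span of its eigenvectors; an eigenvalue is embedded if it lies in the continuous spectrum. $P_0$ is the orthogonal projection in $\mathcal H$ onto the eigenspace of $H$ for $\lambda_0$, and $\overline H:=H+P_0$. $C^k$ limiting absorption hypothesis with threshold $s_1\ge0$: for any $s>s_1$ there is $\delta_1>0$ such that the norm limits $(\overline H-\lambda\pm i0)^{-1}:=\lim_{\epsilon\downarrow0}(\overline H-\lambda\pm i\epsilon)^{-1}$ exist in $\mathcal L(\mathcal H_s,\mathcal H_{-s})$ and are $C^k$ in $\lambda$ in the norm topology for $\lambda\in(\lambda_0-\delta_1,\lambda_0+\delta_1)$.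 $\delta(\overline H-\lambda):=\frac1{2\pi i}\left((\overline H-\lambda-i0)^{-1}-(\overline H-\lambda+i0)^{-1}\right)\in\mathcal L(\mathcal H_s,\mathcal H_{-s})$. The multiplicity of the continuous spectrum of $H$ at $\lambda$ is by definition $\dim\operatorname{Ran}\delta(\overline H-\lambda)$; condition (a) means that it equals $m$ at every $\lambda$ in the interval. Perturbation space $X_s$: a real Banach space whose elements are bounded self-adjoint operators on $\mathcal H$, with $X_s\subset\{W\in\mathcal L(\mathcal H_{-s},\mathcal H_s): W\text{ is real and self-adjoint on }\mathcal H\}$, the inclusion being continuous. For $\lambda$ near $\lambda_0$ and $W\in X_s$ near $0$ the norm limits $(\overline H+W-\lambda\pm i0)^{-1}=\lim_{\epsilon\downarrow 0}(\overline H+W-\lambda\pm i\epsilon)^{-1}$ exist in $\mathcal L(\mathcal H_s,\mathcal H_{-s})$, and $A(\lambda,W):=\frac12P_0\left((\overline H+W-\lambda-i0)^{-1}+(\overline H+W-\lambda+i0)^{-1}\right)P_0$. With $\psi_1$ scaled to have norm $1$ in $\mathcal H$, the function $\lambda_1$ is the (by the implicit function theorem, unique near $\lambda_0$) $C^k$ real-valued function defined in a neighborhood of $0$ in $X_s$ with $\lambda_1(0)=\lambda_0$ and $\langle\psi_1,A(\lambda_1(W),W)\psi_1\rangle=1$. A $C^k$ manifold of codimension $\nu$ in a real Banach space $X$ is a subset which near each of its points is the graph of a $C^k$ map from an open subset of a closed subspace of codimension $\nu$ into a $\nu$-dimensional complement. *)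

theory Defs
  imports "HOL-Analysis.Analysis"
begin

section \<open>Complex vector spaces\<close>

class complex_vector = ab_group_add +
  fixes scaleC :: "complex \<Rightarrow> 'a \<Rightarrow> 'a"  (infixr \<open>*\<^sub>C\<close> 75)
  assumes scaleC_add_right: "a *\<^sub>C (x + y) = a *\<^sub>C x + a *\<^sub>C y"
    and scaleC_add_left: "(a + b) *\<^sub>C x = a *\<^sub>C x + b *\<^sub>C x"
    and scaleC_scaleC: "a *\<^sub>C b *\<^sub>C x = (a * b) *\<^sub>C x"
    and scaleC_one: "1 *\<^sub>C x = x"

global_interpretation complex_vector:
  vector_space "scaleC :: complex \<Rightarrow> 'a \<Rightarrow> 'a::complex_vector"
  defines csubspace = complex_vector.subspace
    and cspan = complex_vector.span
    and cdependent = complex_vector.dependent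
  by unfold_locales (simp_all add: scaleC_add_right scaleC_add_left scaleC_scaleC scaleC_one)

(* The library's dim is 0 on infinite-dimensional spaces, hence the explicit finite basis. *)
definition has_cdim :: "'v::complex_vector set \<Rightarrow> nat \<Rightarrow> bool" where
  "has_cdim V n \<longleftrightarrow> (\<exists>B. finite B \<and> card B = n \<and> \<not> cdependent B \<and> cspan B = V)"

definition clinear_on :: "'v::complex_vector set \<Rightarrow> ('v \<Rightarrow> 'w::complex_vector) \<Rightarrow> bool" where
  "clinear_on V T \<longleftrightarrow>
     (\<forall>f\<in>V. \<forall>g\<in>V. T (f + g) = T f + T g) \<and> (\<forall>f\<in>V. \<forall>c. T (c *\<^sub>C f) = c *\<^sub>C T f)"


section \<open>Scales of Hilbert spaces\<close>

(* Inner products are linear in the second argument. *)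
definition norm_of :: "('v \<Rightarrow> 'v \<Rightarrow> complex) \<Rightarrow> 'v \<Rightarrow> real" where
  "norm_of B f = sqrt (Re (B f f))"

definition hilbert_space_on ::
    "'v::complex_vector set \<Rightarrow> ('v \<Rightarrow> 'v \<Rightarrow> complex) \<Rightarrow> bool" where
  "hilbert_space_on V B \<longleftrightarrow>
     csubspace V \<and>
     (\<forall>f\<in>V. \<forall>g\<in>V. \<forall>h\<in>V. B f (g + h) = B f g + B f h) \<and>
     (\<forall>f\<in>V. \<forall>g\<in>V. \<forall>c. B f (c *\<^sub>C g) = c * B f g) \<and>
     (\<forall>f\<in>V. \<forall>g\<in>V. B f g = cnj (B g f)) \<and>
     (\<forall>f\<in>V. f \<noteq> 0 \<longrightarrow> 0 < Re (B f f)) \<and>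
     (\<forall>X::nat \<Rightarrow> 'v. range X \<subseteq> V \<and>
        (\<forall>e>0. \<exists>N. \<forall>i\<ge>N. \<forall>j\<ge>N. norm_of B (X i - X j) < e) \<longrightarrow>
        (\<exists>f\<in>V. (\<lambda>i. norm_of B (X i - f)) \<longlonglongrightarrow> 0))"

(* All spaces of the scale live in one complex vector space (their union, say), so that the
   embeddings are inclusions.  "ip S t" is the inner product of "sp S t"; "pairing S" is the
   sesquilinear pairing between "sp S t" and "sp S (- t)", for every t; "cj S" is the
   conjugation, together with its extensions to the spaces of negative index. *)
record 'v scale =
  sp :: "real \<Rightarrow> 'v set"
  ip :: "real \<Rightarrow> 'v \<Rightarrow> 'v \<Rightarrow> complex"
  pairing :: "'v \<Rightarrow> 'v \<Rightarrow> complex"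
  cj :: "'v \<Rightarrow> 'v"

definition hnorm :: "'v scale \<Rightarrow> real \<Rightarrow> 'v \<Rightarrow> real" where
  "hnorm S t f = norm_of (ip S t) f"

definition hclosure :: "'v::complex_vector scale \<Rightarrow> real \<Rightarrow> 'v set \<Rightarrow> 'v set" where
  "hclosure S t A = {f \<in> sp S t. \<forall>e>0. \<exists>g\<in>A. hnorm S t (f - g) < e}"

definition dense_in :: "'v::complex_vector scale \<Rightarrow> real \<Rightarrow> 'v set \<Rightarrow> bool" where
  "dense_in S t A \<longleftrightarrow> A \<subseteq> sp S t \<and> hclosure S t A = sp S t"

definition bounded_functional :: "'v::complex_vector scale \<Rightarrow> real \<Rightarrow> ('v \<Rightarrow> complex) \<Rightarrow> bool" where
  "bounded_functional S t \<phi> \<longleftrightarrow>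
     (\<forall>f\<in>sp S t. \<forall>g\<in>sp S t. \<phi> (f + g) = \<phi> f + \<phi> g) \<and>
     (\<forall>f\<in>sp S t. \<forall>c. \<phi> (c *\<^sub>C f) = c * \<phi> f) \<and>
     (\<exists>K. \<forall>f\<in>sp S t. norm (\<phi> f) \<le> K * hnorm S t f)"

(* "sp S (- t)" is the dual of "sp S t": the pairing is bounded and represents every bounded
   functional uniquely.  By the open mapping theorem the norm of "sp S (- t)" is then equivalent
   to the dual norm; equality of the two norms is not required. *)
definition duality :: "'v::complex_vector scale \<Rightarrow> bool" where
  "duality S \<longleftrightarrow>
     (\<forall>f\<in>sp S 0. \<forall>g\<in>sp S 0. pairing S f g = ip S 0 f g) \<and>
     (\<forall>t. \<forall>f\<in>sp S t. \<forall>g\<in>sp S (- t).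
        pairing S f g = cnj (pairing S g f) \<and>
        (\<forall>h\<in>sp S (- t). pairing S f (g + h) = pairing S f g + pairing S f h) \<and>
        (\<forall>c. pairing S f (c *\<^sub>C g) = c * pairing S f g)) \<and>
     (\<forall>t. \<exists>K. \<forall>f\<in>sp S t. \<forall>g\<in>sp S (- t).
        norm (pairing S f g) \<le> K * hnorm S t f * hnorm S (- t) g) \<and>
     (\<forall>t \<phi>. bounded_functional S t \<phi> \<longrightarrow>
        (\<exists>!g. g \<in> sp S (- t) \<and> (\<forall>f\<in>sp S t. \<phi> f = pairing S g f)))"

definition conjugation :: "'v::complex_vector scale \<Rightarrow> bool" where
  "conjugation S \<longleftrightarrow>
     (\<forall>t. \<forall>f\<in>sp S t. cj S f \<in> sp S t) \<and>
     (\<forall>t. \<forall>f\<in>sp S t. \<forall>g\<in>sp S t. cj S (f + g) = cj S f + cj S g) \<and>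
     (\<forall>t. \<forall>f\<in>sp S t. \<forall>c. cj S (c *\<^sub>C f) = cnj c *\<^sub>C cj S f) \<and>
     (\<forall>t. \<exists>K. \<forall>f\<in>sp S t. hnorm S t (cj S f) \<le> K * hnorm S t f) \<and>
     (\<forall>f\<in>sp S 0. cj S (cj S f) = f) \<and>
     (\<forall>f\<in>sp S 0. \<forall>g\<in>sp S 0. ip S 0 (cj S f) (cj S g) = cnj (ip S 0 f g))"

definition hilbert_scale :: "'v::complex_vector scale \<Rightarrow> bool" where
  "hilbert_scale S \<longleftrightarrow>
     (\<forall>t. hilbert_space_on (sp S t) (ip S t)) \<and>
     (\<forall>s t. t \<le> s \<longrightarrow> sp S s \<subseteq> sp S t \<and> (\<exists>K. \<forall>f\<in>sp S s. hnorm S t f \<le> K * hnorm S s f)) \<and>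
     (\<forall>s t. t < s \<longrightarrow> dense_in S t (sp S s)) \<and>
     (\<forall>s>0. \<forall>f\<in>sp S s. hnorm S 0 f \<le> hnorm S s f) \<and>
     duality S \<and> conjugation S"


section \<open>Bounded operators between the spaces of a scale\<close>

(* Operators are extended by 0 outside their domain "sp S a", so that equality of operators
   is equality of functions. *)
definition blin :: "'v::complex_vector scale \<Rightarrow> real \<Rightarrow> real \<Rightarrow> ('v \<Rightarrow> 'v) set" where
  "blin S a b = {T. clinear_on (sp S a) T \<and> T ` sp S a \<subseteq> sp S b \<and>
     (\<exists>K. \<forall>f\<in>sp S a. hnorm S b (T f) \<le> K * hnorm S a f) \<and> (\<forall>f. f \<notin> sp S a \<longrightarrow> T f = 0)}"

definition restrict_to :: "'v::complex_vector scale \<Rightarrow> real \<Rightarrow> ('v \<Rightarrow> 'v) \<Rightarrow> 'v \<Rightarrow> 'v" where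
  "restrict_to S a T = (\<lambda>f. if f \<in> sp S a then T f else 0)"

definition opnorm :: "'v::complex_vector scale \<Rightarrow> real \<Rightarrow> real \<Rightarrow> ('v \<Rightarrow> 'v) \<Rightarrow> real" where
  "opnorm S a b T = (SUP f\<in>{f \<in> sp S a. hnorm S a f \<le> 1}. hnorm S b (T f))"

definition has_norm_limit ::
    "'v::complex_vector scale \<Rightarrow> real \<Rightarrow> real \<Rightarrow> (real \<Rightarrow> 'v \<Rightarrow> 'v) \<Rightarrow> ('v \<Rightarrow> 'v) \<Rightarrow> real filter \<Rightarrow> bool"
  where
  "has_norm_limit S a b T R F \<longleftrightarrow>
     R \<in> blin S a b \<and> (\<forall>\<^sub>F x in F. T x \<in> blin S a b) \<and>
     ((\<lambda>x. opnorm S a b (\<lambda>f. T x f - R f)) \<longlongrightarrow> 0) F"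

(* "D j" is the j-th derivative of the operator-valued function R. *)
definition Ck_operator_family ::
    "'v::complex_vector scale \<Rightarrow> real \<Rightarrow> real \<Rightarrow> nat \<Rightarrow> real set \<Rightarrow> (real \<Rightarrow> 'v \<Rightarrow> 'v) \<Rightarrow> bool" where
  "Ck_operator_family S a b k J R \<longleftrightarrow>
     (\<exists>D::nat \<Rightarrow> real \<Rightarrow> 'v \<Rightarrow> 'v.
        (\<forall>x\<in>J. D 0 x = R x) \<and>
        (\<forall>j\<le>k. \<forall>x\<in>J. D j x \<in> blin S a b) \<and>
        (\<forall>j<k. \<forall>x\<in>J. has_norm_limit S a b
           (\<lambda>y f. of_real (1 / (y - x)) *\<^sub>C (D j y f - D j x f)) (D (Suc j) x) (at x)) \<and>
        (\<forall>x\<in>J. has_norm_limit S a b (D k) (D k x) (at x)))"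


section \<open>Unbounded operators in the space of index 0\<close>

(* An operator is given by its domain D and a function T whose values outside D are irrelevant.
   The last clause equates the graph of the adjoint with the graph of T. *)
definition selfadjoint :: "'v::complex_vector scale \<Rightarrow> 'v set \<Rightarrow> ('v \<Rightarrow> 'v) \<Rightarrow> bool" where
  "selfadjoint S D T \<longleftrightarrow>
     csubspace D \<and> dense_in S 0 D \<and> clinear_on D T \<and> T ` D \<subseteq> sp S 0 \<and>
     {(g, h). g \<in> sp S 0 \<and> h \<in> sp S 0 \<and> (\<forall>f\<in>D. ip S 0 (T f) g = ip S 0 f h)}
       = {(g, T g) | g. g \<in> D}"

definition real_operator :: "'v::complex_vector scale \<Rightarrow> 'v set \<Rightarrow> ('v \<Rightarrow> 'v) \<Rightarrow> bool" where
  "real_operator S D T \<longleftrightarrow> (\<forall>f\<in>D. cj S f \<in> D \<and> T (cj S f) = cj S (T f))"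

definition eigenspace :: "'v::complex_vector set \<Rightarrow> ('v \<Rightarrow> 'v) \<Rightarrow> complex \<Rightarrow> 'v set" where
  "eigenspace D T z = {f \<in> D. T f = z *\<^sub>C f}"

definition point_spectrum :: "'v::complex_vector set \<Rightarrow> ('v \<Rightarrow> 'v) \<Rightarrow> complex set" where
  "point_spectrum D T = {z. \<exists>f\<in>eigenspace D T z. f \<noteq> 0}"

(* Spectrum of T, with domain D, as an operator in the closed subspace K of "sp S 0". *)
definition spectrum_in ::
    "'v::complex_vector scale \<Rightarrow> 'v set \<Rightarrow> 'v set \<Rightarrow> ('v \<Rightarrow> 'v) \<Rightarrow> complex set" where
  "spectrum_in S K D T = - {z. bij_betw (\<lambda>f. T f - z *\<^sub>C f) D K \<and>
     (\<exists>c>0. \<forall>f\<in>D. c * hnorm S 0 f \<le> hnorm S 0 (T f - z *\<^sub>C f))}"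

definition pp_subspace :: "'v::complex_vector scale \<Rightarrow> 'v set \<Rightarrow> ('v \<Rightarrow> 'v) \<Rightarrow> 'v set" where
  "pp_subspace S D T = hclosure S 0 (cspan (\<Union>z. eigenspace D T z))"

definition cont_subspace :: "'v::complex_vector scale \<Rightarrow> 'v set \<Rightarrow> ('v \<Rightarrow> 'v) \<Rightarrow> 'v set" where
  "cont_subspace S D T = {f \<in> sp S 0. \<forall>e\<in>pp_subspace S D T. ip S 0 e f = 0}"

definition cont_spectrum :: "'v::complex_vector scale \<Rightarrow> 'v set \<Rightarrow> ('v \<Rightarrow> 'v) \<Rightarrow> complex set" where
  "cont_spectrum S D T = spectrum_in S (cont_subspace S D T) (D \<inter> cont_subspace S D T) T"

definition embedded_eigenvalue ::
    "'v::complex_vector scale \<Rightarrow> 'v set \<Rightarrow> ('v \<Rightarrow> 'v) \<Rightarrow> real \<Rightarrow> bool" where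
  "embedded_eigenvalue S D T lam \<longleftrightarrow>
     complex_of_real lam \<in> point_spectrum D T \<and> complex_of_real lam \<in> cont_spectrum S D T"

definition resolvent :: "'v::complex_vector set \<Rightarrow> ('v \<Rightarrow> 'v) \<Rightarrow> complex \<Rightarrow> 'v \<Rightarrow> 'v" where
  "resolvent D T z f = (THE g. g \<in> D \<and> T g - z *\<^sub>C g = f)"

(* R is the norm limit of the inverses of T - lam + i \<sigma> \<epsilon> as \<epsilon> decreases to 0; \<sigma> is 1 or -1. *)
definition is_boundary_value :: "'v::complex_vector scale \<Rightarrow> real \<Rightarrow> 'v set \<Rightarrow> ('v \<Rightarrow> 'v) \<Rightarrow>
    real \<Rightarrow> real \<Rightarrow> ('v \<Rightarrow> 'v) \<Rightarrow> bool" where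
  "is_boundary_value S s D T \<sigma> lam R \<longleftrightarrow>
     has_norm_limit S s (- s)
       (\<lambda>\<epsilon>. restrict_to S s (resolvent D T (of_real lam - \<i> * of_real (\<sigma> * \<epsilon>)))) R (at_right 0)"

definition boundary_value :: "'v::complex_vector scale \<Rightarrow> real \<Rightarrow> 'v set \<Rightarrow> ('v \<Rightarrow> 'v) \<Rightarrow>
    real \<Rightarrow> real \<Rightarrow> 'v \<Rightarrow> 'v" where
  "boundary_value S s D T \<sigma> lam = (THE R. is_boundary_value S s D T \<sigma> lam R)"

definition Ck_limiting_absorption :: "'v::complex_vector scale \<Rightarrow> nat \<Rightarrow> real \<Rightarrow> 'v set \<Rightarrow>
    ('v \<Rightarrow> 'v) \<Rightarrow> real set \<Rightarrow> bool" where
  "Ck_limiting_absorption S k s D T J \<longleftrightarrow>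
     (\<forall>\<sigma>\<in>{1, -1}. (\<forall>lam\<in>J. \<exists>R. is_boundary_value S s D T \<sigma> lam R) \<and>
        Ck_operator_family S s (- s) k J (boundary_value S s D T \<sigma>))"

definition spectral_delta :: "'v::complex_vector scale \<Rightarrow> real \<Rightarrow> 'v set \<Rightarrow> ('v \<Rightarrow> 'v) \<Rightarrow>
    real \<Rightarrow> 'v \<Rightarrow> 'v" where
  "spectral_delta S s D T lam f = (1 / (2 * of_real pi * \<i>)) *\<^sub>C
     (boundary_value S s D T (- 1) lam f - boundary_value S s D T 1 lam f)"

(* For f in "sp S 0" this is the orthogonal projection onto E; if E lies in "sp S s", it is
   also its continuous extension to "sp S (- s)". *)
definition proj_onto :: "'v::complex_vector scale \<Rightarrow> 'v set \<Rightarrow> 'v \<Rightarrow> 'v" where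
  "proj_onto S E f = (THE p. p \<in> E \<and> (\<forall>e\<in>E. pairing S e p = pairing S e f))"

definition eigenproj :: "'v::complex_vector scale \<Rightarrow> 'v set \<Rightarrow> ('v \<Rightarrow> 'v) \<Rightarrow> real \<Rightarrow> 'v \<Rightarrow> 'v" where
  "eigenproj S D H lam0 = proj_onto S (eigenspace D H (of_real lam0))"

definition Hbar :: "'v::complex_vector scale \<Rightarrow> 'v set \<Rightarrow> ('v \<Rightarrow> 'v) \<Rightarrow> real \<Rightarrow> 'v \<Rightarrow> 'v" where
  "Hbar S D H lam0 f = H f + eigenproj S D H lam0 f"


section \<open>Perturbations\<close>

(* A Banach space of operators is given as a Banach space 'x together with an injective
   real-linear map \<iota> assigning to each element of 'x the operator that it is. *)
definition perturbation_space ::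
    "'v::complex_vector scale \<Rightarrow> real \<Rightarrow> ('x::banach \<Rightarrow> 'v \<Rightarrow> 'v) \<Rightarrow> bool" where
  "perturbation_space S s \<iota> \<longleftrightarrow>
     inj \<iota> \<and>
     (\<forall>U W f. \<iota> (U + W) f = \<iota> U f + \<iota> W f) \<and>
     (\<forall>r W f. \<iota> (r *\<^sub>R W) f = of_real r *\<^sub>C \<iota> W f) \<and>
     (\<forall>W. \<iota> W \<in> blin S (- s) s \<and> real_operator S (sp S 0) (\<iota> W) \<and> selfadjoint S (sp S 0) (\<iota> W)) \<and>
     (\<exists>K. \<forall>W. opnorm S (- s) s (\<iota> W) \<le> K * norm W)"

definition A_op :: "'v::complex_vector scale \<Rightarrow> real \<Rightarrow> 'v set \<Rightarrow> ('v \<Rightarrow> 'v) \<Rightarrow> real \<Rightarrow>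
    real \<Rightarrow> ('v \<Rightarrow> 'v) \<Rightarrow> 'v \<Rightarrow> 'v" where
  "A_op S s D H lam0 lam W f =
     (let P = eigenproj S D H lam0; T = (\<lambda>g. Hbar S D H lam0 g + W g) in
      (1 / 2) *\<^sub>C P (boundary_value S s D T (- 1) lam (P f) + boundary_value S s D T 1 lam (P f)))"


section \<open>Maps of class C^k and submanifolds of Banach spaces\<close>

definition slots :: "'a set \<Rightarrow> nat \<Rightarrow> 'a list set" where
  "slots E n = {vs. length vs = n \<and> set vs \<subseteq> E}"

definition bounded_multilinear_on ::
    "'a::real_normed_vector set \<Rightarrow> nat \<Rightarrow> ('a list \<Rightarrow> 'b::real_normed_vector) \<Rightarrow> bool" where
  "bounded_multilinear_on E n T \<longleftrightarrow>
     (\<forall>vs\<in>slots E n. \<forall>i<n. \<forall>u\<in>E. \<forall>v\<in>E. \<forall>a b.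
        T (vs[i := a *\<^sub>R u + b *\<^sub>R v]) = a *\<^sub>R T (vs[i := u]) + b *\<^sub>R T (vs[i := v])) \<and>
     (\<exists>K. \<forall>vs\<in>slots E n. norm (T vs) \<le> K * prod_list (map norm vs))"

(* U is a relatively open subset of the subspace E.  "D j x" is the j-th Frechet derivative of f
   at x, as a bounded j-linear map on E; differentiability and continuity are with respect to the
   norm of multilinear maps. *)
definition Ck_on :: "nat \<Rightarrow> 'a::real_normed_vector set \<Rightarrow> 'a set \<Rightarrow>
    ('a \<Rightarrow> 'b::real_normed_vector) \<Rightarrow> bool" where
  "Ck_on k E U f \<longleftrightarrow>
     (\<exists>D::nat \<Rightarrow> 'a \<Rightarrow> 'a list \<Rightarrow> 'b.
        (\<forall>x\<in>U. D 0 x [] = f x) \<and>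
        (\<forall>j\<le>k. \<forall>x\<in>U. bounded_multilinear_on E j (D j x)) \<and>
        (\<forall>j<k. \<forall>x\<in>U. \<forall>e>0. \<exists>d>0. \<forall>h\<in>E. norm h < d \<and> x + h \<in> U \<longrightarrow>
           (\<forall>vs\<in>slots E j. norm (D j (x + h) vs - D j x vs - D (Suc j) x (h # vs))
              \<le> e * norm h * prod_list (map norm vs))) \<and>
        (\<forall>x\<in>U. \<forall>e>0. \<exists>d>0. \<forall>y\<in>U. norm (y - x) < d \<longrightarrow>
           (\<forall>vs\<in>slots E k. norm (D k y vs - D k x vs) \<le> e * prod_list (map norm vs))))"

definition Ck_manifold :: "nat \<Rightarrow> nat \<Rightarrow> 'x::real_normed_vector set \<Rightarrow> bool" where
  "Ck_manifold k \<nu> M \<longleftrightarrow>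
     (\<forall>p\<in>M. \<exists>E F B V U g.
        subspace E \<and> closed E \<and>
        F = span B \<and> finite B \<and> independent B \<and> card B = \<nu> \<and>
        E \<inter> F = {0} \<and> {u + v | u v. u \<in> E \<and> v \<in> F} = UNIV \<and>
        open V \<and> p \<in> V \<and>
        openin (top_of_set E) U \<and> g ` U \<subseteq> F \<and> Ck_on k E U g \<and>
        M \<inter> V = (\<lambda>u. u + g u) ` U)"


section \<open>The eigenvalue branch determined by an eigenvector\<close>

(* lam1 is the function given by the implicit function theorem near (lam0, 0): for W in N it is the
   only solution lam within distance r of lam0. *)
definition eigenvalue_branch :: "'v::complex_vector scale \<Rightarrow> nat \<Rightarrow> real \<Rightarrow> 'v set \<Rightarrow> ('v \<Rightarrow> 'v) \<Rightarrow>
    real \<Rightarrow> ('x::banach \<Rightarrow> 'v \<Rightarrow> 'v) \<Rightarrow> 'v \<Rightarrow> 'x set \<Rightarrow> real \<Rightarrow> ('x \<Rightarrow> real) \<Rightarrow> bool" where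
  "eigenvalue_branch S k s D H lam0 \<iota> \<psi> N r lam1 \<longleftrightarrow>
     open N \<and> 0 \<in> N \<and> r > 0 \<and>
     (\<forall>W\<in>N. \<forall>lam\<in>{lam0 - r<..<lam0 + r}. \<forall>\<sigma>\<in>{1, -1}.
        \<exists>R. is_boundary_value S s D (\<lambda>g. Hbar S D H lam0 g + \<iota> W g) \<sigma> lam R) \<and>
     Ck_on k UNIV N lam1 \<and> lam1 0 = lam0 \<and>
     (\<forall>W\<in>N. lam1 W \<in> {lam0 - r<..<lam0 + r} \<and>
        (\<forall>lam\<in>{lam0 - r<..<lam0 + r}.
           pairing S \<psi> (A_op S s D H lam0 lam (\<iota> W) \<psi>) = 1 \<longleftrightarrow> lam = lam1 W))"

end

(* Write T_W = H + P_0 + W and Y(l, W) = (T_W - l - i0)^(-1), with values in L(H_s, H_-s).  If psi is in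
  Ran P_0 and u = Y(l, W) psi is a vector of H with P_0 u = psi, then (H + W) u = l u.

  The spectral density q = Im Y has rank m at W = 0; by the resolvent equation the density of T_W factors
  through it, so its rank is at most m for small W.  Hence the m equations Im <g_i, Y psi> = 0, for vectors g_i
  whose Gram matrix with respect to q is close to the identity, give q(l) psi = 0, and then
  <psi, q(mu) psi> = O((mu - l)^2) because Y is differentiable.  Dominating 1 / |x - l - i y|^2 by finitely many
  1 / |x - mu_j - i h_j|^2 on the real line (nonnegative rational functions of T_W are nonnegative forms)
  turns this into a bound of (T_W - l - i y)^(-1) psi in H as y decreases to 0, so that u is in H.
  With Re <e_j, Y psi> = 0 for the other n - 1 vectors of a real orthonormal basis of Ran P_0, these are m + n - 1
  real equations for W on the graph l = lambda_1(W); the density of the vectors W psi in H_s makes their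
  differentials at W = 0 independent.

  Embeddedness: m > 0, since otherwise T_0 - lambda_0 would be invertible.  The vectors
  sqrt(eps) (T_W - l - i eps)^(-1) g_i are a Weyl sequence tending weakly to 0, and they are not absorbed by the
  other eigenvectors because H + W has at most n eigenvalues near lambda_0. *)
theory Submission
 imports Defs "HOL-Library.Function_Algebras" "HOL-Computational_Algebra.Fundamental_Theorem_Algebra"
begin

text \<open>The boundary values are only operators from H_s to H_-s, so Y psi is a priori no vector
  of H. Positivity for functions of T_W is therefore drawn from finitely many resolvents off the
  axis: applied to one vector, they become polynomials in T_W acting on a single other vector, and a
  polynomial that is nonnegative on the line has the form |q|^2. The count m + n - 1 rests on
  reality. Resolvents commute with the conjugation up to conjugating the parameter, so Y is
  symmetric on real vectors and its density is real there: each g_i costs one real equation, not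
  two. Once the density annihilates psi, Cauchy-Schwarz makes every <e_j, Y psi> real, so only the
  real parts are left to be imposed. Adding P_0 moves the eigenvalue to lambda_0 + 1, whence Y(l, 0)
  e_j = e_j / (lambda_0 + 1 - l). At (lambda_0, 0) the l-derivative of the matrix <e_i, Y e_j> is
  thus the identity: the equation of psi can be solved for l, all other equations are stationary in
  l, and H + W has at most n eigenvalues near lambda_0.\<close>

abbreviation limseq ("((_)/ ----> (_))" [60, 60] 60)
 where "X ----> L == X \<longlonglongrightarrow> L"

section \<open>Differential calculus for families of bounded multilinear maps\<close>

text \<open>\<open>bnd x a\<close> says that \<open>x\<close> belongs to a given subspace and has seminorm at most \<open>a\<close> there.\<close>
locale bounding =
 fixes bnd :: "'c::real_vector => real => bool"
 assumes bnd_nonneg: "bnd x a ==> 0 <= a"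
  and bnd_zero: "bnd 0 0"
  and bnd_add: "bnd x a ==> bnd y b ==> bnd (x + y) (a + b)"
  and bnd_scale: "bnd x a ==> bnd (r *\<^sub>R x) (\<bar>r\<bar> * a)"
  and bnd_mono: "bnd x a ==> a <= b ==> bnd x b"
begin

lemma bnd_diff: "bnd x a ==> bnd y b ==> bnd (x - y) (a + b)"
 using bnd_add[of x a "-1 *\<^sub>R y" b] bnd_scale[of y b "-1"] by simp

end

abbreviation norm_bnd :: "'b::real_normed_vector => real => bool" where
 "norm_bnd x a \<equiv> norm x <= a"

lemma bounding_norm: "bounding (norm_bnd :: 'b::real_normed_vector => _)"
proof
 show "norm (x + y) <= a + b" if "norm x <= a" "norm y <= b" for x y :: 'b and a b using norm_triangle_ineq[of x y] that by linarith
 show "norm (r *\<^sub>R x) <= \<bar>r\<bar> * a" if "norm x <= a" for x :: 'b and a r using that by (simp add: mult_left_mono)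
qed (auto intro: order_trans[OF norm_ge_zero])

abbreviation nrm :: "'a::real_normed_vector list => real" where
 "nrm vs \<equiv> prod_list (map norm vs)"

lemma nrm_nonneg: "0 <= nrm vs"
 by (induction vs) auto

text \<open>Linearity is peeled off from the head of the list because differentiation adds its
  direction as a new head; \<open>mlin_update\<close> recovers linearity in an arbitrary
  slot.\<close>

primrec mlin :: "nat => ('a::real_vector list => 'c::real_vector) => bool" where
 "mlin 0 T = True"
| "mlin (Suc p) T \<longleftrightarrow> (ALL u. mlin p (%vs. T (u # vs))) &
   (ALL vs u v a b. length vs = p -->
    T ((a *\<^sub>R u + b *\<^sub>R v) # vs) = a *\<^sub>R T (u # vs) + b *\<^sub>R T (v # vs))"

lemma mlin_update:
 "mlin p T ==> length vs = p ==> i < p ==>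
  T (vs[i := a *\<^sub>R u + b *\<^sub>R v]) = a *\<^sub>R T (vs[i := u]) + b *\<^sub>R T (vs[i := v])"
proof (induction p arbitrary: T vs i)
 case (Suc p)
 obtain w ws where vs: "vs = w # ws" "length ws = p" using Suc.prems(2) by (cases vs) auto
 show ?case
 proof (cases i)
  case 0
  thus ?thesis using Suc.prems vs by simp
 next
  case (Suc j)
  thus ?thesis using Suc.IH[of "%vs. T (w # vs)" ws j] Suc.prems vs by simp
 qed
qed simp

lemma mlin_cong:
 "(!!vs. length vs = p ==> T vs = T' vs) ==> mlin p T ==> mlin p T'"
proof (induction p arbitrary: T T')
 case (Suc p)
 have "mlin p (%vs. T' (u # vs))" for u by (rule Suc.IH[of "%vs. T (u # vs)"]) (use Suc.prems in auto)
 moreover have "T' (u # vs) = T (u # vs)" if "length vs = p" for u vs using Suc.prems(1)[of "u # vs"] that by simp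
 ultimately show ?case using Suc.prems(2) by simp
qed simp

lemma mlin_add: "mlin p T ==> mlin p T' ==> mlin p (%vs. T vs + T' vs)"
 by (induction p arbitrary: T T') (auto simp: algebra_simps)

lemma mlin_zero: "mlin p (%vs. 0)"
 by (induction p) auto

definition bd :: "('c => real => bool) => nat => ('a::real_normed_vector list => 'c) => real => bool" where
 "bd bnd p T K \<longleftrightarrow> (ALL vs. length vs = p --> bnd (T vs) (K * nrm vs))"

definition regular_family :: "('c::real_vector => real => bool) => nat => 'a::real_normed_vector set =>
  ('a => 'a list => 'c) => bool" where
 "regular_family bnd p U G \<longleftrightarrow> (ALL x:U. mlin p (G x) & (EX K>=0. bd bnd p (G x) K) &
   (ALL e>0. \<forall>\<^sub>F y in nhds x. bd bnd p (%vs. G y vs - G x vs) e))"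

definition family_deriv :: "('c::real_vector => real => bool) => nat => 'a::real_normed_vector set =>
  ('a => 'a list => 'c) => ('a => 'a list => 'c) => bool" where
 "family_deriv bnd p U G G' \<longleftrightarrow> (ALL x:U. ALL e>0. \<forall>\<^sub>F y in nhds x.
   bd bnd p (%vs. G y vs - G x vs - G' x ((y - x) # vs)) (e * norm (y - x)))"

text \<open>One more derivative means one more slot. With \<open>p\<close> left arbitrary, the
  product and chain rules follow by induction on the order alone, since derivatives are families of
  the same kind.\<close>

primrec Ck :: "('c::real_vector => real => bool) => nat => nat => 'a::real_normed_vector set =>
  ('a => 'a list => 'c) => bool" where
 "Ck bnd 0 p U G \<longleftrightarrow> regular_family bnd p U G"
| "Ck bnd (Suc k) p U G \<longleftrightarrow> regular_family bnd p U G &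
   (EX G'. family_deriv bnd p U G G' & Ck bnd k (Suc p) U G')"

lemma Ck_regular: "Ck bnd k p U G ==> regular_family bnd p U G"
 by (cases k) auto

lemma Ck_Suc_imp: "Ck bnd (Suc k) p U G ==> Ck bnd k p U G"
proof (induction k arbitrary: p G)
 case (Suc k)
 then obtain G' where G': "family_deriv bnd p U G G'" "Ck bnd (Suc k) (Suc p) U G'"
  "regular_family bnd p U G" by auto
 thus ?case using Suc.IH[OF G'(2)] by auto
qed auto

lemma Ck_le: "Ck bnd k p U G ==> j <= k ==> Ck bnd j p U G"
 by (induction k) (use Ck_Suc_imp le_Suc_eq in blast)+

lemma regular_subset: "regular_family bnd p U G ==> V \<subseteq> U ==> regular_family bnd p V G"
 unfolding regular_family_def by blast

lemma family_deriv_subset: "family_deriv bnd p U G G' ==> V \<subseteq> U ==> family_deriv bnd p V G G'"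
 unfolding family_deriv_def by blast

lemma Ck_subset: "Ck bnd k p U G ==> V \<subseteq> U ==> Ck bnd k p V G"
proof (induction k arbitrary: p G)
 case (Suc k)
 then obtain G' where G': "family_deriv bnd p U G G'" "Ck bnd k (Suc p) U G'"
  "regular_family bnd p U G" by auto
 thus ?case using Suc.IH[OF G'(2) Suc.prems(2)] family_deriv_subset[OF G'(1) Suc.prems(2)]
   regular_subset[OF G'(3) Suc.prems(2)] by auto
qed (use regular_subset in auto)

lemma bdD: "bd bnd p T K ==> length vs = p ==> bnd (T vs) (K * nrm vs)"
 by (simp add: bd_def)

lemma bd_Cons: "bd bnd (Suc p) T K ==> bd bnd p (%vs. T (u # vs)) (K * norm u)"
 unfolding bd_def by (metis (no_types, lifting) length_Cons list.simps(9) mult.assoc prod_list.Cons)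

lemma bd_cong: "(!!vs. length vs = p ==> T vs = T' vs) ==> bd bnd p T K ==> bd bnd p T' K"
 unfolding bd_def by auto

lemma Ck_cong:
 assumes U: "open U" and eq: "!!x vs. x \<in> U ==> length vs = p ==> G x vs = G' x vs"
  and G: "Ck bnd k p U G"
 shows "Ck bnd k p U G'"
proof -
 have reg: "regular_family bnd p U G'" if "regular_family bnd p U G" unfolding regular_family_def
 proof (intro ballI conjI allI impI)
  fix x assume x: "x \<in> U"
  note r = that[unfolded regular_family_def, rule_format, OF x]
  show "mlin p (G' x)" by (rule mlin_cong[of p "G x"]) (use r eq[OF x] in auto)
  show "EX K>=0. bd bnd p (G' x) K" using r bd_cong[of p "G x" "G' x"] eq[OF x] by blast
  fix e :: real assume e: "e > 0"
  have "\<forall>\<^sub>F y in nhds x. y \<in> U" using U x by (rule eventually_nhds_in_open)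
  moreover have "\<forall>\<^sub>F y in nhds x. bd bnd p (%vs. G y vs - G x vs) e" using r e by blast
  ultimately show "\<forall>\<^sub>F y in nhds x. bd bnd p (%vs. G' y vs - G' x vs) e"
  proof eventually_elim
   case (elim y)
   show ?case by (rule bd_cong[OF _ elim(2)]) (use eq elim x in auto)
  qed
 qed
 have der: "family_deriv bnd p U G' D" if "family_deriv bnd p U G D" for D unfolding family_deriv_def
 proof (intro ballI allI impI)
  fix x and e :: real assume x: "x \<in> U" and e: "e > 0"
  have "\<forall>\<^sub>F y in nhds x. y \<in> U" using U x by (rule eventually_nhds_in_open)
  moreover have "\<forall>\<^sub>F y in nhds x. bd bnd p (%vs. G y vs - G x vs - D x ((y - x) # vs)) (e * norm (y - x))"
   using that e x unfolding family_deriv_def by blast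
  ultimately show "\<forall>\<^sub>F y in nhds x. bd bnd p (%vs. G' y vs - G' x vs - D x ((y - x) # vs)) (e * norm (y - x))"
  proof eventually_elim
   case (elim y)
   show ?case by (rule bd_cong[OF _ elim(2)]) (use eq elim x in auto)
  qed
 qed
 show ?thesis using G reg der by (cases k) auto
qed

context bounding
begin

lemma bd_mono: "bd bnd p T K ==> K <= K' ==> bd bnd p T K'"
 unfolding bd_def using bnd_mono[OF _ mult_right_mono[OF _ nrm_nonneg]] by blast

lemma bd_add: "bd bnd p T K ==> bd bnd p T' K' ==> bd bnd p (%vs. T vs + T' vs) (K + K')"
 unfolding bd_def by (simp add: bnd_add distrib_right)

lemma bd_zero: "0 <= K ==> bd bnd p (%vs. 0) K"
 unfolding bd_def using bnd_mono[OF bnd_zero] by (simp add: nrm_nonneg)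

lemma Ck_const_family:
 assumes "mlin p T" "bd bnd p T K" "0 <= K"
 shows "Ck bnd k p U (%x. T)"
proof (cases k)
 case 0
 thus ?thesis using assms by (auto simp: regular_family_def bd_zero)
next
 case (Suc j)
 have zero: "Ck bnd j p U (%x vs. 0)" for p j and U :: "'a set"
 proof (induction j arbitrary: p)
  have reg: "regular_family bnd p U (%x vs. 0)" for p by (auto simp: regular_family_def mlin_zero bd_zero intro!: exI[of _ 0])
  {
   case 0
   show ?case using reg by simp
  next
   case (Suc j)
   have "family_deriv bnd p U (%x vs. 0) (%x vs. 0)" by (auto simp: family_deriv_def bd_zero)
   thus ?case using reg Suc[of "Suc p"] unfolding Ck.simps by blast
  }
 qed
 show ?thesis using zero[of j "Suc p" U] assms Suc by (auto simp: bd_zero regular_family_def family_deriv_def intro!: exI[of _ "%x vs. 0"])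
qed

lemma Ck_add:
 fixes G H :: "'d::real_normed_vector => 'd list => 'c"
 shows "Ck bnd k p U G ==> Ck bnd k p U H ==> Ck bnd k p U (%x vs. G x vs + H x vs)"
proof (induction k arbitrary: p G H)
 have reg: "regular_family bnd p U (%x vs. G x vs + H x vs)"
  if r: "regular_family bnd p U G" "regular_family bnd p U H" for p and G H :: "'d => 'd list => 'c" unfolding regular_family_def
 proof (intro ballI conjI allI impI)
  fix x assume x: "x \<in> U"
  note g = r(1)[unfolded regular_family_def, rule_format, OF x]
  note h = r(2)[unfolded regular_family_def, rule_format, OF x]
  show "mlin p (%vs. G x vs + H x vs)" using g h mlin_add by blast
  obtain K L where "K >= 0" "bd bnd p (G x) K" "L >= 0" "bd bnd p (H x) L" using g h by blast
  thus "EX K>=0. bd bnd p (%vs. G x vs + H x vs) K" using bd_add[of p "G x" K "H x" L] by (intro exI[of _ "K + L"]) auto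
  fix e :: real assume "e > 0"
  hence "e / 2 > 0" by simp
  hence "\<forall>\<^sub>F y in nhds x. bd bnd p (%vs. G y vs - G x vs) (e/2)"
   "\<forall>\<^sub>F y in nhds x. bd bnd p (%vs. H y vs - H x vs) (e/2)" using g h by blast+
  thus "\<forall>\<^sub>F y in nhds x. bd bnd p (%vs. G y vs + H y vs - (G x vs + H x vs)) e"
  proof eventually_elim
   case (elim y)
   show ?case by (rule bd_cong[OF _ bd_mono[OF bd_add[OF elim]]]) auto
  qed
 qed
 {
  case 0
  thus ?case using reg by simp
 next
  case (Suc k)
  obtain G' where G': "family_deriv bnd p U G G'" "Ck bnd k (Suc p) U G'" "regular_family bnd p U G" using Suc.prems by auto
  obtain H' where H': "family_deriv bnd p U H H'" "Ck bnd k (Suc p) U H'" "regular_family bnd p U H" using Suc.prems by auto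
  have "family_deriv bnd p U (%x vs. G x vs + H x vs) (%x vs. G' x vs + H' x vs)" unfolding family_deriv_def
  proof (intro ballI allI impI)
   fix x and e :: real assume x: "x \<in> U" and "e > 0"
   hence "e / 2 > 0" by simp
   hence "\<forall>\<^sub>F y in nhds x. bd bnd p (%vs. G y vs - G x vs - G' x ((y - x) # vs)) (e/2 * norm (y - x))"
    "\<forall>\<^sub>F y in nhds x. bd bnd p (%vs. H y vs - H x vs - H' x ((y - x) # vs)) (e/2 * norm (y - x))"
    using G'(1) H'(1) x unfolding family_deriv_def by blast+
   thus "\<forall>\<^sub>F y in nhds x. bd bnd p (%vs. G y vs + H y vs - (G x vs + H x vs)
      - (G' x ((y - x) # vs) + H' x ((y - x) # vs))) (e * norm (y - x))" proof eventually_elim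
    case (elim y)
    show ?case by (rule bd_cong[OF _ bd_mono[OF bd_add[OF elim]]]) auto
   qed
  qed
  thus ?case using reg[OF G'(3) H'(3)] Suc.IH[OF G'(2) H'(2)] by auto
 }
qed

end

text \<open>The slots of a product are distributed over the two factors by a mask.\<close>
fun sel :: "bool list => 'a list => 'a list" where
 "sel (b # m) (v # vs) = (if b then v # sel m vs else sel m vs)"
| "sel _ _ = []"

abbreviation nsel :: "bool list => nat" where
 "nsel m \<equiv> length (filter (%b. b) m)"

lemma length_sel: "length vs = length m ==> length (sel m vs) = nsel m"
 by (induction m vs rule: sel.induct) auto

lemma nrm_sel: "length vs = length m ==> nrm (sel m vs) * nrm (sel (map Not m) vs) = nrm vs"
 by (induction m vs rule: sel.induct) (auto simp: mult_ac)

lemma sel_replicate_False: "sel (replicate n False) vs = []"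
 by (induction n arbitrary: vs) (auto, case_tac vs, auto)

lemma sel_replicate_True: "length vs = n ==> sel (replicate n True) vs = vs"
 by (induction n arbitrary: vs) (auto simp: length_Suc_conv)

text \<open>Linearity is asked only of arguments that carry a bound: composition of arbitrary
  functions is not additive in its right factor, that of bounded operators is.\<close>

locale bounded_bilin =
 A: bounding bndA + B: bounding bndB + C: bounding bndC
 for bndA :: "'p::real_vector => real => bool" and bndB :: "'q::real_vector => real => bool"
  and bndC :: "'r::real_vector => real => bool" +
 fixes mul :: "'p => 'q => 'r"
 assumes mul_bnd: "bndA x a ==> bndB y b ==> bndC (mul x y) (a * b)"
  and mul_linear_left: "bndA x a ==> bndA x' a' ==> bndB y b ==>
   mul (r *\<^sub>R x + t *\<^sub>R x') y = r *\<^sub>R mul x y + t *\<^sub>R mul x' y"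
  and mul_linear_right: "bndA x a ==> bndB y b ==> bndB y' b' ==>
   mul x (r *\<^sub>R y + t *\<^sub>R y') = r *\<^sub>R mul x y + t *\<^sub>R mul x y'"
begin

lemma mul_diff_left: "bndA x a ==> bndA x' a' ==> bndB y b ==> mul (x - x') y = mul x y - mul x' y"
 using mul_linear_left[of x a x' a' y b 1 "-1"] by simp

lemma mul_diff_right: "bndA x a ==> bndB y b ==> bndB y' b' ==> mul x (y - y') = mul x y - mul x y'"
 using mul_linear_right[of x a y b y' b' 1 "-1"] by simp

definition sprod :: "bool list => ('d list => 'p) => ('d list => 'q) => 'd list => 'r" where
 "sprod m T T' vs = mul (T (sel m vs)) (T' (sel (map Not m) vs))"

lemma sprod_Cons: "sprod (b # m) T T' (v # vs) =
  (if b then sprod m (%vs. T (v # vs)) T' vs else sprod m T (%vs. T' (v # vs)) vs)"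
 by (simp add: sprod_def)

lemma bd_sprod:
 assumes T: "bd bndA (nsel m) T K" and T': "bd bndB (nsel (map Not m)) T' K'"
 shows "bd bndC (length m) (sprod m T T') (K * K')"
 unfolding bd_def
proof (intro allI impI)
 fix vs :: "'a list" assume vs: "length vs = length m"
 have "bndC (sprod m T T' vs) ((K * nrm (sel m vs)) * (K' * nrm (sel (map Not m) vs)))"
  unfolding sprod_def using T T' vs length_sel[of vs m] length_sel[of vs "map Not m"] by (intro mul_bnd) (simp_all add: bd_def)
 thus "bndC (sprod m T T' vs) (K * K' * nrm vs)" using nrm_sel[OF vs] by (simp add: algebra_simps)
qed

lemma mlin_sprod:
 assumes "mlin (nsel m) T" "mlin (nsel (map Not m)) T'"
  "bd bndA (nsel m) T K" "bd bndB (nsel (map Not m)) T' K'"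
 shows "mlin (length m) (sprod m T T')"
 using assms
proof (induction m arbitrary: T T' K K')
 case (Cons b m)
 show ?case
 proof (cases b)
  case True
  have "mlin (length m) (%vs. sprod (b # m) T T' (u # vs))" for u using Cons.IH[of "%vs. T (u # vs)" T' "K * norm u" K'] Cons.prems True
   by (simp add: sprod_Cons bd_Cons)
  moreover have "sprod (b # m) T T' ((x *\<^sub>R u + y *\<^sub>R v) # vs)
    = x *\<^sub>R sprod (b # m) T T' (u # vs) + y *\<^sub>R sprod (b # m) T T' (v # vs)"
   if vs: "length vs = length m" for x y u v vs
  proof -
   have 1: "bndA (T (w # sel m vs)) (K * nrm (w # sel m vs))" for w by (rule bdD[OF Cons.prems(3)]) (simp add: True length_sel[OF vs])
   have 2: "bndB (T' (sel (map Not m) vs)) (K' * nrm (sel (map Not m) vs))" by (rule bdD[OF Cons.prems(4)]) (simp add: True length_sel vs)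
   show ?thesis using mul_linear_left[OF 1 1 2] Cons.prems(1) True length_sel[OF vs] by (simp add: sprod_def)
  qed
  ultimately show ?thesis by simp
 next
  case False
  have "mlin (length m) (%vs. sprod (b # m) T T' (u # vs))" for u using Cons.IH[of T "%vs. T' (u # vs)" K "K' * norm u"] Cons.prems False
   by (simp add: sprod_Cons bd_Cons)
  moreover have "sprod (b # m) T T' ((x *\<^sub>R u + y *\<^sub>R v) # vs)
    = x *\<^sub>R sprod (b # m) T T' (u # vs) + y *\<^sub>R sprod (b # m) T T' (v # vs)"
   if vs: "length vs = length m" for x y u v vs
  proof -
   have 1: "bndA (T (sel m vs)) (K * nrm (sel m vs))" by (rule bdD[OF Cons.prems(3)]) (simp add: False length_sel[OF vs])
   have 2: "bndB (T' (w # sel (map Not m) vs)) (K' * nrm (w # sel (map Not m) vs))" for w by (rule bdD[OF Cons.prems(4)]) (simp add: False length_sel vs)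
   show ?thesis using mul_linear_right[OF 1 2 2] Cons.prems(2) False length_sel[of vs "map Not m"] vs by (simp add: sprod_def)
  qed
  ultimately show ?thesis by simp
 qed
qed simp

lemma sprod_diff:
 assumes "bd bndA (nsel m) S a" "bd bndA (nsel m) T a'"
  "bd bndB (nsel (map Not m)) S' b" "bd bndB (nsel (map Not m)) T' b'" "length vs = length m"
 shows "sprod m (%vs. S vs - T vs) S' vs = sprod m S S' vs - sprod m T S' vs"
  "sprod m S (%vs. S' vs - T' vs) vs = sprod m S S' vs - sprod m S T' vs"
 using mul_diff_left[of "S (sel m vs)" _ "T (sel m vs)" _ "S' (sel (map Not m) vs)"]
  mul_diff_right[of "S (sel m vs)" _ "S' (sel (map Not m) vs)" _ "T' (sel (map Not m) vs)"]
  assms length_sel[of vs m] length_sel[of vs "map Not m"]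
 unfolding sprod_def bd_def by (metis length_map)+

lemma regular_sprod:
 assumes G: "regular_family bndA (nsel m) U G" and H: "regular_family bndB (nsel (map Not m)) U H"
 shows "regular_family bndC (length m) U (%x. sprod m (G x) (H x))"
 unfolding regular_family_def
proof (intro ballI conjI allI impI)
 fix x assume x: "x \<in> U"
 note g = G[unfolded regular_family_def, rule_format, OF x]
 note h = H[unfolded regular_family_def, rule_format, OF x]
 obtain K where K: "K >= 0" "bd bndA (nsel m) (G x) K" using g by blast
 obtain L where L: "L >= 0" "bd bndB (nsel (map Not m)) (H x) L" using h by blast
 show "mlin (length m) (sprod m (G x) (H x))" using g h K L mlin_sprod by blast
 show "EX K>=0. bd bndC (length m) (sprod m (G x) (H x)) K" using bd_sprod[OF K(2) L(2)] K L by (intro exI[of _ "K * L"]) auto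
 fix e :: real assume e: "e > 0"
 \<comment> \<open>The increment splits as (G y - G x) H y + G x (H y - H x); the cap 1 bounds
   \<open>H y\<close> by \<open>L + 1\<close>.\<close>
 define d where "d = min 1 (e / (L + 1 + K))"
 have d: "d > 0" "d <= 1" "d * (L + 1) + K * d <= e"
 proof -
  show "d > 0" "d <= 1" using e K L by (auto simp: d_def)
  have "d <= e / (L + 1 + K)" by (simp add: d_def)
  thus "d * (L + 1) + K * d <= e" using K L by (simp add: field_simps)
 qed
 have "\<forall>\<^sub>F y in nhds x. bd bndA (nsel m) (%vs. G y vs - G x vs) d"
  "\<forall>\<^sub>F y in nhds x. bd bndB (nsel (map Not m)) (%vs. H y vs - H x vs) d" using g h d(1) by blast+
 thus "\<forall>\<^sub>F y in nhds x. bd bndC (length m) (%vs. sprod m (G y) (H y) vs - sprod m (G x) (H x) vs) e"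
 proof eventually_elim
  case (elim y)
  have Gy: "bd bndA (nsel m) (G y) (d + K)" by (rule bd_cong[OF _ A.bd_add[OF elim(1) K(2)]]) simp
  have Hy: "bd bndB (nsel (map Not m)) (H y) (L + 1)" by (rule bd_cong[OF _ B.bd_mono[OF B.bd_add[OF elim(2) L(2)]]]) (use d in simp_all)
  have *: "bd bndC (length m) (%vs. sprod m (%vs. G y vs - G x vs) (H y) vs
    + sprod m (G x) (%vs. H y vs - H x vs) vs) (d * (L + 1) + K * d)" by (rule C.bd_add[OF bd_sprod[OF elim(1) Hy] bd_sprod[OF K(2) elim(2)]])
  show ?case by (rule bd_cong[OF _ C.bd_mono[OF * d(3)]])
    (simp add: sprod_diff(1)[OF Gy K(2) Hy L(2)] sprod_diff(2)[OF K(2) Gy Hy L(2)])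
 qed
qed

text \<open>Leibniz rule: the new direction goes to the left or to the right factor, that is,
  \<open>True\<close> or \<open>False\<close> is put in front of the mask. Both terms are again
  masked products, so the induction needs all masks at once.\<close>

lemma Ck_sprod:
 "Ck bndA k (nsel m) U G ==> Ck bndB k (nsel (map Not m)) U H ==>
  Ck bndC k (length m) U (%x. sprod m (G x) (H x))"
proof (induction k arbitrary: m G H)
 case 0
 thus ?case using regular_sprod by simp
next
 case (Suc k)
 obtain G' where G': "family_deriv bndA (nsel m) U G G'" "Ck bndA k (Suc (nsel m)) U G'"
  and G: "regular_family bndA (nsel m) U G" using Suc.prems by auto
 obtain H' where H': "family_deriv bndB (nsel (map Not m)) U H H'" "Ck bndB k (Suc (nsel (map Not m))) U H'"
  and H: "regular_family bndB (nsel (map Not m)) U H" using Suc.prems by auto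
 define D where "D = (%x vs. sprod (True # m) (G' x) (H x) vs + sprod (False # m) (G x) (H' x) vs)"
 have "Ck bndC k (length (True # m)) U (%x. sprod (True # m) (G' x) (H x))" using Suc.IH[of "True # m" G' H] G'(2) Ck_Suc_imp[OF Suc.prems(2)] by simp
 moreover have "Ck bndC k (length (False # m)) U (%x. sprod (False # m) (G x) (H' x))" using Suc.IH[of "False # m" G H'] H'(2) Ck_Suc_imp[OF Suc.prems(1)] by simp
 ultimately have D: "Ck bndC k (Suc (length m)) U D" unfolding D_def using C.Ck_add by simp
 have "family_deriv bndC (length m) U (%x. sprod m (G x) (H x)) D" unfolding family_deriv_def
 proof (intro ballI allI impI)
  fix x and e :: real assume x: "x \<in> U" and e: "e > 0"
  note g = G[unfolded regular_family_def, rule_format, OF x]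
  note h = H[unfolded regular_family_def, rule_format, OF x]
  obtain K where K: "K >= 0" "bd bndA (nsel m) (G x) K" using g by blast
  obtain L where L: "L >= 0" "bd bndB (nsel (map Not m)) (H x) L" using h by blast
  obtain K' where K': "K' >= 0" "bd bndA (Suc (nsel m)) (G' x) K'" using Ck_regular[OF G'(2)] x unfolding regular_family_def by blast
  obtain L' where L': "L' >= 0" "bd bndB (Suc (nsel (map Not m))) (H' x) L'" using Ck_regular[OF H'(2)] x unfolding regular_family_def by blast
  \<comment> \<open>Three errors are to be covered, where h is the increment of the argument: (G y -
    G x - G' h) H y, then G' h (H y - H x), then G x (H y - H x - H' h).\<close>
  define d where "d = min 1 (e / (L + 1 + K' + K))"
  have d: "d > 0" "d <= 1" "d * (L + 1) + K' * d + K * d <= e"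
  proof -
   show "d > 0" "d <= 1" using e K L K' by (auto simp: d_def)
   have "d <= e / (L + 1 + K' + K)" by (simp add: d_def)
   thus "d * (L + 1) + K' * d + K * d <= e" using K L K' by (simp add: field_simps)
  qed
  have "\<forall>\<^sub>F y in nhds x. bd bndA (nsel m) (%vs. G y vs - G x vs - G' x ((y - x) # vs)) (d * norm (y - x))"
   "\<forall>\<^sub>F y in nhds x. bd bndB (nsel (map Not m)) (%vs. H y vs - H x vs - H' x ((y - x) # vs)) (d * norm (y - x))"
   "\<forall>\<^sub>F y in nhds x. bd bndB (nsel (map Not m)) (%vs. H y vs - H x vs) d"
   "\<forall>\<^sub>F y in nhds x. bd bndA (nsel m) (%vs. G y vs - G x vs) d" using G'(1) H'(1) x d(1) g h unfolding family_deriv_def by blast+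
  thus "\<forall>\<^sub>F y in nhds x. bd bndC (length m) (%vs. sprod m (G y) (H y) vs - sprod m (G x) (H x) vs
    - D x ((y - x) # vs)) (e * norm (y - x))"
  proof eventually_elim
   case (elim y)
   define r where "r = norm (y - x)"
   define g' where "g' = (%vs. G' x ((y - x) # vs))"
   define h' where "h' = (%vs. H' x ((y - x) # vs))"
   have r: "r >= 0" by (simp add: r_def)
   have g': "bd bndA (nsel m) g' (K' * r)" using bd_Cons[OF K'(2)] by (simp add: g'_def r_def)
   have h': "bd bndB (nsel (map Not m)) h' (L' * r)" using bd_Cons[OF L'(2)] by (simp add: h'_def r_def)
   have Gy: "bd bndA (nsel m) (G y) (d + K)" by (rule bd_cong[OF _ A.bd_add[OF elim(4) K(2)]]) simp
   have Hy: "bd bndB (nsel (map Not m)) (H y) (L + 1)" by (rule bd_cong[OF _ B.bd_mono[OF B.bd_add[OF elim(3) L(2)]]]) (use d in simp_all)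
   have Gd: "bd bndA (nsel m) (%vs. G y vs - G x vs) d" by (rule elim(4))
   have Gdd: "bd bndA (nsel m) (%vs. G y vs - G x vs - g' vs) (d * r)" using elim(1) by (simp add: g'_def r_def)
   have Hd: "bd bndB (nsel (map Not m)) (%vs. H y vs - H x vs) d" by (rule elim(3))
   have Hdd: "bd bndB (nsel (map Not m)) (%vs. H y vs - H x vs - h' vs) (d * r)" using elim(2) by (simp add: h'_def r_def)
   have 1: "bd bndC (length m) (%vs. (sprod m (%vs. G y vs - G x vs - g' vs) (H y) vs
     + sprod m g' (%vs. H y vs - H x vs) vs)
     + sprod m (G x) (%vs. H y vs - H x vs - h' vs) vs) ((d * r) * (L + 1) + (K' * r) * d + K * (d * r))"
    by (rule C.bd_add[OF C.bd_add[OF bd_sprod[OF Gdd Hy] bd_sprod[OF g' Hd]] bd_sprod[OF K(2) Hdd]])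
   have 2: "(d * r) * (L + 1) + (K' * r) * d + K * (d * r) <= e * norm (y - x)" using mult_right_mono[OF d(3) r] by (simp add: r_def algebra_simps)
   show ?case proof (rule bd_cong[OF _ C.bd_mono[OF 1 2]])
    fix vs :: "'a list" assume vs: "length vs = length m"
    have D: "D x ((y - x) # vs) = sprod m g' (H x) vs + sprod m (G x) h' vs" by (simp add: D_def sprod_Cons g'_def h'_def)
    show "sprod m (%vs. G y vs - G x vs - g' vs) (H y) vs + sprod m g' (%vs. H y vs - H x vs) vs
     + sprod m (G x) (%vs. H y vs - H x vs - h' vs) vs
     = sprod m (G y) (H y) vs - sprod m (G x) (H x) vs - D x ((y - x) # vs)" unfolding D using vs
     by (simp add: sprod_diff(1)[OF Gd g' Hy L(2)] sprod_diff(1)[OF Gy K(2) Hy L(2)]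
       sprod_diff(2)[OF g' Gy Hy L(2)] sprod_diff(2)[OF K(2) Gy Hd h'] sprod_diff(2)[OF K(2) Gy Hy L(2)])
   qed
  qed
 qed
 thus ?case using D regular_sprod[OF G H] by auto
qed

end

lemma mlin_insert:
 "mlin (Suc p) T ==> i <= p ==> mlin p (%vs. T (take i vs @ w # drop i vs))"
proof (induction p arbitrary: T i)
 case (Suc p)
 show ?case
 proof (cases i)
  case 0
  thus ?thesis using Suc.prems(1) by simp
 next
  case i: (Suc j)
  have "mlin p (%vs. T (u # take j vs @ w # drop j vs))" for u using Suc.IH[of "%vs. T (u # vs)" j] Suc.prems i by simp
  thus ?thesis using Suc.prems i by simp
 qed
qed simp

lemma nrm_insert: "nrm (take i vs @ w # drop i vs) = norm w * nrm vs"
proof -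
 have "nrm (take i vs @ w # drop i vs) = nrm (take i vs) * (norm w * nrm (drop i vs))" by simp
 also have "... = norm w * nrm (take i vs @ drop i vs)" by (simp only: map_append prod_list.append mult_ac)
 finally show ?thesis by simp
qed

lemma bd_insert:
 assumes "bd bnd (Suc p) T K" "i <= p"
 shows "bd bnd p (%vs. T (take i vs @ w # drop i vs)) (K * norm w)"
 unfolding bd_def
proof (intro allI impI)
 fix vs :: "'b list" assume "length vs = p"
 hence "bnd (T (take i vs @ w # drop i vs)) (K * nrm (take i vs @ w # drop i vs))" using assms(2) by (intro bdD[OF assms(1)]) simp
 thus "bnd (T (take i vs @ w # drop i vs)) (K * norm w * nrm vs)" by (simp only: nrm_insert mult.assoc)
qed

context bounding
begin

lemma Ck_insert:
 "Ck bnd k (Suc p) U G ==> i <= p ==> Ck bnd k p U (%x vs. G x (take i vs @ w # drop i vs))"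
proof (induction k arbitrary: p G i)
 have scale: "EX d>0. d * norm w <= e" if "e > 0" for e using that by (intro exI[of _ "e / (norm w + 1)"]) (auto simp: field_simps add_pos_nonneg)
 have reg: "regular_family bnd p U (%x vs. G x (take i vs @ w # drop i vs))"
  if r: "regular_family bnd (Suc p) U G" and i: "i <= p" for p G i unfolding regular_family_def
 proof (intro ballI conjI allI impI)
  fix x assume x: "x \<in> U"
  note g = r[unfolded regular_family_def, rule_format, OF x]
  show "mlin p (%vs. G x (take i vs @ w # drop i vs))" using g mlin_insert i by blast
  obtain K where "K >= 0" "bd bnd (Suc p) (G x) K" using g by blast
  thus "EX K>=0. bd bnd p (%vs. G x (take i vs @ w # drop i vs)) K" using bd_insert[of bnd p "G x" K i w] i by (intro exI[of _ "K * norm w"]) auto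
  fix e :: real assume "e > 0"
  then obtain d where d: "d > 0" "d * norm w <= e" using scale by blast
  hence "\<forall>\<^sub>F y in nhds x. bd bnd (Suc p) (%vs. G y vs - G x vs) d" using g by blast
  thus "\<forall>\<^sub>F y in nhds x. bd bnd p (%vs. G y (take i vs @ w # drop i vs) - G x (take i vs @ w # drop i vs)) e"
  proof eventually_elim
   case (elim y)
   show ?case using bd_mono[OF bd_insert[OF elim i] d(2)] .
  qed
 qed
 {
  case 0
  thus ?case using reg by simp
 next
  case (Suc k)
  obtain G' where G': "family_deriv bnd (Suc p) U G G'" "Ck bnd k (Suc (Suc p)) U G'"
   "regular_family bnd (Suc p) U G" using Suc.prems by auto
  have "family_deriv bnd p U (%x vs. G x (take i vs @ w # drop i vs))
    (%x vs. G' x (take (Suc i) vs @ w # drop (Suc i) vs))" unfolding family_deriv_def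
  proof (intro ballI allI impI)
   fix x and e :: real assume x: "x \<in> U" and "e > 0"
   then obtain d where d: "d > 0" "d * norm w <= e" using scale by blast
   hence "\<forall>\<^sub>F y in nhds x. bd bnd (Suc p) (%vs. G y vs - G x vs - G' x ((y - x) # vs)) (d * norm (y - x))"
    using G'(1) x unfolding family_deriv_def by blast
   thus "\<forall>\<^sub>F y in nhds x. bd bnd p (%vs. G y (take i vs @ w # drop i vs) - G x (take i vs @ w # drop i vs)
     - G' x (take (Suc i) ((y - x) # vs) @ w # drop (Suc i) ((y - x) # vs))) (e * norm (y - x))" proof eventually_elim
    case (elim y)
    have "d * norm (y - x) * norm w <= e * norm (y - x)" using mult_right_mono[OF d(2), of "norm (y - x)"] by (simp add: mult_ac)
    from bd_mono[OF bd_insert[OF elim Suc.prems(2), of w] this]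
    show ?case by simp
   qed
  qed
  thus ?case using reg[OF G'(3) Suc.prems(2)] Suc.IH[OF G'(2), of "Suc i"] Suc.prems(2) by auto
 }
qed

lemma Ck_fix: "Ck bnd k (Suc p) U G ==> Ck bnd k p U (%x vs. G x (w # vs))"
 using Ck_insert[of k p U G 0 w] by simp

lemma bounded_bilin_scaleR: "bounded_bilin (norm_bnd :: real => _) bnd bnd (*\<^sub>R)"
proof -
 interpret R: bounding "norm_bnd :: real => real => bool" by (rule bounding_norm)
 show ?thesis
 proof
  show "bnd (x *\<^sub>R y) (a * b)" if x: "norm x <= a" and y: "bnd y b" for x y a b
   using bnd_mono[OF bnd_scale[OF y, of x], of "a * b"] x bnd_nonneg[OF y] by (simp add: mult_right_mono)
 qed (simp_all add: algebra_simps)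
qed

end

lemma bounded_bilin_times: "bounded_bilin (norm_bnd :: real => _) norm_bnd norm_bnd (*)"
proof -
 interpret R: bounding "norm_bnd :: real => real => bool" by (rule bounding_norm)
 have "(*\<^sub>R) = ((*) :: real => real => real)" by (intro ext) simp
 thus ?thesis using R.bounded_bilin_scaleR by metis
qed

locale bounded_lin = A: bounding bndA + B: bounding bndB
 for bndA :: "'p::real_vector => real => bool" and bndB :: "'q::real_vector => real => bool" +
 fixes L :: "'p => 'q" and C :: real
 assumes C: "0 <= C" and L_bnd: "bndA x a ==> bndB (L x) (C * a)"
  and L_linear: "bndA x a ==> bndA y b ==> L (r *\<^sub>R x + t *\<^sub>R y) = r *\<^sub>R L x + t *\<^sub>R L y"
begin

lemma L_diff: "bndA x a ==> bndA y b ==> L (x - y) = L x - L y"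
 using L_linear[of x a y b 1 "-1"] by simp

lemma mlin_L: "mlin p T ==> bd bndA p T K ==> mlin p (%vs. L (T vs))"
proof (induction p arbitrary: T K)
 case (Suc p)
 have "mlin p (%vs. L (T (u # vs)))" for u using Suc.IH[OF _ bd_Cons[OF Suc.prems(2)]] Suc.prems(1) by simp
 moreover have "L (T ((a *\<^sub>R u + b *\<^sub>R v) # vs)) = a *\<^sub>R L (T (u # vs)) + b *\<^sub>R L (T (v # vs))"
  if "length vs = p" for a b u v vs using Suc.prems(1) that L_linear[OF bdD[OF Suc.prems(2)] bdD[OF Suc.prems(2)], of "u # vs" "v # vs" a b] by simp
 ultimately show ?case by simp
qed simp

lemma bd_L: "bd bndA p T K ==> bd bndB p (%vs. L (T vs)) (C * K)"
 unfolding bd_def using L_bnd by (auto simp: mult.assoc)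

lemma Ck_postcompose: "Ck bndA k p U G ==> Ck bndB k p U (%x vs. L (G x vs))"
proof (induction k arbitrary: p G)
 have scale: "EX d>0. C * d <= e" if "e > 0" for e using that C by (intro exI[of _ "e / (C + 1)"]) (auto simp: field_simps add_nonneg_pos)
 have reg: "regular_family bndB p U (%x vs. L (G x vs))" if r: "regular_family bndA p U G" for p G unfolding regular_family_def
 proof (intro ballI conjI allI impI)
  fix x assume x: "x \<in> U"
  note g = r[unfolded regular_family_def, rule_format, OF x]
  obtain K where K: "K >= 0" "bd bndA p (G x) K" using g by blast
  show "mlin p (%vs. L (G x vs))" using g K mlin_L by blast
  show "EX K>=0. bd bndB p (%vs. L (G x vs)) K" using bd_L[OF K(2)] K(1) C by (intro exI[of _ "C * K"]) auto
  fix e :: real assume "e > 0"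
  then obtain d where d: "d > 0" "C * d <= e" using scale by blast
  hence "\<forall>\<^sub>F y in nhds x. bd bndA p (%vs. G y vs - G x vs) d" using g by blast
  thus "\<forall>\<^sub>F y in nhds x. bd bndB p (%vs. L (G y vs) - L (G x vs)) e"
  proof eventually_elim
   case (elim y)
   have Gy: "bd bndA p (G y) (d + K)" by (rule bd_cong[OF _ A.bd_add[OF elim K(2)]]) simp
   show ?case by (rule bd_cong[OF _ B.bd_mono[OF bd_L[OF elim] d(2)]])
     (simp add: L_diff[OF bdD[OF Gy] bdD[OF K(2)]])
  qed
 qed
 {
  case 0
  thus ?case using reg by simp
 next
  case (Suc k)
  obtain G' where G': "family_deriv bndA p U G G'" "Ck bndA k (Suc p) U G'"
   "regular_family bndA p U G" using Suc.prems by auto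
  have "family_deriv bndB p U (%x vs. L (G x vs)) (%x vs. L (G' x vs))" unfolding family_deriv_def
  proof (intro ballI allI impI)
   fix x and e :: real assume x: "x \<in> U" and "e > 0"
   then obtain d where d: "d > 0" "C * d <= e" using scale by blast
   obtain K where K: "K >= 0" "bd bndA p (G x) K" using G'(3) x unfolding regular_family_def by blast
   obtain K' where K': "K' >= 0" "bd bndA (Suc p) (G' x) K'" using Ck_regular[OF G'(2)] x unfolding regular_family_def by blast
   have "\<forall>\<^sub>F y in nhds x. bd bndA p (%vs. G y vs - G x vs) d" using G'(3) x d(1) unfolding regular_family_def by blast
   moreover have "\<forall>\<^sub>F y in nhds x. bd bndA p (%vs. G y vs - G x vs - G' x ((y - x) # vs)) (d * norm (y - x))"
    using G'(1) x d(1) unfolding family_deriv_def by blast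
   ultimately show "\<forall>\<^sub>F y in nhds x. bd bndB p (%vs. L (G y vs) - L (G x vs) - L (G' x ((y - x) # vs))) (e * norm (y - x))" proof eventually_elim
    case (elim y)
    have Gy: "bd bndA p (G y) (d + K)" by (rule bd_cong[OF _ A.bd_add[OF elim(1) K(2)]]) simp
    have "C * (d * norm (y - x)) <= e * norm (y - x)" using mult_right_mono[OF d(2), of "norm (y - x)"] by (simp add: mult_ac)
    from B.bd_mono[OF bd_L[OF elim(2)] this]
    show ?case by (rule bd_cong[rotated])
      (simp add: L_diff[OF bdD[OF elim(1)] bdD[OF bd_Cons[OF K'(2)]]] L_diff[OF bdD[OF Gy] bdD[OF K(2)]])
   qed
  qed
  thus ?case using reg[OF G'(3)] Suc.IH[OF G'(2)] by auto
 }
qed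

end

lemma mlin_map_linear: "linear L ==> mlin p T ==> mlin p (%vs. T (map L vs))"
 by (induction p arbitrary: T) (auto simp: linear_add linear_scale)

lemma nrm_map_le: "(!!v. norm (L v) <= C * norm v) ==> 0 <= C ==> nrm (map L vs) <= C ^ length vs * nrm vs"
proof (induction vs)
 case (Cons v vs)
 have "norm (L v) * nrm (map L vs) <= (C * norm v) * (C ^ length vs * nrm vs)" using Cons nrm_nonneg[of "map L vs"] by (intro mult_mono) simp_all
 thus ?case by (simp add: mult_ac)
qed simp

context bounding
begin

lemma bd_map:
 assumes "bd bnd p T K" "0 <= K" "!!v. norm (L v) <= C * norm v" "0 <= C"
 shows "bd bnd p (%vs. T (map L vs)) (K * C ^ p)"
 unfolding bd_def
proof (intro allI impI)
 fix vs :: "'b list" assume vs: "length vs = p"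
 have "bnd (T (map L vs)) (K * nrm (map L vs))" using vs by (intro bdD[OF assms(1)]) simp
 moreover have "K * nrm (map L vs) <= K * C ^ p * nrm vs" using mult_left_mono[OF nrm_map_le[of L C vs, OF assms(3,4)] assms(2)] vs by (simp add: mult.assoc)
 ultimately show "bnd (T (map L vs)) (K * C ^ p * nrm vs)" by (rule bnd_mono)
qed

text \<open>Inner maps that are affine up to a scalar function times a fixed vector suffice, because
  implicit functions are solved for one scalar at a time. The derivative of the composite then has
  two terms only: the slots mapped by \<open>L\<close>, and the derivative of \<open>g\<close> times
  a family with the slot \<open>w\<close> frozen.\<close>

lemma Ck_compose:
 fixes L :: "'a::real_normed_vector => 'b::real_normed_vector"
 assumes U: "open U" and L: "bounded_linear L" and \<phi>: "!!u. u \<in> U ==> \<phi> u = c + L u + g u *\<^sub>R w"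
  and \<phi>V: "\<phi> ` U \<subseteq> V"
  and G: "Ck bnd k p V G" and g: "Ck norm_bnd k 0 U (%u _. g u)"
 shows "Ck bnd k p U (%u vs. G (\<phi> u) (map L vs))"
 using G g
proof (induction k arbitrary: p G)
 obtain C where C: "C > 0" "!!v. norm (L v) <= C * norm v" using bounded_linear.pos_bounded[OF L] by (metis mult.commute)
 interpret L: bounded_linear L by (rule L)
 have L_lin: "linear L" by (rule L.linear_axioms)
 have g_cont: "(g \<longlongrightarrow> g x) (nhds x)" if "Ck norm_bnd j 0 U (%u _. g u)" "x \<in> U" for j x
 proof (rule tendstoI)
  fix e :: real assume "e > 0"
  hence "e / 2 > 0" by simp
  hence "\<forall>\<^sub>F y in nhds x. bd norm_bnd 0 (%vs::'a list. g y - g x) (e/2)"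
   using Ck_regular[OF that(1)] that(2) unfolding regular_family_def by blast
  thus "\<forall>\<^sub>F y in nhds x. dist (g y) (g x) < e" by eventually_elim (use \<open>e > 0\<close> in \<open>auto simp: bd_def dist_norm\<close>)
 qed
 have \<phi>_cont: "filterlim \<phi> (nhds (\<phi> x)) (nhds x)" if "Ck norm_bnd j 0 U (%u _. g u)" "x \<in> U" for j x
 proof -
  have "((%u. c + L u + g u *\<^sub>R w) \<longlongrightarrow> c + L x + g x *\<^sub>R w) (nhds x)"
   by (intro tendsto_intros g_cont[OF that] L.tendsto filterlim_ident)
  moreover have "\<forall>\<^sub>F u in nhds x. c + L u + g u *\<^sub>R w = \<phi> u" using eventually_nhds_in_open[OF U that(2)] by eventually_elim (simp add: \<phi>)
  ultimately show ?thesis using \<phi>[OF that(2)] by (simp add: filterlim_cong)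
 qed
 have reg: "regular_family bnd p U (%u vs. G (\<phi> u) (map L vs))"
  if r: "regular_family bnd p V G" and gc: "Ck norm_bnd j 0 U (%u _. g u)" for p j and G :: "'b => 'b list => 'c"
  unfolding regular_family_def
 proof (intro ballI conjI allI impI)
  fix x assume x: "x \<in> U"
  hence "\<phi> x \<in> V" using \<phi>V by blast
  note g = r[unfolded regular_family_def, rule_format, OF this]
  show "mlin p (%vs. G (\<phi> x) (map L vs))" using g mlin_map_linear[OF L_lin] by blast
  obtain K where K: "K >= 0" "bd bnd p (G (\<phi> x)) K" using g by blast
  thus "EX K>=0. bd bnd p (%vs. G (\<phi> x) (map L vs)) K" using bd_map[OF K(2,1) C(2)] C(1) by (intro exI[of _ "K * C ^ p"]) auto
  fix e :: real assume e: "e > 0"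
  define d where "d = e / C ^ p"
  have d: "d > 0" "d * C ^ p = e" using e C(1) by (auto simp: d_def)
  hence "\<forall>\<^sub>F y in nhds (\<phi> x). bd bnd p (%vs. G y vs - G (\<phi> x) vs) d" using g by blast
  hence "\<forall>\<^sub>F y in nhds x. bd bnd p (%vs. G (\<phi> y) vs - G (\<phi> x) vs) d" using \<phi>_cont[OF gc x] unfolding filterlim_iff by blast
  thus "\<forall>\<^sub>F y in nhds x. bd bnd p (%vs. G (\<phi> y) (map L vs) - G (\<phi> x) (map L vs)) e"
  proof eventually_elim
   case (elim y)
   show ?case using bd_map[OF elim _ C(2)] d C(1) by simp
  qed
 qed
 {
  case 0
  thus ?case using reg[OF _ 0(2)] by simp
 next
  case (Suc k)
  interpret M: bounded_bilin "norm_bnd :: real => real => bool" bnd bnd "(*\<^sub>R)" by (rule bounded_bilin_scaleR)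
  obtain G' where G': "family_deriv bnd p V G G'" "Ck bnd k (Suc p) V G'"
   "regular_family bnd p V G" using Suc.prems by auto
  obtain g' where g': "family_deriv norm_bnd 0 U (%u _. g u) g'" "Ck norm_bnd k (Suc 0) U g'" using Suc.prems by auto
  have g0: "Ck norm_bnd k 0 U (%u _. g u)" using Ck_Suc_imp[OF Suc.prems(2)] .
  \<comment> \<open>The mask hands the new direction to \<open>g'\<close> and the old
    \<open>p\<close> slots to the other factor.\<close>
  define m where "m = True # replicate p False"
  have m: "nsel m = Suc 0" "nsel (map Not m) = p" "length m = Suc p" by (simp_all add: m_def filter_replicate)
  define D where "D = (%u vs. G' (\<phi> u) (map L vs) + M.sprod m (g' u) (%vs. G' (\<phi> u) (w # map L vs)) vs)"
  have G'\<phi>: "Ck bnd k (Suc p) U (%u vs. G' (\<phi> u) (map L vs))" by (rule Suc.IH[OF G'(2) g0])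
  have "Ck bnd k p U (%u vs. G' (\<phi> u) (w # map L vs))" by (rule Suc.IH[OF Ck_fix[OF G'(2)] g0])
  hence "Ck bnd k (Suc p) U (%u. M.sprod m (g' u) (%vs. G' (\<phi> u) (w # map L vs)))"
   using M.Ck_sprod[of k m U g' "%u vs. G' (\<phi> u) (w # map L vs)"] g'(2) by (simp only: m)
  hence D: "Ck bnd k (Suc p) U D" unfolding D_def by (rule Ck_add[OF G'\<phi>])
  have D_Cons: "D u (h # vs) = G' (\<phi> u) (L h # map L vs) + g' u [h] *\<^sub>R G' (\<phi> u) (w # map L vs)"
   if "length vs = p" for u h vs using that unfolding D_def m_def M.sprod_def by (simp add: sel_replicate_False sel_replicate_True)
  have "family_deriv bnd p U (%u vs. G (\<phi> u) (map L vs)) D" unfolding family_deriv_def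
  proof (intro ballI allI impI)
   fix x and e :: real assume x: "x \<in> U" and e: "e > 0"
   have \<phi>x: "\<phi> x \<in> V" using x \<phi>V by blast
   obtain K where K: "K >= 0" "bd bnd (Suc p) (G' (\<phi> x)) K" using Ck_regular[OF G'(2)] \<phi>x unfolding regular_family_def by blast
   have lin: "mlin (Suc p) (G' (\<phi> x))" using Ck_regular[OF G'(2)] \<phi>x unfolding regular_family_def by blast
   obtain k' where k': "k' >= 0" "bd norm_bnd (Suc 0) (g' x) k'" using Ck_regular[OF g'(2)] x unfolding regular_family_def by blast
   \<comment> \<open>With h the increment of u, the increment of \<open>\<phi>\<close> is L h + (r +
     g' h) w, where r is the remainder of \<open>g\<close>. The bracket collects the size of this
     increment and of the remainder r w fed into \<open>G'\<close>; \<open>C ^ p\<close> comes from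
     mapping the slots by \<open>L\<close>.\<close>
   define d where "d = min 1 (e / (C ^ p * (C + (k' + 1) * norm w + K * norm w) + 1))"
   have pos: "C ^ p * (C + (k' + 1) * norm w + K * norm w) >= 0" using C k' K by simp
   have d: "d > 0" "d <= 1" using e pos by (auto simp: d_def add_nonneg_pos)
   have "d <= e / (C ^ p * (C + (k' + 1) * norm w + K * norm w) + 1)" by (simp add: d_def)
   hence "d * (C ^ p * (C + (k' + 1) * norm w + K * norm w) + 1) <= e" using pos by (simp add: pos_le_divide_eq add_nonneg_pos)
   hence de: "d * (C ^ p * (C + (k' + 1) * norm w + K * norm w)) <= e" using d by (simp add: distrib_left)
   have "\<forall>\<^sub>F y in nhds (\<phi> x). bd bnd p (%vs. G y vs - G (\<phi> x) vs - G' (\<phi> x) ((y - \<phi> x) # vs)) (d * norm (y - \<phi> x))"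
    using G'(1) \<phi>x d(1) unfolding family_deriv_def by blast
   hence "\<forall>\<^sub>F y in nhds x. bd bnd p (%vs. G (\<phi> y) vs - G (\<phi> x) vs - G' (\<phi> x) ((\<phi> y - \<phi> x) # vs)) (d * norm (\<phi> y - \<phi> x))"
    using \<phi>_cont[OF g0 x] unfolding filterlim_iff by blast
   moreover have "\<forall>\<^sub>F y in nhds x. bd norm_bnd 0 (%vs. g y - g x - g' x ((y - x) # vs)) (d * norm (y - x))"
    using g'(1) x d(1) unfolding family_deriv_def by blast
   moreover have "\<forall>\<^sub>F y in nhds x. y \<in> U" using U x by (rule eventually_nhds_in_open)
   ultimately show "\<forall>\<^sub>F y in nhds x. bd bnd p (%vs. G (\<phi> y) (map L vs) - G (\<phi> x) (map L vs)
     - D x ((y - x) # vs)) (e * norm (y - x))" proof eventually_elim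
    case (elim y)
    define h where "h = y - x"
    define r where "r = g y - g x - g' x [h]"
    have r: "\<bar>r\<bar> <= d * norm h" using elim(2) by (simp add: bd_def r_def h_def)
    have g'h: "\<bar>g' x [h]\<bar> <= k' * norm h" using bdD[OF k'(2), where vs = "[h]"] by simp
    have diff: "\<phi> y - \<phi> x = L h + (r + g' x [h]) *\<^sub>R w" using \<phi>[OF x] \<phi>[OF elim(3)] by (simp add: h_def r_def L.diff algebra_simps)
    have "\<bar>r + g' x [h]\<bar> <= (k' + 1) * norm h" proof -
     have "\<bar>r\<bar> <= 1 * norm h" using r mult_right_mono[OF d(2), of "norm h"] by simp
     thus ?thesis using g'h by (simp add: algebra_simps)
    qed
    hence "norm (\<phi> y - \<phi> x) <= C * norm h + (k' + 1) * norm h * norm w" unfolding diff using C(2)[of h]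
     by (intro order_trans[OF norm_triangle_ineq] add_mono) (auto intro: mult_right_mono)
    hence "d * norm (\<phi> y - \<phi> x) <= d * (C * norm h + (k' + 1) * norm h * norm w)" using d(1) by simp
    from bd_map[OF bd_mono[OF elim(1) this] _ C(2)]
    have 1: "bd bnd p (%vs. G (\<phi> y) (map L vs) - G (\<phi> x) (map L vs) - G' (\<phi> x) ((\<phi> y - \<phi> x) # map L vs))
      (d * (C * norm h + (k' + 1) * norm h * norm w) * C ^ p)" using C d k' by simp
    have "bd bnd p (%vs. G' (\<phi> x) ((r *\<^sub>R w) # vs)) (K * norm (r *\<^sub>R w))" by (rule bd_Cons[OF K(2)])
    moreover have "K * norm (r *\<^sub>R w) <= K * (d * norm h * norm w)" using r K by (auto intro!: mult_left_mono mult_right_mono)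
    ultimately have "bd bnd p (%vs. G' (\<phi> x) ((r *\<^sub>R w) # vs)) (K * (d * norm h * norm w))" by (rule bd_mono)
    from bd_map[OF this _ C(2)]
    have 2: "bd bnd p (%vs. G' (\<phi> x) ((r *\<^sub>R w) # map L vs)) (K * (d * norm h * norm w) * C ^ p)" using C K d by simp
    have 3: "d * (C * norm h + (k' + 1) * norm h * norm w) * C ^ p + K * (d * norm h * norm w) * C ^ p
      <= e * norm (y - x)" using mult_right_mono[OF de, of "norm h"] by (simp add: h_def algebra_simps)
    show ?case proof (rule bd_cong[OF _ bd_mono[OF bd_add[OF 1 2] 3]])
     fix vs :: "'a list" assume vs: "length vs = p"
     have add: "G' (\<phi> x) ((a *\<^sub>R u + b *\<^sub>R v) # map L vs)
       = a *\<^sub>R G' (\<phi> x) (u # map L vs) + b *\<^sub>R G' (\<phi> x) (v # map L vs)" for a b u v using lin vs by simp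
     have "G' (\<phi> x) ((\<phi> y - \<phi> x) # map L vs)
       = G' (\<phi> x) (L h # map L vs) + (r + g' x [h]) *\<^sub>R G' (\<phi> x) (w # map L vs)" unfolding diff using add[of 1 "L h" "r + g' x [h]" w] by simp
     moreover have "G' (\<phi> x) ((r *\<^sub>R w) # map L vs) = r *\<^sub>R G' (\<phi> x) (w # map L vs)" using add[of r w 0 0] by simp
     ultimately show "G (\<phi> y) (map L vs) - G (\<phi> x) (map L vs) - G' (\<phi> x) ((\<phi> y - \<phi> x) # map L vs)
       + G' (\<phi> x) ((r *\<^sub>R w) # map L vs)
      = G (\<phi> y) (map L vs) - G (\<phi> x) (map L vs) - D x ((y - x) # vs)" using D_Cons[OF vs, of x h] by (simp add: h_def algebra_simps)
    qed
   qed
  qed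
  thus ?case using reg[OF G'(3) g0] D by auto
 }
qed

end

context bounded_bilin
begin

lemma Ck_mul: "Ck bndA k 0 U (%x _. f x) ==> Ck bndB k 0 U (%x _. g x) ==> Ck bndC k 0 U (%x _. mul (f x) (g x))"
 using Ck_sprod[of k "[]" U "%x _. f x" "%x _. g x"] by (simp add: sprod_def[abs_def])

lemma Ck_mul_left:
 assumes "open U" "Ck bndA k 0 U (%x _. f x)" "Ck bndB k p U G"
 shows "Ck bndC k p U (%x vs. mul (f x) (G x vs))"
proof (rule Ck_cong[OF assms(1)])
 show "Ck bndC k p U (%x. sprod (replicate p False) (%_. f x) (G x))"
  using Ck_sprod[of k "replicate p False" U "%x _. f x" G] assms by (simp add: filter_replicate)
qed (simp add: sprod_def sel_replicate_True)

lemma Ck_mul_right: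
 assumes "open U" "Ck bndA k p U G" "Ck bndB k 0 U (%x _. f x)"
 shows "Ck bndC k p U (%x vs. mul (G x vs) (f x))"
proof (rule Ck_cong[OF assms(1)])
 show "Ck bndC k p U (%x. sprod (replicate p True) (G x) (%_. f x))"
  using Ck_sprod[of k "replicate p True" U G "%x _. f x"] assms by (simp add: filter_replicate)
qed (simp add: sprod_def sel_replicate_True)

end

section \<open>Functions of class \<open>C\<^sup>k\<close>\<close>

abbreviation Ck_fun :: "nat => 'a::real_normed_vector set => ('a => 'b::real_normed_vector) => bool" where
 "Ck_fun k U f \<equiv> Ck norm_bnd k 0 U (%x _. f x)"

lemma regular_fun_iff: "regular_family norm_bnd 0 U (%x _. f x) \<longleftrightarrow> (ALL x:U. isCont f x)"
proof -
 have "(ALL e>0. \<forall>\<^sub>F y in nhds x. norm (f y - f x) <= e) \<longleftrightarrow> isCont f x" for x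
 proof -
  have "isCont f x \<longleftrightarrow> (f \<longlongrightarrow> f x) (nhds x)" by (simp add: isCont_def tendsto_at_iff_tendsto_nhds)
  also have "... \<longleftrightarrow> (ALL e>0. \<forall>\<^sub>F y in nhds x. norm (f y - f x) < e)" by (simp add: tendsto_iff dist_norm)
  also have "... \<longleftrightarrow> (ALL e>0. \<forall>\<^sub>F y in nhds x. norm (f y - f x) <= e)"
  proof (intro iffI allI impI)
   fix e :: real assume "ALL e>0. \<forall>\<^sub>F y in nhds x. norm (f y - f x) <= e" "e > 0"
   hence "\<forall>\<^sub>F y in nhds x. norm (f y - f x) <= e / 2" by (meson half_gt_zero)
   thus "\<forall>\<^sub>F y in nhds x. norm (f y - f x) < e" by eventually_elim (use \<open>e > 0\<close> in simp)
  next
   fix e :: real assume "ALL e>0. \<forall>\<^sub>F y in nhds x. norm (f y - f x) < e" "e > 0"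
   hence "\<forall>\<^sub>F y in nhds x. norm (f y - f x) < e" by blast
   thus "\<forall>\<^sub>F y in nhds x. norm (f y - f x) <= e" by eventually_elim simp
  qed
  finally show ?thesis by simp
 qed
 moreover have "EX K>=0. norm (f x) <= K" for x by (rule exI[of _ "norm (f x)"]) simp
 ultimately show ?thesis by (simp add: regular_family_def bd_def)
qed

lemma Ck_fun_isCont: "Ck_fun k U f ==> x \<in> U ==> isCont f x"
 using Ck_regular regular_fun_iff by blast

lemma Ck_fun_continuous_on: "Ck_fun k U f ==> continuous_on U f"
 by (simp add: Ck_fun_isCont continuous_at_imp_continuous_on)

lemma Ck_fun_SucD:
 assumes "Ck_fun (Suc k) U f"
 obtains f' where "!!x. x \<in> U ==> (f has_derivative (%h. f' x [h])) (at x)" "Ck norm_bnd k 1 U f'"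
proof -
 obtain f' where f': "family_deriv norm_bnd 0 U (%x _. f x) f'" "Ck norm_bnd k 1 U f'" using assms by auto
 have "(f has_derivative (%h. f' x [h])) (at x)" if x: "x \<in> U" for x unfolding has_derivative_within_alt2
 proof (intro conjI allI impI)
  have r: "mlin 1 (f' x)" "EX K>=0. bd norm_bnd 1 (f' x) K" using Ck_regular[OF f'(2)] x unfolding regular_family_def by blast+
  then obtain K where K: "bd norm_bnd 1 (f' x) K" by blast
  have lin: "f' x [a *\<^sub>R u + b *\<^sub>R v] = a *\<^sub>R f' x [u] + b *\<^sub>R f' x [v]" for a b u v using r(1) by simp
  show "bounded_linear (%h. f' x [h])"
  proof (rule bounded_linear_intro)
   show "f' x [u + v] = f' x [u] + f' x [v]" for u v using lin[of 1 u 1 v] by simp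
   show "f' x [a *\<^sub>R u] = a *\<^sub>R f' x [u]" for a u using lin[of a u 0 0] by simp
   show "norm (f' x [u]) <= norm u * K" for u using bdD[OF K, of "[u]"] by (simp add: mult.commute)
  qed
  fix e :: real assume "e > 0"
  hence "\<forall>\<^sub>F y in nhds x. bd norm_bnd 0 (%vs. f y - f x - f' x ((y - x) # vs)) (e * norm (y - x))"
   using f'(1) x unfolding family_deriv_def by blast
  hence "\<forall>\<^sub>F y in at x. bd norm_bnd 0 (%vs. f y - f x - f' x ((y - x) # vs)) (e * norm (y - x))"
   by (simp add: eventually_at_filter eventually_mono)
  thus "\<forall>\<^sub>F y in at x. norm (f y - f x - f' x [y - x]) <= e * norm (y - x)" by eventually_elim (simp add: bd_def)
 qed
 thus thesis using f'(2) that by blast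
qed

lemma Ck_fun_SucI:
 assumes d: "!!x. x \<in> U ==> (f has_derivative (%h. f' x [h])) (at x)" and f': "Ck norm_bnd k 1 U f'"
 shows "Ck_fun (Suc k) U f"
proof -
 have "family_deriv norm_bnd 0 U (%x _. f x) f'" unfolding family_deriv_def
 proof (intro ballI allI impI)
  fix x and e :: real assume x: "x \<in> U" and "e > 0"
  hence "\<forall>\<^sub>F y in at x. norm (f y - f x - f' x [y - x]) <= e * norm (y - x)" using d[OF x] unfolding has_derivative_within_alt2 by blast
  moreover have "f' x [0] = 0" using linear_0[OF bounded_linear.linear[OF has_derivative_bounded_linear[OF d[OF x]]]] by simp
  ultimately have "\<forall>\<^sub>F y in nhds x. norm (f y - f x - f' x [y - x]) <= e * norm (y - x)" unfolding eventually_at_filter by (elim eventually_mono) auto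
  thus "\<forall>\<^sub>F y in nhds x. bd norm_bnd 0 (%vs. f y - f x - f' x ((y - x) # vs)) (e * norm (y - x))" by eventually_elim (simp add: bd_def)
 qed
 moreover have "regular_family norm_bnd 0 U (%x _. f x)" unfolding regular_fun_iff using d has_derivative_continuous by blast
 ultimately show ?thesis using f' by auto
qed

lemma Ck_fun_const:
 fixes c :: "'b::real_normed_vector"
 shows "Ck_fun k U (%x. c)"
proof -
 interpret R: bounding "norm_bnd :: 'b => real => bool" by (rule bounding_norm)
 show ?thesis by (rule R.Ck_const_family[where K = "norm c"]) (auto simp: bd_def)
qed

lemma Ck_fun_mult: "Ck_fun k U f ==> Ck_fun k U g ==> Ck_fun k U (%x. f x * g x :: real)"
 by (rule bounded_bilin.Ck_mul[OF bounded_bilin_times])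

lemma Ck_fun_divide:
 fixes a :: "'a::real_normed_vector => real"
 assumes U: "open U" and nz: "!!x. x \<in> U ==> a x ~= 0"
 shows "Ck_fun k U a ==> Ck_fun k U (%x. 1 / a x)"
proof (induction k)
 case 0
 thus ?case using nz unfolding Ck.simps regular_fun_iff by (intro ballI continuous_intros) auto
next
 case (Suc k)
 obtain a' where a': "!!x. x \<in> U ==> (a has_derivative (%h. a' x [h])) (at x)" "Ck norm_bnd k 1 U a'"
  using Ck_fun_SucD[OF Suc.prems] by blast
 have inv: "Ck_fun k U (%x. 1 / a x)" using Suc.IH Ck_Suc_imp[OF Suc.prems] by blast
 have "Ck_fun k U (%x. (-1) * ((1 / a x) * (1 / a x)))" by (intro Ck_fun_mult inv Ck_fun_const)
 from bounded_bilin.Ck_mul_left[OF bounded_bilin_times U this a'(2)]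
 have "Ck norm_bnd k 1 U (%x vs. ((-1) * ((1 / a x) * (1 / a x))) * a' x vs)" .
 thus ?case
 proof (rule Ck_fun_SucI[rotated])
  fix x assume x: "x \<in> U"
  show "((%x. 1 / a x) has_derivative (%h. ((-1) * ((1 / a x) * (1 / a x))) * a' x [h])) (at x)"
   using nz[OF x] by (auto intro!: derivative_eq_intros a'(1)[OF x] simp: field_simps power2_eq_square)
 qed
qed

text \<open>Unfolding the recursion of \<open>Ck\<close> produces the chain of derivatives that
  \<open>Ck_on\<close> asks for; a chain for the derivative is extended by putting the family itself
  in front with \<open>case_nat\<close>.\<close>

lemma Ck_fun_imp_Ck_on:
 assumes U: "open U" and f: "Ck_fun k U f"
 shows "Ck_on k E (U \<inter> E) f"
proof -
 have "EX D. D 0 = G & (ALL j<=k. regular_family norm_bnd (p + j) U (D j)) &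
   (ALL j<k. family_deriv norm_bnd (p + j) U (D j) (D (Suc j)))"
  if "Ck norm_bnd k p U G" for k p and G :: "'a => 'a list => 'b" using that
 proof (induction k arbitrary: p G)
  case 0
  thus ?case by (intro exI[of _ "%_. G"]) simp
 next
  case (Suc k)
  then obtain G' where G': "regular_family norm_bnd p U G" "family_deriv norm_bnd p U G G'" "Ck norm_bnd k (Suc p) U G'" by auto
  from Suc.IH[OF this(3)] obtain D where D: "D 0 = G'" "ALL j<=k. regular_family norm_bnd (Suc p + j) U (D j)"
   "ALL j<k. family_deriv norm_bnd (Suc p + j) U (D j) (D (Suc j))" by blast
  show ?case
  proof (intro exI[of _ "case_nat G D"] conjI allI impI)
   show "regular_family norm_bnd (p + j) U (case j of 0 => G | Suc x => D x)" if "j <= Suc k" for j using that G' D by (cases j) auto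
   show "family_deriv norm_bnd (p + j) U (case j of 0 => G | Suc x => D x)
     (case Suc j of 0 => G | Suc x => D x)" if "j < Suc k" for j using that G' D by (cases j) auto
  qed simp
 qed
 from this[OF f] obtain D where D0: "D 0 = (%x _. f x)"
  and reg: "!!j. j <= k ==> regular_family norm_bnd j U (D j)"
  and der: "!!j. j < k ==> family_deriv norm_bnd j U (D j) (D (Suc j))" by auto
 show ?thesis unfolding Ck_on_def
 proof (intro exI[of _ D] conjI ballI allI impI)
  show "D 0 x [] = f x" for x by (simp add: D0)
  fix x assume "x \<in> U \<inter> E"
  hence x: "x \<in> U" by blast
  show "bounded_multilinear_on E j (D j x)" if "j <= k" for j unfolding bounded_multilinear_on_def
  proof (intro conjI ballI allI impI)
   have r: "mlin j (D j x)" "EX K>=0. bd norm_bnd j (D j x) K" using reg[OF that] x unfolding regular_family_def by blast+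
   show "D j x (vs[i := a *\<^sub>R u + b *\<^sub>R v]) = a *\<^sub>R D j x (vs[i := u]) + b *\<^sub>R D j x (vs[i := v])"
    if "vs \<in> slots E j" "i < j" for vs i a b u v using mlin_update[OF r(1), of vs i] that unfolding slots_def by simp
   show "EX K. ALL vs:slots E j. norm (D j x vs) <= K * nrm vs" using r(2) unfolding bd_def slots_def by blast
  qed
  fix e :: real assume e: "e > 0"
  show "EX d>0. ALL h:E. norm h < d & x + h \<in> U \<inter> E --> (ALL vs:slots E j.
    norm (D j (x + h) vs - D j x vs - D (Suc j) x (h # vs)) <= e * norm h * nrm vs)" if "j < k" for j
  proof -
   have "\<forall>\<^sub>F y in nhds x. bd norm_bnd j (%vs. D j y vs - D j x vs - D (Suc j) x ((y - x) # vs)) (e * norm (y - x))"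
    using der[OF that] e x unfolding family_deriv_def by blast
   then obtain d where d: "d > 0" "!!y. dist y x < d ==>
     bd norm_bnd j (%vs. D j y vs - D j x vs - D (Suc j) x ((y - x) # vs)) (e * norm (y - x))" unfolding eventually_nhds_metric by blast
   show ?thesis proof (intro exI[of _ d] conjI ballI impI d(1))
    fix h vs assume "norm h < d & x + h \<in> U \<inter> E" "vs \<in> slots E j"
    thus "norm (D j (x + h) vs - D j x vs - D (Suc j) x (h # vs)) <= e * norm h * nrm vs" using d(2)[of "x + h"] by (simp add: bd_def slots_def dist_norm)
   qed
  qed
  show "EX d>0. ALL y:U \<inter> E. norm (y - x) < d --> (ALL vs:slots E k.
    norm (D k y vs - D k x vs) <= e * nrm vs)"
  proof -
   have "\<forall>\<^sub>F y in nhds x. bd norm_bnd k (%vs. D k y vs - D k x vs) e" using reg[of k] e x unfolding regular_family_def by blast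
   then obtain d where d: "d > 0" "!!y. dist y x < d ==> bd norm_bnd k (%vs. D k y vs - D k x vs) e" unfolding eventually_nhds_metric by blast
   show ?thesis proof (intro exI[of _ d] conjI ballI impI d(1))
    fix y vs assume "norm (y - x) < d" "vs \<in> slots E k"
    thus "norm (D k y vs - D k x vs) <= e * nrm vs" using d(2)[of y] by (simp add: bd_def slots_def dist_norm)
   qed
  qed
 qed
qed

section \<open>The implicit function theorem\<close>

lemma Ck_fun_shift:
 assumes "open U0" "!!x. x \<in> U0 ==> x + t x *\<^sub>R e \<in> U" "Ck_fun k U0 t" "Ck norm_bnd k p U G"
 shows "Ck norm_bnd k p U0 (%x vs. G (x + t x *\<^sub>R e) vs)"
proof -
 interpret R: bounding "norm_bnd :: 'b => real => bool" by (rule bounding_norm)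
 show ?thesis using R.Ck_compose[OF assms(1) bounded_linear_ident, of "%x. x + t x *\<^sub>R e" 0 t e U] assms(2-4) by (auto simp: image_subset_iff)
qed

text \<open>Near \<open>x0\<close> the function grows along \<open>e\<close> with slope at least
  \<open>c / 2\<close>. The intermediate value theorem then gives a zero, the growth its uniqueness
  and a Lipschitz bound, and differentiating the equation the formula for the derivative.\<close>

lemma scalar_implicit_function:
 fixes F :: "'a::real_normed_vector => real"
 assumes U: "open U" "x0 \<in> U" and F: "Ck_fun (Suc k) U F" and F0: "F x0 = 0"
  and F': "(F has_derivative F') (at x0)" "F' e > 0"
 obtains U0 \<eta> \<tau> where "open U0" "x0 \<in> U0" "\<eta> > 0"
  "!!x t. x \<in> U0 ==> \<bar>t\<bar> < \<eta> ==> x + t *\<^sub>R e \<in> U"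
  "!!x t. x \<in> U0 ==> \<bar>t\<bar> < \<eta> ==> F (x + t *\<^sub>R e) = 0 \<longleftrightarrow> t = \<tau> x"
  "!!x. x \<in> U0 ==> \<bar>\<tau> x\<bar> < \<eta>" "\<tau> x0 = 0" "Ck_fun (Suc k) U0 \<tau>"
proof -
 interpret R: bounding "norm_bnd :: real => real => bool" by (rule bounding_norm)
 obtain f' where f': "!!x. x \<in> U ==> (F has_derivative (%h. f' x [h])) (at x)" "Ck norm_bnd k 1 U f'" using Ck_fun_SucD[OF F] by blast
 define c where "c = f' x0 [e]"
 have "(%h. f' x0 [h]) = F'" using has_derivative_unique[OF f'(1)[OF U(2)] F'(1)] .
 hence c: "c > 0" using F'(2) unfolding c_def by metis
 have e0: "e ~= 0" using F'(2) linear_0[OF bounded_linear.linear[OF has_derivative_bounded_linear[OF F'(1)]]] by auto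
 have fe: "Ck_fun k U (%x. f' x [e])"
 proof -
  have "Ck norm_bnd k 0 U (%x vs. f' x (e # vs))" using R.Ck_fix f'(2) by simp
  thus ?thesis by (rule Ck_cong[OF U(1), rotated]) simp
 qed
 have "\<forall>\<^sub>F x in nhds x0. x \<in> U & f' x [e] > c / 2"
 proof (rule eventually_conj)
  show "\<forall>\<^sub>F x in nhds x0. x \<in> U" using U by (rule eventually_nhds_in_open)
  have "((%x. f' x [e]) \<longlongrightarrow> c) (nhds x0)" using Ck_fun_isCont[OF fe U(2)] tendsto_at_iff_tendsto_nhds[of "%x. f' x [e]" x0]
   by (simp add: isCont_def c_def)
  thus "\<forall>\<^sub>F x in nhds x0. f' x [e] > c / 2" by (rule order_tendstoD) (use c in simp)
 qed
 then obtain \<rho> where \<rho>: "\<rho> > 0" "!!x. dist x x0 < \<rho> ==> x \<in> U & f' x [e] > c / 2" unfolding eventually_nhds_metric by blast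
 define \<eta> where "\<eta> = \<rho> / (2 * norm e)"
 have \<eta>: "\<eta> > 0" using \<rho> e0 by (simp add: \<eta>_def)
 have near: "dist (x + t *\<^sub>R e) x0 < \<rho>" if "dist x x0 < \<rho> / 2" "\<bar>t\<bar> <= \<eta>" for x t
 proof -
  have "norm (t *\<^sub>R e) <= \<rho> / 2" using mult_right_mono[OF that(2), of "norm e"] e0 by (simp add: \<eta>_def field_simps)
  thus ?thesis using that(1) norm_triangle_ineq[of "x - x0" "t *\<^sub>R e"] by (simp add: dist_norm algebra_simps)
 qed
 have growth: "F (x + t *\<^sub>R e) - F (x + s *\<^sub>R e) >= c / 2 * (t - s)"
  if x: "dist x x0 < \<rho> / 2" and "- \<eta> <= s" "s < t" "t <= \<eta>" for x s t
 proof -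
  have "((%r. F (x + r *\<^sub>R e)) has_real_derivative f' (x + r *\<^sub>R e) [e]) (at r)" if "s <= r" "r <= t" for r
  proof -
   have rU: "x + r *\<^sub>R e \<in> U" using \<rho>(2) near[OF x, of r] that \<open>- \<eta> <= s\<close> \<open>t <= \<eta>\<close> by auto
   have "((%r. F (x + r *\<^sub>R e)) has_derivative (%h. f' (x + r *\<^sub>R e) [h *\<^sub>R e])) (at r)" proof -
    have "((%r. x + r *\<^sub>R e) has_derivative (%h. h *\<^sub>R e)) (at r)" by (auto intro!: derivative_eq_intros)
    from has_derivative_compose[OF this, of F "%h. f' (x + r *\<^sub>R e) [h]"] f'(1)[OF rU]
    show ?thesis by simp
   qed
   moreover have "f' (x + r *\<^sub>R e) [h *\<^sub>R e] = f' (x + r *\<^sub>R e) [e] * h" for h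
    using linear_scale[OF bounded_linear.linear[OF has_derivative_bounded_linear[OF f'(1)[OF rU]]], of h e] by (simp add: mult.commute)
   ultimately show ?thesis by (simp add: has_field_derivative_def)
  qed
  from MVT2[OF \<open>s < t\<close> this] obtain z where z: "s < z" "z < t"
   "F (x + t *\<^sub>R e) - F (x + s *\<^sub>R e) = (t - s) * f' (x + z *\<^sub>R e) [e]" by auto
  have "f' (x + z *\<^sub>R e) [e] > c / 2" using \<rho>(2) near[OF x, of z] z that by auto
  hence "(t - s) * (c / 2) <= (t - s) * f' (x + z *\<^sub>R e) [e]" using \<open>s < t\<close> by (intro mult_left_mono) auto
  thus ?thesis using z(3) by (simp add: mult.commute)
 qed
 have growth_abs: "c / 2 * \<bar>t - s\<bar> <= \<bar>F (x + t *\<^sub>R e) - F (x + s *\<^sub>R e)\<bar>"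
  if "dist x x0 < \<rho> / 2" "\<bar>s\<bar> <= \<eta>" "\<bar>t\<bar> <= \<eta>" for x s t
 proof -
  have "- \<eta> <= s" "s <= \<eta>" "- \<eta> <= t" "t <= \<eta>" using that(2,3) by auto
  thus ?thesis using growth[OF that(1), of s t] growth[OF that(1), of t s] by (cases s t rule: linorder_cases) (auto simp: abs_if)
 qed
 \<comment> \<open>Over these points \<open>F\<close> has opposite signs at the two ends of the
   segment.\<close>
 define U0 where "U0 = (ball x0 (\<rho> / 2) \<inter> (%x. F (x + \<eta> *\<^sub>R e)) -` {0<..}) \<inter>
   (ball x0 (\<rho> / 2) \<inter> (%x. F (x + (- \<eta>) *\<^sub>R e)) -` {..<0})"
 have cont: "continuous_on (ball x0 (\<rho> / 2)) (%x. F (x + t *\<^sub>R e))" if "\<bar>t\<bar> <= \<eta>" for t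
 proof (rule continuous_on_compose2[OF Ck_fun_continuous_on[OF F]])
  show "(%x. x + t *\<^sub>R e) ` ball x0 (\<rho> / 2) \<subseteq> U" using \<rho>(2) near[OF _ that] by (auto simp: dist_commute)
 qed (intro continuous_intros)
 have oU0: "open U0" unfolding U0_def using \<eta> by (intro open_Int continuous_open_preimage cont) auto
 have xU0: "x0 \<in> U0" using growth[of x0 0 \<eta>] growth[of x0 "-\<eta>" 0] F0 \<rho>(1) \<eta> mult_pos_pos[OF c \<eta>] unfolding U0_def by auto
 have U0D: "dist x x0 < \<rho> / 2" "F (x + \<eta> *\<^sub>R e) > 0" "F (x + (- \<eta>) *\<^sub>R e) < 0" if "x \<in> U0" for x
  using that by (auto simp: U0_def dist_commute)
 have ex: "EX t. \<bar>t\<bar> < \<eta> & F (x + t *\<^sub>R e) = 0" if x: "x \<in> U0" for x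
 proof -
  have "continuous_on {-\<eta>..\<eta>} (%t. F (x + t *\<^sub>R e))"
  proof (rule continuous_on_compose2[OF Ck_fun_continuous_on[OF F]])
   show "(%t. x + t *\<^sub>R e) ` {-\<eta>..\<eta>} \<subseteq> U" using \<rho>(2) near[OF U0D(1)[OF x]] by auto
  qed (intro continuous_intros)
  from IVT'[of "%t. F (x + t *\<^sub>R e)" "-\<eta>" 0 \<eta>, OF _ _ _ this] U0D[OF x] \<eta>
  obtain t where t: "-\<eta> <= t" "t <= \<eta>" "F (x + t *\<^sub>R e) = 0" by (metis less_eq_real_def neg_le_0_iff_le order_trans)
  hence "t ~= \<eta>" "t ~= -\<eta>" using U0D[OF x] by auto
  thus ?thesis using t by (intro exI[of _ t]) auto
 qed
 define \<tau> where "\<tau> x = (SOME t. \<bar>t\<bar> < \<eta> & F (x + t *\<^sub>R e) = 0)" for x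
 have \<tau>: "\<bar>\<tau> x\<bar> < \<eta>" "F (x + \<tau> x *\<^sub>R e) = 0" if "x \<in> U0" for x using someI_ex[OF ex[OF that]] unfolding \<tau>_def by blast+
 have uniq: "F (x + t *\<^sub>R e) = 0 \<longleftrightarrow> t = \<tau> x" if "x \<in> U0" "\<bar>t\<bar> < \<eta>" for x t
  using growth_abs[OF U0D(1)[OF that(1)], of "\<tau> x" t] \<tau>[OF that(1)] that(2) c by (auto simp: zero_less_mult_iff mult_le_0_iff)
 have inU: "x + t *\<^sub>R e \<in> U" if "x \<in> U0" "\<bar>t\<bar> < \<eta>" for x t using \<rho>(2) near[OF U0D(1)[OF that(1)], of t] that(2) by auto
 define \<phi> where "\<phi> x = x + \<tau> x *\<^sub>R e" for x
 define \<tau>' where "\<tau>' x vs = (-1) * (1 / f' (\<phi> x) [e]) * f' (\<phi> x) vs" for x vs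
 have \<phi>U: "\<phi> x \<in> U" "f' (\<phi> x) [e] > c / 2" if "x \<in> U0" for x
  using \<rho>(2) near[OF U0D(1)[OF that], of "\<tau> x"] \<tau>(1)[OF that] by (auto simp: \<phi>_def)
 have der: "(\<tau> has_derivative (%h. \<tau>' x [h])) (at x)" if x: "x \<in> U0" for x unfolding has_derivative_within_alt2
 proof (intro conjI allI impI)
  have bl: "bounded_linear (%h. f' (\<phi> x) [h])" using has_derivative_bounded_linear[OF f'(1)[OF \<phi>U(1)[OF x]]] .
  interpret dF: bounded_linear "%h. f' (\<phi> x) [h]" by (rule bl)
  show "bounded_linear (%h. \<tau>' x [h])" unfolding \<tau>'_def by (rule bounded_linear_const_mult[OF bl])
  define a where "a = f' (\<phi> x) [e]"
  have a: "a > 0" using \<phi>U(2)[OF x] c by (simp add: a_def)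
  obtain B where B: "B > 0" "!!h. norm (f' (\<phi> x) [h]) <= norm h * B" using dF.pos_bounded by blast
  have F\<phi>: "F (\<phi> x) = 0" using \<tau>(2)[OF x] by (simp add: \<phi>_def)
  have approx: "\<forall>\<^sub>F Y in nhds (\<phi> x). \<bar>F Y - f' (\<phi> x) [Y - \<phi> x]\<bar> <= d * norm (Y - \<phi> x)" if "d > 0" for d
  proof -
   have "\<forall>\<^sub>F Y in at (\<phi> x). norm (F Y - F (\<phi> x) - f' (\<phi> x) [Y - \<phi> x]) <= d * norm (Y - \<phi> x)"
    using f'(1)[OF \<phi>U(1)[OF x]] that unfolding has_derivative_within_alt2 by blast
   thus ?thesis unfolding eventually_at_filter by (rule eventually_mono) (use F\<phi> dF.zero in auto)
  qed
  define l where "l = 2 * (1 + B) / c"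
  \<comment> \<open>A Lipschitz bound must precede differentiability: it makes the increment of
    \<open>\<phi>\<close> of the order of y - x, so that the first-order error of \<open>F\<close>
    at \<open>\<phi> x\<close> is small against y - x.\<close>
  have lip: "\<forall>\<^sub>F y in nhds x. \<bar>\<tau> y - \<tau> x\<bar> <= l * norm (y - x)"
  proof -
   have "filterlim (%y. y + \<tau> x *\<^sub>R e) (nhds (\<phi> x)) (nhds x)" unfolding \<phi>_def by (intro tendsto_intros filterlim_ident)
   hence "\<forall>\<^sub>F y in nhds x. \<bar>F (y + \<tau> x *\<^sub>R e) - f' (\<phi> x) [y + \<tau> x *\<^sub>R e - \<phi> x]\<bar> <= 1 * norm (y + \<tau> x *\<^sub>R e - \<phi> x)"
    using approx[OF zero_less_one] unfolding filterlim_iff by blast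
   moreover have "\<forall>\<^sub>F y in nhds x. y \<in> U0" using oU0 x by (rule eventually_nhds_in_open)
   ultimately show ?thesis proof eventually_elim
    case (elim y)
    have "c / 2 * \<bar>\<tau> y - \<tau> x\<bar> <= \<bar>F (y + \<tau> y *\<^sub>R e) - F (y + \<tau> x *\<^sub>R e)\<bar>"
     using growth_abs[OF U0D(1)[OF elim(2)], of "\<tau> x" "\<tau> y"] \<tau>(1)[OF x] \<tau>(1)[OF elim(2)] by simp
    also have "... = \<bar>F (y + \<tau> x *\<^sub>R e)\<bar>" using \<tau>(2)[OF elim(2)] by simp
    also have "... <= norm (y - x) + norm (y - x) * B" using elim(1) B(2)[of "y - x"] by (simp add: \<phi>_def)
    finally show ?case using c by (simp add: l_def field_simps)
   qed
  qed
  have l: "l > 0" using c B by (simp add: l_def)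
  have \<tau>_lim: "(\<tau> \<longlongrightarrow> \<tau> x) (nhds x)"
  proof -
   have "((%y. \<tau> y - \<tau> x) \<longlongrightarrow> 0) (nhds x)" proof (rule Lim_null_comparison)
    show "\<forall>\<^sub>F y in nhds x. norm (\<tau> y - \<tau> x) <= l * norm (y - x)" using lip by simp
    have "((%y. l * norm (y - x)) \<longlongrightarrow> l * norm (x - x)) (nhds x)" by (intro tendsto_intros filterlim_ident)
    thus "((%y. l * norm (y - x)) \<longlongrightarrow> 0) (nhds x)" by simp
   qed
   thus ?thesis by (simp add: LIM_zero_cancel)
  qed
  have \<phi>_lim: "filterlim \<phi> (nhds (\<phi> x)) (nhds x)" unfolding \<phi>_def by (intro tendsto_intros filterlim_ident \<tau>_lim)
  fix eps :: real assume eps: "eps > 0"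
  define d where "d = eps * a / (1 + l * norm e)"
  have dpos: "1 + l * norm e > 0" using l by (simp add: add_pos_nonneg)
  have d: "d > 0" "d * (1 + l * norm e) = eps * a" using eps a dpos by (simp_all add: d_def)
  have "\<forall>\<^sub>F y in nhds x. \<bar>F (\<phi> y) - f' (\<phi> x) [\<phi> y - \<phi> x]\<bar> <= d * norm (\<phi> y - \<phi> x)"
   using approx[OF d(1)] \<phi>_lim unfolding filterlim_iff by blast
  moreover have "\<forall>\<^sub>F y in nhds x. y \<in> U0" using oU0 x by (rule eventually_nhds_in_open)
  ultimately have "\<forall>\<^sub>F y in nhds x. norm (\<tau> y - \<tau> x - \<tau>' x [y - x]) <= eps * norm (y - x)" using lip
  proof eventually_elim
   case (elim y)
   have eq: "\<phi> y - \<phi> x = (y - x) + (\<tau> y - \<tau> x) *\<^sub>R e" by (simp add: \<phi>_def algebra_simps)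
   have "norm (\<phi> y - \<phi> x) <= norm (y - x) + l * norm (y - x) * norm e" unfolding eq using elim(3)
    by (intro order_trans[OF norm_triangle_ineq] add_mono) (auto intro: mult_right_mono)
   hence "d * norm (\<phi> y - \<phi> x) <= d * (norm (y - x) + l * norm (y - x) * norm e)" using d(1) by simp
   also have "... = eps * a * norm (y - x)" by (subst d(2)[symmetric]) (simp add: algebra_simps)
   finally have "\<bar>F (\<phi> y) - f' (\<phi> x) [\<phi> y - \<phi> x]\<bar> <= eps * a * norm (y - x)" using elim(1) by simp
   moreover have "F (\<phi> y) = 0" using \<tau>(2)[OF elim(2)] by (simp add: \<phi>_def)
   moreover have "f' (\<phi> x) [\<phi> y - \<phi> x] = f' (\<phi> x) [y - x] + (\<tau> y - \<tau> x) * a" unfolding eq dF.add dF.scaleR a_def by simp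
   ultimately have "\<bar>(\<tau> y - \<tau> x) * a + f' (\<phi> x) [y - x]\<bar> <= eps * a * norm (y - x)" by simp
   moreover have "(\<tau> y - \<tau> x) * a + f' (\<phi> x) [y - x] = a * (\<tau> y - \<tau> x - \<tau>' x [y - x])"
    using a by (simp add: \<tau>'_def a_def[symmetric] field_simps)
   ultimately have "a * \<bar>\<tau> y - \<tau> x - \<tau>' x [y - x]\<bar> <= a * (eps * norm (y - x))" using a by (simp add: abs_mult mult_ac)
   thus ?case using a by simp
  qed
  thus "\<forall>\<^sub>F y in at x. norm (\<tau> y - \<tau> x - \<tau>' x [y - x]) <= eps * norm (y - x)"
   by (simp add: eventually_at_filter eventually_mono)
 qed
 \<comment> \<open>Bootstrap: \<open>\<tau>'\<close> is made of derivatives of \<open>F\<close>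
   taken at \<open>\<phi>\<close>, so it is as regular as \<open>\<tau>\<close> up to order
   \<open>k\<close>, and \<open>\<tau>\<close> gains one order.\<close>
 have "Ck_fun j U0 \<tau>" if "j <= Suc k" for j using that
 proof (induction j)
  case 0
  show ?case unfolding Ck.simps regular_fun_iff using der has_derivative_continuous by blast
 next
  case (Suc j)
  hence j: "Ck_fun j U0 \<tau>" "j <= k" by auto
  have 1: "Ck norm_bnd j 1 U0 (%x vs. f' (\<phi> x) vs)"
   unfolding \<phi>_def by (rule Ck_fun_shift[OF oU0 _ j(1) Ck_le[OF f'(2) j(2)]]) (use inU \<tau>(1) in blast)
  have 2: "Ck_fun j U0 (%x. f' (\<phi> x) [e])" unfolding \<phi>_def by (rule Ck_fun_shift[OF oU0 _ j(1) Ck_le[OF fe j(2)]]) (use inU \<tau>(1) in blast)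
  have "Ck_fun j U0 (%x. (-1) * (1 / f' (\<phi> x) [e]))" by (intro Ck_fun_mult Ck_fun_const Ck_fun_divide 2 oU0) (use \<phi>U(2) c in force)
  from bounded_bilin.Ck_mul_left[OF bounded_bilin_times oU0 this 1]
  have "Ck norm_bnd j 1 U0 \<tau>'" unfolding \<tau>'_def .
  thus ?case using Ck_fun_SucI[of U0 \<tau> \<tau>' j] der by blast
 qed
 moreover have "\<tau> x0 = 0" using uniq[OF xU0, of 0] F0 \<eta> by simp
 ultimately show thesis using that[of U0 \<eta> \<tau>] oU0 xU0 \<eta> inU uniq \<tau>(1) by blast
qed

text \<open>The last equation is solved for its own coordinate and substituted into the others.
  Since the other \<open>l i\<close> vanish on the last vector, their values at \<open>x0\<close>
  are unchanged, and the induction applies. Its last clause, on substitution, yields the regularity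
  of the coordinate solved first.\<close>

lemma implicit_graph:
 fixes F :: "nat => 'a::real_normed_vector => real" and e :: "nat => 'a"
 assumes "open U" "x0 \<in> U" "!!i. i < \<nu> ==> Ck_fun (Suc k) U (F i)" "!!i. i < \<nu> ==> F i x0 = 0"
  "!!i. i < \<nu> ==> (F i has_derivative l i) (at x0)"
  "!!i j. i < \<nu> ==> j < \<nu> ==> l i (e j) = (if i = j then 1 else 0)"
 shows "EX U0 \<eta> c. open U0 & x0 \<in> U0 & \<eta> > 0 & (ALL i<\<nu>. Ck_fun (Suc k) U0 (c i)) &
  (ALL x:U0. ALL i<\<nu>. \<bar>c i x\<bar> < \<eta>) &
  (ALL x:U0. ALL t. (ALL i<\<nu>. \<bar>t i\<bar> < \<eta>) --> x + (SUM i<\<nu>. t i *\<^sub>R e i) \<in> U &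
    ((ALL i<\<nu>. F i (x + (SUM i<\<nu>. t i *\<^sub>R e i)) = 0) \<longleftrightarrow> (ALL i<\<nu>. t i = c i x))) &
  (ALL G. Ck_fun (Suc k) U G --> Ck_fun (Suc k) U0 (%x. G (x + (SUM i<\<nu>. c i x *\<^sub>R e i)) :: real))"
 using assms
proof (induction \<nu> arbitrary: U F l)
 case 0
 thus ?case by (intro exI[of _ U] exI[of _ 1]) auto
next
 case (Suc \<nu>)
 have U: "open U" "x0 \<in> U" by fact+
 obtain U1 \<eta>1 \<tau> where U1: "open U1" "x0 \<in> U1" "\<eta>1 > 0"
  "!!x t. x \<in> U1 ==> \<bar>t\<bar> < \<eta>1 ==> x + t *\<^sub>R e \<nu> \<in> U"
  "!!x t. x \<in> U1 ==> \<bar>t\<bar> < \<eta>1 ==> F \<nu> (x + t *\<^sub>R e \<nu>) = 0 \<longleftrightarrow> t = \<tau> x"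
  "!!x. x \<in> U1 ==> \<bar>\<tau> x\<bar> < \<eta>1" "\<tau> x0 = 0" "Ck_fun (Suc k) U1 \<tau>"
  by (rule scalar_implicit_function[OF U Suc.prems(3,4,5), of \<nu> "e \<nu>"])
   (use Suc.prems(6)[of \<nu> \<nu>] in auto)
 define F1 where "F1 i x = F i (x + \<tau> x *\<^sub>R e \<nu>)" for i x
 have shift: "Ck_fun (Suc k) U1 (%x. G (x + \<tau> x *\<^sub>R e \<nu>))" if "Ck_fun (Suc k) U G" for G :: "'a => real"
  by (rule Ck_fun_shift[OF U1(1) _ U1(8) that]) (use U1(4,6) in blast)
 have "EX U0 \<eta> c. open U0 & x0 \<in> U0 & \<eta> > 0 & (ALL i<\<nu>. Ck_fun (Suc k) U0 (c i)) &
  (ALL x:U0. ALL i<\<nu>. \<bar>c i x\<bar> < \<eta>) &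
  (ALL x:U0. ALL t. (ALL i<\<nu>. \<bar>t i\<bar> < \<eta>) --> x + (SUM i<\<nu>. t i *\<^sub>R e i) \<in> U1 &
    ((ALL i<\<nu>. F1 i (x + (SUM i<\<nu>. t i *\<^sub>R e i)) = 0) \<longleftrightarrow> (ALL i<\<nu>. t i = c i x))) &
  (ALL G. Ck_fun (Suc k) U1 G --> Ck_fun (Suc k) U0 (%x. G (x + (SUM i<\<nu>. c i x *\<^sub>R e i)) :: real))"
 proof (rule Suc.IH[where l = l])
  fix i assume i: "i < \<nu>"
  show "Ck_fun (Suc k) U1 (F1 i)" unfolding F1_def by (rule shift) (use Suc.prems(3) i in simp)
  show "F1 i x0 = 0" using Suc.prems(4)[of i] i U1(7) by (simp add: F1_def)
  obtain \<tau>' where "!!x. x \<in> U1 ==> (\<tau> has_derivative (%h. \<tau>' x [h])) (at x)" using Ck_fun_SucD[OF U1(8)] by blast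
  hence "((%x. x + \<tau> x *\<^sub>R e \<nu>) has_derivative (%h. h + \<tau>' x0 [h] *\<^sub>R e \<nu>)) (at x0)"
   using U1(2) by (auto intro!: derivative_eq_intros)
  from has_derivative_compose[OF this, of "F i" "l i"]
  have "(F1 i has_derivative (%h. l i (h + \<tau>' x0 [h] *\<^sub>R e \<nu>))) (at x0)" using Suc.prems(5)[of i] i U1(7) by (simp add: F1_def[abs_def])
  moreover have "l i (h + \<tau>' x0 [h] *\<^sub>R e \<nu>) = l i h" for h
  proof -
   have "linear (l i)" using has_derivative_bounded_linear[OF Suc.prems(5)[of i]] i bounded_linear.linear by auto
   thus ?thesis using Suc.prems(6)[of i \<nu>] i by (simp add: linear_add linear_scale)
  qed
  ultimately show "(F1 i has_derivative l i) (at x0)" by simp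
  fix j assume "j < \<nu>"
  thus "l i (e j) = (if i = j then 1 else 0)" using Suc.prems(6) i by simp
 qed (use U1 in auto)
 then obtain U2 \<eta>2 c where U2': "open U2" "x0 \<in> U2" "\<eta>2 > 0" "ALL i<\<nu>. Ck_fun (Suc k) U2 (c i)"
  "ALL x:U2. ALL i<\<nu>. \<bar>c i x\<bar> < \<eta>2"
  "ALL x:U2. ALL t. (ALL i<\<nu>. \<bar>t i\<bar> < \<eta>2) --> x + (SUM i<\<nu>. t i *\<^sub>R e i) \<in> U1 &
    ((ALL i<\<nu>. F1 i (x + (SUM i<\<nu>. t i *\<^sub>R e i)) = 0) \<longleftrightarrow> (ALL i<\<nu>. t i = c i x))"
  "ALL G. Ck_fun (Suc k) U1 G --> Ck_fun (Suc k) U2 (%x. G (x + (SUM i<\<nu>. c i x *\<^sub>R e i)) :: real)"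
  by (elim exE conjE) (rule that; assumption)
 note U2 = U2'(1-3) U2'(4,5)[rule_format] U2'(6)[rule_format, THEN conjunct1]
  U2'(6)[rule_format, THEN conjunct2] U2'(7)[rule_format]
 define \<Gamma> where "\<Gamma> x = x + (SUM i<\<nu>. c i x *\<^sub>R e i)" for x
 have \<Gamma>U1: "\<Gamma> x \<in> U1" if "x \<in> U2" for x unfolding \<Gamma>_def by (rule U2(6)[OF that U2(5)[OF that]])
 define c' where "c' = c(\<nu> := %x. \<tau> (\<Gamma> x))"
 have c': "c' i = c i" if "i < \<nu>" for i using that by (simp add: c'_def)
 have c'Ck: "Ck_fun (Suc k) U2 (c' i)" if "i < Suc \<nu>" for i using that U2(4)[of i] U2(8)[OF U1(8)] by (cases "i = \<nu>") (auto simp: c'_def \<Gamma>_def)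
 have c0: "c i x0 = 0" if "i < \<nu>" for i
 proof -
  have "F1 i x0 = 0" if "i < \<nu>" for i using Suc.prems(4)[of i] that U1(7) by (simp add: F1_def)
  hence "ALL i<\<nu>. 0 = c i x0" using U2(7)[OF U2(2), of "%_. 0"] U2(3) by simp
  thus ?thesis using that by simp
 qed
 hence \<Gamma>0: "\<Gamma> x0 = x0" by (simp add: \<Gamma>_def)
 define \<eta> where "\<eta> = min \<eta>1 \<eta>2"
 define U0 where "U0 = U2 \<inter> (\<Inter>i\<in>{..<Suc \<nu>}. U2 \<inter> c' i -` {-\<eta><..<\<eta>})"
 have "open (U2 \<inter> c' i -` {-\<eta><..<\<eta>})" if "i < Suc \<nu>" for i by (rule continuous_open_preimage[OF Ck_fun_continuous_on[OF c'Ck[OF that]] U2(1)]) simp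
 hence "open U0" unfolding U0_def by (intro open_Int[OF U2(1) open_INT]) auto
 moreover have "x0 \<in> U0" using U2(2,3) U1(3,7) c0 \<Gamma>0 by (auto simp: U0_def c'_def \<eta>_def less_Suc_eq)
 moreover have "\<eta> > 0" using U1 U2 by (simp add: \<eta>_def)
 moreover have "ALL i<Suc \<nu>. Ck_fun (Suc k) U0 (c' i)" using c'Ck Ck_subset[of norm_bnd "Suc k" 0 U2 _ U0] by (simp only: U0_def) blast
 moreover have "ALL x:U0. ALL i<Suc \<nu>. \<bar>c' i x\<bar> < \<eta>" by (auto simp: U0_def abs_less_iff)
 moreover have "x + (SUM i<Suc \<nu>. t i *\<^sub>R e i) \<in> U &
    ((ALL i<Suc \<nu>. F i (x + (SUM i<Suc \<nu>. t i *\<^sub>R e i)) = 0) \<longleftrightarrow> (ALL i<Suc \<nu>. t i = c' i x))"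
  if x: "x \<in> U0" and t: "ALL i<Suc \<nu>. \<bar>t i\<bar> < \<eta>" for x t
 proof -
  define y where "y = x + (SUM i<\<nu>. t i *\<^sub>R e i)"
  have x2: "x \<in> U2" using x by (auto simp: U0_def)
  have t2: "\<bar>t i\<bar> < \<eta>2" if "i < \<nu>" for i using t that by (simp add: \<eta>_def)
  have y: "y \<in> U1" unfolding y_def using U2(6)[OF x2 t2] .
  have sum: "x + (SUM i<Suc \<nu>. t i *\<^sub>R e i) = y + t \<nu> *\<^sub>R e \<nu>" by (simp add: y_def)
  have t1: "\<bar>t \<nu>\<bar> < \<eta>1" using t by (simp add: \<eta>_def)
  have "(ALL i<Suc \<nu>. F i (y + t \<nu> *\<^sub>R e \<nu>) = 0) \<longleftrightarrow> t \<nu> = \<tau> y & (ALL i<\<nu>. F i (y + t \<nu> *\<^sub>R e \<nu>) = 0)"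
   using U1(5)[OF y t1] by (auto simp: less_Suc_eq)
  also have "... \<longleftrightarrow> t \<nu> = \<tau> y & (ALL i<\<nu>. F1 i y = 0)" by (auto simp: F1_def)
  also have "... \<longleftrightarrow> t \<nu> = \<tau> y & (ALL i<\<nu>. t i = c i x)" unfolding y_def using U2(7)[OF x2 t2] by simp
  also have "... \<longleftrightarrow> t \<nu> = \<tau> (\<Gamma> x) & (ALL i<\<nu>. t i = c i x)" by (auto simp: y_def \<Gamma>_def)
  also have "... \<longleftrightarrow> (ALL i<Suc \<nu>. t i = c' i x)" by (auto simp: c'_def less_Suc_eq)
  finally show ?thesis using U1(4)[OF y t1] unfolding sum by blast
 qed
 moreover have "Ck_fun (Suc k) U0 (%x. G (x + (SUM i<Suc \<nu>. c' i x *\<^sub>R e i)))"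
  if "Ck_fun (Suc k) U G" for G :: "'a => real"
 proof -
  have "Ck_fun (Suc k) U2 (%x. G (\<Gamma> x + \<tau> (\<Gamma> x) *\<^sub>R e \<nu>))" using U2(8)[OF shift[OF that]] by (simp add: \<Gamma>_def)
  moreover have "\<Gamma> x + \<tau> (\<Gamma> x) *\<^sub>R e \<nu> = x + (SUM i<Suc \<nu>. c' i x *\<^sub>R e i)" for x by (simp add: \<Gamma>_def c'_def)
  ultimately have "Ck_fun (Suc k) U2 (%x. G (x + (SUM i<Suc \<nu>. c' i x *\<^sub>R e i)))" by simp
  thus ?thesis by (rule Ck_subset) (auto simp: U0_def)
 qed
 ultimately show ?case by (intro exI[of _ U0] exI[of _ \<eta>] exI[of _ c'] conjI allI ballI impI; blast)
qed

section \<open>Hilbert spaces\<close>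

text \<open>Only semidefinite, so that the same algebra serves the inner products of the scale and,
  later, the spectral density.\<close>

locale semi_form =
 fixes V :: "'v::complex_vector set" and q :: "'v => 'v => complex"
 assumes V: "csubspace V"
  and q_add_right: "f \<in> V ==> g \<in> V ==> h \<in> V ==> q f (g + h) = q f g + q f h"
  and q_scale_right: "f \<in> V ==> g \<in> V ==> q f (c *\<^sub>C g) = c * q f g"
  and q_herm: "f \<in> V ==> g \<in> V ==> q f g = cnj (q g f)"
  and q_nonneg: "f \<in> V ==> 0 <= Re (q f f)"
begin

lemma V_zero: "0 \<in> V" and V_add: "f \<in> V ==> g \<in> V ==> f + g \<in> V"
 and V_diff: "f \<in> V ==> g \<in> V ==> f - g \<in> V" and V_scale: "f \<in> V ==> c *\<^sub>C f \<in> V"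
 using V complex_vector.subspace_0 complex_vector.subspace_add complex_vector.subspace_diff
  complex_vector.subspace_scale by auto

lemma V_sum: "(!!i. i \<in> I ==> f i \<in> V) ==> sum f I \<in> V"
 using V by (rule complex_vector.subspace_sum)

lemma q_add_left: "f \<in> V ==> g \<in> V ==> h \<in> V ==> q (f + g) h = q f h + q g h"
 using q_herm[of "f + g" h] q_herm[of f h] q_herm[of g h] q_add_right[of h f g] by (simp add: V_add)

lemma q_scale_left: "f \<in> V ==> g \<in> V ==> q (c *\<^sub>C f) g = cnj c * q f g"
 using q_herm[of "c *\<^sub>C f" g] q_herm[of f g] q_scale_right[of g f c] by (simp add: V_scale)

lemma q_diff_right: "f \<in> V ==> g \<in> V ==> h \<in> V ==> q f (g - h) = q f g - q f h"
 using q_add_right[of f "g - h" h] V_diff[of g h] by simp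

lemma q_diff_left: "f \<in> V ==> g \<in> V ==> h \<in> V ==> q (f - g) h = q f h - q g h"
 using q_herm[of "f - g" h] q_herm[of f h] q_herm[of g h] q_diff_right[of h f g] by (simp add: V_diff)

lemma q_zero_right: "f \<in> V ==> q f 0 = 0" and q_zero_left: "f \<in> V ==> q 0 f = 0"
 using q_diff_right[of f f f] q_diff_left[of f f f] by auto

lemma q_sum_right: "f \<in> V ==> (!!i. i \<in> I ==> g i \<in> V) ==> q f (sum g I) = (SUM i:I. q f (g i))"
 by (induction I rule: infinite_finite_induct) (auto simp: q_zero_right q_add_right V_sum)

lemma q_sum_left: "f \<in> V ==> (!!i. i \<in> I ==> g i \<in> V) ==> q (sum g I) f = (SUM i:I. q (g i) f)"
 by (induction I rule: infinite_finite_induct) (auto simp: q_zero_left q_add_left V_sum)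

lemma q_real: "f \<in> V ==> q f f = of_real (Re (q f f))"
 using q_herm[of f f] by (simp add: complex_eq_iff)

lemma q_quadratic:
 assumes "f \<in> V" "g \<in> V"
 shows "Re (q (f + t *\<^sub>C g) (f + t *\<^sub>C g)) = Re (q f f) + 2 * Re (t * q f g) + (cmod t)^2 * Re (q g g)"
proof -
 have "q (f + t *\<^sub>C g) (f + t *\<^sub>C g) = q f f + t * q f g + cnj t * q g f + cnj t * t * q g g"
  using assms by (simp add: q_add_left q_add_right q_scale_left q_scale_right V_add V_scale algebra_simps)
 moreover have "Re (cnj t * q g f) = Re (t * q f g)" using q_herm[OF assms(2,1)] by (metis complex_cnj_mult complex_cnj_cnj cnj.simps(1))
 moreover have "cnj t * t * q g g = of_real ((cmod t)^2) * q g g" by (metis complex_norm_square mult.commute)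
 hence "Re (cnj t * t * q g g) = (cmod t)^2 * Re (q g g)" by (simp only: Re_complex_of_real times_complex.simps Im_complex_of_real mult_zero_left diff_zero)
 ultimately show ?thesis by simp
qed

lemma cauchy_schwarz_sq:
 assumes "f \<in> V" "g \<in> V"
 shows "(cmod (q f g))^2 <= Re (q f f) * Re (q g g)"
proof -
 define a b c where "a = Re (q f f)" "b = q f g" "c = Re (q g g)"
 have nn: "0 <= a + 2 * Re (t * b) + (cmod t)^2 * c" for t
  using q_quadratic[OF assms, of t] q_nonneg[of "f + t *\<^sub>C g"] assms by (simp add: a_b_c_def V_add V_scale)
 have "cnj b * b = of_real ((cmod b)^2)" by (metis complex_norm_square mult.commute)
 hence re: "Re ((of_real r * cnj b) * b) = r * (cmod b)^2" for r by (simp add: mult.assoc)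
 have cm: "(cmod (of_real r * cnj b))^2 = r^2 * (cmod b)^2" for r by (simp add: norm_mult power_mult_distrib)
 have c: "c >= 0" using q_nonneg[OF assms(2)] by (simp add: a_b_c_def)
 have a: "a >= 0" using q_nonneg[OF assms(1)] by (simp add: a_b_c_def)
 show ?thesis
 proof (cases "c = 0")
  case True
  have "(cmod b)^2 = 0"
  proof (rule ccontr)
   assume "(cmod b)^2 ~= 0"
   hence "(cmod b)^2 > 0" by simp
   \<comment> \<open>For a null vector \<open>g\<close> the quadratic is affine in \<open>t\<close>;
     this \<open>t\<close> gives it the value -1.\<close>
   thus False using nn[of "of_real (- (a + 1) / (2 * (cmod b)^2)) * cnj b"] True a unfolding re by (simp add: field_simps)
  qed
  thus ?thesis using True by (simp add: a_b_c_def)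
 next
  case False
  hence c: "c > 0" using c by simp
  have "0 <= a + 2 * ((-1 / c) * (cmod b)^2) + (-1 / c)^2 * (cmod b)^2 * c" using nn[of "of_real (-1 / c) * cnj b"] unfolding re cm .
  hence "0 <= a - (cmod b)^2 / c" using c by (simp add: power2_eq_square field_simps)
  thus ?thesis using c by (simp add: a_b_c_def field_simps)
 qed
qed

end

locale hilbert_on = semi_form V B for V :: "'v::complex_vector set" and B +
 assumes definite: "f \<in> V ==> f ~= 0 ==> 0 < Re (B f f)"
  and complete: "range X \<subseteq> V ==> (!!e. e > 0 ==> EX N. ALL i>=N. ALL j>=N. norm_of B (X i - X j) < e) ==>
   EX f:V. (%i. norm_of B (X i - f)) ----> 0"

lemma hilbert_space_on_imp_hilbert_on:
 assumes h: "hilbert_space_on V B"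
 shows "hilbert_on V B"
proof -
 have s: "csubspace V" using h by (simp add: hilbert_space_on_def)
 have sc: "B f (c *\<^sub>C g) = c * B f g" if "f \<in> V" "g \<in> V" for f g c using h that unfolding hilbert_space_on_def by blast
 have "B 0 0 = 0" using sc[of 0 0 0] complex_vector.subspace_0[OF s] by simp
 show ?thesis
 proof
  have pos: "0 < Re (B f f)" if "f \<in> V" "f ~= 0" for f using h that unfolding hilbert_space_on_def by blast
  thus "0 <= Re (B f f)" if "f \<in> V" for f using that \<open>B 0 0 = 0\<close> by (cases "f = 0") (auto intro: less_imp_le)
  show "0 < Re (B f f)" if "f \<in> V" "f ~= 0" for f by (rule pos[OF that])
  show "EX f:V. (%i. norm_of B (X i - f)) ----> 0"
   if "range X \<subseteq> V" "!!e. e > 0 ==> EX N. ALL i>=N. ALL j>=N. norm_of B (X i - X j) < e" for X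
   using h that unfolding hilbert_space_on_def by blast
  show "csubspace V" by (rule s)
  show "B f (c *\<^sub>C g) = c * B f g" if "f \<in> V" "g \<in> V" for f g c by (rule sc[OF that])
  show "B f (g + h) = B f g + B f h" if "f \<in> V" "g \<in> V" "h \<in> V" for f g h using h that unfolding hilbert_space_on_def by blast
  show "B f g = cnj (B g f)" if "f \<in> V" "g \<in> V" for f g using h that unfolding hilbert_space_on_def by blast
 qed
qed

context hilbert_on
begin

abbreviation nm :: "'v => real" where "nm \<equiv> norm_of B"

lemma nm_sq: "f \<in> V ==> (nm f)^2 = Re (B f f)"
 by (simp add: norm_of_def q_nonneg)

lemma B_self: "f \<in> V ==> B f f = of_real ((nm f)^2)"
 using q_real nm_sq by simp

lemma nm_nonneg: "f \<in> V ==> 0 <= nm f"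
 by (simp add: norm_of_def q_nonneg)

lemma nm_zero [simp]: "nm 0 = 0"
 by (simp add: norm_of_def q_zero_right V_zero)

lemma nm_eq_0: "f \<in> V ==> nm f = 0 \<longleftrightarrow> f = 0"
 using definite[of f] nm_sq[of f] nm_zero by fastforce

lemma cauchy_schwarz: "f \<in> V ==> g \<in> V ==> cmod (B f g) <= nm f * nm g"
 using cauchy_schwarz_sq[of f g]
 by (rule_tac power2_le_imp_le) (simp_all add: nm_sq power_mult_distrib nm_nonneg)

lemma nm_add_sq: "f \<in> V ==> g \<in> V ==> (nm (f + t *\<^sub>C g))^2 = (nm f)^2 + 2 * Re (t * B f g) + (cmod t)^2 * (nm g)^2"
 using q_quadratic[of f g t] by (simp add: nm_sq V_add V_scale)

lemma nm_diff_sq: "f \<in> V ==> g \<in> V ==> (nm (f - g))^2 = (nm f)^2 - 2 * Re (B f g) + (nm g)^2"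
 using nm_add_sq[of f g "-1"] by simp

lemma nm_scale: "f \<in> V ==> nm (c *\<^sub>C f) = cmod c * nm f"
proof -
 assume f: "f \<in> V"
 have "(nm (0 + c *\<^sub>C f))^2 = (cmod c * nm f)^2" using nm_add_sq[OF V_zero f, of c] f by (simp add: q_zero_left power_mult_distrib)
 thus ?thesis using f by (simp add: power2_eq_iff_nonneg nm_nonneg V_scale)
qed

lemma nm_triangle: "f \<in> V ==> g \<in> V ==> nm (f + g) <= nm f + nm g"
proof (rule power2_le_imp_le)
 assume fg: "f \<in> V" "g \<in> V"
 have "Re (B f g) <= nm f * nm g" using cauchy_schwarz[OF fg] complex_Re_le_cmod[of "B f g"] by linarith
 thus "(nm (f + g))^2 <= (nm f + nm g)^2" using nm_add_sq[OF fg, of 1] by (simp add: power2_sum)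
qed (simp add: nm_nonneg)

lemma nm_minus: "f \<in> V ==> nm (- f) = nm f"
 using nm_scale[of f "-1"] by simp

lemma nm_triangle_diff: "f \<in> V ==> g \<in> V ==> nm (f - g) <= nm f + nm g"
 using nm_triangle[of f "- g"] nm_minus[of g] V_scale[of g "-1"] by simp

lemma nm_commute: "f \<in> V ==> g \<in> V ==> nm (f - g) = nm (g - f)"
 using nm_minus[of "f - g"] by (simp add: V_diff)

lemma nm_triangle3: "f \<in> V ==> g \<in> V ==> h \<in> V ==> nm (f - h) <= nm (f - g) + nm (g - h)"
 using nm_triangle[of "f - g" "g - h"] by (simp add: V_diff)

lemma nm_sum: "(!!i. i \<in> I ==> f i \<in> V) ==> nm (sum f I) <= (SUM i:I. nm (f i))"
proof (induction I rule: infinite_finite_induct)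
 case (insert i I)
 thus ?case using nm_triangle[of "f i" "sum f I"] by (force simp: V_sum)
qed auto

lemma limit_B:
 assumes "!!i. X i \<in> V" "f \<in> V" "g \<in> V" "((%i. nm (X i - f)) \<longlongrightarrow> 0) F"
 shows "((%i. B g (X i)) \<longlongrightarrow> B g f) F"
proof -
 have "((%i. B g (X i) - B g f) \<longlongrightarrow> 0) F"
 proof (rule Lim_null_comparison)
  show "\<forall>\<^sub>F i in F. norm (B g (X i) - B g f) <= nm g * nm (X i - f)" using cauchy_schwarz[of g "X _ - f"] assms by (simp add: q_diff_right V_diff)
  show "((%i. nm g * nm (X i - f)) \<longlongrightarrow> 0) F" using tendsto_mult_right_zero[OF assms(4)] .
 qed
 thus ?thesis by (simp add: LIM_zero_cancel)
qed

lemma limit_nm: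
 assumes "!!i. X i \<in> V" "f \<in> V" "((%i. nm (X i - f)) \<longlongrightarrow> 0) F"
 shows "((%i. nm (X i)) \<longlongrightarrow> nm f) F"
proof -
 have "((%i. nm (X i) - nm f) \<longlongrightarrow> 0) F"
 proof (rule Lim_null_comparison)
  show "\<forall>\<^sub>F i in F. norm (nm (X i) - nm f) <= nm (X i - f)"
  proof (rule always_eventually, rule allI)
   fix i
   show "norm (nm (X i) - nm f) <= nm (X i - f)" using nm_triangle[of "X i - f" f] nm_triangle[of "f - X i" "X i"] nm_commute[of f "X i"] assms by (simp add: V_diff)
  qed
 qed (rule assms(3))
 thus ?thesis by (simp add: LIM_zero_cancel)
qed

text \<open>A minimizing sequence is Cauchy by the parallelogram law, as midpoints stay in
  \<open>M\<close>; at the minimum every first variation vanishes.\<close>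

lemma projection_exists:
 assumes M: "csubspace M" "M \<subseteq> V"
  and closed: "!!X f. range X \<subseteq> M ==> f \<in> V ==> (%i. nm (X i - f)) ----> 0 ==> f \<in> M"
  and x: "x \<in> V"
 shows "EX p:M. ALL m:M. B m (x - p) = 0"
proof -
 define A where "A = (%m. (nm (x - m))^2) ` M"
 define d where "d = Inf A"
 have A: "A ~= {}" "bdd_below A" using complex_vector.subspace_0[OF M(1)] by (auto simp: A_def intro!: bdd_belowI[of _ 0])
 have d_le: "d <= (nm (x - m))^2" if "m \<in> M" for m unfolding d_def using A that by (intro cInf_lower) (auto simp: A_def)
 have "EX m:M. (nm (x - m))^2 < d + 1 / Suc i" for i using cInf_lessD[OF A(1), of "d + 1 / Suc i"] by (auto simp: d_def A_def)
 then obtain m where m: "!!i. m i \<in> M" "!!i. (nm (x - m i))^2 < d + 1 / Suc i" by metis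
 have mV: "m i \<in> V" for i using m(1) M(2) by blast
 have para: "(nm (m i - m j))^2 <= 2 / Suc i + 2 / Suc j" for i j
 proof -
  define u v where "u = x - m i" "v = x - m j"
  have uv: "u \<in> V" "v \<in> V" using x mV by (auto simp: u_v_def V_diff)
  have mid: "(1/2) *\<^sub>C (m i + m j) \<in> M" using M(1) m(1) by (intro complex_vector.subspace_scale complex_vector.subspace_add)
  have half: "(1/2::complex) *\<^sub>C (y + y) = y" for y :: 'v
  proof -
   have "(1/2::complex) *\<^sub>C (y + y) = (1/2 + 1/2 :: complex) *\<^sub>C y" by (simp only: scaleC_add_right scaleC_add_left)
   thus ?thesis by (simp add: scaleC_one)
  qed
  have "x - (1/2) *\<^sub>C (m i + m j) = (1/2) *\<^sub>C (x + x) - (1/2) *\<^sub>C (m i + m j)" by (simp only: half)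
  also have "... = (1/2) *\<^sub>C ((x + x) - (m i + m j))" by (simp only: complex_vector.scale_right_diff_distrib)
  also have "(x + x) - (m i + m j) = u + v" by (simp add: u_v_def)
  finally have "x - (1/2) *\<^sub>C (m i + m j) = (1/2) *\<^sub>C (u + v)" .
  hence "d <= (nm (u + v))^2 / 4" using d_le[OF mid] uv by (simp add: nm_scale V_add power_divide)
  moreover have "(nm (u + v))^2 + (nm (u - v))^2 = 2 * (nm u)^2 + 2 * (nm v)^2" using nm_add_sq[OF uv, of 1] nm_diff_sq[OF uv] by simp
  moreover have "nm (u - v) = nm (m i - m j)" using nm_commute[OF mV mV, of i j] by (simp add: u_v_def)
  ultimately show ?thesis using m(2)[of i] m(2)[of j] by (simp add: u_v_def)
 qed
 have "EX p:V. (%i. nm (m i - p)) ----> 0"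
 proof (rule complete)
  fix e :: real assume e: "e > 0"
  obtain N0 where "4 / e^2 < real N0" using reals_Archimedean2 by blast
  then obtain N where N: "4 / e^2 < real (Suc N)" by (intro that[of N0]) simp
  show "EX N. ALL i>=N. ALL j>=N. nm (m i - m j) < e"
  proof (intro exI[of _ N] allI impI)
   fix i j assume "i >= N" "j >= N"
   hence "2 / real (Suc i) <= 2 / Suc N" "2 / real (Suc j) <= 2 / Suc N" by (auto intro!: divide_left_mono)
   moreover have "4 / real (Suc N) < e^2" using N e by (simp add: field_simps del: of_nat_Suc)
   ultimately have "(nm (m i - m j))^2 < e^2" using para[of i j] by linarith
   thus "nm (m i - m j) < e" using e by (simp add: power2_less_imp_less)
  qed
 qed (use mV in auto)
 then obtain p where p: "p \<in> V" "(%i. nm (m i - p)) ----> 0" by blast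
 have pM: "p \<in> M" using closed[of m p] m(1) p by auto
 define z where "z = x - p"
 have zV: "z \<in> V" using x p by (simp add: z_def V_diff)
 have z_le: "(nm z)^2 <= d"
 proof (rule LIMSEQ_le)
  have "(%i. nm ((x - m i) - z)) ----> 0" using p(2) nm_commute[OF p(1) mV] by (simp add: z_def)
  thus "(%i. (nm (x - m i))^2) ----> (nm z)^2" using zV x mV by (intro tendsto_intros limit_nm) (auto simp: V_diff)
  show "(%i. d + 1 / Suc i) ----> d" using tendsto_add[OF tendsto_const LIMSEQ_Suc[OF lim_1_over_n], of d] by simp
  show "EX N. ALL n>=N. (nm (x - m n))^2 <= d + 1 / Suc n" using m(2) less_imp_le by blast
 qed
 have "B w z = 0" if w: "w \<in> M" for w
 proof (rule ccontr)
  assume nz: "B w z ~= 0"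
  have wV: "w \<in> V" using w M by blast
  define b where "b = B z w"
  have b: "b = cnj (B w z)" using q_herm[OF zV wV] by (simp add: b_def)
  \<comment> \<open>Moving \<open>p\<close> by a multiple of \<open>w\<close> changes the squared
    distance by a term linear in \<open>r\<close> and one quadratic in it;
    \<open>r * (nm w)^2 < 1\<close> lets the linear one win.\<close>
  define r where "r = 1 / ((nm w)^2 + 1)"
  have r: "r > 0" "r * (nm w)^2 < 1" by (auto simp: r_def field_simps add_pos_nonneg)
  have "p - (- of_real r * cnj b) *\<^sub>C w \<in> M" using M(1) pM w by (intro complex_vector.subspace_diff complex_vector.subspace_scale)
  from d_le[OF this] have "d <= (nm (z + (- of_real r * cnj b) *\<^sub>C w))^2" by (simp add: z_def algebra_simps)
  also have "... = (nm z)^2 + 2 * Re (- of_real r * cnj b * b) + (cmod (- of_real r * cnj b))^2 * (nm w)^2"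
   using nm_add_sq[OF zV wV] unfolding b_def .
  also have "- of_real r * cnj b * b = of_real (- r * (cmod b)^2)" using complex_norm_square[of b] by (simp add: mult.commute mult.left_commute)
  also have "(cmod (- of_real r * cnj b))^2 = r^2 * (cmod b)^2" by (simp add: norm_mult power_mult_distrib)
  also have "Re (of_real (- r * (cmod b)^2)) = - r * (cmod b)^2" by (simp only: Re_complex_of_real)
  finally have "2 * (r * (cmod b)^2) <= r * (cmod b)^2 * (r * (nm w)^2)" using z_le by (simp add: power2_eq_square algebra_simps)
  moreover have "r * (cmod b)^2 > 0" using r nz b by simp
  ultimately have "2 <= r * (nm w)^2" using mult_le_cancel_left_pos[of "r * (cmod b)^2" 2 "r * (nm w)^2"] by (simp only: mult.commute[of 2])
  thus False using r by simp
 qed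
 thus ?thesis using pM by (intro bexI[of _ p]) (auto simp: z_def)
qed

end

locale hscale =
 fixes S :: "'v::complex_vector scale"
 assumes scale: "hilbert_scale S"

sublocale hscale \<subseteq> H: hilbert_on "sp S t" "ip S t"
 rewrites "norm_of (ip S t) = hnorm S t" for t
proof -
 show "hilbert_on (sp S t) (ip S t)" for t using scale by (intro hilbert_space_on_imp_hilbert_on) (simp add: hilbert_scale_def)
 show "norm_of (ip S t) = hnorm S t" for t by (intro ext) (simp add: hnorm_def)
qed

abbreviation (in hscale) nm0 where "nm0 \<equiv> hnorm S 0"
abbreviation (in hscale) ip0 where "ip0 \<equiv> ip S 0"
abbreviation (in hscale) sp0 where "sp0 \<equiv> sp S 0"
abbreviation (in hscale) pr where "pr \<equiv> pairing S"

context hscale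
begin

lemma sp_mono: "t <= r ==> f \<in> sp S r ==> f \<in> sp S t"
 using scale unfolding hilbert_scale_def by blast

lemma sp_0: "0 <= r ==> f \<in> sp S r ==> f \<in> sp0" and sp_neg: "0 <= r ==> f \<in> sp0 ==> f \<in> sp S (- r)"
 using sp_mono[of 0 r f] sp_mono[of "- r" 0 f] by auto

lemma embedding_bound:
 assumes "t <= r"
 obtains K where "K > 0" "!!f. f \<in> sp S r ==> hnorm S t f <= K * hnorm S r f"
proof -
 obtain K where K: "ALL f:sp S r. hnorm S t f <= K * hnorm S r f" using scale assms unfolding hilbert_scale_def by blast
 have "hnorm S t f <= (\<bar>K\<bar> + 1) * hnorm S r f" if "f \<in> sp S r" for f
  using K that H.nm_nonneg[OF that] mult_right_mono[of K "\<bar>K\<bar> + 1" "hnorm S r f"] by fastforce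
 thus thesis using that[of "\<bar>K\<bar> + 1"] by simp
qed

lemma dense: "t < r ==> f \<in> sp S t ==> e > 0 ==> EX g:sp S r. hnorm S t (f - g) < e"
 using scale unfolding hilbert_scale_def dense_in_def hclosure_def by blast

lemma dual: "duality S" and conj: "conjugation S"
 using scale by (simp_all add: hilbert_scale_def)

lemma pairing_0: "f \<in> sp0 ==> g \<in> sp0 ==> pr f g = ip0 f g"
 using dual unfolding duality_def by blast

lemma pairing_herm: "f \<in> sp S t ==> g \<in> sp S (- t) ==> pr f g = cnj (pr g f)"
 using dual unfolding duality_def by blast

lemma pairing_add_right:
 "f \<in> sp S t ==> g \<in> sp S (- t) ==> h \<in> sp S (- t) ==> pr f (g + h) = pr f g + pr f h"
 using dual unfolding duality_def by blast

lemma pairing_scale_right: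
 "f \<in> sp S t ==> g \<in> sp S (- t) ==> pr f (c *\<^sub>C g) = c * pr f g"
 using dual unfolding duality_def by blast

lemma pairing_diff_right:
 "f \<in> sp S t ==> g \<in> sp S (- t) ==> h \<in> sp S (- t) ==> pr f (g - h) = pr f g - pr f h"
 using pairing_add_right[of f t "g - h" h] H.V_diff[of g "-t" h] by simp

lemma pairing_zero_right: "f \<in> sp S t ==> pr f 0 = 0"
 using pairing_diff_right[of f t 0 0] H.V_zero by simp

lemma pairing_add_left:
 "f \<in> sp S t ==> g \<in> sp S t ==> h \<in> sp S (- t) ==> pr (f + g) h = pr f h + pr g h"
 using pairing_add_right[of h "-t" f g] pairing_herm[of f t h] pairing_herm[of g t h]
  pairing_herm[of "f + g" t h] H.V_add[of f t g] by simp

lemma pairing_scale_left: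
 "f \<in> sp S t ==> h \<in> sp S (- t) ==> pr (c *\<^sub>C f) h = cnj c * pr f h"
 using pairing_scale_right[of h "-t" f c] pairing_herm[of f t h]
  pairing_herm[of "c *\<^sub>C f" t h] H.V_scale[of f t c] by simp

lemma pairing_bound:
 obtains K where "K > 0" "!!f g. f \<in> sp S t ==> g \<in> sp S (- t) ==> cmod (pr f g) <= K * hnorm S t f * hnorm S (- t) g"
proof -
 obtain K where K: "ALL f:sp S t. ALL g:sp S (- t). cmod (pr f g) <= K * hnorm S t f * hnorm S (- t) g" using dual unfolding duality_def by blast
 have "cmod (pr f g) <= (\<bar>K\<bar> + 1) * hnorm S t f * hnorm S (- t) g" if fg: "f \<in> sp S t" "g \<in> sp S (- t)" for f g
 proof -
  have "K * (hnorm S t f * hnorm S (- t) g) <= (\<bar>K\<bar> + 1) * (hnorm S t f * hnorm S (- t) g)"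
   using H.nm_nonneg[OF fg(1)] H.nm_nonneg[OF fg(2)] by (intro mult_right_mono) auto
  thus ?thesis using K fg by (auto simp: mult.assoc intro: order_trans)
 qed
 thus thesis using that[of "\<bar>K\<bar> + 1"] by simp
qed

text \<open>Such a \<open>g\<close> represents the zero functional, and so does 0; representing
  vectors are unique.\<close>

lemma pairing_separates:
 assumes "g \<in> sp S (- t)" "!!f. f \<in> sp S t ==> pr g f = 0"
 shows "g = 0"
proof -
 have "bounded_functional S t (%_. 0)" unfolding bounded_functional_def using H.nm_nonneg by (auto intro!: exI[of _ 0])
 hence "\<exists>!g. g \<in> sp S (- t) & (ALL f:sp S t. 0 = pr g f)" using dual unfolding duality_def by blast
 moreover have "0 = pr 0 f" if "f \<in> sp S t" for f using pairing_scale_left[of 0 "-t" f 0] that H.V_zero by simp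
 ultimately show ?thesis using assms H.V_zero by metis
qed

lemma cj_in: "f \<in> sp S t ==> cj S f \<in> sp S t"
 and cj_add: "f \<in> sp S t ==> g \<in> sp S t ==> cj S (f + g) = cj S f + cj S g"
 and cj_scale: "f \<in> sp S t ==> cj S (c *\<^sub>C f) = cnj c *\<^sub>C cj S f"
 and cj_cj: "f \<in> sp0 ==> cj S (cj S f) = f"
 and cj_ip: "f \<in> sp0 ==> g \<in> sp0 ==> ip0 (cj S f) (cj S g) = cnj (ip0 f g)"
 using conj unfolding conjugation_def by blast+

lemma cj_diff: "f \<in> sp S t ==> g \<in> sp S t ==> cj S (f - g) = cj S f - cj S g"
 using cj_add[of "f - g" t g] H.V_diff[of f t g] by simp

end

lemma clinear_onD:
 assumes "clinear_on V T"
 shows "f \<in> V ==> g \<in> V ==> T (f + g) = T f + T g" "f \<in> V ==> T (c *\<^sub>C f) = c *\<^sub>C T f"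
 using assms by (auto simp: clinear_on_def)

section \<open>Resolvents of self-adjoint operators\<close>

locale selfadj = hscale S for S :: "'v::complex_vector scale" +
 fixes D :: "'v set" and T :: "'v => 'v"
 assumes sa: "selfadjoint S D T"
begin

lemma D: "csubspace D" and D_dense: "dense_in S 0 D" and T_lin: "clinear_on D T"
 and T_in: "f \<in> D ==> T f \<in> sp0"
 using sa unfolding selfadjoint_def by auto

lemma graph: "{(g, h). g \<in> sp0 & h \<in> sp0 & (ALL f:D. ip0 (T f) g = ip0 f h)} = {(g, T g) | g. g \<in> D}"
 using sa unfolding selfadjoint_def by blast

lemma D_sub: "f \<in> D ==> f \<in> sp0"
 using D_dense unfolding dense_in_def by blast

lemma D_zero: "0 \<in> D" and D_add: "f \<in> D ==> g \<in> D ==> f + g \<in> D"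
 and D_diff: "f \<in> D ==> g \<in> D ==> f - g \<in> D" and D_scale: "f \<in> D ==> c *\<^sub>C f \<in> D"
 using D complex_vector.subspace_0 complex_vector.subspace_add complex_vector.subspace_diff
  complex_vector.subspace_scale by auto

lemmas T_add = clinear_onD(1)[OF T_lin] and T_scale = clinear_onD(2)[OF T_lin]

lemma T_diff: "f \<in> D ==> g \<in> D ==> T (f - g) = T f - T g"
 using T_add[of "f - g" g] D_diff[of f g] by simp

lemma T_zero: "T 0 = 0"
 using T_diff[OF D_zero D_zero] by simp

lemma T_symmetric: "f \<in> D ==> g \<in> D ==> ip0 (T f) g = ip0 f (T g)"
 using graph by blast

lemma adjointI:
 assumes "g \<in> sp0" "h \<in> sp0" "!!f. f \<in> D ==> ip0 (T f) g = ip0 f h"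
 shows "g \<in> D" "T g = h"
proof -
 have "(g, h) \<in> {(g, T g) | g. g \<in> D}" using assms graph by blast
 thus "g \<in> D" "T g = h" by auto
qed

definition shifted :: "complex => 'v => 'v" where
 "shifted z f = T f - z *\<^sub>C f"

lemma shifted_in: "f \<in> D ==> shifted z f \<in> sp0"
 by (simp add: shifted_def H.V_diff H.V_scale T_in D_sub)

lemma shifted_diff: "f \<in> D ==> g \<in> D ==> shifted z (f - g) = shifted z f - shifted z g"
 by (simp add: shifted_def T_diff complex_vector.scale_right_diff_distrib)

lemma shifted_add: "f \<in> D ==> g \<in> D ==> shifted z (f + g) = shifted z f + shifted z g"
 by (simp add: shifted_def T_add scaleC_add_right)

lemma shifted_scale: "f \<in> D ==> shifted z (c *\<^sub>C f) = c *\<^sub>C shifted z f"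
 by (simp add: shifted_def T_scale complex_vector.scale_right_diff_distrib scaleC_scaleC mult.commute)

lemma shifted_adjoint: "f \<in> D ==> g \<in> D ==> ip0 (shifted z f) g = ip0 f (shifted (cnj z) g)"
 by (simp add: shifted_def H.q_diff_left H.q_diff_right H.q_scale_left H.q_scale_right H.V_scale
   T_in D_sub T_symmetric)

text \<open>The lower bound makes the range closed, the limit of preimages lying in the domain
  because \<open>T\<close> equals its adjoint. A vector orthogonal to the range lies in the domain
  and in the kernel at \<open>cnj z\<close>, hence vanishes.\<close>

lemma shifted_bij:
 assumes c: "c > 0" and bound: "!!f. f \<in> D ==> c * nm0 f <= nm0 (shifted z f)"
  and inj: "!!f. f \<in> D ==> shifted (cnj z) f = 0 ==> f = 0"
 shows "bij_betw (shifted z) D (sp0)"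
proof -
 define M where "M = shifted z ` D"
 have M_sub: "M \<subseteq> sp0" using shifted_in by (auto simp: M_def)
 have M: "csubspace M" unfolding complex_vector.subspace_def
 proof (intro conjI ballI allI)
  show "0 \<in> M" using D_zero T_zero by (force simp: M_def shifted_def)
  show "x + y \<in> M" if "x \<in> M" "y \<in> M" for x y using that by (auto simp: M_def shifted_add[symmetric] D_add)
  show "a *\<^sub>C x \<in> M" if "x \<in> M" for x a using that by (auto simp: M_def shifted_scale[symmetric] D_scale)
 qed
 have closed: "y \<in> M" if X: "range X \<subseteq> M" and y: "y \<in> sp0" and lim: "(%i. nm0 (X i - y)) ----> 0" for X y
 proof -
  have "EX f:D. X i = shifted z f" for i using X by (auto simp: M_def)
  then obtain f where f: "!!i. f i \<in> D" "!!i. X i = shifted z (f i)" by metis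
  have f0: "f i \<in> sp0" and X0: "X i \<in> sp0" for i using f D_sub shifted_in by auto
  have "EX g:sp0. (%i. nm0 (f i - g)) ----> 0"
  proof (rule H.complete)
   fix e :: real assume e: "e > 0"
   hence "\<forall>\<^sub>F i in sequentially. nm0 (X i - y) < c * e / 2" using lim c by (intro order_tendstoD(2)[OF lim]) simp
   then obtain N where N: "!!i. i >= N ==> nm0 (X i - y) < c * e / 2" unfolding eventually_sequentially by blast
   have "nm0 (f i - f j) < e" if "i >= N" "j >= N" for i j proof -
    have "c * nm0 (f i - f j) <= nm0 (X i - X j)" using bound[OF D_diff[OF f(1) f(1)]] f by (simp add: shifted_diff)
    also have "... <= nm0 (X i - y) + nm0 (y - X j)" by (rule H.nm_triangle3[OF X0 y X0])
    also have "nm0 (y - X j) = nm0 (X j - y)" by (rule H.nm_commute[OF y X0])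
    also have "nm0 (X i - y) + nm0 (X j - y) < c * e / 2 + c * e / 2" using N that by (intro add_strict_mono) auto
    finally show ?thesis using c by simp
   qed
   thus "EX N. ALL i>=N. ALL j>=N. nm0 (f i - f j) < e" by blast
  qed (use f0 in auto)
  then obtain g where g: "g \<in> sp0" "(%i. nm0 (f i - g)) ----> 0" by blast
  have "ip0 (T d) g = ip0 d (y + z *\<^sub>C g)" if d: "d \<in> D" for d
  proof (rule LIMSEQ_unique)
   show "(%i. ip0 (T d) (f i)) ----> ip0 (T d) g" by (rule H.limit_B[OF f0 g(1) T_in[OF d] g(2)])
   have "(%i. ip0 d (X i) + z * ip0 d (f i)) ----> ip0 d y + z * ip0 d g"
    by (intro tendsto_intros H.limit_B[OF X0 y D_sub[OF d] lim] H.limit_B[OF f0 g(1) D_sub[OF d] g(2)])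
   moreover have "ip0 d (X i) + z * ip0 d (f i) = ip0 (T d) (f i)" for i
    using f d by (simp add: shifted_def H.q_diff_right H.q_scale_right H.V_scale T_in D_sub T_symmetric)
   ultimately show "(%i. ip0 (T d) (f i)) ----> ip0 d (y + z *\<^sub>C g)"
    using y g(1) d by (simp add: H.q_add_right H.q_scale_right H.V_scale D_sub)
  qed
  from adjointI[OF g(1) _ this] have "g \<in> D" "T g = y + z *\<^sub>C g" using y g(1) by (auto simp: H.V_add H.V_scale)
  hence "y = shifted z g" by (simp add: shifted_def)
  thus ?thesis using \<open>g \<in> D\<close> by (auto simp: M_def)
 qed
 have "y \<in> M" if y: "y \<in> sp0" for y
 proof -
  have "EX p:M. ALL m:M. ip0 m (y - p) = 0" by (rule H.projection_exists[OF M M_sub _ y]) (rule closed)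
  then obtain p where p: "p \<in> M" "ALL m:M. ip0 m (y - p) = 0" by blast
  define w where "w = y - p"
  have w: "w \<in> sp0" using y p M_sub by (auto simp: w_def H.V_diff)
  have "ip0 (T d) w = ip0 d (cnj z *\<^sub>C w)" if d: "d \<in> D" for d
  proof -
   have "ip0 (shifted z d) w = 0" using p(2) d by (auto simp: w_def M_def)
   thus ?thesis using d w by (simp add: shifted_def H.q_diff_left H.q_scale_left H.q_scale_right H.V_scale T_in D_sub)
  qed
  from adjointI[OF w _ this] have "w \<in> D" "shifted (cnj z) w = 0" using w by (auto simp: shifted_def H.V_scale)
  hence "w = 0" by (rule inj)
  thus ?thesis using p by (simp add: w_def)
 qed
 moreover have "inj_on (shifted z) D"
 proof (rule inj_onI)
  fix f g assume fg: "f \<in> D" "g \<in> D" "shifted z f = shifted z g"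
  hence "c * nm0 (f - g) <= 0" using bound[OF D_diff[OF fg(1,2)]] by (simp add: shifted_diff)
  hence "nm0 (f - g) <= 0" using c by (simp add: mult_le_0_iff)
  moreover have "f - g \<in> sp0" using fg D_diff D_sub by blast
  ultimately have "f - g = 0" using H.nm_eq_0 H.nm_nonneg by fastforce
  thus "f = g" by simp
 qed
 ultimately show ?thesis using M_sub by (auto simp: bij_betw_def M_def)
qed

lemma Im_ip_shifted:
 assumes "f \<in> D"
 shows "Im (ip0 f (shifted z f)) = - Im z * (nm0 f)^2"
proof -
 have f0: "f \<in> sp0" using D_sub assms .
 have "Im (ip0 f (T f)) = 0" using T_symmetric[OF assms assms] H.q_herm[OF f0 T_in[OF assms]] by (simp add: complex_eq_iff)
 thus ?thesis using f0 assms by (simp add: shifted_def H.q_diff_right H.q_scale_right H.V_scale T_in H.B_self flip: of_real_power)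
qed

lemma shifted_lower:
 assumes f: "f \<in> D"
 shows "\<bar>Im z\<bar> * nm0 f <= nm0 (shifted z f)"
proof (cases "nm0 f = 0")
 case False
 have f0: "f \<in> sp0" using D_sub f .
 have pos: "nm0 f > 0" using False H.nm_nonneg[OF f0] by simp
 have "\<bar>Im z\<bar> * (nm0 f)^2 <= nm0 f * nm0 (shifted z f)" using Im_ip_shifted[OF f, of z] abs_Im_le_cmod[of "ip0 f (shifted z f)"]
   H.cauchy_schwarz[OF f0 shifted_in[OF f], of z] by (simp add: abs_mult)
 hence "nm0 f * (\<bar>Im z\<bar> * nm0 f) <= nm0 f * nm0 (shifted z f)" by (simp add: power2_eq_square mult_ac)
 thus ?thesis using pos by simp
qed (simp add: H.nm_nonneg shifted_in f)

abbreviation R :: "complex => 'v => 'v" where "R \<equiv> resolvent D T"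

lemma resolvent_bij: "Im z ~= 0 ==> bij_betw (shifted z) D (sp0)"
proof (rule shifted_bij[of "\<bar>Im z\<bar>"])
 fix f assume z: "Im z ~= 0" and f: "f \<in> D" "shifted (cnj z) f = 0"
 have "\<bar>Im z\<bar> * nm0 f <= 0" using shifted_lower[OF f(1), of "cnj z"] f(2) by simp
 hence "nm0 f <= 0" using z by (simp add: mult_le_0_iff)
 thus "f = 0" using H.nm_eq_0 H.nm_nonneg D_sub f(1) by fastforce
qed (auto simp: shifted_lower)

context
 fixes z assumes z: "Im z ~= 0"
begin

lemma R_unique: "g \<in> D ==> shifted z g = f ==> R z f = g"
 unfolding resolvent_def
 using bij_betw_imp_inj_on[OF resolvent_bij[OF z]] by (auto simp: shifted_def inj_on_def intro!: the_equality)

lemma R_shifted: "g \<in> D ==> R z (shifted z g) = g"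
 by (rule R_unique) auto

lemma R_props: "f \<in> sp0 ==> R z f \<in> D" "f \<in> sp0 ==> shifted z (R z f) = f"
proof -
 assume "f \<in> sp0"
 then obtain g where "g \<in> D" "f = shifted z g" using bij_betw_imp_surj_on[OF resolvent_bij[OF z]] by blast
 thus "R z f \<in> D" "shifted z (R z f) = f" using R_shifted by auto
qed

lemma R_in: "f \<in> sp0 ==> R z f \<in> sp0"
 using R_props D_sub by blast

lemma R_add: "f \<in> sp0 ==> g \<in> sp0 ==> R z (f + g) = R z f + R z g"
 by (rule R_unique) (auto simp: D_add R_props shifted_add)

lemma R_diff: "f \<in> sp0 ==> g \<in> sp0 ==> R z (f - g) = R z f - R z g"
 by (rule R_unique) (auto simp: D_diff R_props shifted_diff)

lemma R_scale: "f \<in> sp0 ==> R z (c *\<^sub>C f) = c *\<^sub>C R z f"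
 by (rule R_unique) (auto simp: D_scale R_props shifted_scale)

lemma R_sum: "(!!i. i \<in> I ==> f i \<in> sp0) ==> R z (sum f I) = (SUM i:I. R z (f i))"
proof (induction I rule: infinite_finite_induct)
 case (infinite I)
 thus ?case using R_diff[of 0 0] H.V_zero by simp
next
 case empty
 thus ?case using R_diff[of 0 0] H.V_zero by simp
qed (simp add: R_add H.V_sum)

lemma R_bound: "f \<in> sp0 ==> nm0 (R z f) <= nm0 f / \<bar>Im z\<bar>"
 using shifted_lower[of "R z f" z] R_props[of f] z by (simp add: field_simps)

lemma R_T: "f \<in> D ==> R z (T f) = f + z *\<^sub>C R z f" "f \<in> sp0 ==> T (R z f) = f + z *\<^sub>C R z f"
proof -
 show "T (R z f) = f + z *\<^sub>C R z f" if "f \<in> sp0" for f using R_props(2)[OF that] by (simp add: shifted_def algebra_simps)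
 show "R z (T f) = f + z *\<^sub>C R z f" if "f \<in> D" using R_shifted[OF that] that by (simp add: shifted_def R_diff R_scale T_in D_sub H.V_scale algebra_simps)
qed

text \<open>Through this identity boundary values of <f, R f> control Im z * |R f|^2, the only
  quantity known about resolvents near the axis.\<close>

lemma Im_ip_R: "f \<in> sp0 ==> Im (ip0 f (R z f)) = Im z * (nm0 (R z f))^2"
 using Im_ip_shifted[of "R z f" z] R_props[of f] H.q_herm[of f 0 "R z f"] R_in[of f] by simp

end

lemma R_adjoint:
 assumes "Im z ~= 0" "f \<in> sp0" "g \<in> sp0"
 shows "ip0 (R z f) g = ip0 f (R (cnj z) g)"
 using shifted_adjoint[of "R z f" "R (cnj z) g" z] R_props[of z f] R_props[of "cnj z" g] assms by simp

lemma resolvent_identity: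
 assumes "Im z ~= 0" "Im w ~= 0" "f \<in> sp0"
 shows "R z f - R w f = (z - w) *\<^sub>C R z (R w f)"
proof -
 have "shifted z (R w f) = f - (z - w) *\<^sub>C R w f" using R_props(2)[OF assms(2,3)] by (simp add: shifted_def algebra_simps complex_vector.scale_left_diff_distrib)
 hence "R w f = R z (f - (z - w) *\<^sub>C R w f)" using R_shifted[OF assms(1) R_props(1)[OF assms(2,3)]] by simp
 also have "... = R z f - (z - w) *\<^sub>C R z (R w f)" using assms by (simp add: R_diff R_scale R_in H.V_scale)
 finally show ?thesis by (simp add: algebra_simps)
qed

lemma R_cj:
 assumes "real_operator S D T" "Im z ~= 0" "f \<in> sp0"
 shows "R z (cj S f) = cj S (R (cnj z) f)"
proof (rule R_unique[OF assms(2)])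
 have r: "R (cnj z) f \<in> D" "shifted (cnj z) (R (cnj z) f) = f" "R (cnj z) f \<in> sp0" "T (R (cnj z) f) \<in> sp0"
  using R_props[of "cnj z" f] R_in[of "cnj z" f] T_in assms by auto
 show "cj S (R (cnj z) f) \<in> D" using r assms(1) by (simp add: real_operator_def)
 have "cj S (T u - cnj z *\<^sub>C u) = cj S (T u) - z *\<^sub>C cj S u" if "u \<in> sp0" "T u \<in> sp0" for u
  using that by (simp add: cj_diff[of _ 0] cj_scale[of _ 0] H.V_scale)
 hence "shifted z (cj S (R (cnj z) f)) = cj S (shifted (cnj z) (R (cnj z) f))" using r assms(1) unfolding shifted_def real_operator_def by metis
 thus "shifted z (cj S (R (cnj z) f)) = cj S f" using r by simp
qed

lemma selfadjoint_perturbed: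
 assumes B: "clinear_on (sp0) B" "!!f. f \<in> sp0 ==> B f \<in> sp0"
  and sym: "!!f g. f \<in> sp0 ==> g \<in> sp0 ==> ip0 (B f) g = ip0 f (B g)"
 shows "selfadjoint S D (%f. T f + B f)"
 unfolding selfadjoint_def
proof (intro conjI)
 show "clinear_on D (%f. T f + B f)" using clinear_onD[OF B(1)] by (auto simp: clinear_on_def T_add T_scale D_sub scaleC_add_right)
 show "(%f. T f + B f) ` D \<subseteq> sp0" using T_in B(2) D_sub H.V_add by auto
 have "g \<in> D & h = T g + B g"
  if g: "g \<in> sp0" and h: "h \<in> sp0" and eq: "ALL f:D. ip0 (T f + B f) g = ip0 f h" for g h
 proof -
  have "ip0 (T f) g = ip0 f (h - B g)" if f: "f \<in> D" for f
  proof -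
   have "ip0 (T f) g + ip0 (B f) g = ip0 f h" using eq[rule_format, OF f] H.q_add_left[OF T_in[OF f] B(2)[OF D_sub[OF f]] g] by simp
   thus ?thesis using f g h B(2) D_sub[OF f] sym by (simp add: H.q_diff_right algebra_simps)
  qed
  from adjointI[OF g _ this] show ?thesis using h B(2)[OF g] H.V_diff by (simp add: algebra_simps)
 qed
 moreover have "ip0 (T f + B f) g = ip0 f (T g + B g)" if "f \<in> D" "g \<in> D" for f g
  using that B(2) T_in D_sub sym T_symmetric by (simp add: H.q_add_left H.q_add_right)
 ultimately show "{(g, h). g \<in> sp0 & h \<in> sp0 & (ALL f:D. ip0 (T f + B f) g = ip0 f h)}
   = {(g, T g + B g) | g. g \<in> D}" using D_sub T_in B(2) H.V_add by auto
qed (use D D_dense in auto)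

end

section \<open>Positivity of rational functions of a self-adjoint operator\<close>

definition nonneg_complex :: "complex set" where
 "nonneg_complex = {w. Im w = 0 & 0 <= Re w}"

lemma closed_nonneg_complex: "closed nonneg_complex"
 unfolding nonneg_complex_def by (intro closed_Collect_conj closed_Collect_eq closed_Collect_le continuous_intros)

lemma nonneg_complex_scale: "0 < r ==> of_real r * w \<in> nonneg_complex \<longleftrightarrow> w \<in> nonneg_complex"
 by (auto simp: nonneg_complex_def zero_le_mult_iff)

lemma poly_at_right_nonneg:
 assumes "!!x. x > r ==> poly h (of_real x) \<in> nonneg_complex"
 shows "poly h (of_real r) \<in> nonneg_complex"
proof (rule Lim_in_closed_set[OF closed_nonneg_complex])
 show "\<forall>\<^sub>F x in at_right r. poly h (of_real x) \<in> nonneg_complex" using assms by (auto simp: eventually_at_filter)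
 have "isCont (%x. poly h (of_real x)) r" by (intro isCont_o2[OF _ poly_isCont] continuous_intros)
 thus "((%x. poly h (of_real x)) \<longlongrightarrow> poly h (of_real r)) (at_right r)" by (meson continuous_within filterlim_at_split isCont_def)
qed (rule trivial_limit_at_right_real)

text \<open>Roots are removed in conjugate pairs, which divides the polynomial by |x - z|^2 on the
  line. A real root is double, since otherwise the sign would change there. The root
  \<open>z\<close> of each pair is kept for \<open>q\<close>.\<close>

lemma nonneg_poly_square:
 fixes f :: "complex poly"
 assumes "!!x::real. poly f (of_real x) \<in> nonneg_complex"
 shows "EX q. f = map_poly cnj q * q"
 using assms
proof (induction "degree f" arbitrary: f rule: less_induct)
 case less
 have real: "poly (map_poly cnj f) (of_real x) = poly f (of_real x)" for x :: real using less.prems[of x] by (simp add: nonneg_complex_def complex_eq_iff)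
 have cnj_f: "map_poly cnj f = f"
 proof (rule ccontr)
  assume "map_poly cnj f ~= f"
  hence "finite {w. poly (map_poly cnj f - f) w = 0}" by (intro poly_roots_finite) simp
  moreover have "range complex_of_real \<subseteq> {w. poly (map_poly cnj f - f) w = 0}" using real by auto
  ultimately have "finite (range complex_of_real)" by (rule finite_subset[rotated])
  thus False using infinite_UNIV_char_0[where ?'a = real] finite_imageD[of complex_of_real UNIV] by (simp add: inj_on_def)
 qed
 show ?case
 proof (cases "degree f = 0")
  case True
  then obtain c where f: "f = [:c:]" by (rule degree_eq_zeroE)
  hence "c = of_real (Re c)" "Re c >= 0" using less.prems[of 0] by (auto simp: nonneg_complex_def complex_eq_iff)
  hence "cnj (of_real (sqrt (Re c))) * of_real (sqrt (Re c)) = c" by (metis complex_cnj_complex_of_real of_real_mult real_sqrt_mult_self abs_of_nonneg)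
  thus ?thesis using f by (intro exI[of _ "[:of_real (sqrt (Re c)):]"]) (simp add: map_poly_pCons)
 next
  case False
  hence "\<not> constant (poly f)" by (simp add: constant_degree)
  then obtain z where z: "poly f z = 0" using fundamental_theorem_of_algebra by blast
  then obtain g where g: "f = [:- z, 1:] * g" by (metis poly_eq_0_iff_dvd dvdE)
  have "EX h. f = [:- cnj z, 1:] * ([:- z, 1:] * h) & (ALL x::real. poly h (of_real x) \<in> nonneg_complex)"
  proof (cases "Im z = 0")
   case Im: False
   have "poly f (cnj z) = 0" using z cnj_f by (metis complex_cnj_cnj complex_cnj_zero poly_cnj)
   moreover have "cnj z ~= z" using Im by (simp add: complex_eq_iff)
   ultimately have "poly g (cnj z) = 0" by (simp add: g)
   then obtain h where h: "g = [:- cnj z, 1:] * h" by (metis poly_eq_0_iff_dvd dvdE)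
   have "poly h (of_real x) \<in> nonneg_complex" for x :: real proof -
    have "poly f (of_real x) = of_real ((cmod (of_real x - z))^2) * poly h (of_real x)" unfolding complex_norm_square by (simp add: g h algebra_simps)
    moreover have "of_real x ~= z" using Im by auto
    hence "(cmod (of_real x - z))^2 > 0" by simp
    ultimately show ?thesis using less.prems[of x] nonneg_complex_scale by metis
   qed
   moreover have "f = [:- cnj z, 1:] * ([:- z, 1:] * h)" unfolding g h by (rule mult.left_commute)
   ultimately show ?thesis by blast
  next
   case True
   define r where "r = Re z"
   have zr: "z = of_real r" using True by (simp add: r_def complex_eq_iff)
   have fx: "poly f (of_real x) = of_real (x - r) * poly g (of_real x)" for x by (simp add: g zr algebra_simps)
   have "poly g (of_real x) \<in> nonneg_complex" if "x > r" for x using nonneg_complex_scale[of "x - r" "poly g (of_real x)"] fx[of x] less.prems[of x] that by simp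
   hence 1: "poly g (of_real r) \<in> nonneg_complex" by (rule poly_at_right_nonneg)
   \<comment> \<open>The reflected cofactor, so that the limit from the right also covers the left
     side of \<open>r\<close>: the value of \<open>g\<close> at \<open>r\<close> is both nonnegative
     and nonpositive.\<close>
   define g' where "g' = pcompose (- g) [:0, -1:]"
   have g': "poly g' (of_real x) = - poly g (of_real (- x))" for x by (simp add: g'_def poly_pcompose)
   have "poly g' (of_real x) \<in> nonneg_complex" if "x > - r" for x proof -
    have "poly f (of_real (- x)) = of_real (x + r) * poly g' (of_real x)" unfolding fx g' by (simp add: algebra_simps)
    thus ?thesis using nonneg_complex_scale[of "x + r" "poly g' (of_real x)"] less.prems[of "- x"] that by simp
   qed
   hence "poly g' (of_real (- r)) \<in> nonneg_complex" by (rule poly_at_right_nonneg)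
   hence "poly g (of_real r) = 0" using 1 unfolding g' by (simp add: nonneg_complex_def complex_eq_iff)
   then obtain h where h: "g = [:- z, 1:] * h" unfolding zr by (metis poly_eq_0_iff_dvd dvdE)
   have hx: "poly h (of_real x) \<in> nonneg_complex" if "x > r" for x proof -
    have "poly f (of_real x) = of_real ((x - r)^2) * poly h (of_real x)" by (simp add: fx h zr power2_eq_square algebra_simps)
    thus ?thesis using nonneg_complex_scale[of "(x - r)^2"] less.prems[of x] that by simp
   qed
   have hx': "poly h (of_real x) \<in> nonneg_complex" if "x < r" for x proof -
    have "poly f (of_real x) = of_real ((x - r)^2) * poly h (of_real x)" by (simp add: fx h zr power2_eq_square algebra_simps)
    thus ?thesis using nonneg_complex_scale[of "(x - r)^2"] less.prems[of x] that by simp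
   qed
   have "poly h (of_real x) \<in> nonneg_complex" for x using hx hx' poly_at_right_nonneg[of r h] by (cases x r rule: linorder_cases) auto
   thus ?thesis using g h by (intro exI[of _ h]) (simp add: zr)
  qed
  then obtain h where h: "f = [:- cnj z, 1:] * ([:- z, 1:] * h)" "!!x::real. poly h (of_real x) \<in> nonneg_complex" by blast
  have "h ~= 0" using h(1) False by auto
  hence nz: "[:- z, 1:] * h ~= 0" by (simp only: mult_eq_0_iff) simp
  have "degree f = degree [:- cnj z, 1:] + degree ([:- z, 1:] * h)" unfolding h(1) by (rule degree_mult_eq[OF _ nz]) simp
  also have "degree ([:- z, 1:] * h) = degree [:- z, 1:] + degree h" by (rule degree_mult_eq[OF _ \<open>h ~= 0\<close>]) simp
  finally have "degree f = degree h + 2" by simp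
  then obtain q where q: "h = map_poly cnj q * q" using less.hyps[of h] h(2) by auto
  have "map_poly cnj ([:- z, 1:] * q) = [:- cnj z, 1:] * map_poly cnj q" unfolding poly_eq_poly_eq_iff[symmetric] by (rule ext) simp
  thus ?thesis by (intro exI[of _ "[:- z, 1:] * q"]) (simp only: h(1) q mult.assoc mult.left_commute)
 qed
qed

context selfadj
begin

text \<open>\<open>X\<close> lists the powers of \<open>T\<close> on \<open>X 0\<close> as far as
  they exist. Writing \<open>\<psi>\<close> as a polynomial in \<open>T\<close> applied to
  \<open>X 0\<close> turns all the resolvents of \<open>\<psi>\<close> in question into polynomials
  acting on the same vector.\<close>

definition chain :: "nat => (nat => 'v) => bool" where
 "chain N X \<longleftrightarrow> X N \<in> sp0 & (ALL i<N. X i \<in> D & T (X i) = X (Suc i))"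

text \<open>If \<open>chain N X\<close> and \<open>degree p \<le> N\<close>, then \<open>act X p\<close> is \<open>p(T) (X 0)\<close>.\<close>
definition act :: "(nat => 'v) => complex poly => 'v" where
 "act X p = (SUM i<=degree p. coeff p i *\<^sub>C X i)"

lemma act_eq: "degree p <= N ==> act X p = (SUM i<=N. coeff p i *\<^sub>C X i)"
 unfolding act_def by (intro sum.mono_neutral_left) (auto simp: coeff_eq_0)

lemma chain_in: "chain N X ==> i <= N ==> X i \<in> sp0"
 using D_sub unfolding chain_def by (cases "i = N") auto

lemma act_in: "chain N X ==> degree p <= N ==> act X p \<in> sp0"
 unfolding act_def by (intro H.V_sum H.V_scale chain_in[of N X]) auto

lemma D_sum: "(!!i. i \<in> I ==> f i \<in> D) ==> sum f I \<in> D"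
 using D by (rule complex_vector.subspace_sum)

lemma T_sum: "(!!i. i \<in> I ==> f i \<in> D) ==> T (sum f I) = (SUM i:I. T (f i))"
 by (induction I rule: infinite_finite_induct) (auto simp: T_zero T_add D_sum)

lemma act_mult:
 assumes X: "chain N X" and p: "degree p < N"
 shows "act X p \<in> D" "shifted z (act X p) = act X ([:- z, 1:] * p)"
proof -
 obtain M where N: "N = Suc M" using p by (cases N) auto
 have act_p: "act X p = (SUM i<=M. coeff p i *\<^sub>C X i)" using p N by (intro act_eq) simp
 have XD: "X i \<in> D" "T (X i) = X (Suc i)" if "i <= M" for i using X that N by (auto simp: chain_def)
 show aD: "act X p \<in> D" unfolding act_p using XD D_scale by (intro D_sum) auto
 have Tp: "T (act X p) = (SUM i<=M. coeff p i *\<^sub>C X (Suc i))" unfolding act_p using XD by (subst T_sum) (auto simp: D_scale T_scale)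
 have "degree ([:- z, 1:] * p) <= Suc M" using degree_mult_le[of "[:- z, 1:]" p] p N by simp
 hence "act X ([:- z, 1:] * p) = (SUM i<=Suc M. coeff ([:- z, 1:] * p) i *\<^sub>C X i)" by (rule act_eq)
 also have "... = (SUM i<=Suc M. (- z * coeff p i) *\<^sub>C X i) + (SUM i<=Suc M. coeff (pCons 0 p) i *\<^sub>C X i)"
  by (simp only: sum.distrib[symmetric] scaleC_add_left[symmetric]) simp
 also have "(SUM i<=Suc M. coeff (pCons 0 p) i *\<^sub>C X i) = T (act X p)" unfolding Tp by (subst sum.atMost_Suc_shift) simp
 also have "(SUM i<=Suc M. (- z * coeff p i) *\<^sub>C X i) = (SUM i<=M. (- z * coeff p i) *\<^sub>C X i)" using p N by (simp add: coeff_eq_0)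
 also have "... = - (z *\<^sub>C act X p)" unfolding act_p by (simp add: complex_vector.scale_sum_right scaleC_scaleC sum_negf)
 finally show "shifted z (act X p) = act X ([:- z, 1:] * p)" by (simp add: shifted_def)
qed

lemma degree_prod_linear: "finite J ==> degree (\<Prod>i\<in>J. [:- z i, 1:] :: complex poly) = card J"
 by (subst degree_prod_sum_eq) auto

text \<open>One application of \<open>R (z j)\<close> to a chain of length \<open>N\<close> gains a
  derivative: the image can be prolonged by one more power of \<open>T\<close>.\<close>

lemma chain_exists:
 assumes "finite J" "!!i. i \<in> J ==> Im (z i) ~= 0" "\<psi> \<in> sp0"
 shows "EX X. chain (card J) X & act X (\<Prod>i\<in>J. [:- z i, 1:]) = \<psi>"
 using assms(1,2)
proof (induction J)
 case empty
 show ?case using assms(3) by (intro exI[of _ "%_. \<psi>"]) (simp add: chain_def act_def scaleC_one)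
next
 case (insert j J)
 define N where "N = card J"
 define p where "p = (\<Prod>i\<in>J. [:- z i, 1:])"
 have p: "degree p = N" unfolding p_def N_def using insert.hyps by (simp add: degree_prod_linear)
 obtain X where X: "chain N X" "act X p = \<psi>" using insert.IH insert.prems by (auto simp: N_def p_def)
 have zj: "Im (z j) ~= 0" using insert.prems by simp
 define Y where "Y i = (if i <= N then R (z j) (X i) else T (R (z j) (X N)))" for i
 have XS: "X i \<in> sp0" if "i <= N" for i using chain_in[OF X(1) that] .
 have Y: "chain (Suc N) Y" unfolding chain_def
 proof (intro conjI allI impI)
  show "Y (Suc N) \<in> sp0" using R_props(1)[OF zj XS] T_in by (simp add: Y_def)
  fix i assume i: "i < Suc N"
  show "Y i \<in> D" using R_props(1)[OF zj XS] i by (simp add: Y_def)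
  show "T (Y i) = Y (Suc i)"
  proof (cases "i < N")
   case True
   hence "X i \<in> D" "T (X i) = X (Suc i)" using X(1) by (auto simp: chain_def)
   thus ?thesis using True R_T(1)[OF zj, of "X i"] R_T(2)[OF zj XS, of i] by (simp add: Y_def)
  qed (use i in \<open>simp add: Y_def less_Suc_eq\<close>)
 qed
 have "act Y p = R (z j) (act X p)"
 proof -
  have "act Y p = (SUM i<=N. R (z j) (coeff p i *\<^sub>C X i))" unfolding act_def p using R_scale[OF zj XS] by (intro sum.cong) (auto simp: Y_def)
  also have "... = R (z j) (act X p)" unfolding act_def p using XS by (intro R_sum[OF zj, symmetric] H.V_scale) auto
  finally show ?thesis .
 qed
 hence "shifted (z j) (act Y p) = \<psi>" using X(2) R_props(2)[OF zj assms(3)] by simp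
 moreover have "shifted (z j) (act Y p) = act Y ([:- z j, 1:] * p)" by (rule act_mult(2)[OF Y]) (simp add: p)
 moreover have "(\<Prod>i\<in>insert j J. [:- z i, 1:]) = [:- z j, 1:] * p" using insert.hyps by (simp add: p_def)
 moreover have "card (insert j J) = Suc N" using insert.hyps by (simp add: N_def)
 ultimately show ?case using Y by metis
qed

text \<open>By symmetry <T^a x, T^b x> depends on a + b only, so the form is a linear moment
  functional \<open>L\<close> of the product polynomial. Linearity of \<open>L\<close> is what
  transfers polynomial identities to forms.\<close>

lemma ip_act:
 assumes X: "chain N X"
 obtains L :: "complex poly => complex"
 where "!!p q. degree p <= N ==> degree q <= N ==> ip0 (act X p) (act X q) = L (map_poly cnj p * q)"
  "!!I c f. finite (I :: 'i set) ==> L (SUM i:I. smult (c i) (f i)) = (SUM i:I. c i * L (f i))"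
proof -
 \<comment> \<open>For k <= 2N this splits k into two exponents that are both at most N.\<close>
 define M where "M k = ip0 (X (k - min k N)) (X (min k N))" for k
 have M: "ip0 (X a) (X b) = M (a + b)" if "a <= N" "b <= N" for a b using that
 proof (induction a arbitrary: b)
  case (Suc a)
  show ?case
  proof (cases "b < N")
   case True
   hence "ip0 (X (Suc a)) (X b) = ip0 (X a) (X (Suc b))" using X Suc.prems T_symmetric[of "X a" "X b"] by (auto simp: chain_def)
   thus ?thesis using Suc.IH[of "Suc b"] Suc.prems True by simp
  qed (use Suc.prems in \<open>simp add: M_def min_def\<close>)
 qed (simp add: M_def)
 define L where "L f = (SUM k<=2*N. coeff f k * M k)" for f
 have L_sum: "L (sum f I) = (SUM i:I. L (f i))" for f and I :: "nat set" unfolding L_def by (simp add: coeff_sum sum_distrib_right) (rule sum.swap)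
 have L_lin: "L (SUM i:I. smult (c i) (f i)) = (SUM i:I. c i * L (f i))" for c f and I :: "'i set"
  unfolding L_def by (simp add: coeff_sum sum_distrib_right sum_distrib_left mult.assoc) (rule sum.swap)
 have L_monom: "L (monom c k) = c * M k" if "k <= 2*N" for c k unfolding L_def using that by (simp add: if_distrib[of "%x. x * _"] sum.delta cong: if_cong)
 have "ip0 (act X p) (act X q) = L (map_poly cnj p * q)" if p: "degree p <= N" and q: "degree q <= N" for p q
 proof -
  have XS: "X i \<in> sp0" if "i <= N" for i using chain_in[OF X that] .
  have "ip0 (act X p) (act X q) = (SUM i<=N. SUM j<=N. cnj (coeff p i) * (coeff q j * ip0 (X i) (X j)))"
  proof -
   have "ip0 (act X p) (act X q) = (SUM i<=N. ip0 (coeff p i *\<^sub>C X i) (SUM j<=N. coeff q j *\<^sub>C X j))"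
    unfolding act_eq[OF p] act_eq[OF q] by (rule H.q_sum_left) (auto intro!: H.V_sum H.V_scale XS)
   also have "... = (SUM i<=N. SUM j<=N. ip0 (coeff p i *\<^sub>C X i) (coeff q j *\<^sub>C X j))"
    by (intro sum.cong refl H.q_sum_right) (auto intro!: H.V_scale XS)
   finally show ?thesis by (simp add: H.q_scale_left H.q_scale_right H.V_scale XS mult.left_commute)
  qed
  also have "... = (SUM i<=N. SUM j<=N. L (monom (cnj (coeff p i) * coeff q j) (i + j)))" by (intro sum.cong refl) (simp add: M L_monom)
  also have "... = L (SUM i<=N. SUM j<=N. monom (cnj (coeff p i) * coeff q j) (i + j))" by (simp add: L_sum)
  also have "(SUM i<=N. SUM j<=N. monom (cnj (coeff p i) * coeff q j) (i + j))
    = (SUM i<=N. monom (coeff (map_poly cnj p) i) i) * (SUM j<=N. monom (coeff q j) j)" by (simp add: sum_product mult_monom coeff_map_poly)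
  also have "... = map_poly cnj p * q" using p q by (simp add: poly_as_sum_of_monoms' degree_map_poly)
  finally show ?thesis .
 qed
 thus thesis using that L_lin by blast
qed

text \<open>Multiplied by |P|^2 the rational function becomes a polynomial that is nonnegative on
  the line, hence |q|^2; by \<open>ip_act\<close> the sum in question is then the squared norm of
  q(T) applied to the base vector.\<close>

lemma rational_positivity:
 assumes J: "finite J" and z: "!!j. j \<in> J ==> Im (z j) ~= 0" and \<psi>: "\<psi> \<in> sp0"
  and nonneg: "!!x::real. 0 <= (SUM j:J. a j / (cmod (of_real x - z j))^2)"
 shows "0 <= (SUM j:J. a j * (nm0 (R (z j) \<psi>))^2)"
proof -
 define P where "P = (\<Prod>i\<in>J. [:- z i, 1:])"
 define p where "p j = (\<Prod>i\<in>J - {j}. [:- z i, 1:])" for j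
 have P: "P = [:- z j, 1:] * p j" if "j \<in> J" for j unfolding P_def p_def using J that by (rule prod.remove)
 obtain X where X: "chain (card J) X" "act X P = \<psi>" using chain_exists[OF J, of z \<psi>] z \<psi> unfolding P_def by blast
 have deg: "degree (p j) < card J" if "j \<in> J" for j unfolding p_def using card_Diff1_less[OF J that] J by (simp only: degree_prod_linear finite_Diff)
 have Rp: "R (z j) \<psi> = act X (p j)" if "j \<in> J" for j using R_unique[OF z[OF that] act_mult(1)[OF X(1) deg[OF that]]] act_mult(2)[OF X(1) deg[OF that]]
   P[OF that] X(2) by simp
 obtain L where L: "!!p q. degree p <= card J ==> degree q <= card J ==>
   ip0 (act X p) (act X q) = L (map_poly cnj p * q)"
  and Lin: "!!I c f. finite (I :: 'a set) ==> L (SUM i:I. smult (c i) (f i)) = (SUM i:I. c i * L (f i))"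
  by (rule ip_act[OF X(1), where ?'i = 'a]) (rule that; assumption)
 define f where "f = (SUM j:J. smult (of_real (a j)) (map_poly cnj (p j) * p j))"
 have "poly f (of_real x) \<in> nonneg_complex" for x :: real
 proof -
  have "poly f (of_real x) = (SUM j:J. of_real (a j * (cmod (poly (p j) (of_real x)))^2))"
   unfolding f_def of_real_mult complex_norm_square by (simp add: poly_sum mult_ac)
  also have "... = of_real (SUM j:J. a j * (cmod (poly (p j) (of_real x)))^2)" by simp
  also have "(SUM j:J. a j * (cmod (poly (p j) (of_real x)))^2)
    = (cmod (poly P (of_real x)))^2 * (SUM j:J. a j / (cmod (of_real x - z j))^2)" unfolding sum_distrib_left
  proof (intro sum.cong refl)
   fix j assume j: "j \<in> J"
   have "of_real x ~= z j" using z[OF j] by (metis Im_complex_of_real)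
   moreover have "poly P (of_real x) = (of_real x - z j) * poly (p j) (of_real x)" unfolding P[OF j] poly_mult by simp
   ultimately show "a j * (cmod (poly (p j) (of_real x)))^2
     = (cmod (poly P (of_real x)))^2 * (a j / (cmod (of_real x - z j))^2)" by (simp add: norm_mult power_mult_distrib)
  qed
  finally show ?thesis using nonneg[of x] by (simp add: nonneg_complex_def)
 qed
 then obtain q where q: "f = map_poly cnj q * q" using nonneg_poly_square by blast
 \<comment> \<open>Only powers up to \<open>card J\<close> are available on the base vector, so
   \<open>q\<close> must not exceed this degree.\<close>
 have degq: "degree q <= card J"
 proof (cases "q = 0")
  case False
  have "degree f <= 2 * card J" unfolding f_def
  proof (rule degree_sum_le[OF J])
   fix j assume j: "j \<in> J"
   show "degree (smult (of_real (a j)) (map_poly cnj (p j) * p j)) <= 2 * card J" using degree_mult_le[of "map_poly cnj (p j)" "p j"] deg[OF j]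
     degree_smult_le[of "of_real (a j)" "map_poly cnj (p j) * p j"] by (simp add: degree_map_poly)
  qed
  moreover have "degree f = 2 * degree q" unfolding q using False by (subst degree_mult_eq) (auto simp: degree_map_poly map_poly_eq_0_iff)
  ultimately show ?thesis by simp
 qed simp
 have "of_real (SUM j:J. a j * (nm0 (R (z j) \<psi>))^2) = (SUM j:J. of_real (a j) * L (map_poly cnj (p j) * p j))" unfolding of_real_sum of_real_mult
 proof (intro sum.cong refl)
  fix j assume j: "j \<in> J"
  have "L (map_poly cnj (p j) * p j) = ip0 (R (z j) \<psi>) (R (z j) \<psi>)" using L[of "p j" "p j"] deg[OF j] Rp[OF j] by simp
  thus "of_real (a j) * of_real ((nm0 (R (z j) \<psi>))^2) = of_real (a j) * L (map_poly cnj (p j) * p j)" using H.B_self[OF R_in[OF z[OF j] \<psi>]] by simp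
 qed
 also have "... = L f" unfolding f_def using Lin[OF J, of "%j. of_real (a j)"] by simp
 also have "... = of_real ((nm0 (act X q))^2)" using L[OF degq degq] H.B_self[OF act_in[OF X(1) degq]] by (simp add: q)
 finally have "(SUM j:J. a j * (nm0 (R (z j) \<psi>))^2) = (nm0 (act X q))^2" by (simp only: of_real_eq_iff)
 thus ?thesis by simp
qed

lemma rational_positivity_list:
 assumes z: "!!w z. (w, z) \<in> set xs ==> Im z ~= 0" and \<psi>: "\<psi> \<in> sp0"
  and nonneg: "!!x::real. 0 <= (\<Sum>(w, z)\<leftarrow>xs. w / (cmod (of_real x - z))^2)"
 shows "0 <= (\<Sum>(w, z)\<leftarrow>xs. w * (nm0 (R z \<psi>))^2)"
proof -
 have sum: "(\<Sum>(w, z)\<leftarrow>xs. F w z) = (SUM j<length xs. F (fst (xs ! j)) (snd (xs ! j)))" for F :: "real => complex => real"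
  by (simp add: sum_list_sum_nth case_prod_beta atLeast0LessThan)
 show ?thesis unfolding sum
 proof (rule rational_positivity[OF _ _ \<psi>])
  show "Im (snd (xs ! j)) ~= 0" if "j \<in> {..<length xs}" for j using z[of "fst (xs ! j)" "snd (xs ! j)"] that by simp
  show "0 <= (SUM j<length xs. fst (xs ! j) / (cmod (of_real x - snd (xs ! j)))^2)" for x :: real using nonneg[of x] unfolding sum .
 qed simp
qed

text \<open>By the previous lemma it suffices to dominate \<open>1 / ((x - l)\<^sup>2 + y\<^sup>2)\<close> on the real line by a sum
 of kernels \<open>w / \<bar>x - z\<bar>\<^sup>2\<close>; a bisection provides one whose nodes \<open>z\<close> are so close to the real axis that
 \<open>Im z * \<parallel>R z \<psi>\<parallel>\<^sup>2\<close> is controlled by its boundary value.\<close>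
lemma vertical_growth:
 assumes \<psi>: "\<psi> \<in> sp0" and d: "d > 0" and K: "K > 0" and y: "y > 0"
  and bv: "!!\<mu>. \<bar>\<mu> - l\<bar> <= d ==> \<mu> ~= l ==>
   EX h0>0. ALL h. 0 < h & h < h0 --> h * (nm0 (R (Complex \<mu> h) \<psi>))^2 <= K * (\<mu> - l)^2"
  and bv_l: "!!e. e > 0 ==> EX h0>0. ALL h. 0 < h & h < h0 --> h * (nm0 (R (Complex l h) \<psi>))^2 <= e"
 shows "(nm0 (R (Complex l y) \<psi>))^2 <= 16 * K * d + 2 * (nm0 (R (Complex l d) \<psi>))^2"
proof -
 define N where "N z = (nm0 (R z \<psi>))^2" for z
 define k where "k x = 1 / ((x - l)^2 + y^2)" for x
 have cm: "(cmod (of_real x - Complex a b))^2 = (x - a)^2 + b^2" for x a b by (simp add: cmod_power2)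
 \<comment> \<open>\<open>Q a b\<close>: on this interval \<open>k\<close> is dominated at a cost
   proportional to its length. The cost is additive, so it suffices to know \<open>Q\<close> for
   short intervals around each point.\<close>
 define Q where "Q a b \<longleftrightarrow> a < b --> (EX xs. (ALL (w, z):set xs. 0 <= w & Im z ~= 0) &
   (ALL x:{a..b}. k x <= (\<Sum>(w, z)\<leftarrow>xs. w / (cmod (of_real x - z))^2)) &
   (\<Sum>(w, z)\<leftarrow>xs. w * N z) <= 8 * K * (b - a))" for a b
 \<comment> \<open>One node at height b - a above \<open>t\<close> is enough: on the interval |x -
   t|^2 + (b - a)^2 is at most 2 (b - a)^2, so its kernel with this weight stays above
   \<open>c\<close>.\<close>
 have single: "Q a b" if "a <= t" "t <= b" "!!x. x \<in> {a..b} ==> k x <= c" "0 <= c"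
  "a < b ==> 2 * (b - a)^2 * c * N (Complex t (b - a)) <= 8 * K * (b - a)" for a b t c unfolding Q_def
 proof (intro impI exI[of _ "[(2 * (b - a)^2 * c, Complex t (b - a))]"] conjI ballI)
  assume ab: "a < b"
  show "case x of (w, z) => 0 <= w & Im z ~= 0" if "x \<in> set [(2 * (b - a)^2 * c, Complex t (b - a))]" for x
   using that ab \<open>0 <= c\<close> by simp
  show "(\<Sum>(w, z)\<leftarrow>[(2 * (b - a)^2 * c, Complex t (b - a))]. w * N z) <= 8 * K * (b - a)" using that(5) ab by simp
  fix x assume x: "x \<in> {a..b}"
  have pos: "(x - t)^2 + (b - a)^2 > 0" using ab by (simp add: add_nonneg_pos)
  have "(x - t)^2 <= (b - a)^2" using x that(1,2) by (intro abs_le_square_iff[THEN iffD1]) auto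
  hence "c * ((x - t)^2 + (b - a)^2) <= c * (2 * (b - a)^2)" using \<open>0 <= c\<close> by (intro mult_left_mono) auto
  hence "c <= 2 * (b - a)^2 * c / ((x - t)^2 + (b - a)^2)" using pos by (simp add: pos_le_divide_eq mult_ac)
  thus "k x <= (\<Sum>(w, z)\<leftarrow>[(2 * (b - a)^2 * c, Complex t (b - a))]. w / (cmod (of_real x - z))^2)" using that(3)[OF x] by (simp add: cm)
 qed
 have "Q (l - d) (l + d)"
 proof (rule Bolzano)
  show "l - d <= l + d" using d by simp
  fix a b c assume Q: "Q a b" "Q b c" and ab: "a <= b" "b <= c"
  show "Q a c"
  proof (cases "a = b \<or> b = c")
   case True
   thus ?thesis using Q by auto
  next
   case False
   hence lt: "a < b" "b < c" using ab by auto
   from Q(1) lt obtain xs where xs: "ALL (w, z):set xs. 0 <= w & Im z ~= 0"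
    "ALL x:{a..b}. k x <= (\<Sum>(w, z)\<leftarrow>xs. w / (cmod (of_real x - z))^2)"
    "(\<Sum>(w, z)\<leftarrow>xs. w * N z) <= 8 * K * (b - a)" unfolding Q_def by blast
   from Q(2) lt obtain ys where ys: "ALL (w, z):set ys. 0 <= w & Im z ~= 0"
    "ALL x:{b..c}. k x <= (\<Sum>(w, z)\<leftarrow>ys. w / (cmod (of_real x - z))^2)"
    "(\<Sum>(w, z)\<leftarrow>ys. w * N z) <= 8 * K * (c - b)" unfolding Q_def by blast
   have nn: "0 <= (\<Sum>(w, z)\<leftarrow>us. w / (cmod (of_real x - z))^2)"
    if "ALL (w, z):set us. 0 <= w & Im z ~= 0" for us and x :: real using that by (intro sum_list_nonneg) auto
   show ?thesis unfolding Q_def proof (intro impI exI[of _ "xs @ ys"] conjI ballI)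
    show "case x of (w, z) => 0 <= w & Im z ~= 0" if "x \<in> set (xs @ ys)" for x using that xs(1) ys(1) by auto
    show "(\<Sum>(w, z)\<leftarrow>xs @ ys. w * N z) <= 8 * K * (c - a)" using xs(3) ys(3) by (simp add: algebra_simps)
    fix x assume "x \<in> {a..c}"
    then consider "x \<in> {a..b}" | "x \<in> {b..c}" by fastforce
    thus "k x <= (\<Sum>(w, z)\<leftarrow>xs @ ys. w / (cmod (of_real x - z))^2)" proof cases
     case 1
     thus ?thesis using bspec[OF xs(2) 1] nn[OF ys(1), of x] by simp
    next
     case 2
     thus ?thesis using bspec[OF ys(2) 2] nn[OF xs(1), of x] by simp
    qed
   qed
  qed
 next
  fix t assume t: "l - d <= t" "t <= l + d"
  show "EX \<delta>>0. ALL a b. a <= t & t <= b & b - a < \<delta> --> Q a b"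
  proof (cases "t = l")
   case True
   \<comment> \<open>At \<open>l\<close> itself \<open>k\<close> is as large as 1 / y^2; this is
     compensated by requiring h |R psi|^2 to be at most K y^2, possible because its boundary value
     there vanishes.\<close>
   have "K * y^2 > 0" using K y by simp
   then obtain h0 where h0: "h0 > 0" "!!h. 0 < h ==> h < h0 ==> h * N (Complex l h) <= K * y^2"
    using bv_l[OF \<open>K * y^2 > 0\<close>] unfolding N_def by blast
   show ?thesis proof (intro exI[of _ h0] conjI allI impI h0(1))
    fix a b assume ab: "a <= t & t <= b & b - a < h0"
    show "Q a b" proof (rule single[of a t b "1 / y^2"])
     show "k x <= 1 / y^2" for x using y unfolding k_def by (intro divide_left_mono) (auto simp: add_nonneg_pos)
     assume "a < b"
     hence "(b - a) * N (Complex l (b - a)) <= K * y^2" using h0(2) ab by simp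
     hence "2 * (b - a) / y^2 * ((b - a) * N (Complex l (b - a))) <= 2 * (b - a) / y^2 * (K * y^2)"
      using \<open>a < b\<close> by (intro mult_left_mono) auto
     also have "... = 2 * K * (b - a)" using y by simp
     also have "... <= 8 * K * (b - a)" using \<open>a < b\<close> K by (intro mult_right_mono) auto
     finally show "2 * (b - a)^2 * (1 / y^2) * N (Complex t (b - a)) <= 8 * K * (b - a)" using True by (simp add: power2_eq_square mult_ac)
    qed (use ab in auto)
   qed
  next
   case False
   obtain h0 where h0: "h0 > 0" "!!h. 0 < h ==> h < h0 ==> h * N (Complex t h) <= K * (t - l)^2"
    using bv[of t] t False unfolding N_def by (auto simp: abs_le_iff)
   show ?thesis proof (intro exI[of _ "min h0 (\<bar>t - l\<bar> / 2)"] conjI allI impI)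
    show "0 < min h0 (\<bar>t - l\<bar> / 2)" using h0 False by simp
    fix a b assume ab: "a <= t & t <= b & b - a < min h0 (\<bar>t - l\<bar> / 2)"
    have tl: "(t - l)^2 > 0" using False by simp
    \<comment> \<open>On an interval shorter than half of |t - l| one has |x - l| >= |t - l| / 2;
      the quadratic smallness at \<open>t\<close> cancels the factor 4 / (t - l)^2.\<close>
    show "Q a b" proof (rule single[of a t b "4 / (t - l)^2"])
     show "k x <= 4 / (t - l)^2" if "x \<in> {a..b}" for x proof -
      have "\<bar>t - l\<bar> <= 2 * \<bar>x - l\<bar>" using that ab by (auto simp: abs_if split: if_splits)
      hence "\<bar>t - l\<bar> <= \<bar>2 * (x - l)\<bar>" unfolding abs_mult by simp
      hence "(t - l)^2 <= (2 * (x - l))^2" by (simp only: abs_le_square_iff)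
      hence "(t - l)^2 <= 4 * (x - l)^2" unfolding power_mult_distrib by simp
      hence le: "(t - l)^2 <= 4 * ((x - l)^2 + y^2)" using zero_le_power2[of y] unfolding distrib_left by linarith
      have "4 * ((x - l)^2 + y^2) > 0" using y by (simp add: add_nonneg_pos)
      hence "4 / (4 * ((x - l)^2 + y^2)) <= 4 / (t - l)^2" using tl le by (intro divide_left_mono mult_pos_pos) simp_all
      moreover have "4 / (4 * u) = 1 / u" for u :: real by simp
      ultimately show ?thesis unfolding k_def by metis
     qed
     assume "a < b"
     hence "(b - a) * N (Complex t (b - a)) <= K * (t - l)^2" using h0(2) ab by simp
     hence "8 * (b - a) / (t - l)^2 * ((b - a) * N (Complex t (b - a))) <= 8 * (b - a) / (t - l)^2 * (K * (t - l)^2)"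
      using \<open>a < b\<close> by (intro mult_left_mono) auto
     also have "... = 8 * K * (b - a)" using tl by simp
     finally show "2 * (b - a)^2 * (4 / (t - l)^2) * N (Complex t (b - a)) <= 8 * K * (b - a)" by (simp add: power2_eq_square mult_ac)
    qed (use ab in auto)
   qed
  qed
 qed
 then obtain xs where xs: "ALL (w, z):set xs. 0 <= w & Im z ~= 0"
  "ALL x:{l - d..l + d}. k x <= (\<Sum>(w, z)\<leftarrow>xs. w / (cmod (of_real x - z))^2)"
  "(\<Sum>(w, z)\<leftarrow>xs. w * N z) <= 8 * K * (l + d - (l - d))" using d unfolding Q_def by auto
 \<comment> \<open>The node at height \<open>d\<close> with weight 2 dominates \<open>k\<close>
   outside the interval of radius \<open>d\<close>; the list \<open>xs\<close> does so inside, at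
   cost 8 K times the length 2 d.\<close>
 have "0 <= (\<Sum>(w, z)\<leftarrow>(2, Complex l d) # (-1, Complex l y) # xs. w * (nm0 (R z \<psi>))^2)"
 proof (rule rational_positivity_list[OF _ \<psi>])
  show "Im z ~= 0" if "(w, z) \<in> set ((2, Complex l d) # (-1, Complex l y) # xs)" for w z using that xs(1) d y by auto
  fix x :: real
  have "k x <= 2 / ((x - l)^2 + d^2) + (\<Sum>(w, z)\<leftarrow>xs. w / (cmod (of_real x - z))^2)"
  proof (cases "x \<in> {l - d..l + d}")
   case True
   thus ?thesis using bspec[OF xs(2) True] by (simp add: add_increasing)
  next
   case False
   hence "\<bar>d\<bar> <= \<bar>x - l\<bar>" using d by (auto simp: abs_if)
   hence "d^2 <= (x - l)^2" by (simp only: abs_le_square_iff)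
   hence "(x - l)^2 + d^2 <= 2 * ((x - l)^2 + y^2)" using zero_le_power2[of y] unfolding distrib_left by linarith
   moreover have "(x - l)^2 + d^2 > 0" using d by (simp add: add_nonneg_pos)
   moreover have "1 / v <= 2 / u" if "u <= 2 * v" "0 < u" for u v :: real using that by (simp add: field_simps)
   ultimately have "k x <= 2 / ((x - l)^2 + d^2)" unfolding k_def by blast
   moreover have "0 <= (\<Sum>(w, z)\<leftarrow>xs. w / (cmod (of_real x - z))^2)" using xs(1) by (intro sum_list_nonneg) auto
   ultimately show ?thesis by simp
  qed
  thus "0 <= (\<Sum>(w, z)\<leftarrow>(2, Complex l d) # (-1, Complex l y) # xs. w / (cmod (of_real x - z))^2)" by (simp add: cm k_def)
 qed
 thus ?thesis using xs(3) by (simp add: N_def algebra_simps)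
qed

end

section \<open>Bounded operators in the scale\<close>

text \<open>Operators are functions, and this structure makes the operator bounds \<open>bop\<close>
  an instance of \<open>bounding\<close>, to which the calculus applies.\<close>

instantiation "fun" :: (type, complex_vector) real_vector
begin

definition scaleR_fun :: "real => ('a => 'b) => 'a => 'b" where
 "scaleR_fun r T = (%x. of_real r *\<^sub>C T x)"

instance
 by standard (auto simp: scaleR_fun_def fun_eq_iff scaleC_add_right scaleC_add_left scaleC_scaleC scaleC_one)

end

lemma scaleR_fun_apply [simp]: "(r *\<^sub>R T) x = of_real r *\<^sub>C T x"
 by (simp add: scaleR_fun_def)

context hscale
begin

definition bop :: "real => real => ('v => 'v) => real => bool" where
 "bop a b T K \<longleftrightarrow> T \<in> blin S a b & 0 <= K & (ALL f:sp S a. hnorm S b (T f) <= K * hnorm S a f)"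

lemma blinD:
 assumes "T \<in> blin S a b"
 shows "f \<in> sp S a ==> T f \<in> sp S b" "f \<in> sp S a ==> g \<in> sp S a ==> T (f + g) = T f + T g"
  "f \<in> sp S a ==> T (c *\<^sub>C f) = c *\<^sub>C T f" "f \<notin> sp S a ==> T f = 0"
 using assms by (auto simp: blin_def clinear_on_def)

lemma blin_diff: "T \<in> blin S a b ==> f \<in> sp S a ==> g \<in> sp S a ==> T (f - g) = T f - T g"
 using blinD(2)[of T a b "f - g" g] H.V_diff[of f a g] by simp

lemma blin_zero: "T \<in> blin S a b ==> T 0 = 0"
 using blin_diff[of T a b 0 0] H.V_zero by simp

lemma blin_in: "T \<in> blin S a b ==> T f \<in> sp S b"
 using blinD(1,4)[of T a b f] H.V_zero by (cases "f \<in> sp S a") auto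

lemma bopD:
 assumes "bop a b T K"
 shows "T \<in> blin S a b" "0 <= K" "f \<in> sp S a ==> hnorm S b (T f) <= K * hnorm S a f"
 using assms by (auto simp: bop_def)

lemma bopI:
 assumes "!!f. f \<in> sp S a ==> T f \<in> sp S b" "!!f g. f \<in> sp S a ==> g \<in> sp S a ==> T (f + g) = T f + T g"
  "!!f c. f \<in> sp S a ==> T (c *\<^sub>C f) = c *\<^sub>C T f" "!!f. f \<notin> sp S a ==> T f = 0"
  "0 <= K" "!!f. f \<in> sp S a ==> hnorm S b (T f) <= K * hnorm S a f"
 shows "bop a b T K"
 using assms unfolding bop_def blin_def clinear_on_def by blast

lemma bop_mono: "bop a b T K ==> K <= K' ==> bop a b T K'"
 unfolding bop_def by (meson H.nm_nonneg mult_right_mono order_trans)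

lemma bounding_bop: "bounding (bop a b)"
proof
 show "0 <= K" if "bop a b T K" for T K using that by (rule bopD)
 show "bop a b 0 0" by (rule bopI) (auto simp: H.V_zero)
 show "bop a b T K'" if "bop a b T K" "K <= K'" for T K K' using bop_mono that .
 show "bop a b (T + U) (K + L)" if T: "bop a b T K" and U: "bop a b U L" for T U K L
 proof (rule bopI)
  fix f assume f: "f \<in> sp S a"
  have "hnorm S b (T f + U f) <= hnorm S b (T f) + hnorm S b (U f)" using f T U by (intro H.nm_triangle) (auto simp: bop_def dest: blinD(1))
  thus "hnorm S b ((T + U) f) <= (K + L) * hnorm S a f" using bopD(3)[OF T f] bopD(3)[OF U f] by (simp add: distrib_right)
 qed (simp_all add: blinD[OF bopD(1)[OF T]] blinD[OF bopD(1)[OF U]] bopD(2)[OF T] bopD(2)[OF U]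
   scaleC_add_right H.V_add)
 show "bop a b (r *\<^sub>R T) (\<bar>r\<bar> * K)" if T: "bop a b T K" for T K r
 proof (rule bopI)
  fix f assume f: "f \<in> sp S a"
  show "hnorm S b ((r *\<^sub>R T) f) <= \<bar>r\<bar> * K * hnorm S a f"
   using bopD(3)[OF T f] blinD(1)[OF bopD(1)[OF T] f] by (simp add: H.nm_scale mult.assoc mult_left_mono)
 qed (simp_all add: blinD[OF bopD(1)[OF T]] bopD(2)[OF T] scaleC_add_right scaleC_scaleC mult.commute H.V_scale)
qed

sublocale O: bounding "bop a b" for a b by (rule bounding_bop)

lemma bounded_bilin_comp: "bounded_bilin (bop b c) (bop a b) (bop a c) (o)"
proof -
 have "bop a c (T o U) (K * L)" if T: "bop b c T K" and U: "bop a b U L" for T U K L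
 proof (rule bopI)
  note Tl = blinD[OF bopD(1)[OF T]] and Ul = blinD[OF bopD(1)[OF U]]
  show "0 <= K * L" using bopD(2)[OF T] bopD(2)[OF U] by simp
  fix f assume f: "f \<in> sp S a"
  have "hnorm S c (T (U f)) <= K * hnorm S b (U f)" using bopD(3)[OF T Ul(1)[OF f]] .
  also have "... <= K * (L * hnorm S a f)" using bopD(3)[OF U f] bopD(2)[OF T] by (intro mult_left_mono)
  finally show "hnorm S c ((T o U) f) <= K * L * hnorm S a f" by (simp add: mult.assoc)
 qed (use blinD[OF bopD(1)[OF T]] blinD[OF bopD(1)[OF U]] blin_zero[OF bopD(1)[OF T]] in auto)
 moreover have "T o (r *\<^sub>R U + t *\<^sub>R U') = r *\<^sub>R (T o U) + t *\<^sub>R (T o U')"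
  if T: "bop b c T K" and U: "bop a b U L" and U': "bop a b U' L'" for T U U' K L L' r t
  using blinD[OF bopD(1)[OF T]] blin_in[OF bopD(1)[OF U]] blin_in[OF bopD(1)[OF U']] by (auto simp: fun_eq_iff H.V_scale)
 ultimately show ?thesis by (intro bounded_bilin.intro bounded_bilin_axioms.intro bounding_bop) (auto simp: fun_eq_iff)
qed

sublocale OC: bounded_bilin "bop b c" "bop a b" "bop a c" "(o)" for a b c by (rule bounded_bilin_comp)

abbreviation Id :: "real => 'v => 'v" where "Id a \<equiv> restrict_to S a (%f. f)"

lemma bop_Id: "bop a a (Id a) 1"
 by (rule bopI) (auto simp: restrict_to_def H.V_add H.V_scale)

lemma bop_opnorm:
 assumes T: "T \<in> blin S a b"
 shows "bop a b T (opnorm S a b T)"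
proof -
 obtain K where K: "!!f. f \<in> sp S a ==> hnorm S b (T f) <= K * hnorm S a f" using T by (auto simp: blin_def)
 define A where "A = (%f. hnorm S b (T f)) ` {f \<in> sp S a. hnorm S a f <= 1}"
 have bdd: "bdd_above A"
 proof (rule bdd_aboveI)
  fix y assume "y \<in> A"
  then obtain f where f: "f \<in> sp S a" "hnorm S a f <= 1" "y = hnorm S b (T f)" by (auto simp: A_def)
  have "K * hnorm S a f <= \<bar>K\<bar> * 1" using f H.nm_nonneg[OF f(1)] by (intro mult_mono) auto
  thus "y <= \<bar>K\<bar>" using K[OF f(1)] f(3) by simp
 qed
 have le: "hnorm S b (T f) <= opnorm S a b T" if "f \<in> sp S a" "hnorm S a f <= 1" for f
  unfolding opnorm_def using bdd that by (intro cSUP_upper) (auto simp: A_def)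
 have "0 <= opnorm S a b T" using le[OF H.V_zero] blin_zero[OF T] by simp
 moreover have "hnorm S b (T f) <= opnorm S a b T * hnorm S a f" if f: "f \<in> sp S a" for f
 proof (cases "f = 0")
  case False
  hence pos: "hnorm S a f > 0" using H.nm_nonneg[OF f] H.nm_eq_0[OF f] by simp
  have "hnorm S b (T (of_real (1 / hnorm S a f) *\<^sub>C f)) <= opnorm S a b T" using pos f by (intro le) (auto simp: H.V_scale H.nm_scale norm_divide)
  thus ?thesis using pos f T by (simp add: blinD H.nm_scale norm_divide field_simps)
 qed (simp add: blin_zero[OF T])
 ultimately show ?thesis using T by (simp add: bop_def)
qed

lemma opnorm_le: "bop a b T K ==> opnorm S a b T <= K"
 unfolding opnorm_def
proof (rule cSUP_least)
 show "{f \<in> sp S a. hnorm S a f <= 1} ~= {}" using H.V_zero[of a] by (force simp: H.nm_zero)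
 fix f assume T: "bop a b T K" and "f \<in> {f \<in> sp S a. hnorm S a f <= 1}"
 hence f: "f \<in> sp S a" "hnorm S a f <= 1" by auto
 show "hnorm S b (T f) <= K" using bopD(3)[OF T f(1)] mult_left_mono[OF f(2) bopD(2)[OF T]] by simp
qed

lemma opnorm_nonneg: "T \<in> blin S a b ==> 0 <= opnorm S a b T"
 using bopD(2)[OF bop_opnorm] .

lemma fun_diff: "(%f. T f - U f) = T - (U :: 'v => 'v)"
 by (simp add: fun_eq_iff)

lemma blin_diff_op: "T \<in> blin S a b ==> U \<in> blin S a b ==> T - U \<in> blin S a b"
 using O.bnd_diff[OF bop_opnorm bop_opnorm] bopD(1) by blast

lemma has_norm_limitD:
 assumes "has_norm_limit S a b T R F"
 shows "R \<in> blin S a b" "e > 0 ==> \<forall>\<^sub>F x in F. bop a b (T x - R) e"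
proof -
 show R: "R \<in> blin S a b" using assms by (simp add: has_norm_limit_def)
 assume e: "e > 0"
 have "\<forall>\<^sub>F x in F. opnorm S a b (%f. T x f - R f) < e" "\<forall>\<^sub>F x in F. T x \<in> blin S a b"
 proof -
  have "((%x. opnorm S a b (%f. T x f - R f)) \<longlongrightarrow> 0) F" using assms by (simp add: has_norm_limit_def)
  thus "\<forall>\<^sub>F x in F. opnorm S a b (%f. T x f - R f) < e" using e by (rule order_tendstoD(2))
  show "\<forall>\<^sub>F x in F. T x \<in> blin S a b" using assms by (simp add: has_norm_limit_def)
 qed
 thus "\<forall>\<^sub>F x in F. bop a b (T x - R) e"
 proof eventually_elim
  case (elim x)
  hence "opnorm S a b (T x - R) <= e" using fun_diff[of "T x" R] by simp
  thus ?case by (rule bop_mono[OF bop_opnorm[OF blin_diff_op[OF elim(2) R]]])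
 qed
qed

lemma has_norm_limitI:
 assumes R: "R \<in> blin S a b" and lim: "!!e. e > 0 ==> \<forall>\<^sub>F x in F. bop a b (T x - R) e"
 shows "has_norm_limit S a b T R F"
 unfolding has_norm_limit_def
proof (intro conjI R)
 have blin: "T x \<in> blin S a b" if "bop a b (T x - R) e" for x e
 proof -
  have "T x - R + R \<in> blin S a b" using bopD(1)[OF O.bnd_add[OF that bop_opnorm[OF R]]] .
  thus ?thesis by simp
 qed
 show "\<forall>\<^sub>F x in F. T x \<in> blin S a b" using lim[OF zero_less_one] by eventually_elim (rule blin)
 show "((%x. opnorm S a b (%f. T x f - R f)) \<longlongrightarrow> 0) F"
 proof (rule tendstoI)
  fix e :: real assume e: "e > 0"
  hence "\<forall>\<^sub>F x in F. bop a b (T x - R) (e/2)" by (intro lim) simp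
  thus "\<forall>\<^sub>F x in F. dist (opnorm S a b (%f. T x f - R f)) 0 < e"
  proof eventually_elim
   case (elim x)
   have "opnorm S a b (T x - R) < e" using opnorm_le[OF elim] e by simp
   thus ?case using opnorm_nonneg[OF bopD(1)[OF elim]] using fun_diff[of "T x" R] by (simp add: dist_real_def)
  qed
 qed
qed

lemma bop_le_all_imp_zero:
 assumes "!!e. e > 0 ==> bop a b T e"
 shows "T = 0"
proof (rule ext)
 fix f
 have T: "T \<in> blin S a b" using assms[OF zero_less_one] bopD by blast
 show "T f = 0 f"
 proof (cases "f \<in> sp S a")
  case True
  have "hnorm S b (T f) <= 0"
  proof (rule field_le_epsilon)
   fix e :: real assume e: "e > 0"
   define d where "d = e / (hnorm S a f + 1)"
   have n: "hnorm S a f >= 0" by (rule H.nm_nonneg[OF True])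
   hence "d > 0" using e by (simp add: d_def)
   from bopD(3)[OF assms[OF this] True] have "hnorm S b (T f) <= d * hnorm S a f" .
   also have "... <= e" using n e by (simp add: d_def field_simps)
   finally show "hnorm S b (T f) <= 0 + e" by simp
  qed
  thus ?thesis using H.nm_eq_0[OF blinD(1)[OF T True]] H.nm_nonneg[OF blinD(1)[OF T True]] by simp
 qed (simp add: blinD(4)[OF T])
qed

lemma has_norm_limit_unique:
 assumes "has_norm_limit S a b T R F" "has_norm_limit S a b T R' F" "F ~= bot"
 shows "R = R'"
proof -
 have "bop a b (R - R') e" if "e > 0" for e
 proof -
  have "e / 2 > 0" using that by simp
  hence "\<forall>\<^sub>F x in F. bop a b (T x - R) (e/2) & bop a b (T x - R') (e/2)"
   by (intro eventually_conj has_norm_limitD(2)[OF assms(1)] has_norm_limitD(2)[OF assms(2)])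
  then obtain x where "bop a b (T x - R) (e/2)" "bop a b (T x - R') (e/2)" using eventually_happens assms(3) by blast
  from O.bnd_diff[OF this(2,1)] show ?thesis by simp
 qed
 hence "R - R' = 0" by (rule bop_le_all_imp_zero)
 thus ?thesis by simp
qed

text \<open>Completeness of the space of bounded operators, obtained from pointwise limits along 1 /
  (n + 1); the Cauchy bound passes to the limit because the norm is continuous.\<close>

lemma operator_limit_exists:
 assumes Y: "!!eps::real. eps > 0 ==> Y eps \<in> blin S a b"
  and cauchy: "!!e. e > 0 ==> EX d>0. ALL eps eps'. 0 < eps & eps < d & 0 < eps' & eps' < d --> bop a b (Y eps - Y eps') e"
 shows "EX L. has_norm_limit S a b Y L (at_right 0)"
proof -
 define X where "X n = Y (1 / real (Suc n))" for n
 have X: "X n \<in> blin S a b" for n by (simp add: X_def Y)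
 have small: "EX N. ALL n>=N. 1 / real (Suc n) < d" if d: "d > 0" for d :: real
 proof -
  obtain N where "1 / real (Suc N) < d" using d nat_approx_posE by blast
  moreover have "1 / real (Suc n) <= 1 / real (Suc N)" if "n >= N" for n using that by (simp add: frac_le)
  ultimately show ?thesis by (meson le_less_trans)
 qed
 have ex: "EX g:sp S b. (%n. hnorm S b (X n f - g)) ----> 0" if f: "f \<in> sp S a" for f
 proof (rule H.complete)
  fix e :: real assume e: "e > 0"
  have n: "hnorm S a f >= 0" by (rule H.nm_nonneg[OF f])
  define e' where "e' = e / (hnorm S a f + 1)"
  have e': "e' > 0" "e' * hnorm S a f < e" using n e by (auto simp: e'_def field_simps)
  obtain d where d: "d > 0" "!!eps eps'. 0 < eps ==> eps < d ==> 0 < eps' ==> eps' < d ==> bop a b (Y eps - Y eps') e'"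
   using cauchy[OF e'(1)] by blast
  obtain N where N: "!!n. n >= N ==> 1 / real (Suc n) < d" using small[OF d(1)] by blast
  have "hnorm S b (X i f - X j f) < e" if "i >= N" "j >= N" for i j
   using bopD(3)[OF d(2) f, of "1 / real (Suc i)" "1 / real (Suc j)"] N that e'(2) by (simp add: X_def)
  thus "EX N. ALL i>=N. ALL j>=N. hnorm S b (X i f - X j f) < e" by blast
 qed (use blinD(1)[OF X f] in auto)
 define L where "L f = (if f \<in> sp S a then SOME g. g \<in> sp S b & (%n. hnorm S b (X n f - g)) ----> 0 else 0)" for f
 have L: "L f \<in> sp S b" "(%n. hnorm S b (X n f - L f)) ----> 0" if "f \<in> sp S a" for f
  using someI_ex[of "%g. g \<in> sp S b & (%n. hnorm S b (X n f - g)) ----> 0"] ex[OF that] that by (auto simp: L_def)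
 have XD: "X n f \<in> sp S b" if "f \<in> sp S a" for n f using blinD(1)[OF X that] .
 have lim: "(%n. ip S b h (X n f)) ----> ip S b h (L f)" if "f \<in> sp S a" "h \<in> sp S b" for f h
  by (rule H.limit_B[OF XD[OF that(1)] L(1)[OF that(1)] that(2) L(2)[OF that(1)]])
 \<comment> \<open>Limits are known only in norm, so linearity of \<open>L\<close> is verified on
   inner products.\<close>
 have eqI: "g = h" if gh: "g \<in> sp S b" "h \<in> sp S b" "!!x. x \<in> sp S b ==> ip S b x g = ip S b x h" for g h
 proof -
  have "ip S b (g - h) (g - h) = 0" using gh by (simp add: H.q_diff_right H.V_diff)
  thus ?thesis using H.definite[OF H.V_diff[OF gh(1,2)]] by force
 qed
 have L_add: "L (f + g) = L f + L g" if fg: "f \<in> sp S a" "g \<in> sp S a" for f g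
 proof (rule eqI)
  fix x assume x: "x \<in> sp S b"
  have "(%n. ip S b x (X n (f + g))) ----> ip S b x (L f) + ip S b x (L g)"
   using tendsto_add[OF lim[OF fg(1) x] lim[OF fg(2) x]] fg x XD by (simp add: blinD(2)[OF X] H.q_add_right)
  from LIMSEQ_unique[OF lim[OF H.V_add[OF fg] x] this] show "ip S b x (L (f + g)) = ip S b x (L f + L g)" using fg x L(1) by (simp add: H.q_add_right)
 qed (use fg L(1) in \<open>auto intro: H.V_add\<close>)
 have L_scale: "L (c *\<^sub>C f) = c *\<^sub>C L f" if f: "f \<in> sp S a" for f c
 proof (rule eqI)
  fix x assume x: "x \<in> sp S b"
  have "(%n. ip S b x (X n (c *\<^sub>C f))) ----> c * ip S b x (L f)"
   using tendsto_mult[OF tendsto_const lim[OF f x], of c] f x XD by (simp add: blinD(3)[OF X] H.q_scale_right)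
  from LIMSEQ_unique[OF lim[OF H.V_scale[OF f] x] this] show "ip S b x (L (c *\<^sub>C f)) = ip S b x (c *\<^sub>C L f)" using f x L(1) by (simp add: H.q_scale_right)
 qed (use f L(1) in \<open>auto intro: H.V_scale\<close>)
 have close: "bop a b (Y eps - L) e" if e: "e > 0" and d: "!!eps eps'. 0 < eps ==> eps < d ==> 0 < eps' ==> eps' < d ==> bop a b (Y eps - Y eps') e"
  and "d > 0" "0 < eps" "eps < d" for e d eps
 proof (rule bopI)
  note Yl = blinD[OF Y[OF \<open>0 < eps\<close>]]
  show "(Y eps - L) f \<in> sp S b" if "f \<in> sp S a" for f using that Yl(1) L(1) by (simp add: H.V_diff)
  show "(Y eps - L) (f + g) = (Y eps - L) f + (Y eps - L) g" if "f \<in> sp S a" "g \<in> sp S a" for f g using that Yl L_add by simp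
  show "(Y eps - L) (c *\<^sub>C f) = c *\<^sub>C (Y eps - L) f" if "f \<in> sp S a" for f c
   using that Yl L_scale by (simp add: complex_vector.scale_right_diff_distrib)
  show "(Y eps - L) f = 0" if "f \<notin> sp S a" for f using that Yl by (simp add: L_def)
  fix f assume f: "f \<in> sp S a"
  obtain N where N: "!!n. n >= N ==> 1 / real (Suc n) < d" using small[OF \<open>d > 0\<close>] by blast
  have "(%n. hnorm S b (Y eps f - X n f)) ----> hnorm S b (Y eps f - L f)"
  proof (rule H.limit_nm)
   have "hnorm S b ((Y eps f - X n f) - (Y eps f - L f)) = hnorm S b (X n f - L f)" for n using H.nm_commute[OF L(1)[OF f] XD[OF f], of n] by simp
   thus "(%n. hnorm S b ((Y eps f - X n f) - (Y eps f - L f))) ----> 0" using L(2)[OF f] by simp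
  qed (use f Yl(1) XD L(1) in \<open>auto simp: H.V_diff\<close>)
  moreover have "ALL n>=N. hnorm S b (Y eps f - X n f) <= e * hnorm S a f"
   using bopD(3)[OF d f] N \<open>0 < eps\<close> \<open>eps < d\<close> by (simp add: X_def)
  ultimately show "hnorm S b ((Y eps - L) f) <= e * hnorm S a f" by (intro LIMSEQ_le_const2[of "%n. hnorm S b (Y eps f - X n f)"]) auto
 qed (use e in simp)
 have ev: "\<forall>\<^sub>F eps in at_right 0. bop a b (Y eps - L) e" if e: "e > 0" for e
 proof -
  obtain d where d: "d > 0" "!!eps eps'. 0 < eps ==> eps < d ==> 0 < eps' ==> eps' < d ==> bop a b (Y eps - Y eps') e"
   using cauchy[OF e] by blast
  show ?thesis unfolding eventually_at_right_field using close[OF e d(2) d(1)] d(1) by (intro exI[of _ d]) blast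
 qed
 have "L \<in> blin S a b"
 proof -
  have "\<forall>\<^sub>F eps in at_right (0::real). bop a b (Y eps - L) 1 & 0 < eps"
   using ev[OF zero_less_one] eventually_at_right_less by (rule eventually_conj)
  then obtain eps :: real where "bop a b (Y eps - L) 1" "eps > 0" using eventually_happens trivial_limit_at_right_real by blast
  from bopD(1)[OF O.bnd_diff[OF bop_opnorm[OF Y[OF this(2)]] this(1)]] show ?thesis by simp
 qed
 thus ?thesis using has_norm_limitI ev by blast
qed

end

lemma (in bounding) Ck_diff:
 assumes U: "open U" and G: "Ck bnd k p U G" and H: "Ck bnd k p U H"
 shows "Ck bnd k p U (%x vs. G x vs - H x vs)"
proof -
 have "Ck bnd k p U (%x vs. (-1) *\<^sub>R H x vs)" by (rule bounded_bilin.Ck_mul_left[OF bounded_bilin_scaleR U Ck_fun_const H])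
 from Ck_add[OF G this] show ?thesis by simp
qed

context hscale
begin

lemma has_norm_limit_cong: "\<forall>\<^sub>F x in F. T1 x = T2 x ==> has_norm_limit S a b T1 R F ==> has_norm_limit S a b T2 R F"
proof (rule has_norm_limitI)
 assume eq: "\<forall>\<^sub>F x in F. T1 x = T2 x" and lim: "has_norm_limit S a b T1 R F"
 show "R \<in> blin S a b" using has_norm_limitD(1)[OF lim] .
 show "\<forall>\<^sub>F x in F. bop a b (T2 x - R) e" if "e > 0" for e using has_norm_limitD(2)[OF lim that] eq by eventually_elim simp
qed

lemma has_norm_limit_const: "T \<in> blin S a b ==> has_norm_limit S a b (%_. T) T F"
proof (rule has_norm_limitI)
 fix e :: real assume "e > 0"
 hence "bop a b 0 e" using O.bnd_mono[OF O.bnd_zero] by simp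
 thus "\<forall>\<^sub>F x in F. bop a b (T - T) e" by simp
qed

lemma has_norm_limit_diff:
 assumes T: "has_norm_limit S a b T R F" and U: "has_norm_limit S a b U Q F"
 shows "has_norm_limit S a b (%x. T x - U x) (R - Q) F"
proof (rule has_norm_limitI)
 show "R - Q \<in> blin S a b" using has_norm_limitD(1)[OF T] has_norm_limitD(1)[OF U] by (rule blin_diff_op)
 fix e :: real assume "e > 0"
 hence e: "e / 2 > 0" by simp
 show "\<forall>\<^sub>F x in F. bop a b (T x - U x - (R - Q)) e" using has_norm_limitD(2)[OF T e] has_norm_limitD(2)[OF U e]
 proof eventually_elim
  case (elim x)
  have "T x - U x - (R - Q) = (T x - R) - (U x - Q)" by simp
  thus ?case using O.bnd_diff[OF elim] by (simp only: field_sum_of_halves)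
 qed
qed

lemma has_norm_limit_comp:
 assumes T: "has_norm_limit S b c T R F" and U: "has_norm_limit S a b U Q F"
 shows "has_norm_limit S a c (%x. T x o U x) (R o Q) F"
proof (rule has_norm_limitI)
 note R = bop_opnorm[OF has_norm_limitD(1)[OF T]] and Q = bop_opnorm[OF has_norm_limitD(1)[OF U]]
 define r q where "r = opnorm S b c R" "q = opnorm S a b Q"
 have rq: "r >= 0" "q >= 0" using bopD(2)[OF R] bopD(2)[OF Q] by (simp_all add: r_q_def)
 show "R o Q \<in> blin S a c" using bopD(1)[OF OC.mul_bnd[OF R Q]] .
 fix e :: real assume e: "e > 0"
 define d where "d = min 1 (e / (q + 1 + r))"
 have d: "d > 0" "d <= 1" using e rq by (auto simp: d_def)
 have "d <= e / (q + 1 + r)" by (simp add: d_def)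
 hence de: "d * (1 + q) + r * d <= e" using rq by (simp add: field_simps)
 show "\<forall>\<^sub>F x in F. bop a c ((T x o U x) - (R o Q)) e" using has_norm_limitD(2)[OF T d(1)] has_norm_limitD(2)[OF U d(1)]
 proof eventually_elim
  case (elim x)
  have Ux: "bop a b (U x) (1 + q)" using bop_mono[OF O.bnd_add[OF elim(2) Q], of "1 + q"] d by (simp add: r_q_def)
  have Tx: "bop b c (T x) (d + r)" using O.bnd_add[OF elim(1) R] by (simp add: r_q_def)
  have *: "bop a c (((T x - R) o U x) + (R o (U x - Q))) (d * (1 + q) + r * d)"
   using O.bnd_add[OF OC.mul_bnd[OF elim(1) Ux] OC.mul_bnd[OF R elim(2)]] by (simp add: r_q_def)
  have "((T x - R) o U x) + (R o (U x - Q)) = (T x o U x) - (R o Q)" unfolding OC.mul_diff_left[OF Tx R Ux] OC.mul_diff_right[OF R Ux Q] by simp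
  thus ?case using bop_mono[OF * de] by metis
 qed
qed

text \<open>An exact two-sided form of the resolvent equation, used with three choices: the same
  \<open>W\<close> at two heights (existence of the limit), two points (l, W) (differentiability),
  and the two signs of the boundary value (finite rank of the jump).\<close>

lemma resolvent_difference:
 assumes R: "R1 \<in> blin S a b" "R2 \<in> blin S a b" and Y: "Y1 \<in> blin S a b" "Y2 \<in> blin S a b"
  and W: "W1 \<in> blin S b a" "W2 \<in> blin S b a"
  and eq: "Y1 = R1 - (R1 o (W1 o Y1))" "Y2 = R2 - (Y2 o (W2 o R2))"
 shows "Y2 - Y1 = ((Id b - (Y2 o W2)) o ((R2 - R1) o (Id a - (W1 o Y1)))) - (Y2 o ((W2 - W1) o Y1))"
proof (rule ext)
 fix f
 have zero: "R1 0 = 0" "R2 0 = 0" "Y1 0 = 0" "Y2 0 = 0" "W1 0 = 0" "W2 0 = 0" using R Y W blin_zero by blast+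
 show "(Y2 - Y1) f = (((Id b - (Y2 o W2)) o ((R2 - R1) o (Id a - (W1 o Y1)))) - (Y2 o ((W2 - W1) o Y1))) f"
 proof (cases "f \<in> sp S a")
  case True
  note Y1f = blin_in[OF Y(1), of f]
  define h where "h = f - W1 (Y1 f)"
  have h: "h \<in> sp S a" using True blin_in[OF W(1)] by (simp add: h_def H.V_diff)
  have y1: "Y1 f = R1 h" using fun_cong[OF eq(1), of f] True blin_in[OF W(1)] by (simp add: h_def blin_diff[OF R(1)])
  define g where "g = R2 h - R1 h"
  have g: "g \<in> sp S b" using blin_in[OF R(1)] blin_in[OF R(2)] by (simp add: g_def H.V_diff)
  have "Y2 (W2 (R2 h)) = R2 h - Y2 h" using fun_cong[OF eq(2), of h] by (simp add: algebra_simps)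
  hence "Y2 (W2 g) = R2 h - Y2 h - Y2 (W2 (Y1 f))" unfolding g_def y1 using blin_in[OF R(1)] blin_in[OF R(2)] blin_in[OF W(2)]
   by (simp add: blin_diff[OF W(2)] blin_diff[OF Y(2)])
  moreover have "Y2 h = Y2 f - Y2 (W1 (Y1 f))" using True blin_in[OF W(1)] by (simp add: h_def blin_diff[OF Y(2)])
  moreover have "Y2 (W2 (Y1 f) - W1 (Y1 f)) = Y2 (W2 (Y1 f)) - Y2 (W1 (Y1 f))" using blin_in[OF W(1)] blin_in[OF W(2)] by (simp add: blin_diff[OF Y(2)])
  moreover have "(Id a - (W1 o Y1)) f = h" using True by (simp add: h_def restrict_to_def)
  ultimately show ?thesis using g y1 by (simp add: restrict_to_def g_def[symmetric]) (simp add: g_def)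
 next
  case False
  thus ?thesis using R Y zero by (simp add: blinD(4) restrict_to_def)
 qed
qed

text \<open>The norm of \<open>Y\<close> is finite beforehand, so the equation bounds it by c plus
  half of itself.\<close>

lemma resolvent_a_priori:
 assumes R: "bop a b R c" and W: "bop b a W w" and cw: "c * w <= 1 / 2"
  and Y: "Y \<in> blin S a b" and eq: "Y = R - (R o (W o Y))"
 shows "bop a b Y (2 * c)"
proof -
 define N where "N = opnorm S a b Y"
 have YN: "bop a b Y N" unfolding N_def by (rule bop_opnorm[OF Y])
 have "bop a b Y (c + c * (w * N))" using O.bnd_diff[OF R OC.mul_bnd[OF R OC.mul_bnd[OF W YN]]] eq by simp
 hence "N <= c + c * (w * N)" unfolding N_def by (rule opnorm_le)
 also have "c * (w * N) <= 1 / 2 * N" using mult_right_mono[OF cw bopD(2)[OF YN]] by (simp add: mult.assoc)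
 finally have "N <= 2 * c" by simp
 thus ?thesis using bop_mono[OF YN] by simp
qed

end

section \<open>Boundary values of perturbed resolvents\<close>

locale perturbation = selfadj S D T for S :: "'v::complex_vector scale" and D T +
 fixes s :: real and \<iota> :: "'x::banach => 'v => 'v"
 assumes s_pos: "0 < s" and pert: "perturbation_space S s \<iota>"
begin

abbreviation sps where "sps \<equiv> sp S s"
abbreviation spm where "spm \<equiv> sp S (- s)"
abbreviation RT where "RT W \<equiv> resolvent D (%g. T g + \<iota> W g)"

lemma \<iota>_add: "\<iota> (U + W) = \<iota> U + \<iota> W" and \<iota>_scale: "\<iota> (r *\<^sub>R W) = r *\<^sub>R \<iota> W"
 using pert by (auto simp: perturbation_space_def fun_eq_iff)

lemma \<iota>_diff: "\<iota> (U - W) = \<iota> U - \<iota> W" and \<iota>_zero: "\<iota> 0 = 0"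
proof -
 show "\<iota> (U - W) = \<iota> U - \<iota> W" for U W using \<iota>_add[of "U - W" W] by (simp add: algebra_simps)
 from this[of 0 0] show "\<iota> 0 = 0" by simp
qed

lemma \<iota>_blin: "\<iota> W \<in> blin S (- s) s"
 using pert by (simp add: perturbation_space_def)

lemma \<iota>_bound: obtains K where "K > 0" "!!W. bop (- s) s (\<iota> W) (K * norm W)"
proof -
 obtain K where K: "!!W. opnorm S (- s) s (\<iota> W) <= K * norm W" using pert by (auto simp: perturbation_space_def)
 have "K * norm W <= (\<bar>K\<bar> + 1) * norm W" for W by (intro mult_right_mono) auto
 hence "bop (- s) s (\<iota> W) ((\<bar>K\<bar> + 1) * norm W)" for W using bop_mono[OF bop_opnorm[OF \<iota>_blin]] K order_trans by blast
 thus thesis using that[of "\<bar>K\<bar> + 1"] by simp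
qed

lemma sp_s: "f \<in> sps ==> f \<in> sp0" and sp_ms: "f \<in> sp0 ==> f \<in> spm"
 using sp_0[of s f] sp_neg[of s f] s_pos by auto

lemma \<iota>_in: "\<iota> W f \<in> sps" and \<iota>_in0: "\<iota> W f \<in> sp0"
 using blin_in[OF \<iota>_blin] sp_s by auto

lemma \<iota>_selfadjoint: "selfadjoint S (sp0) (\<iota> W)" and \<iota>_real: "real_operator S (sp0) (\<iota> W)"
 using pert by (auto simp: perturbation_space_def)

lemma \<iota>_symmetric: "f \<in> sp0 ==> g \<in> sp0 ==> ip0 (\<iota> W f) g = ip0 f (\<iota> W g)"
proof -
 interpret I: selfadj S "sp0" "\<iota> W" using \<iota>_selfadjoint by unfold_locales
 show "f \<in> sp0 ==> g \<in> sp0 ==> ip0 (\<iota> W f) g = ip0 f (\<iota> W g)" by (rule I.T_symmetric)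
qed

lemma \<iota>_clinear: "clinear_on (sp0) (\<iota> W)"
 using \<iota>_selfadjoint[of W] by (simp add: selfadjoint_def)

abbreviation TW :: "'x => 'v => 'v" where "TW W \<equiv> %g. T g + \<iota> W g"

lemma TW_selfadjoint: "selfadjoint S D (TW W)"
 by (rule selfadjoint_perturbed) (auto simp: \<iota>_clinear \<iota>_in0 \<iota>_symmetric)

sublocale P: selfadj S D "TW W" for W
 by unfold_locales (rule TW_selfadjoint)

lemma TW_zero: "TW 0 = T"
 by (simp add: \<iota>_zero)

definition RW :: "'x => complex => 'v => 'v" where
 "RW W z = restrict_to S s (RT W z)"

lemma RW_eq: "f \<in> sps ==> RW W z f = RT W z f"
 by (simp add: RW_def restrict_to_def)

lemma RW_blin: assumes z: "Im z ~= 0" shows "RW W z \<in> blin S s (- s)"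
proof -
 obtain K1 where K1: "K1 > 0" "!!f. f \<in> sp0 ==> hnorm S (- s) f <= K1 * nm0 f" using embedding_bound[of "-s" 0] s_pos by auto
 obtain K2 where K2: "K2 > 0" "!!f. f \<in> sps ==> nm0 f <= K2 * hnorm S s f" using embedding_bound[of 0 s] s_pos by auto
 have "bop s (- s) (RW W z) (K1 * (K2 / \<bar>Im z\<bar>))"
 proof (rule bopI)
  fix f assume f: "f \<in> sps"
  have f0: "f \<in> sp0" using sp_s[OF f] .
  have "hnorm S (- s) (RW W z f) <= K1 * nm0 (RT W z f)" unfolding RW_eq[OF f] by (rule K1(2)[OF P.R_in[OF z f0]])
  also have "... <= K1 * (K2 * hnorm S s f / \<bar>Im z\<bar>)" using P.R_bound[OF z f0, of W] K2(2)[OF f] K1(1) z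
   by (intro mult_left_mono order_trans[OF P.R_bound[OF z f0]] divide_right_mono) auto
  finally show "hnorm S (- s) (RW W z f) <= K1 * (K2 / \<bar>Im z\<bar>) * hnorm S s f" by (simp add: mult_ac)
 qed (use K1 K2 z in \<open>auto simp: RW_def restrict_to_def P.R_add P.R_scale P.R_in H.V_add H.V_scale sp_s sp_ms\<close>)
 thus ?thesis by (rule bopD)
qed

lemma RW_equations:
 assumes z: "Im z ~= 0"
 shows "RW W z = RW 0 z - (RW 0 z o (\<iota> W o RW W z))" "RW W z = RW 0 z - (RW W z o (\<iota> W o RW 0 z))"
proof -
 have s0: "P.shifted 0 z f = T f - z *\<^sub>C f" for f unfolding P.shifted_def by (simp add: \<iota>_zero)
 have sW: "P.shifted W z f = P.shifted 0 z f + \<iota> W f" for f unfolding P.shifted_def by (simp add: \<iota>_zero)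
 have 0: "RW W z f = 0" "RW 0 z f = 0" if "f \<notin> sps" for f using that by (auto simp: RW_def restrict_to_def)
 have R0: "RW V z 0 = 0" for V using blin_zero[OF RW_blin[OF z]] .
 have i0: "\<iota> W 0 = 0" using blin_zero[OF \<iota>_blin] .
 show "RW W z = RW 0 z - (RW 0 z o (\<iota> W o RW W z))"
 proof (rule ext)
  fix f
  show "RW W z f = (RW 0 z - (RW 0 z o (\<iota> W o RW W z))) f"
  proof (cases "f \<in> sps")
   case True
   define u where "u = RW W z f"
   have u: "u \<in> D" "P.shifted W z u = f" using P.R_props[OF z sp_s[OF True], of W] True by (auto simp: u_def RW_eq)
   hence "P.shifted 0 z u = f - \<iota> W u" by (simp add: sW algebra_simps)
   from P.R_unique[OF z u(1) this] have "u = resolvent D (TW 0) z (f - \<iota> W u)" by simp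
   also have "... = RW 0 z (f - \<iota> W u)" using True \<iota>_in by (intro RW_eq[symmetric] H.V_diff)
   also have "... = RW 0 z f - RW 0 z (\<iota> W u)" using True \<iota>_in by (intro blin_diff[OF RW_blin[OF z]])
   finally show ?thesis by (simp add: u_def)
  qed (simp add: 0 R0 i0)
 qed
 show "RW W z = RW 0 z - (RW W z o (\<iota> W o RW 0 z))"
 proof (rule ext)
  fix f
  show "RW W z f = (RW 0 z - (RW W z o (\<iota> W o RW 0 z))) f"
  proof (cases "f \<in> sps")
   case True
   define u where "u = RW 0 z f"
   have u: "u \<in> D" "P.shifted 0 z u = f" using P.R_props[OF z sp_s[OF True], of 0] True by (auto simp: u_def RW_eq)
   hence "P.shifted W z u = f + \<iota> W u" by (simp add: sW)
   from P.R_unique[OF z u(1) this] have "u = RT W z (f + \<iota> W u)" by simp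
   also have "... = RW W z (f + \<iota> W u)" using True \<iota>_in by (intro RW_eq[symmetric] H.V_add)
   also have "... = RW W z f + RW W z (\<iota> W u)" using True \<iota>_in by (intro blinD(2)[OF RW_blin[OF z]])
   finally show ?thesis by (simp add: u_def algebra_simps)
  qed (simp add: 0 R0 i0)
 qed
qed

text \<open>The sign convention of the hypothesis: \<open>\<sigma>\<close> = -1 approaches the real
  axis from above, \<open>\<sigma>\<close> = 1 from below.\<close>

definition zz :: "real => real => real => complex" where
 "zz \<sigma> l eps = of_real l - \<i> * of_real (\<sigma> * eps)"

lemma Im_zz: "Im (zz \<sigma> l eps) = - \<sigma> * eps"
 by (simp add: zz_def)

lemma boundary_iff: "is_boundary_value S s D (TW W) \<sigma> l Y \<longleftrightarrow> has_norm_limit S s (- s) (%eps. RW W (zz \<sigma> l eps)) Y (at_right 0)"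
 by (simp add: is_boundary_value_def RW_def zz_def)

lemma boundary_value_eq: "is_boundary_value S s D (TW W) \<sigma> l Y ==> boundary_value S s D (TW W) \<sigma> l = Y"
 unfolding boundary_value_def
 by (rule the_equality) (auto simp: boundary_iff intro: has_norm_limit_unique[OF _ _ trivial_limit_at_right_real])

lemma eventually_zz: "\<sigma> \<in> {1, -1} ==> \<forall>\<^sub>F eps in at_right 0. Im (zz \<sigma> l eps) ~= 0"
 using eventually_at_right_less[of "0::real"] by eventually_elim (auto simp: Im_zz)

text \<open>Off the axis the perturbed resolvents exist by self-adjointness. Where the unperturbed
  one is within \<open>c\<close> of \<open>Q\<close> its bound is 2 c, so the a priori estimate
  gives 4 c for the perturbed one; the difference identity then makes the family Cauchy.\<close>

lemma boundary_value_perturbed: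
 assumes \<sigma>: "\<sigma> \<in> {1, -1}" and Q: "is_boundary_value S s D T \<sigma> l Q" "bop s (- s) Q c" and c: "c > 0"
  and W: "bop (- s) s (\<iota> W) w" and cw: "4 * c * w <= 1"
 shows "EX Y. is_boundary_value S s D (TW W) \<sigma> l Y & bop s (- s) Y (4 * c) &
  Y = Q - (Q o (\<iota> W o Y)) & Y = Q - (Y o (\<iota> W o Q))"
proof -
 have w: "w >= 0" using bopD(2)[OF W] .
 define z where "z eps = zz \<sigma> l eps" for eps
 have limR: "has_norm_limit S s (- s) (%eps. RW 0 (z eps)) Q (at_right 0)" using Q(1) boundary_iff[of 0 \<sigma> l Q] by (simp add: TW_zero z_def)
 have Imz: "Im (z eps) ~= 0" if "eps > 0" for eps using that \<sigma> by (auto simp: Im_zz z_def)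
 have Yb: "bop s (- s) (RW W (z eps)) (4 * c)" if "eps > 0" "bop s (- s) (RW 0 (z eps) - Q) c" for eps
 proof -
  have "bop s (- s) (RW 0 (z eps)) (2 * c)" using O.bnd_add[OF that(2) Q(2)] by simp
  moreover have "2 * c * w <= 1 / 2" using cw by simp
  ultimately show ?thesis using resolvent_a_priori[OF _ W _ RW_blin[OF Imz[OF that(1)]] RW_equations(1)[OF Imz[OF that(1)]]] by fastforce
 qed
 have "EX L. has_norm_limit S s (- s) (%eps. RW W (z eps)) L (at_right 0)"
 proof (rule operator_limit_exists)
  show "RW W (z eps) \<in> blin S s (- s)" if "eps > 0" for eps using RW_blin[OF Imz[OF that]] .
  fix e :: real assume e: "e > 0"
  \<comment> \<open>The outer factors have norm at most 2 and the unperturbed resolvents differ by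
    at most 2 e', which adds up to 8 e'; the cap \<open>c\<close> gives access to the bound 4
    c.\<close>
  define e' where "e' = min c (e / 8)"
  have e': "e' > 0" "e' <= c" "e' <= e / 8" using c e by (auto simp: e'_def)
  obtain d where d: "d > 0" "!!eps. 0 < eps ==> eps < d ==> bop s (- s) (RW 0 (z eps) - Q) e'"
   using has_norm_limitD(2)[OF limR e'(1)] unfolding eventually_at_right_field by auto
  have "bop s (- s) (RW W (z eps) - RW W (z eps')) e" if eps: "0 < eps" "eps < d" "0 < eps'" "eps' < d" for eps eps'
  proof -
   note z1 = Imz[OF eps(3)] and z2 = Imz[OF eps(1)]
   have Y2: "bop s (- s) (RW W (z eps)) (4 * c)" by (rule Yb[OF eps(1) bop_mono[OF d(2)[OF eps(1,2)] e'(2)]])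
   have Y1: "bop s (- s) (RW W (z eps')) (4 * c)" by (rule Yb[OF eps(3) bop_mono[OF d(2)[OF eps(3,4)] e'(2)]])
   have A: "bop (- s) (- s) (Id (- s) - (RW W (z eps) o \<iota> W)) 2" by (rule bop_mono[OF O.bnd_diff[OF bop_Id OC.mul_bnd[OF Y2 W]]]) (use cw in simp)
   have B: "bop s s (Id s - (\<iota> W o RW W (z eps'))) 2"
    by (rule bop_mono[OF O.bnd_diff[OF bop_Id OC.mul_bnd[OF W Y1]]]) (use cw in \<open>simp add: mult_ac\<close>)
   have "RW 0 (z eps) - RW 0 (z eps') = (RW 0 (z eps) - Q) - (RW 0 (z eps') - Q)" by simp
   hence Rd: "bop s (- s) (RW 0 (z eps) - RW 0 (z eps')) (e' + e')" using O.bnd_diff[OF d(2)[OF eps(1,2)] d(2)[OF eps(3,4)]] by simp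
   have "bop s (- s) (RW W (z eps) o ((\<iota> W - \<iota> W) o RW W (z eps'))) (4 * c * (0 * (4 * c)))"
    using OC.mul_bnd[OF Y2 OC.mul_bnd[OF O.bnd_zero Y1]] by (simp only: diff_self)
   from O.bnd_diff[OF OC.mul_bnd[OF A OC.mul_bnd[OF Rd B]] this]
   show ?thesis unfolding resolvent_difference[OF RW_blin[OF z1, of 0] RW_blin[OF z2, of 0] RW_blin[OF z1, of W]
      RW_blin[OF z2, of W] \<iota>_blin \<iota>_blin RW_equations(1)[OF z1] RW_equations(2)[OF z2], symmetric] by (rule bop_mono) (use e'(3) in simp)
  qed
  thus "EX d>0. ALL eps eps'. 0 < eps & eps < d & 0 < eps' & eps' < d --> bop s (- s) (RW W (z eps) - RW W (z eps')) e"
   using d(1) by blast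
 qed
 then obtain Y where Y: "has_norm_limit S s (- s) (%eps. RW W (z eps)) Y (at_right 0)" by blast
 have ev: "\<forall>\<^sub>F eps in at_right 0. Im (z eps) ~= 0" using eventually_zz[OF \<sigma>] by (simp add: z_def)
 note cW = has_norm_limit_const[OF \<iota>_blin, of W "at_right (0::real)"]
 have "has_norm_limit S s (- s) (%eps. RW W (z eps)) (Q - (Q o (\<iota> W o Y))) (at_right 0)"
  by (rule has_norm_limit_cong[OF _ has_norm_limit_diff[OF limR has_norm_limit_comp[OF limR has_norm_limit_comp[OF cW Y]]]])
   (use ev in eventually_elim, rule RW_equations(1)[symmetric])
 hence 1: "Y = Q - (Q o (\<iota> W o Y))" using has_norm_limit_unique[OF Y] trivial_limit_at_right_real by blast
 have "has_norm_limit S s (- s) (%eps. RW W (z eps)) (Q - (Y o (\<iota> W o Q))) (at_right 0)"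
  by (rule has_norm_limit_cong[OF _ has_norm_limit_diff[OF limR has_norm_limit_comp[OF Y has_norm_limit_comp[OF cW limR]]]])
   (use ev in eventually_elim, rule RW_equations(2)[symmetric])
 hence 2: "Y = Q - (Y o (\<iota> W o Q))" using has_norm_limit_unique[OF Y] trivial_limit_at_right_real by blast
 have "c * w <= 1 / 2" using cw by simp
 from resolvent_a_priori[OF Q(2) W this has_norm_limitD(1)[OF Y] 1]
 have "bop s (- s) Y (4 * c)" by (rule bop_mono) (use c in simp)
 thus ?thesis using Y 1 2 by (auto simp: boundary_iff z_def)
qed

end

section \<open>Smooth dependence of the boundary values on the energy and the perturbation\<close>

lemma eventually_norm_diff_small:
 fixes x :: "'a::real_normed_vector"
 assumes "e > 0"
 shows "\<forall>\<^sub>F y in nhds x. C * norm (y - x) <= e"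
proof -
 have "((%y. C * norm (y - x)) \<longlongrightarrow> C * norm (x - x)) (nhds x)" by (intro tendsto_intros filterlim_ident)
 hence "((%y. C * norm (y - x)) \<longlongrightarrow> 0) (nhds x)" by simp
 from order_tendstoD(2)[OF this assms] show ?thesis by eventually_elim simp
qed

lemma mlin_prod_fst: "mlin j (%vs::(real \<times> 'x::real_vector) list. prod_list (map fst vs) *\<^sub>R A)"
proof (induction j arbitrary: A)
 case (Suc j)
 have "mlin j (%vs::(real \<times> 'x) list. prod_list (map fst (u # vs)) *\<^sub>R A)" for u using Suc[of "fst u *\<^sub>R A"] by (simp add: mult.commute)
 thus ?case unfolding mlin.simps by (intro conjI allI impI) (simp_all add: algebra_simps)
qed simp

lemma prod_fst_le: "\<bar>prod_list (map fst vs)\<bar> <= nrm (vs :: (real \<times> 'x::real_normed_vector) list)"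
proof (induction vs)
 case (Cons v vs)
 have "\<bar>fst v\<bar> * \<bar>prod_list (map fst vs)\<bar> <= norm v * nrm vs" using Cons norm_fst_le[of "fst v" "snd v"] by (intro mult_mono) auto
 thus ?case by (simp add: abs_mult)
qed simp

lemma (in bounding) bd_prod_fst:
 assumes A: "bnd A K"
 shows "bd bnd j (%vs::(real \<times> 'x::real_normed_vector) list. prod_list (map fst vs) *\<^sub>R A) K"
 unfolding bd_def
proof (intro allI impI)
 fix vs :: "(real \<times> 'x) list"
 show "bnd (prod_list (map fst vs) *\<^sub>R A) (K * nrm vs)" by (rule bnd_mono[OF bnd_scale[OF A]])
   (use mult_right_mono[OF prod_fst_le[of vs] bnd_nonneg[OF A]] in \<open>simp add: mult.commute\<close>)
qed

context hscale
begin

text \<open>The j-th derivative in one real variable becomes the j-linear map that multiplies it by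
  the product of the first components. The family is read on pairs so that it can be combined with
  functions of \<open>W\<close>.\<close>

lemma Ck_operator_family_imp_Ck:
 assumes J: "open J" and F: "Ck_operator_family S a b k J F"
 shows "Ck (bop a b) k 0 (fst -` J) (%(x :: real \<times> 'x::real_normed_vector) _. F (fst x))"
proof -
 obtain Q where "(ALL x:J. Q 0 x = F x) & (ALL j<=k. ALL x:J. Q j x \<in> blin S a b) &
    (ALL j<k. ALL x:J. has_norm_limit S a b
      (%y f. of_real (1 / (y - x)) *\<^sub>C (Q j y f - Q j x f)) (Q (Suc j) x) (at x)) &
    (ALL x:J. has_norm_limit S a b (Q k) (Q k x) (at x))" using F unfolding Ck_operator_family_def by (elim exE) (rule that)
 hence Q0: "!!x. x \<in> J ==> Q 0 x = F x"
  and Qin: "!!j x. j <= k ==> x \<in> J ==> Q j x \<in> blin S a b"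
  and Qd: "!!j x. j < k ==> x \<in> J ==> has_norm_limit S a b
      (%y f. of_real (1 / (y - x)) *\<^sub>C (Q j y f - Q j x f)) (Q (Suc j) x) (at x)"
  and Qc: "!!x. x \<in> J ==> has_norm_limit S a b (Q k) (Q k x) (at x)" by simp_all
 have quot: "\<forall>\<^sub>F y in nhds x. bop a b (Q j y - Q j x - (y - x) *\<^sub>R Q (Suc j) x) (e * \<bar>y - x\<bar>)"
  if "j < k" "x \<in> J" "e > 0" for j x e
 proof -
  have "\<forall>\<^sub>F y in at x. bop a b ((%f. of_real (1 / (y - x)) *\<^sub>C (Q j y f - Q j x f)) - Q (Suc j) x) e"
   using has_norm_limitD(2)[OF Qd[OF that(1,2)] that(3)] .
  thus ?thesis unfolding eventually_at_filter
  proof eventually_elim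
   case (elim y)
   show ?case proof (cases "y = x")
    case True
    thus ?thesis using O.bnd_zero by simp
   next
    case False
    define Z where "Z = Q j y - Q j x"
    have "(%f. of_real (1 / (y - x)) *\<^sub>C (Q j y f - Q j x f)) = (1 / (y - x)) *\<^sub>R Z" by (simp add: fun_eq_iff Z_def)
    hence "bop a b ((y - x) *\<^sub>R ((1 / (y - x)) *\<^sub>R Z - Q (Suc j) x)) (\<bar>y - x\<bar> * e)" using O.bnd_scale elim False by simp
    moreover have "(y - x) *\<^sub>R ((1 / (y - x)) *\<^sub>R Z - Q (Suc j) x) = Z - (y - x) *\<^sub>R Q (Suc j) x"
     using False by (simp only: real_vector.scale_right_diff_distrib scaleR_scaleR) simp
    ultimately show ?thesis by (simp add: Z_def mult.commute)
   qed
  qed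
 qed
 \<comment> \<open>Continuity is given for the top derivative only; below it follows from
   differentiability.\<close>
 have cont: "\<forall>\<^sub>F y in nhds x. bop a b (Q j y - Q j x) e" if "j <= k" "x \<in> J" "e > 0" for j x e
 proof (cases "j = k")
  case True
  have "\<forall>\<^sub>F y in at x. bop a b (Q j y - Q j x) e" using has_norm_limitD(2)[OF Qc[OF that(2)] that(3)] True by simp
  moreover have "bop a b (Q j x - Q j x) e" using O.bnd_mono[OF O.bnd_zero, of e] that(3) by simp
  ultimately show ?thesis unfolding eventually_at_filter by (elim eventually_mono) (metis UNIV_I)
 next
  case False
  hence j: "j < k" "Suc j <= k" using that by auto
  note B = bop_opnorm[OF Qin[OF j(2) that(2)]]
  show ?thesis using quot[OF j(1) that(2) zero_less_one] eventually_norm_diff_small[OF that(3), of "1 + opnorm S a b (Q (Suc j) x)" x]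
  proof eventually_elim
   case (elim y)
   have "bop a b ((Q j y - Q j x - (y - x) *\<^sub>R Q (Suc j) x) + (y - x) *\<^sub>R Q (Suc j) x)
     (1 * \<bar>y - x\<bar> + \<bar>y - x\<bar> * opnorm S a b (Q (Suc j) x))" using O.bnd_add[OF elim(1) O.bnd_scale[OF B]] .
   hence "bop a b (Q j y - Q j x) (1 * \<bar>y - x\<bar> + \<bar>y - x\<bar> * opnorm S a b (Q (Suc j) x))" by (simp only: diff_add_cancel)
   thus ?case by (rule bop_mono) (use elim(2) in \<open>simp add: algebra_simps\<close>)
  qed
 qed
 define G where "G j x vs = prod_list (map fst vs) *\<^sub>R Q j (fst x)" for j and x :: "real \<times> 'x" and vs :: "(real \<times> 'x) list"
 have fst_lim: "filterlim fst (nhds (fst x)) (nhds x)" for x :: "real \<times> 'x" using tendsto_fst[OF filterlim_ident] .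
 have reg: "regular_family (bop a b) j (fst -` J) (G j)" if j: "j <= k" for j unfolding regular_family_def
 proof (intro ballI conjI allI impI)
  fix x :: "real \<times> 'x" assume "x \<in> fst -` J"
  hence x: "fst x \<in> J" by simp
  show "mlin j (G j x)" unfolding G_def by (rule mlin_prod_fst)
  note B = bop_opnorm[OF Qin[OF j x]]
  show "EX K>=0. bd (bop a b) j (G j x) K" unfolding G_def using O.bd_prod_fst[OF B] bopD(2)[OF B] by blast
  fix e :: real assume "e > 0"
  hence "\<forall>\<^sub>F y in nhds (fst x). bop a b (Q j y - Q j (fst x)) e" using cont j x by blast
  hence "\<forall>\<^sub>F y in nhds x. bop a b (Q j (fst y) - Q j (fst x)) e" using fst_lim unfolding filterlim_iff by blast
  thus "\<forall>\<^sub>F y in nhds x. bd (bop a b) j (%vs. G j y vs - G j x vs) e"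
  proof eventually_elim
   case (elim y)
   show ?case by (rule bd_cong[OF _ O.bd_prod_fst[OF elim]]) (simp add: G_def real_vector.scale_right_diff_distrib)
  qed
 qed
 have der: "family_deriv (bop a b) j (fst -` J) (G j) (G (Suc j))" if j: "j < k" for j unfolding family_deriv_def
 proof (intro ballI allI impI)
  fix x :: "real \<times> 'x" and e :: real assume "x \<in> fst -` J" and e: "e > 0"
  hence x: "fst x \<in> J" by simp
  have "\<forall>\<^sub>F y in nhds x. bop a b (Q j (fst y) - Q j (fst x) - (fst y - fst x) *\<^sub>R Q (Suc j) (fst x)) (e * \<bar>fst y - fst x\<bar>)"
   using quot[OF j x e] fst_lim unfolding filterlim_iff by blast
  thus "\<forall>\<^sub>F y in nhds x. bd (bop a b) j (%vs. G j y vs - G j x vs - G (Suc j) x ((y - x) # vs)) (e * norm (y - x))"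
  proof eventually_elim
   case (elim y)
   have "e * \<bar>fst y - fst x\<bar> <= e * norm (y - x)" using norm_fst_le[of "fst (y - x)" "snd (y - x)"] e by (simp add: minus_prod_def)
   from O.bd_prod_fst[OF bop_mono[OF elim this]]
   show ?case by (rule bd_cong[rotated])
    (simp add: G_def real_vector.scale_right_diff_distrib mult.commute)
  qed
 qed
 have "Ck (bop a b) i j (fst -` J) (G j)" if "i + j <= k" for i j using that
 proof (induction i arbitrary: j)
  case (Suc i)
  thus ?case using reg[of j] der[of j] Suc.IH[of "Suc j"] by auto
 qed (use reg in simp)
 from this[of k 0] have "Ck (bop a b) k 0 (fst -` J) (G 0)" by simp
 thus ?thesis
 proof (rule Ck_cong[rotated 2])
  show "open (fst -` J :: (real \<times> 'x) set)" using J by (intro open_vimage continuous_intros)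
 qed (use Q0 in \<open>simp add: G_def\<close>)
qed

lemma bounded_lin_pairing:
 assumes f: "f \<in> sp S t" and g: "g \<in> sp S a"
 obtains C where "bounded_lin (bop a (- t)) norm_bnd (%T. pr f (T g)) C"
proof -
 obtain K where K: "K > 0" "!!f g. f \<in> sp S t ==> g \<in> sp S (- t) ==> cmod (pr f g) <= K * hnorm S t f * hnorm S (- t) g"
  using pairing_bound by blast
 have pos: "0 <= K * hnorm S t f * hnorm S a g" using K(1) H.nm_nonneg[OF f] H.nm_nonneg[OF g] by simp
 have "bounded_lin (bop a (- t)) norm_bnd (%T. pr f (T g)) (K * hnorm S t f * hnorm S a g)"
 proof (intro bounded_lin.intro bounded_lin_axioms.intro bounding_bop bounding_norm pos)
  fix T c assume T: "bop a (- t) T c"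
  have "cmod (pr f (T g)) <= K * hnorm S t f * hnorm S (- t) (T g)" using K(2)[OF f blin_in[OF bopD(1)[OF T]]] .
  also have "... <= K * hnorm S t f * (c * hnorm S a g)" using bopD(3)[OF T g] K(1) H.nm_nonneg[OF f] by (intro mult_left_mono) auto
  finally show "norm (pr f (T g)) <= K * hnorm S t f * hnorm S a g * c" by (simp add: mult_ac)
 next
  fix T U c d and r u :: real assume T: "bop a (- t) T c" and U: "bop a (- t) U d"
  have "pr f (of_real r *\<^sub>C T g + of_real u *\<^sub>C U g) = of_real r * pr f (T g) + of_real u * pr f (U g)"
   using f blin_in[OF bopD(1)[OF T]] blin_in[OF bopD(1)[OF U]] by (simp add: pairing_add_right[of _ t] pairing_scale_right[of _ t] H.V_scale)
  thus "pr f ((r *\<^sub>R T + u *\<^sub>R U) g) = r *\<^sub>R pr f (T g) + u *\<^sub>R pr f (U g)" by (simp add: scaleR_conv_of_real)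
 qed
 thus thesis by (rule that)
qed

end

text \<open>\<open>c\<close> bounds the unperturbed boundary values near \<open>l0\<close>,
  \<open>\<kappa>\<close> the inclusion of the perturbations. The radius \<open>\<rho>\<close> is
  small enough for \<open>boundary_value_perturbed\<close>, so that 4 c bounds the perturbed
  boundary values on all of \<open>U\<close>.\<close>

locale lap_nbhd = perturbation S D T s \<iota>
 for S :: "'v::complex_vector scale" and D T s and \<iota> :: "'x::banach => 'v => 'v" +
 fixes k :: nat and l0 \<delta> c \<kappa> \<rho> :: real
 assumes \<delta>_pos: "\<delta> > 0" and c_pos: "c > 0" and \<kappa>_pos: "\<kappa> > 0" and \<rho>_pos: "\<rho> > 0" and small: "4 * c * (\<kappa> * \<rho>) <= 1"
  and \<iota>_bop: "bop (- s) s (\<iota> W) (\<kappa> * norm W)"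
  and boundary: "\<sigma> \<in> {1, -1} ==> l \<in> {l0 - \<delta><..<l0 + \<delta>} ==> is_boundary_value S s D T \<sigma> l (boundary_value S s D T \<sigma> l)"
  and boundary_bop: "\<sigma> \<in> {1, -1} ==> l \<in> {l0 - \<delta><..<l0 + \<delta>} ==> bop s (- s) (boundary_value S s D T \<sigma> l) c"
  and family: "Ck_operator_family S s (- s) k {l0 - \<delta><..<l0 + \<delta>} (boundary_value S s D T (- 1))"
begin

definition bv :: "real => real => 'x => 'v => 'v" where
 "bv \<sigma> l W = boundary_value S s D (TW W) \<sigma> l"

abbreviation I where "I \<equiv> {l0 - \<delta><..<l0 + \<delta>}"

definition U :: "(real \<times> 'x) set" where "U = I \<times> ball 0 \<rho>"

lemma U_iff: "(l, W) \<in> U \<longleftrightarrow> l \<in> I & norm W < \<rho>"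
 by (auto simp: U_def)

lemma open_U: "open U"
 unfolding U_def by (intro open_Times) auto

lemma bv_props:
 assumes "\<sigma> \<in> {1, -1}" "(l, W) \<in> U"
 shows "is_boundary_value S s D (TW W) \<sigma> l (bv \<sigma> l W)" "bop s (- s) (bv \<sigma> l W) (4 * c)"
  "bv \<sigma> l W = bv \<sigma> l 0 - (bv \<sigma> l 0 o (\<iota> W o bv \<sigma> l W))"
  "bv \<sigma> l W = bv \<sigma> l 0 - (bv \<sigma> l W o (\<iota> W o bv \<sigma> l 0))"
proof -
 have l: "l \<in> I" and W: "norm W < \<rho>" using assms(2) by (auto simp: U_iff)
 have "4 * c * (\<kappa> * norm W) <= 4 * c * (\<kappa> * \<rho>)" using W \<kappa>_pos c_pos by (intro mult_left_mono) auto
 hence "4 * c * (\<kappa> * norm W) <= 1" using small by simp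
 from boundary_value_perturbed[OF assms(1) boundary[OF assms(1) l] boundary_bop[OF assms(1) l] c_pos \<iota>_bop this]
 obtain Y where Y: "is_boundary_value S s D (TW W) \<sigma> l Y" "bop s (- s) Y (4 * c)"
  "Y = bv \<sigma> l 0 - (bv \<sigma> l 0 o (\<iota> W o Y))" "Y = bv \<sigma> l 0 - (Y o (\<iota> W o bv \<sigma> l 0))"
  by (auto simp: bv_def TW_zero)
 have "bv \<sigma> l W = Y" unfolding bv_def by (rule boundary_value_eq[OF Y(1)])
 thus "is_boundary_value S s D (TW W) \<sigma> l (bv \<sigma> l W)" "bop s (- s) (bv \<sigma> l W) (4 * c)"
  "bv \<sigma> l W = bv \<sigma> l 0 - (bv \<sigma> l 0 o (\<iota> W o bv \<sigma> l W))"
  "bv \<sigma> l W = bv \<sigma> l 0 - (bv \<sigma> l W o (\<iota> W o bv \<sigma> l 0))" using Y by auto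
qed

lemma U_zero: "l \<in> I ==> (l, 0) \<in> U"
 using \<rho>_pos by (simp add: U_iff)

definition Y :: "real \<times> 'x => 'v => 'v" where "Y x = bv (- 1) (fst x) (snd x)"
definition Y0 :: "real \<times> 'x => 'v => 'v" where "Y0 x = bv (- 1) (fst x) 0"
definition Wx :: "real \<times> 'x => 'v => 'v" where "Wx x = \<iota> (snd x)"
text \<open>\<open>A\<close> and \<open>B\<close> are the outer factors of
  \<open>resolvent_difference\<close>; by the choice of \<open>\<rho>\<close> their norms are at
  most 2 on \<open>U\<close>.\<close>

definition A where "A x = Id (- s) - (Y x o Wx x)"
definition B where "B x = Id s - (Wx x o Y x)"

lemma Y_bop: "x \<in> U ==> bop s (- s) (Y x) (4 * c)" and Y0_bop: "x \<in> U ==> bop s (- s) (Y0 x) (4 * c)"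
 using bv_props(2)[of "-1" "fst x" "snd x"] bv_props(2)[of "-1" "fst x" 0] U_zero[of "fst x"] U_iff[of "fst x" "snd x"]
 by (auto simp: Y_def Y0_def)

lemma W_bop: "bop (- s) s (Wx x) (\<kappa> * norm (snd x))"
 unfolding Wx_def by (rule \<iota>_bop)

lemma small_x: "x \<in> U ==> 4 * c * (\<kappa> * norm (snd x)) <= 1"
proof -
 assume "x \<in> U"
 hence "4 * c * (\<kappa> * norm (snd x)) <= 4 * c * (\<kappa> * \<rho>)" using \<kappa>_pos c_pos by (intro mult_left_mono) (auto simp: U_def)
 thus ?thesis using small by simp
qed

lemma A_bop: "x \<in> U ==> bop (- s) (- s) (A x) 2"
 unfolding A_def by (rule bop_mono[OF O.bnd_diff[OF bop_Id OC.mul_bnd[OF Y_bop W_bop]]]) (use small_x in auto)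

lemma B_bop: "x \<in> U ==> bop s s (B x) 2"
 unfolding B_def by (rule bop_mono[OF O.bnd_diff[OF bop_Id OC.mul_bnd[OF W_bop Y_bop]]])
  (use small_x in \<open>auto simp: mult_ac\<close>)

lemma Y_diff:
 assumes x: "x \<in> U" and y: "y \<in> U"
 shows "Y y - Y x = (A y o ((Y0 y - Y0 x) o B x)) - (Y y o ((Wx y - Wx x) o Y x))"
 unfolding A_def B_def
proof (rule resolvent_difference)
 show "Y x = Y0 x - (Y0 x o (Wx x o Y x))" using bv_props(3)[of "-1" "fst x" "snd x"] x by (simp add: Y_def Y0_def Wx_def)
 show "Y y = Y0 y - (Y y o (Wx y o Y0 y))" using bv_props(4)[of "-1" "fst y" "snd y"] y by (simp add: Y_def Y0_def Wx_def)
qed (use x y Y_bop Y0_bop W_bop bopD(1) in blast)+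

lemma W_diff_bop: "bop (- s) s (Wx y - Wx x) (\<kappa> * norm (y - x))"
proof -
 have "bop (- s) s (Wx y - Wx x) (\<kappa> * norm (snd (y - x)))" using \<iota>_bop[of "snd y - snd x"] by (simp add: Wx_def \<iota>_diff)
 thus ?thesis by (rule bop_mono) (use norm_snd_le[of "snd (y - x)" "fst (y - x)"] \<kappa>_pos in \<open>simp del: snd_diff fst_diff\<close>)
qed

lemma Y0_Ck: "Ck (bop s (- s)) k 0 U (%x _. Y0 x)"
proof -
 have "Ck (bop s (- s)) k 0 (fst -` I) (%(x :: real \<times> 'x) _. boundary_value S s D T (- 1) (fst x))" by (rule Ck_operator_family_imp_Ck[OF _ family]) simp
 hence "Ck (bop s (- s)) k 0 (fst -` I) (%(x :: real \<times> 'x) _. Y0 x)" by (simp add: Y0_def bv_def TW_zero)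
 thus ?thesis by (rule Ck_subset) (auto simp: U_def)
qed

lemma W_Ck: "Ck (bop (- s) s) j 0 U (%x _. Wx x)"
 and W_lin: "mlin 1 (%vs. Wx (hd vs))" "bd (bop (- s) s) 1 (%vs. Wx (hd vs)) \<kappa>"
proof -
 show m: "mlin 1 (%vs. Wx (hd vs))" by (simp add: Wx_def \<iota>_add \<iota>_scale)
 show b: "bd (bop (- s) s) 1 (%vs. Wx (hd vs)) \<kappa>" unfolding bd_def
 proof (intro allI impI)
  fix vs :: "(real \<times> 'x) list" assume "length vs = 1"
  then obtain v where vs: "vs = [v]" by (auto simp: length_Suc_conv)
  have "\<kappa> * norm (snd v) <= \<kappa> * norm v" using norm_snd_le[of "snd v" "fst v"] \<kappa>_pos by simp
  thus "bop (- s) s (Wx (hd vs)) (\<kappa> * nrm vs)" unfolding vs by (simp add: bop_mono[OF W_bop])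
 qed
 have reg: "regular_family (bop (- s) s) 0 U (%x _. Wx x)" unfolding regular_family_def
 proof (intro ballI conjI allI impI)
  fix x assume "x \<in> U"
  show "EX K>=0. bd (bop (- s) s) 0 (%_::(real \<times> 'x) list. Wx x) K"
   using W_bop[of x] \<kappa>_pos by (intro exI[of _ "\<kappa> * norm (snd x)"]) (simp add: bd_def)
  fix e :: real assume "e > 0"
  from eventually_norm_diff_small[OF this, of \<kappa> x]
  show "\<forall>\<^sub>F y in nhds x. bd (bop (- s) s) 0 (%_::(real \<times> 'x) list. Wx y - Wx x) e"
   by eventually_elim (simp add: bd_def bop_mono[OF W_diff_bop])
 qed simp
 have "family_deriv (bop (- s) s) 0 U (%x _. Wx x) (%x vs. Wx (hd vs))" unfolding family_deriv_def
 proof (intro ballI allI impI always_eventually)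
  fix x y :: "real \<times> 'x" and e :: real assume "e > 0"
  have "Wx y - Wx x - Wx (y - x) = 0" by (simp add: Wx_def \<iota>_diff)
  thus "bd (bop (- s) s) 0 (%vs. Wx y - Wx x - Wx (hd ((y - x) # vs))) (e * norm (y - x))"
   using bop_mono[OF O.bnd_zero, of "e * norm (y - x)"] \<open>e > 0\<close> by (simp add: bd_def)
 qed
 moreover have "Ck (bop (- s) s) i 1 U (%x vs. Wx (hd vs))" for i using O.Ck_const_family[OF m b] \<kappa>_pos by simp
 ultimately show "Ck (bop (- s) s) j 0 U (%x _. Wx x)" using reg by (cases j) auto
qed

lemma A_Ck:
 assumes "Ck (bop s (- s)) j 0 U (%x _. Y x)"
 shows "Ck (bop (- s) (- s)) j 0 U (%x _. A x)"
proof -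
 have "Ck (bop (- s) (- s)) j 0 U (%x _. Id (- s))" by (rule O.Ck_const_family[where K = 1]) (auto simp: bd_def bop_Id)
 from O.Ck_diff[OF open_U this OC.Ck_mul[OF assms W_Ck]] show ?thesis unfolding A_def .
qed

lemma B_Ck:
 assumes "Ck (bop s (- s)) j 0 U (%x _. Y x)"
 shows "Ck (bop s s) j 0 U (%x _. B x)"
proof -
 have "Ck (bop s s) j 0 U (%x _. Id s)" by (rule O.Ck_const_family[where K = 1]) (auto simp: bd_def bop_Id)
 from O.Ck_diff[OF open_U this OC.Ck_mul[OF W_Ck assms]] show ?thesis unfolding B_def .
qed

lemma Y_continuous: "Ck (bop s (- s)) 0 0 U (%x _. Y x)"
 unfolding Ck.simps regular_family_def
proof (intro ballI conjI allI impI)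
 fix x assume x: "x \<in> U"
 show "EX K>=0. bd (bop s (- s)) 0 (%_::(real \<times> 'x) list. Y x) K" using Y_bop[OF x] c_pos by (intro exI[of _ "4 * c"]) (simp add: bd_def)
 fix e :: real assume e: "e > 0"
 hence e8: "e / 8 > 0" and e2: "e / 2 > 0" by simp_all
 have "\<forall>\<^sub>F y in nhds x. bd (bop s (- s)) 0 (%_::(real \<times> 'x) list. Y0 y - Y0 x) (e / 8)"
  using Ck_regular[OF Y0_Ck] x e8 unfolding regular_family_def by blast
 moreover have "\<forall>\<^sub>F y in nhds x. y \<in> U" using open_U x by (rule eventually_nhds_in_open)
 ultimately show "\<forall>\<^sub>F y in nhds x. bd (bop s (- s)) 0 (%_::(real \<times> 'x) list. Y y - Y x) e"
  using eventually_norm_diff_small[OF e2, of "4 * c * (\<kappa> * (4 * c))" x]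
 proof eventually_elim
  case (elim y)
  have Rd: "bop s (- s) (Y0 y - Y0 x) (e / 8)" using elim(1) by (simp add: bd_def)
  from O.bnd_diff[OF OC.mul_bnd[OF A_bop[OF elim(2)] OC.mul_bnd[OF Rd B_bop[OF x]]]
    OC.mul_bnd[OF Y_bop[OF elim(2)] OC.mul_bnd[OF W_diff_bop Y_bop[OF x]]]]
  have "bop s (- s) (Y y - Y x) (2 * (e / 8 * 2) + 4 * c * (\<kappa> * norm (y - x) * (4 * c)))" unfolding Y_diff[OF x elim(2)] .
  hence "bop s (- s) (Y y - Y x) e" by (rule bop_mono) (use elim(3) in \<open>simp add: algebra_simps\<close>)
  thus ?case by (simp add: bd_def)
 qed
qed simp

text \<open>The difference identity \<open>Y_diff\<close> is exact; its linear part arises by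
  freezing the outer factors \<open>A y\<close> and \<open>Y y\<close> at \<open>x\<close>, which
  costs a second-order error because they are continuous.\<close>

lemma Y_derivative:
 assumes Y0': "family_deriv (bop s (- s)) 0 U (%x _. Y0 x) Y0'" "regular_family (bop s (- s)) 1 U Y0'"
 shows "family_deriv (bop s (- s)) 0 U (%x _. Y x)
  (%x vs. (A x o (Y0' x vs o B x)) - (Y x o (Wx (hd vs) o Y x)))"
 unfolding family_deriv_def
proof (intro ballI allI impI)
 fix x and e :: real assume x: "x \<in> U" and e: "e > 0"
 obtain K where K: "K >= 0" "bd (bop s (- s)) 1 (Y0' x) K" using Y0'(2) x unfolding regular_family_def by blast
 \<comment> \<open>The three terms of \<open>M\<close> belong to the variation of \<open>A\<close>,
   the remainder of \<open>Y0\<close> and the variation of \<open>Y\<close>, in this order.\<close>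
 define M where "M = 2 * (K + 1) + 4 + 4 * c * \<kappa>"
 have M: "M > 0" using K c_pos \<kappa>_pos by (simp add: M_def add_nonneg_pos)
 define d where "d = min 1 (e / M)"
 have d: "d > 0" "d <= 1" using e M by (auto simp: d_def)
 have "d <= e / M" by (simp add: d_def)
 hence dM: "d * M <= e" using M by (simp add: field_simps)
 have "\<forall>\<^sub>F y in nhds x. bd (bop s (- s)) 0 (%vs. Y0 y - Y0 x - Y0' x ((y - x) # vs)) (d * norm (y - x))"
  using Y0'(1) x d(1) unfolding family_deriv_def by blast
 moreover have "\<forall>\<^sub>F y in nhds x. y \<in> U" using open_U x by (rule eventually_nhds_in_open)
 moreover have "\<forall>\<^sub>F y in nhds x. bd (bop s (- s)) 0 (%_::(real \<times> 'x) list. Y y - Y x) d"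
  using Y_continuous x d(1) unfolding Ck.simps regular_family_def by blast
 moreover have "\<forall>\<^sub>F y in nhds x. bd (bop (- s) (- s)) 0 (%_::(real \<times> 'x) list. A y - A x) d"
  using A_Ck[OF Y_continuous] x d(1) unfolding Ck.simps regular_family_def by blast
 ultimately show "\<forall>\<^sub>F y in nhds x. bd (bop s (- s)) 0 (%vs. Y y - Y x -
   ((A x o (Y0' x ((y - x) # vs) o B x)) - (Y x o (Wx (hd ((y - x) # vs)) o Y x)))) (e * norm (y - x))"
 proof eventually_elim
  case (elim y)
  define r where "r = norm (y - x)"
  have r: "r >= 0" by (simp add: r_def)
  define L where "L = Y0' x [y - x]"
  have L: "bop s (- s) L (K * r)" using bdD[OF K(2), of "[y - x]"] by (simp add: L_def r_def)
  have Rdd: "bop s (- s) (Y0 y - Y0 x - L) (d * r)" using elim(1) by (simp add: bd_def L_def r_def)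
  have "bop s (- s) ((Y0 y - Y0 x - L) + L) (d * r + K * r)" using O.bnd_add[OF Rdd L] .
  moreover have "d * r + K * r <= (K + 1) * r" using mult_right_mono[OF d(2) r] by (simp add: algebra_simps)
  ultimately have Rd: "bop s (- s) (Y0 y - Y0 x) ((K + 1) * r)" using bop_mono by fastforce
  have Yd: "bop s (- s) (Y y - Y x) d" and Ad: "bop (- s) (- s) (A y - A x) d" using elim(3,4) by (simp_all add: bd_def)
  have Wd: "bop (- s) s (Wx y - Wx x) (\<kappa> * r)" using W_diff_bop by (simp add: r_def)
  have Wh: "Wx (y - x) = Wx y - Wx x" by (simp add: Wx_def \<iota>_diff)
  note bops = A_bop[OF x] A_bop[OF elim(2)] B_bop[OF x] Y_bop[OF x] Y_bop[OF elim(2)]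
  have 1: "bop s (- s) ((((A y - A x) o ((Y0 y - Y0 x) o B x)) + (A x o ((Y0 y - Y0 x - L) o B x)))
    - ((Y y - Y x) o ((Wx y - Wx x) o Y x))) ((d * ((K + 1) * r * 2) + 2 * (d * r * 2)) + d * (\<kappa> * r * (4 * c)))"
   by (rule O.bnd_diff[OF O.bnd_add[OF OC.mul_bnd[OF Ad OC.mul_bnd[OF Rd bops(3)]]
    OC.mul_bnd[OF bops(1) OC.mul_bnd[OF Rdd bops(3)]]] OC.mul_bnd[OF Yd OC.mul_bnd[OF Wd bops(4)]]])
  have 2: "(d * ((K + 1) * r * 2) + 2 * (d * r * 2)) + d * (\<kappa> * r * (4 * c)) <= e * norm (y - x)"
   using mult_right_mono[OF dM r] by (simp add: M_def r_def algebra_simps)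
  have RB: "bop s (- s) ((Y0 y - Y0 x) o B x) ((K + 1) * r * 2)" by (rule OC.mul_bnd[OF Rd bops(3)])
  have WY: "bop s s ((Wx y - Wx x) o Y x) (\<kappa> * r * (4 * c))" by (rule OC.mul_bnd[OF Wd bops(4)])
  have LB: "bop s (- s) (L o B x) (K * r * 2)" by (rule OC.mul_bnd[OF L bops(3)])
  have e1: "(A y - A x) o ((Y0 y - Y0 x) o B x) = (A y o ((Y0 y - Y0 x) o B x)) - (A x o ((Y0 y - Y0 x) o B x))"
   by (rule OC.mul_diff_left[OF bops(2,1) RB])
  have e2: "A x o ((Y0 y - Y0 x - L) o B x) = (A x o ((Y0 y - Y0 x) o B x)) - (A x o (L o B x))"
   unfolding OC.mul_diff_left[OF Rd L bops(3)] by (rule OC.mul_diff_right[OF bops(1) RB LB])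
  have e3: "(Y y - Y x) o ((Wx y - Wx x) o Y x) = (Y y o ((Wx y - Wx x) o Y x)) - (Y x o ((Wx y - Wx x) o Y x))"
   by (rule OC.mul_diff_left[OF bops(5,4) WY])
  have eq: "(((A y - A x) o ((Y0 y - Y0 x) o B x)) + (A x o ((Y0 y - Y0 x - L) o B x)))
    - ((Y y - Y x) o ((Wx y - Wx x) o Y x))
   = Y y - Y x - ((A x o (L o B x)) - (Y x o ((Wx y - Wx x) o Y x)))" unfolding e1 e2 e3 unfolding Y_diff[OF x elim(2)] by simp
  from bop_mono[OF 1 2] show ?case unfolding eq by (simp add: bd_def Wh L_def)
 qed
qed

text \<open>Bootstrap: the derivative of \<open>Y\<close> is composed of \<open>Y\<close>, of
  factors made from it, and of derivatives of given families, so each order of smoothness of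
  \<open>Y\<close> yields the next.\<close>

lemma Y_Ck: "j <= k ==> Ck (bop s (- s)) j 0 U (%x _. Y x)"
proof (induction j)
 case 0
 show ?case by (rule Y_continuous)
next
 case (Suc j)
 hence Yj: "Ck (bop s (- s)) j 0 U (%x _. Y x)" by simp
 have "Ck (bop s (- s)) (Suc j) 0 U (%x _. Y0 x)" by (rule Ck_le[OF Y0_Ck Suc.prems])
 then obtain Y0' where Y0': "family_deriv (bop s (- s)) 0 U (%x _. Y0 x) Y0'" "Ck (bop s (- s)) j 1 U Y0'" by auto
 have W1: "Ck (bop (- s) s) j 1 U (%x vs. Wx (hd vs))" using O.Ck_const_family[OF W_lin] \<kappa>_pos by simp
 have "Ck (bop s (- s)) j 1 U (%x vs. (A x o (Y0' x vs o B x)) - (Y x o (Wx (hd vs) o Y x)))"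
  by (intro O.Ck_diff[OF open_U] OC.Ck_mul_left[OF open_U A_Ck[OF Yj]] OC.Ck_mul_right[OF open_U _ B_Ck[OF Yj]]
    OC.Ck_mul_left[OF open_U Yj] OC.Ck_mul_right[OF open_U _ Yj] Y0'(2) W1)
 thus ?case using Y_derivative[OF Y0'(1) Ck_regular[OF Y0'(2)]] Ck_regular[OF Yj] by auto
qed

lemma pairing_Y_Ck:
 assumes "f \<in> sps" "g \<in> sps"
 shows "Ck_fun k U (%x. pr f (Y x g))"
proof -
 obtain C where "bounded_lin (bop s (- s)) norm_bnd (%T. pr f (T g)) C" using bounded_lin_pairing[OF assms] .
 from bounded_lin.Ck_postcompose[OF this Y_Ck[OF order_refl]] show ?thesis .
qed

text \<open>Along the ray t V the resolvent equation reads F t = F 0 - t G t exactly, so continuity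
  of \<open>G\<close> at 0 gives the derivative.\<close>

lemma pairing_Y_derivative:
 assumes k: "k >= 1" and f: "f \<in> sps" and g: "g \<in> sps"
 obtains d where "((%x. pr f (Y x g)) has_derivative d) (at (l0, 0))"
  "!!V. d (0, V) = - pr f (bv (- 1) l0 0 (\<iota> V (bv (- 1) l0 0 g)))"
proof -
 obtain j where j: "k = Suc j" using k by (cases k) auto
 have x: "(l0, 0) \<in> U" using \<delta>_pos by (intro U_zero) auto
 obtain d where d: "((%x. pr f (Y x g)) has_derivative d) (at (l0, 0))" using Ck_fun_SucD[OF pairing_Y_Ck[OF f g, unfolded j]] x by blast
 show thesis
 proof (rule that[OF d])
  fix V :: 'x
  define h where "h = \<iota> V (Y (l0, 0) g)"
  have h: "h \<in> sps" unfolding h_def by (rule \<iota>_in)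
  define G where "G t = pr f (Y (l0, t *\<^sub>R V) h)" for t
  define F where "F t = pr f (Y (l0, t *\<^sub>R V) g)" for t
  have F: "F t = F 0 - t *\<^sub>R G t" if "(l0, t *\<^sub>R V) \<in> U" for t
  proof -
   note B = bopD(1)[OF Y_bop[OF that]]
   have "Y (l0, t *\<^sub>R V) g = Y (l0, 0) g - of_real t *\<^sub>C Y (l0, t *\<^sub>R V) h"
    using fun_cong[OF bv_props(4)[of "- 1", OF _ that], of g] blinD(3)[OF B h, of "of_real t"] by (simp add: Y_def h_def \<iota>_scale)
   thus ?thesis using pairing_diff_right[OF f blin_in[OF bopD(1)[OF Y_bop[OF x]]] H.V_scale[OF blin_in[OF B]], of g "of_real t" h]
     pairing_scale_right[OF f blin_in[OF B], of "of_real t" h] by (simp add: F_def G_def scaleR_conv_of_real)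
  qed
  have "((%t. (l0, t *\<^sub>R V)) \<longlongrightarrow> (l0, 0 *\<^sub>R V)) (at (0::real))" by (intro tendsto_intros)
  hence lim: "((%t. (l0, t *\<^sub>R V)) \<longlongrightarrow> (l0, 0)) (at (0::real))" by simp
  have "(G \<longlongrightarrow> G 0) (at 0)" using isCont_tendsto_compose[OF Ck_fun_isCont[OF pairing_Y_Ck[OF f h] x] lim] by (simp add: G_def[abs_def])
  hence "((%t. norm (G t - G 0)) \<longlongrightarrow> 0) (at 0)" by (simp add: LIM_zero tendsto_norm_zero)
  moreover have "\<forall>\<^sub>F t in at 0. norm (G t - G 0) = norm (F (0 + t) - F 0 - t *\<^sub>R (- G 0)) / norm t"
   using topological_tendstoD[OF lim open_U x] eventually_neq_at_within[of 0 0 UNIV]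
  proof eventually_elim
   case (elim t)
   have "F (0 + t) - F 0 - t *\<^sub>R (- G 0) = - (t *\<^sub>R (G t - G 0))" using F[OF elim(1)] by (simp add: scaleR_diff_right)
   thus ?case using elim(2) by simp
  qed
  ultimately have "((%t. norm (F (0 + t) - F 0 - t *\<^sub>R (- G 0)) / norm t) \<longlongrightarrow> 0) (at 0)" by (rule Lim_transform_eventually)
  hence "(F has_derivative (%t. t *\<^sub>R (- G 0))) (at 0)" unfolding has_derivative_at using bounded_linear_scaleR_left by blast
  moreover have "((%t. (l0, t *\<^sub>R V)) has_derivative (%t. (0, t *\<^sub>R V))) (at (0::real))" by (auto intro!: derivative_eq_intros)
  from has_derivative_compose[OF this, of _ d] d have "(F has_derivative (%t. d (0, t *\<^sub>R V))) (at 0)" by (simp add: F_def[abs_def])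
  ultimately have "(%t. t *\<^sub>R (- G 0)) = (%t. d (0, t *\<^sub>R V))" by (rule has_derivative_unique)
  from fun_cong[OF this, of 1] show "d (0, V) = - pr f (bv (- 1) l0 0 (\<iota> V (bv (- 1) l0 0 g)))" by (simp add: G_def h_def Y_def)
 qed
qed

end

section \<open>The spectral density as a semidefinite form\<close>

lemma (in hscale) bounded_lin_limit:
 assumes L: "bounded_lin (bop a b) norm_bnd L C" and T: "has_norm_limit S a b T Q F"
 shows "((%x. L (T x)) \<longlongrightarrow> L Q) F"
proof (rule tendstoI)
 interpret L: bounded_lin "bop a b" norm_bnd L C by (rule L)
 fix e :: real assume e: "e > 0"
 define d where "d = e / (C + 1)"
 have d: "d > 0" "C * d < e" using e L.C by (auto simp: d_def field_simps add_nonneg_pos)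
 note Q = bop_opnorm[OF has_norm_limitD(1)[OF T]]
 show "\<forall>\<^sub>F x in F. dist (L (T x)) (L Q) < e" using has_norm_limitD(2)[OF T d(1)]
 proof eventually_elim
  case (elim x)
  have "bop a b ((T x - Q) + Q) (d + opnorm S a b Q)" using O.bnd_add[OF elim Q] .
  hence "bop a b (T x) (d + opnorm S a b Q)" by simp
  from L.L_diff[OF this Q] have "L (T x - Q) = L (T x) - L Q" .
  thus ?case using L.L_bnd[OF elim] d(2) by (simp add: dist_norm)
 qed
qed

lemma inverse_seq:
 obtains eps :: "nat => real" where "!!n. eps n > 0" "!!m n. m < n ==> eps n < eps m" "eps ----> 0"
  "filterlim eps (at_right 0) sequentially"
proof (rule that[of "%n. 1 / real (Suc n)"])
 show lim: "(%n. 1 / real (Suc n)) ----> 0" by (rule LIMSEQ_Suc[OF lim_1_over_n])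
 show "filterlim (%n. 1 / real (Suc n)) (at_right 0) sequentially" unfolding filterlim_at using lim by (auto intro: always_eventually)
qed (auto simp: frac_less2)

locale real_lap = lap_nbhd S D T s \<iota> k l0 \<delta> c \<kappa> \<rho>
 for S :: "'v::complex_vector scale" and D T s and \<iota> :: "'x::banach => 'v => 'v" and k l0 \<delta> c \<kappa> \<rho> +
 assumes T_real: "real_operator S D T" and k_pos: "k >= 1"
begin

lemma TW_real: "real_operator S D (TW W)"
 unfolding real_operator_def
proof (intro ballI conjI)
 fix f assume f: "f \<in> D"
 show "cj S f \<in> D" using T_real f by (simp add: real_operator_def)
 have "T (cj S f) = cj S (T f)" "\<iota> W (cj S f) = cj S (\<iota> W f)" using T_real \<iota>_real[of W] f D_sub by (auto simp: real_operator_def)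
 thus "T (cj S f) + \<iota> W (cj S f) = cj S (T f + \<iota> W f)" using T_in[OF f] \<iota>_in0 by (simp add: cj_add[of _ 0])
qed

abbreviation Rv :: "'x => real => real => 'v => 'v" where
 "Rv W l eps \<equiv> RT W (Complex l eps)"

lemma zz_Complex: "zz (- 1) l eps = Complex l eps" "zz 1 l eps = cnj (Complex l eps)"
 by (simp_all add: zz_def complex_eq_iff)

lemma pairing_0': "f \<in> sps ==> g \<in> sp0 ==> pr f g = ip0 f g"
 using pairing_0 sp_s by blast

lemma Y_in: "(l, W) \<in> U ==> Y (l, W) f \<in> spm"
 using blin_in[OF bopD(1)[OF Y_bop]] by blast

text \<open>Testing with vectors of H_s turns the norm limits into limits of inner products in H;
  there R(z)* = R(cnj z), so the two boundary values are adjoint to each other.\<close>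

lemma boundary_limits:
 assumes x: "(l, W) \<in> U" and f: "f \<in> sps" and g: "g \<in> sps"
 shows "((%eps. ip0 f (Rv W l eps g)) \<longlongrightarrow> pr f (Y (l, W) g)) (at_right 0)"
  "pr f (bv 1 l W g) = cnj (pr g (Y (l, W) f))"
proof -
 have lim: "((%eps. ip0 f (Rv W l eps g)) \<longlongrightarrow> pr f (Y (l, W) g)) (at_right 0)"
  if f: "f \<in> sps" and g: "g \<in> sps" for f g
 proof -
  obtain C where C: "bounded_lin (bop s (- s)) norm_bnd (%T. pr f (T g)) C" using bounded_lin_pairing[OF f g] .
  have "has_norm_limit S s (- s) (%eps. RW W (zz (- 1) l eps)) (Y (l, W)) (at_right 0)"
   using bv_props(1)[of "-1" l W] x boundary_iff by (simp add: Y_def)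
  from bounded_lin_limit[OF C this]
  have "((%eps. pr f (RW W (Complex l eps) g)) \<longlongrightarrow> pr f (Y (l, W) g)) (at_right 0)" by (simp add: zz_Complex)
  moreover have "\<forall>\<^sub>F eps in at_right 0. pr f (RW W (Complex l eps) g) = ip0 f (Rv W l eps g)"
   using eventually_at_right_less[of "0::real"] by eventually_elim (use f g in \<open>simp add: RW_eq pairing_0' P.R_in sp_s\<close>)
  ultimately show ?thesis by (rule Lim_transform_eventually)
 qed
 show "((%eps. ip0 f (Rv W l eps g)) \<longlongrightarrow> pr f (Y (l, W) g)) (at_right 0)" by (rule lim[OF f g])
 obtain C where C: "bounded_lin (bop s (- s)) norm_bnd (%T. pr f (T g)) C" using bounded_lin_pairing[OF f g] .
 have "has_norm_limit S s (- s) (%eps. RW W (zz 1 l eps)) (bv 1 l W) (at_right 0)" using bv_props(1)[of 1 l W] x boundary_iff by simp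
 from bounded_lin_limit[OF C this]
 have 1: "((%eps. pr f (RW W (cnj (Complex l eps)) g)) \<longlongrightarrow> pr f (bv 1 l W g)) (at_right 0)" by (simp add: zz_Complex)
 have "((%eps. cnj (ip0 g (Rv W l eps f))) \<longlongrightarrow> cnj (pr g (Y (l, W) f))) (at_right 0)" by (intro tendsto_intros lim f g)
 moreover have "\<forall>\<^sub>F eps in at_right 0. cnj (ip0 g (Rv W l eps f)) = pr f (RW W (cnj (Complex l eps)) g)"
  using eventually_at_right_less[of "0::real"]
 proof eventually_elim
  case (elim eps)
  hence z: "Im (Complex l eps) ~= 0" "Im (cnj (Complex l eps)) ~= 0" by auto
  have "cnj (ip0 g (Rv W l eps f)) = ip0 (Rv W l eps f) g" by (rule H.q_herm[symmetric, OF P.R_in[OF z(1) sp_s[OF f]] sp_s[OF g]])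
  also have "... = ip0 f (RT W (cnj (Complex l eps)) g)" by (rule P.R_adjoint[OF z(1) sp_s[OF f] sp_s[OF g]])
  also have "... = pr f (RW W (cnj (Complex l eps)) g)" using P.R_in[OF z(2) sp_s[OF g]] by (simp add: RW_eq[OF g] pairing_0'[OF f])
  finally show ?case .
 qed
 ultimately have "((%eps. pr f (RW W (cnj (Complex l eps)) g)) \<longlongrightarrow> cnj (pr g (Y (l, W) f))) (at_right 0)"
  by (rule Lim_transform_eventually)
 with 1 show "pr f (bv 1 l W g) = cnj (pr g (Y (l, W) f))" using tendsto_unique trivial_limit_at_right_real by blast
qed

text \<open>\<open>pr f (Y x g)\<close> is a symmetric complex bilinear expression on real vectors, because the
 resolvent commutes with the conjugation up to passing to the conjugate spectral parameter.\<close>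
lemma pairing_Y_symmetric:
 assumes x: "(l, W) \<in> U" and f: "f \<in> sps" "cj S f = f" and g: "g \<in> sps" "cj S g = g"
 shows "pr f (Y (l, W) g) = pr g (Y (l, W) f)"
proof -
 have "\<forall>\<^sub>F eps in at_right 0. ip0 f (Rv W l eps g) = ip0 g (Rv W l eps f)" using eventually_at_right_less[of "0::real"]
 proof eventually_elim
  case (elim eps)
  hence z: "Im (Complex l eps) ~= 0" by auto
  note f0 = sp_s[OF f(1)] and g0 = sp_s[OF g(1)]
  have "ip0 f (Rv W l eps g) = ip0 (cj S f) (cj S (RT W (cnj (Complex l eps)) g))" using P.R_cj[OF TW_real z g0] f g by simp
  also have "... = cnj (ip0 f (RT W (cnj (Complex l eps)) g))" using P.R_in[of "cnj (Complex l eps)", OF _ g0] z by (intro cj_ip f0) auto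
  also have "... = cnj (ip0 (Rv W l eps f) g)" using P.R_adjoint[OF z f0 g0] by simp
  also have "... = ip0 g (Rv W l eps f)" using H.q_herm[OF g0 P.R_in[OF z f0]] by simp
  finally show ?case .
 qed
 from Lim_transform_eventually[OF boundary_limits(1)[OF x f(1) g(1)] this]
 show ?thesis using boundary_limits(1)[OF x g(1) f(1)] tendsto_unique trivial_limit_at_right_real by blast
qed

text \<open>By \<open>q_jump\<close> this is pi times the form of the spectral density; written with
  one boundary value only, it inherits the smoothness of \<open>Y\<close>.\<close>

definition q :: "real \<times> 'x => 'v => 'v => complex" where
 "q x f g = (pr f (Y x g) - cnj (pr g (Y x f))) / (2 * \<i>)"

definition jump :: "real \<times> 'x => 'v => 'v" where
 "jump x f = Y x f - bv 1 (fst x) (snd x) f"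

lemma q_jump: "(l, W) \<in> U ==> f \<in> sps ==> g \<in> sps ==> q (l, W) f g = pr f (jump (l, W) g) / (2 * \<i>)"
 using boundary_limits(2)[of l W f g] pairing_diff_right[of f s "Y (l, W) g" "bv 1 l W g"]
  Y_in[of l W g] blin_in[OF bopD(1)[OF bv_props(2)[of 1 l W]]]
 by (simp add: q_def jump_def)

lemma Re_q: "Re (q x f f) = Im (pr f (Y x f))"
 by (simp add: q_def Re_divide power2_eq_square)

text \<open>By symmetry of \<open>Y\<close> on real vectors the cross term is the conjugate of the
  same number. Hence vanishing of \<open>q\<close> on a pair of real vectors is a single real
  condition.\<close>

lemma q_real_vectors:
 assumes "(l, W) \<in> U" "f \<in> sps" "cj S f = f" "g \<in> sps" "cj S g = g"
 shows "q (l, W) f g = of_real (Im (pr f (Y (l, W) g)))"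
 using pairing_Y_symmetric[OF assms] by (simp add: q_def complex_eq_iff Re_divide Im_divide power2_eq_square)

text \<open>The limit of \<open>Im_ip_R\<close> at the axis; nonnegativity of \<open>q\<close> is a
  consequence.\<close>

lemma vertical_limit:
 assumes x: "(l, W) \<in> U" and f: "f \<in> sps"
 shows "((%eps. eps * (nm0 (Rv W l eps f))^2) \<longlongrightarrow> Re (q (l, W) f f)) (at_right 0)"
proof -
 have "((%eps. Im (ip0 f (Rv W l eps f))) \<longlongrightarrow> Re (q (l, W) f f)) (at_right 0)"
  unfolding Re_q by (intro tendsto_intros boundary_limits x f)
 moreover have "\<forall>\<^sub>F eps in at_right 0. Im (ip0 f (Rv W l eps f)) = eps * (nm0 (Rv W l eps f))^2"
  using eventually_at_right_less[of "0::real"] by eventually_elim (use P.Im_ip_R sp_s[OF f] in simp)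
 ultimately show ?thesis by (rule Lim_transform_eventually)
qed

lemma q_semi_form: "x \<in> U ==> semi_form (sps) (q x)"
proof (cases x)
 case (Pair l W)
 assume "x \<in> U"
 hence x: "(l, W) \<in> U" using Pair by simp
 note Yl = blinD[OF bopD(1)[OF Y_bop[OF x]]] and Yin = Y_in[OF x]
 have "semi_form (sps) (q (l, W))"
 proof
  show "csubspace (sps)" by (rule H.V)
  show "q (l, W) f (g + h) = q (l, W) f g + q (l, W) f h" if "f \<in> sps" "g \<in> sps" "h \<in> sps" for f g h
   using that Yin by (simp add: q_def Yl pairing_add_right[of _ s] pairing_add_left[of _ s] field_simps)
  show "q (l, W) f (c *\<^sub>C g) = c * q (l, W) f g" if "f \<in> sps" "g \<in> sps" for f g c
   using that Yin by (simp add: q_def Yl pairing_scale_right[of _ s] pairing_scale_left[of _ s] field_simps)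
  show "q (l, W) f g = cnj (q (l, W) g f)" for f g by (simp add: q_def field_simps)
  show "0 <= Re (q (l, W) f f)" if "f \<in> sps" for f
  proof (rule tendsto_lowerbound[OF vertical_limit[OF x that]])
   show "\<forall>\<^sub>F eps in at_right 0. 0 <= eps * (nm0 (Rv W l eps f))^2"
    using eventually_at_right_less[of "0::real"] by eventually_elim simp
  qed (rule trivial_limit_at_right_real)
 qed
 thus ?thesis using Pair by simp
qed

text \<open>Supplies \<open>vertical_growth\<close> with its boundary data. The bound on
  \<open>q\<close> is strict because a limit controls the values near the axis only up to a
  margin.\<close>

lemma vertical_bound:
 assumes x: "(l, W) \<in> U" and \<psi>: "\<psi> \<in> sps" and d: "d > 0" and K: "K > 0"
  and dI: "!!\<mu>. \<bar>\<mu> - l\<bar> <= d ==> \<mu> \<in> I" and zero: "Re (q (l, W) \<psi> \<psi>) = 0"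
  and quad: "!!\<mu>. \<bar>\<mu> - l\<bar> <= d ==> \<mu> ~= l ==> Re (q (\<mu>, W) \<psi> \<psi>) < K * (\<mu> - l)^2"
  and y: "y > 0"
 shows "(nm0 (Rv W l y \<psi>))^2 <= 16 * K * d + 2 * (nm0 (Rv W l d \<psi>))^2"
proof (rule P.vertical_growth[OF sp_s[OF \<psi>] d K y])
 have ev: "EX h0>0. ALL h. 0 < h & h < h0 --> h * (nm0 (Rv W \<mu> h \<psi>))^2 <= b"
  if "(\<mu>, W) \<in> U" "Re (q (\<mu>, W) \<psi> \<psi>) < b" for \<mu> b using order_tendstoD(2)[OF vertical_limit[OF that(1) \<psi>] that(2)]
  unfolding eventually_at_right_field by (auto intro: less_imp_le)
 have W: "norm W < \<rho>" using x by (simp add: U_iff)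
 show "EX h0>0. ALL h. 0 < h & h < h0 --> h * (nm0 (Rv W \<mu> h \<psi>))^2 <= K * (\<mu> - l)^2"
  if "\<bar>\<mu> - l\<bar> <= d" "\<mu> ~= l" for \<mu> using that dI W quad by (intro ev) (auto simp: U_iff)
 show "EX h0>0. ALL h. 0 < h & h < h0 --> h * (nm0 (Rv W l h \<psi>))^2 <= e" if "e > 0" for e using that zero by (intro ev x) simp
qed

text \<open>As the height decreases, |R psi|^2 increases and stays bounded, and |u_n - u_m|^2 is at
  most the difference of these squares: the vectors converge in H. Self-adjointness puts the limit
  into the domain, and pairing with H_s identifies it with \<open>Y (l, W) \<psi>\<close>.\<close>

lemma regular_solution:
 assumes x: "(l, W) \<in> U" and \<psi>: "\<psi> \<in> sps" and bound: "!!eps. eps > 0 ==> (nm0 (Rv W l eps \<psi>))^2 <= C"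
 shows "Y (l, W) \<psi> \<in> D" "P.shifted W (of_real l) (Y (l, W) \<psi>) = \<psi>"
proof -
 obtain eps :: "nat => real" where eps: "!!n. eps n > 0" "!!m n. m < n ==> eps n < eps m" "eps ----> 0"
  "filterlim eps (at_right 0) sequentially" by (rule inverse_seq) (rule that; assumption)
 define u where "u n = Rv W l (eps n) \<psi>" for n
 note \<psi>0 = sp_s[OF \<psi>]
 have Im: "Im (Complex l (eps n)) ~= 0" for n using eps(1)[of n] by simp
 have uD: "u n \<in> D" "P.shifted W (Complex l (eps n)) (u n) = \<psi>" for n using P.R_props[OF Im \<psi>0] by (auto simp: u_def)
 have u0: "u n \<in> sp0" for n using D_sub[OF uD(1)] .
 define N where "N n = (nm0 (u n))^2" for n
 \<comment> \<open>The resolvent identity between height eps m and the conjugate of height eps n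
   expresses <u n, u m> through <psi, u>; imaginary parts turn this into the squared norms
   \<open>N\<close>.\<close>
 have inner: "(nm0 (u n - u m))^2 = (N n - N m) * (eps m - eps n) / (eps n + eps m)" for m n
 proof -
  define z w where "z = Complex l (eps m)" "w = cnj (Complex l (eps n))"
  have zw: "Im z ~= 0" "Im w ~= 0" "Im (cnj w) ~= 0" using Im by (auto simp: z_w_def)
  define F where "F j = ip0 \<psi> (u j)" for j
  have ImF: "Im (F j) = eps j * N j" for j using P.Im_ip_R[OF Im[of j] \<psi>0, of W] by (simp add: F_def u_def N_def)
  have "ip0 (u n) (u m) = ip0 \<psi> (RT W w (u m))" using P.R_adjoint[OF zw(3) \<psi>0 u0[of m], of W] by (simp add: u_def z_w_def)
  moreover have "ip0 \<psi> (RT W w \<psi>) = cnj (F n)"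
   using P.R_adjoint[OF zw(3) \<psi>0 \<psi>0, of W] H.q_herm[OF u0[of n] \<psi>0] by (simp add: F_def u_def z_w_def)
  moreover have "RT W w \<psi> - u m = (w - z) *\<^sub>C RT W w (u m)" using P.resolvent_identity[OF zw(2,1) \<psi>0] by (simp add: u_def z_w_def)
  hence "ip0 \<psi> (RT W w \<psi>) - ip0 \<psi> (u m) = (w - z) * ip0 \<psi> (RT W w (u m))"
   using H.q_diff_right[OF \<psi>0 P.R_in[OF zw(2) \<psi>0] u0] H.q_scale_right[OF \<psi>0 P.R_in[OF zw(2) u0]] by metis
  ultimately have "cnj (F n) - F m = (w - z) * ip0 (u n) (u m)" by (simp add: F_def)
  moreover have "w - z = - \<i> * of_real (eps n + eps m)" by (simp add: z_w_def complex_eq_iff)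
  ultimately have "Im (cnj (F n) - F m) = Im (- \<i> * of_real (eps n + eps m) * ip0 (u n) (u m))" by (simp only:)
  also have "... = - (eps n + eps m) * Re (ip0 (u n) (u m))" by (simp add: algebra_simps)
  finally have "Im (cnj (F n) - F m) = - (eps n + eps m) * Re (ip0 (u n) (u m))" .
  hence sr: "(eps n + eps m) * Re (ip0 (u n) (u m)) = eps n * N n + eps m * N m" by (simp add: ImF algebra_simps)
  have pos: "eps n + eps m > 0" using eps(1)[of n] eps(1)[of m] by simp
  have "(nm0 (u n - u m))^2 = N n + N m - 2 * Re (ip0 (u n) (u m))" using H.nm_diff_sq[OF u0[of n] u0[of m]] by (simp add: N_def)
  hence "(nm0 (u n - u m))^2 * (eps n + eps m)
    = (N n + N m) * (eps n + eps m) - 2 * ((eps n + eps m) * Re (ip0 (u n) (u m)))" by (simp only:) (simp add: algebra_simps)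
  also have "... = (N n - N m) * (eps m - eps n)" unfolding sr by (simp add: algebra_simps)
  finally show ?thesis using pos by (simp add: eq_divide_eq)
 qed
 have le: "(nm0 (u n - u m))^2 <= N n - N m" "N m <= N n" if "m < n" for m n
 proof -
  define r where "r = (eps m - eps n) / (eps n + eps m)"
  have r: "0 < r" "r <= 1" using eps(1)[of n] eps(1)[of m] eps(2)[OF that] by (auto simp: r_def field_simps)
  have eq: "(nm0 (u n - u m))^2 = (N n - N m) * r" using inner by (simp add: r_def)
  hence "0 <= (N n - N m) * r" by (metis zero_le_power2)
  thus "N m <= N n" using r by (simp add: zero_le_mult_iff)
  thus "(nm0 (u n - u m))^2 <= N n - N m" unfolding eq using r by (simp add: mult_left_le)
 qed
 have "incseq N" unfolding incseq_def using le(2) by (metis le_less order_refl)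
 moreover have "ALL n. N n <= C" using bound[OF eps(1)] by (simp add: N_def u_def)
 ultimately have "Cauchy N" using incseq_convergent LIMSEQ_imp_Cauchy by metis
 have "EX u0:sp0. (%n. nm0 (u n - u0)) ----> 0"
 proof (rule H.complete)
  fix e :: real assume e: "e > 0"
  then obtain M where M: "!!m n. m >= M ==> n >= M ==> dist (N m) (N n) < e^2"
   using \<open>Cauchy N\<close> unfolding Cauchy_def by (metis zero_less_power)
  have "nm0 (u i - u j) < e" if ij: "i >= M" "j >= M" for i j
  proof -
   have lt: "nm0 (u i - u j) < e" if "j < i" "i >= M" "j >= M" for i j
    using le(1)[OF that(1)] M[OF that(2,3)] e by (intro power2_less_imp_less[of _ e]) (auto simp: dist_real_def)
   consider "i = j" | "j < i" | "i < j" by linarith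
   thus ?thesis proof cases
    case 3
    thus ?thesis using lt[of i j] ij H.nm_commute[OF u0[of i] u0[of j]] by metis
   qed (use lt ij e in auto)
  qed
  thus "EX M. ALL i>=M. ALL j>=M. nm0 (u i - u j) < e" by blast
 qed (use u0 in auto)
 then obtain v where v: "v \<in> sp0" "(%n. nm0 (u n - v)) ----> 0" by blast
 have "ip0 (TW W d) v = ip0 d (\<psi> + of_real l *\<^sub>C v)" if d: "d \<in> D" for d
 proof (rule LIMSEQ_unique)
  have d0: "d \<in> sp0" using D_sub d .
  show "(%n. ip0 (TW W d) (u n)) ----> ip0 (TW W d) v" by (rule H.limit_B[OF u0 v(1) P.T_in[OF d] v(2)])
  have "ip0 (TW W d) (u n) = ip0 d \<psi> + Complex l (eps n) * ip0 d (u n)" for n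
  proof -
   have "TW W (u n) = \<psi> + Complex l (eps n) *\<^sub>C u n" using uD(2)[of n] unfolding P.shifted_def by (simp add: algebra_simps)
   thus ?thesis using P.T_symmetric[OF d uD(1)[of n], of W] d0 \<psi>0 u0 by (simp add: H.q_add_right H.q_scale_right H.V_scale)
  qed
  moreover have "(%n. ip0 d \<psi> + Complex l (eps n) * ip0 d (u n)) ----> ip0 d \<psi> + Complex l 0 * ip0 d v"
   by (intro tendsto_intros H.limit_B[OF u0 v(1) d0 v(2)] tendsto_Complex eps(3))
  ultimately show "(%n. ip0 (TW W d) (u n)) ----> ip0 d (\<psi> + of_real l *\<^sub>C v)"
   using d0 \<psi>0 v(1) by (simp add: H.q_add_right H.q_scale_right H.V_scale complex_of_real_def)
 qed
 from P.adjointI[OF v(1) _ this] have vD: "v \<in> D" "TW W v = \<psi> + of_real l *\<^sub>C v" using \<psi>0 v(1) by (auto simp: H.V_add H.V_scale)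
 have "Y (l, W) \<psi> - v = 0"
 proof (rule pairing_separates[of _ s])
  note v' = sp_ms[OF v(1)] and Yin = Y_in[OF x, of \<psi>]
  show "Y (l, W) \<psi> - v \<in> spm" using Yin v' by (rule H.V_diff)
  fix f assume f: "f \<in> sps"
  have "(%n. ip0 f (u n)) ----> pr f (Y (l, W) \<psi>)"
   using filterlim_compose[OF boundary_limits(1)[OF x f \<psi>] eps(4)] by (simp add: u_def)
  moreover have "(%n. ip0 f (u n)) ----> ip0 f v" by (rule H.limit_B[OF u0 v(1) sp_s[OF f] v(2)])
  ultimately have "pr f (Y (l, W) \<psi>) = pr f v" using LIMSEQ_unique pairing_0'[OF f v(1)] by metis
  hence "pr f (Y (l, W) \<psi> - v) = 0" using pairing_diff_right[OF f Yin v'] by simp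
  thus "pr (Y (l, W) \<psi> - v) f = 0" using pairing_herm[of f s "Y (l, W) \<psi> - v"] f Yin v' by (simp add: H.V_diff)
 qed
 hence "Y (l, W) \<psi> = v" by simp
 thus "Y (l, W) \<psi> \<in> D" "P.shifted W (of_real l) (Y (l, W) \<psi>) = \<psi>" using vD unfolding P.shifted_def by auto
qed

text \<open>The vectors sqrt(eps) R g satisfy (T_W - l) f = sqrt(eps) g + i eps f, which tends to 0.
  They tend weakly to 0 because <h, R g> converges for \<open>h\<close> in H_s, and H_s is
  dense.\<close>

lemma weyl_sequence:
 assumes x: "(l, W) \<in> U" and g: "g \<in> sps"
 obtains f :: "nat => 'v" where "!!n. f n \<in> D" "(%n. (nm0 (f n))^2) ----> Re (q (l, W) g g)"
  "(%n. nm0 (P.shifted W (of_real l) (f n))) ----> 0"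
  "!!\<phi>. \<phi> \<in> sp0 ==> (%n. ip0 \<phi> (f n)) ----> 0"
proof -
 obtain eps :: "nat => real" where eps: "!!n. eps n > 0" "eps ----> 0"
  "filterlim eps (at_right 0) sequentially" by (rule inverse_seq) (rule that; assumption)
 note g0 = sp_s[OF g]
 have Im: "Im (Complex l (eps n)) ~= 0" for n using eps(1)[of n] by simp
 define u where "u n = Rv W l (eps n) g" for n
 have uD: "u n \<in> D" "P.shifted W (Complex l (eps n)) (u n) = g" for n using P.R_props[OF Im g0] by (auto simp: u_def)
 have u0: "u n \<in> sp0" for n using D_sub[OF uD(1)] .
 define f where "f n = of_real (sqrt (eps n)) *\<^sub>C u n" for n
 have fD: "f n \<in> D" for n by (simp add: f_def D_scale uD)
 have f0: "f n \<in> sp0" for n using D_sub[OF fD] .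
 have fsq: "(nm0 (f n))^2 = eps n * (nm0 (u n))^2" for n using eps(1)[of n] u0 by (simp add: f_def H.nm_scale power_mult_distrib)
 have lim: "(%n. (nm0 (f n))^2) ----> Re (q (l, W) g g)"
  unfolding fsq u_def using filterlim_compose[OF vertical_limit[OF x g] eps(3)] .
 then obtain C where C: "!!n. (nm0 (f n))^2 <= C" using convergent_imp_bounded[OF lim] unfolding bounded_iff by (metis abs_le_iff rangeI real_norm_def)
 define c where "c = sqrt (C + 1)"
 have fc: "nm0 (f n) <= c" for n unfolding c_def by (rule real_le_rsqrt) (use C[of n] in simp)
 have sh: "P.shifted W (of_real l) (f n) = of_real (sqrt (eps n)) *\<^sub>C g + (\<i> * of_real (eps n)) *\<^sub>C f n" for n
 proof -
  have "P.shifted W (of_real l) (u n) = P.shifted W (Complex l (eps n)) (u n) + (Complex l (eps n) - of_real l) *\<^sub>C u n"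
   unfolding P.shifted_def by (simp add: algebra_simps complex_vector.scale_left_diff_distrib)
  also have "Complex l (eps n) - of_real l = \<i> * of_real (eps n)" by (simp add: complex_eq_iff)
  finally have "P.shifted W (of_real l) (u n) = g + (\<i> * of_real (eps n)) *\<^sub>C u n" by (simp only: uD(2))
  thus ?thesis unfolding f_def P.shifted_scale[OF uD(1)] by (simp add: scaleC_add_right scaleC_scaleC mult_ac)
 qed
 have sq: "(%n. sqrt (eps n)) ----> 0" using tendsto_real_sqrt[OF eps(2)] by simp
 have "(%n. nm0 (P.shifted W (of_real l) (f n))) ----> 0"
 proof (rule Lim_null_comparison)
  show "\<forall>\<^sub>F n in sequentially. norm (nm0 (P.shifted W (of_real l) (f n))) <= sqrt (eps n) * nm0 g + eps n * c"
  proof (intro always_eventually allI)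
   fix n
   have "nm0 (P.shifted W (of_real l) (f n)) <= nm0 (of_real (sqrt (eps n)) *\<^sub>C g) + nm0 ((\<i> * of_real (eps n)) *\<^sub>C f n)"
    unfolding sh by (intro H.nm_triangle H.V_scale g0 f0)
   also have "... = sqrt (eps n) * nm0 g + eps n * nm0 (f n)" using eps(1)[of n] g0 f0 by (simp add: H.nm_scale norm_mult)
   also have "eps n * nm0 (f n) <= eps n * c" using fc eps(1)[of n] by simp
   finally show "norm (nm0 (P.shifted W (of_real l) (f n))) <= sqrt (eps n) * nm0 g + eps n * c" using H.nm_nonneg[OF P.shifted_in[OF fD]] by simp
  qed
  have "(%n. sqrt (eps n) * nm0 g + eps n * c) ----> 0 * nm0 g + 0 * c" by (intro tendsto_intros sq eps(2))
  thus "(%n. sqrt (eps n) * nm0 g + eps n * c) ----> 0" by simp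
 qed
 moreover have "(%n. ip0 \<phi> (f n)) ----> 0" if \<phi>: "\<phi> \<in> sp0" for \<phi>
 proof (rule tendstoI)
  fix e :: real assume e: "e > 0"
  have c0: "c >= 0" using fc[of 0] H.nm_nonneg[OF f0[of 0]] by linarith
  define d where "d = e / (2 * (c + 1))"
  have d: "d > 0" "d * c < e / 2" using e c0 by (auto simp: d_def field_simps)
  obtain h where h: "h \<in> sps" "nm0 (\<phi> - h) < d" using dense[OF s_pos \<phi> d(1)] by blast
  note h0 = sp_s[OF h(1)]
  have "(%n. of_real (sqrt (eps n)) * ip0 h (u n)) ----> of_real 0 * pr h (Y (l, W) g)"
   using filterlim_compose[OF boundary_limits(1)[OF x h(1) g] eps(3)] by (intro tendsto_intros sq) (simp add: u_def)
  hence "(%n. ip0 h (f n)) ----> 0" using h0 u0 by (simp add: f_def H.q_scale_right)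
  hence "\<forall>\<^sub>F n in sequentially. dist (ip0 h (f n)) 0 < e / 2" by (rule tendstoD) (use e in simp)
  thus "\<forall>\<^sub>F n in sequentially. dist (ip0 \<phi> (f n)) 0 < e"
  proof eventually_elim
   case (elim n)
   have "ip0 \<phi> (f n) = ip0 (\<phi> - h) (f n) + ip0 h (f n)" using \<phi> h0 f0 by (simp add: H.q_diff_left)
   hence "cmod (ip0 \<phi> (f n)) <= cmod (ip0 (\<phi> - h) (f n)) + cmod (ip0 h (f n))" by (simp add: norm_triangle_ineq)
   also have "cmod (ip0 (\<phi> - h) (f n)) <= nm0 (\<phi> - h) * nm0 (f n)" by (intro H.cauchy_schwarz H.V_diff \<phi> h0 f0)
   also have "... <= d * c" using h(2) fc H.nm_nonneg[OF f0] d(1) by (intro mult_mono) auto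
   finally show ?case using elim d(2) by (simp add: dist_norm)
  qed
 qed
 ultimately show thesis using that[of f] fD lim by blast
qed

end

section \<open>Orthonormal families and forms of finite rank\<close>

text \<open>Stated for families, since values may repeat; a repetition is itself a relation.\<close>

lemma family_dependent:
 fixes v :: "nat => 'v::complex_vector"
 assumes B: "finite B" "card B <= m" and v: "!!i. i <= m ==> v i \<in> cspan B"
 shows "EX a. (EX i<=m. a i ~= 0) & (SUM i<=m. a i *\<^sub>C v i) = 0"
proof (cases "inj_on v {..m}")
 case False
 then obtain i j where ij: "i <= m" "j <= m" "i ~= j" "v i = v j" by (auto simp: inj_on_def)
 define a :: "nat => complex" where "a l = (if l = i then 1 else 0) - (if l = j then 1 else 0)" for l
 have "(SUM l<=m. a l *\<^sub>C v l) = (SUM l<=m. (if l = i then v l else 0)) - (SUM l<=m. (if l = j then v l else 0))" unfolding sum_subtractf[symmetric]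
  by (intro sum.cong refl) (auto simp: a_def complex_vector.scale_left_diff_distrib scaleC_one)
 also have "... = 0" using ij by simp
 finally show ?thesis using ij by (intro exI[of _ a]) (auto simp: a_def)
next
 case True
 define S where "S = v ` {..m}"
 have "card S = Suc m" using True by (simp add: S_def card_image)
 have "cdependent S"
 proof (rule ccontr)
  assume "\<not> cdependent S"
  from complex_vector.independent_span_bound[OF B(1) this] have "card S <= card B" using v by (auto simp: S_def)
  thus False using \<open>card S = Suc m\<close> B(2) by simp
 qed
 then obtain u where u: "EX w:S. u w ~= 0" "(SUM w:S. u w *\<^sub>C w) = 0" using complex_vector.dependent_finite[of S] by (auto simp: S_def)
 have "(SUM i<=m. u (v i) *\<^sub>C v i) = 0" using u(2) unfolding S_def sum.reindex[OF True] by simp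
 thus ?thesis using u(1) by (intro exI[of _ "%i. u (v i)"]) (auto simp: S_def)
qed

text \<open>A matrix close to the identity is diagonally dominant: the deviation absorbs at most
  half of the l1 norm of \<open>c\<close>.\<close>

lemma gram_l1:
 fixes G :: "nat => nat => complex"
 assumes G: "!!i j. i < r ==> j < r ==> cmod (G i j - (if i = j then 1 else 0)) <= \<eta>" and \<eta>: "real r * \<eta> <= 1 / 2"
 shows "(SUM i<r. cmod (c i)) <= 2 * (SUM i<r. cmod (SUM j<r. G i j * c j))"
proof -
 define s where "s = (SUM i<r. cmod (c i))"
 have s: "s >= 0" by (simp add: s_def sum_nonneg)
 have "cmod (c i) <= cmod (SUM j<r. G i j * c j) + \<eta> * s" if i: "i < r" for i
 proof -
  have "c i = (SUM j<r. (if i = j then 1 else 0) * c j)" using i by (simp add: if_distrib[of "%x. x * _"] cong: if_cong)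
  hence eq: "c i = (SUM j<r. G i j * c j) - (SUM j<r. (G i j - (if i = j then 1 else 0)) * c j)" by (simp add: left_diff_distrib sum_subtractf)
  have "cmod (c i) <= cmod (SUM j<r. G i j * c j) + cmod (SUM j<r. (G i j - (if i = j then 1 else 0)) * c j)"
   by (rule order_trans[OF eq_refl[OF arg_cong[OF eq, of cmod]] norm_triangle_ineq4])
  also have "cmod (SUM j<r. (G i j - (if i = j then 1 else 0)) * c j) <= (SUM j<r. \<eta> * cmod (c j))"
  proof (rule sum_norm_le)
   fix j assume "j \<in> {..<r}"
   thus "cmod ((G i j - (if i = j then 1 else 0)) * c j) <= \<eta> * cmod (c j)" unfolding norm_mult using G[OF i] by (intro mult_right_mono) auto
  qed
  finally show ?thesis by (simp add: s_def sum_distrib_left)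
 qed
 hence "s <= (SUM i<r. cmod (SUM j<r. G i j * c j) + \<eta> * s)" unfolding s_def by (intro sum_mono) auto
 also have "... = (SUM i<r. cmod (SUM j<r. G i j * c j)) + real r * \<eta> * s" by (simp add: sum.distrib)
 also have "real r * \<eta> * s <= 1 / 2 * s" using \<eta> s by (rule mult_right_mono)
 finally show ?thesis by (simp add: s_def)
qed

context semi_form
begin

definition ortho :: "(nat => 'v) => nat => 'v set => bool" where
 "ortho b r M \<longleftrightarrow> (ALL i<r. b i \<in> M) & (ALL i<r. ALL j<r. q (b i) (b j) = (if i = j then 1 else 0))"

lemma q_combination:
 assumes "f \<in> V" "!!i. i \<in> I ==> b i \<in> V"
 shows "q f (SUM i:I. c i *\<^sub>C b i) = (SUM i:I. c i * q f (b i))"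
 using assms by (subst q_sum_right) (auto simp: V_scale q_scale_right)

text \<open>An orthonormal family of greatest length leaves only null remainders, for otherwise the
  normalized remainder would prolong it. The closure conditions are those of one Gram-Schmidt step,
  so \<open>M\<close> may be a merely real subspace on which the coefficients are real.\<close>

lemma orthonormal_exhaustion:
 assumes M: "M \<subseteq> V" and closed: "!!x b. x \<in> M ==> b \<in> M ==> x - q b x *\<^sub>C b \<in> M"
  and scaled: "!!x t. x \<in> M ==> of_real t *\<^sub>C x \<in> M"
  and bounded: "!!r b. ortho b r M ==> r <= N" and start: "ortho b0 r0 M"
 obtains r b where "r0 <= r" "!!i. i < r0 ==> b i = b0 i" "ortho b r M"
  "!!x. x \<in> M ==> q (x - (SUM i<r. q (b i) x *\<^sub>C b i)) (x - (SUM i<r. q (b i) x *\<^sub>C b i)) = 0"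
proof -
 define P where "P r \<longleftrightarrow> r0 <= r & (EX b. (ALL i<r0. b i = b0 i) & ortho b r M)" for r
 have "P r0" using start by (auto simp: P_def)
 moreover have bdd: "!!r. P r ==> r <= N" using bounded by (auto simp: P_def)
 ultimately obtain r where r: "P r" "!!r'. P r' ==> r' <= r" using GreatestI_nat[of P r0 N] Greatest_le_nat[of P _ N] by blast
 then obtain b where b: "r0 <= r" "ALL i<r0. b i = b0 i" "ortho b r M" by (auto simp: P_def)
 have bM: "b i \<in> M" "b i \<in> V" if "i < r" for i using b(3) that M by (auto simp: ortho_def)
 have bb: "q (b i) (b j) = (if i = j then 1 else 0)" if "i < r" "j < r" for i j using b(3) that by (simp add: ortho_def)
 have "q y y = 0" if x: "x \<in> M" and y: "y = x - (SUM i<r. q (b i) x *\<^sub>C b i)" for x y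
 proof -
  have xV: "x \<in> V" using x M by blast
  have part: "x - (SUM i<k. q (b i) x *\<^sub>C b i) \<in> M" if "k <= r" for k using that
  proof (induction k)
   case (Suc k)
   define z where "z = x - (SUM i<k. q (b i) x *\<^sub>C b i)"
   have z: "z \<in> M" using Suc by (simp add: z_def)
   have "q (b k) (SUM i<k. q (b i) x *\<^sub>C b i) = (SUM i<k. q (b i) x * q (b k) (b i))" by (rule q_combination) (use Suc bM in auto)
   also have "... = 0" using Suc by (intro sum.neutral) (auto simp: bb)
   finally have "q (b k) z = q (b k) x" unfolding z_def using Suc bM xV by (subst q_diff_right) (auto intro!: V_sum V_scale)
   thus ?case using closed[OF z bM(1)[of k]] Suc by (simp add: z_def algebra_simps)
  qed (use x in simp)
  hence yM: "y \<in> M" by (simp add: y)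
  hence yV: "y \<in> V" using M by blast
  have by0: "q (b i) y = 0" if i: "i < r" for i
  proof -
   have "q (b i) (SUM j<r. q (b j) x *\<^sub>C b j) = (SUM j<r. q (b j) x * q (b i) (b j))" by (rule q_combination) (use i bM in auto)
   also have "... = (SUM j<r. if i = j then q (b j) x else 0)" using i by (intro sum.cong) (auto simp: bb)
   also have "... = q (b i) x" using i by simp
   finally show ?thesis unfolding y using i bM xV by (subst q_diff_right) (auto intro!: V_sum V_scale)
  qed
  show ?thesis
  proof (rule ccontr)
   assume "q y y ~= 0"
   hence pos: "Re (q y y) > 0" using q_real[OF yV] q_nonneg[OF yV] by (metis less_eq_real_def of_real_0)
   define t where "t = 1 / sqrt (Re (q y y))"
   define w where "w = of_real t *\<^sub>C y"
   have w: "w \<in> M" "w \<in> V" using scaled[OF yM] M by (auto simp: w_def)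
   have "q w w = of_real t * (of_real t * q y y)" unfolding w_def using yV by (simp add: q_scale_left q_scale_right V_scale)
   also have "... = of_real (t * t * Re (q y y))" using q_real[OF yV] by (metis of_real_mult mult.assoc)
   also have "t * t * Re (q y y) = 1" using pos by (simp add: t_def)
   finally have ww: "q w w = 1" by simp
   have bw: "q (b i) w = 0" "q w (b i) = 0" if "i < r" for i using by0[OF that] q_herm[OF yV bM(2)[OF that]] bM(2)[OF that] yV
    by (auto simp: w_def q_scale_right q_scale_left)
   have "ortho (b(r := w)) (Suc r) M" unfolding ortho_def using bM w ww bw bb by (auto simp: less_Suc_eq)
   hence "P (Suc r)" unfolding P_def using b by (intro conjI exI[of _ "b(r := w)"]) auto
   thus False using r(2) by fastforce
  qed
 qed
 thus thesis using that[of r b] b by blast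
qed

text \<open>More than \<open>m\<close> vectors have dependent images under \<open>\<Delta>\<close>;
  the relation gives a vector in the radical of the form, and pairing it with each
  \<open>b j\<close> shows that its coefficients vanish.\<close>

lemma ortho_bound:
 assumes b: "ortho b r M" "M \<subseteq> V" and B: "finite B" "card B <= m"
  and \<Delta>: "!!f. f \<in> M ==> \<Delta> f \<in> cspan B"
  and vanish: "!!c. (SUM i<=m. c i *\<^sub>C \<Delta> (b i)) = 0 ==> (!!i. i <= m ==> b i \<in> M) ==>
   (!!g. g \<in> M ==> q g (SUM i<=m. c i *\<^sub>C b i) = 0)"
 shows "r <= m"
proof (rule ccontr)
 assume "\<not> r <= m"
 hence bM: "b i \<in> M" "b i \<in> V" if "i <= m" for i using b that by (auto simp: ortho_def)
 obtain a where a: "EX i<=m. a i ~= 0" "(SUM i<=m. a i *\<^sub>C \<Delta> (b i)) = 0"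
  using family_dependent[OF B, of "%i. \<Delta> (b i)"] \<Delta> bM(1) by blast
 have "a j = 0" if j: "j <= m" for j
 proof -
  have "0 = q (b j) (SUM i<=m. a i *\<^sub>C b i)" using vanish[OF a(2)] bM j by simp
  also have "... = (SUM i<=m. a i * q (b j) (b i))" by (rule q_combination) (use bM j in auto)
  also have "... = (SUM i<=m. if j = i then a i else 0)" using b(1) \<open>\<not> r <= m\<close> j by (intro sum.cong) (auto simp: ortho_def)
  also have "... = a j" using j by simp
  finally show ?thesis by simp
 qed
 thus False using a(1) by blast
qed

text \<open>Modulo the radical the \<open>m\<close> vectors \<open>g i\<close> and \<open>f\<close>
  are dependent, and the Gram matrix keeps the \<open>g i\<close> independent, so \<open>f\<close>
  is a combination of them. \<open>gram_l1\<close> bounds its coefficients by the numbers q (g i) f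
  and is the source of the factor 2.\<close>

lemma finite_rank_bound:
 assumes B: "finite B" "card B <= m" and \<Delta>: "!!f. f \<in> V ==> \<Delta> f \<in> cspan B"
  and \<Delta>_add: "!!f g. f \<in> V ==> g \<in> V ==> \<Delta> (f + g) = \<Delta> f + \<Delta> g"
  and \<Delta>_scale: "!!f c. f \<in> V ==> \<Delta> (c *\<^sub>C f) = c *\<^sub>C \<Delta> f"
  and vanish: "!!f g. f \<in> V ==> g \<in> V ==> \<Delta> f = 0 ==> q g f = 0"
  and g: "!!i. i < m ==> g i \<in> V"
  and gram: "!!i j. i < m ==> j < m ==> cmod (q (g i) (g j) - (if i = j then 1 else 0)) <= \<eta>"
  and \<eta>: "real m * \<eta> <= 1 / 2" and f: "f \<in> V"
 shows "Re (q f f) <= 2 * (SUM i<m. cmod (q (g i) f))^2"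
proof -
 have \<Delta>_sum: "\<Delta> (SUM i:I. c i *\<^sub>C h i) = (SUM i:I. c i *\<^sub>C \<Delta> (h i))" if "!!i. i \<in> I ==> h i \<in> V" "finite I"
  for c and h :: "nat => 'v" and I using that(2,1)
 proof (induction I)
  case empty
  show ?case using \<Delta>_scale[OF V_zero, of 0] by simp
 qed (simp add: \<Delta>_add \<Delta>_scale V_sum V_scale)
 define v where "v i = (if i < m then g i else f)" for i
 have vV: "v i \<in> V" for i using g f by (simp add: v_def)
 obtain a where a: "EX i<=m. a i ~= 0" "(SUM i<=m. a i *\<^sub>C \<Delta> (v i)) = 0"
  using family_dependent[OF B, of "%i. \<Delta> (v i)"] \<Delta> vV by blast
 have split: "(SUM i<=m. F i) = (SUM i<m. F i) + F m" for F :: "nat => 'b::comm_monoid_add" by (simp add: lessThan_Suc_atMost[symmetric])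
 define h where "h = (SUM i<=m. a i *\<^sub>C v i)"
 have hV: "h \<in> V" unfolding h_def by (intro V_sum V_scale vV)
 have "\<Delta> h = 0" unfolding h_def using \<Delta>_sum[of "{..m}" v a] vV a(2) by simp
 hence qh: "q u h = 0" if "u \<in> V" for u using vanish hV that by blast
 have key: "(SUM j<m. q u (g j) * a j) + a m * q u f = 0" if u: "u \<in> V" for u
 proof -
  have "0 = (SUM i<=m. a i * q u (v i))" using qh[OF u] q_combination[OF u, of "{..m}" v a] vV by (simp add: h_def)
  thus ?thesis by (simp add: split v_def mult.commute)
 qed
 \<comment> \<open>Otherwise the relation would involve the \<open>g i\<close> alone, which
   \<open>gram_l1\<close> excludes.\<close>
 have am: "a m ~= 0"
 proof
  assume am: "a m = 0"
  have "(SUM i<m. cmod (a i)) <= 2 * (SUM i<m. cmod (SUM j<m. q (g i) (g j) * a j))" by (rule gram_l1[OF gram \<eta>])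
  also have "... = 0" using key[OF g] am by simp
  finally have "(SUM i<m. cmod (a i)) = 0" using sum_nonneg[of "{..<m}" "%i. cmod (a i)"] by simp
  hence "a i = 0" if "i < m" for i using that by (simp add: sum_nonneg_eq_0_iff)
  thus False using a(1) am le_neq_implies_less by blast
 qed
 define c where "c i = - a i / a m" for i
 have qc: "q u f = (SUM j<m. q u (g j) * c j)" if u: "u \<in> V" for u
 proof -
  have "(SUM j<m. q u (g j) * c j) = - (SUM j<m. q u (g j) * a j) / a m" by (simp add: c_def sum_negf sum_divide_distrib)
  also have "(SUM j<m. q u (g j) * a j) = - (a m * q u f)" using key[OF u] by (simp add: eq_neg_iff_add_eq_0)
  finally show ?thesis using am by simp
 qed
 define b where "b = (SUM i<m. cmod (q (g i) f))"
 have "(SUM i<m. cmod (c i)) <= 2 * (SUM i<m. cmod (SUM j<m. q (g i) (g j) * c j))" by (rule gram_l1[OF gram \<eta>])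
 hence c_le: "(SUM i<m. cmod (c i)) <= 2 * b" using qc[OF g] by (simp add: b_def)
 have "Re (q f f) <= cmod (SUM j<m. q f (g j) * c j)" using qc[OF f] complex_Re_le_cmod[of "q f f"] by simp
 also have "... <= (SUM j<m. b * cmod (c j))"
 proof (rule sum_norm_le)
  fix j assume j: "j \<in> {..<m}"
  have "cmod (q f (g j)) = cmod (q (g j) f)" using q_herm[OF f g] j by simp
  also have "... <= b" unfolding b_def using j by (intro member_le_sum) auto
  finally show "cmod (q f (g j) * c j) <= b * cmod (c j)" by (simp add: norm_mult mult_right_mono)
 qed
 also have "... = b * (SUM j<m. cmod (c j))" by (simp add: sum_distrib_left)
 also have "... <= b * (2 * b)" using c_le by (intro mult_left_mono) (auto simp: b_def sum_nonneg)
 finally show ?thesis by (simp add: b_def power2_eq_square)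
qed

end

section \<open>Weyl sequences and the continuous spectrum\<close>

context selfadj
begin

lemma eigenvalue_real: "f \<in> eigenspace D T z ==> f ~= 0 ==> Im z = 0"
proof -
 assume f: "f \<in> eigenspace D T z" "f ~= 0"
 hence D: "f \<in> D" "shifted z f = 0" by (auto simp: eigenspace_def shifted_def)
 have "\<bar>Im z\<bar> * nm0 f <= 0" using shifted_lower[OF D(1), of z] D(2) by simp
 moreover have "nm0 f > 0" using H.nm_eq_0[OF D_sub[OF D(1)]] H.nm_nonneg[OF D_sub[OF D(1)]] f(2) by simp
 ultimately show ?thesis by (simp add: mult_le_0_iff)
qed

lemma eigen_ip:
 assumes e: "e \<in> eigenspace D T z" and f: "f \<in> D"
 shows "ip0 e (shifted w f) = (z - w) * ip0 e f"
proof (cases "e = 0")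
 case True
 thus ?thesis using H.q_zero_left[OF shifted_in[OF f]] H.q_zero_left[OF D_sub[OF f]] by simp
next
 case False
 have "cnj z = z" using eigenvalue_real[OF e False] by (simp add: complex_eq_iff)
 have eD: "e \<in> D" "T e = z *\<^sub>C e" using e by (auto simp: eigenspace_def)
 have "ip0 e (T f) = ip0 (T e) f" using T_symmetric[OF eD(1) f] by simp
 thus ?thesis using eD f \<open>cnj z = z\<close>
  by (simp add: shifted_def H.q_diff_right H.q_scale_right H.q_scale_left D_sub T_in H.V_scale left_diff_distrib)
qed

lemma eigen_orthogonal:
 assumes "e \<in> eigenspace D T z" "f \<in> eigenspace D T w" "z ~= w"
 shows "ip0 e f = 0"
proof -
 have "f \<in> D" "shifted w f = 0" using assms(2) by (auto simp: eigenspace_def shifted_def)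
 thus ?thesis using eigen_ip[OF assms(1), of f w] assms(1,3) H.q_zero_right[of e 0] by (auto simp: eigenspace_def D_sub)
qed

abbreviation eigenvectors where "eigenvectors \<equiv> (\<Union>z. eigenspace D T z)"

lemma eigenspace_subspace: "csubspace (eigenspace D T z)"
 unfolding complex_vector.subspace_def eigenspace_def
 by (auto simp: D_zero T_zero D_add T_add D_scale T_scale scaleC_add_right scaleC_scaleC mult.commute)

lemma eigenvectors_sub: "e \<in> cspan eigenvectors ==> e \<in> sp0"
 using complex_vector.span_minimal[OF _ H.V, of eigenvectors 0] D_sub by (auto simp: eigenspace_def)

text \<open>Terms are grouped by eigenvalue, so that distinct summands are orthogonal and Pythagoras
  applies.\<close>

lemma span_eigenvectors:
 assumes "g \<in> cspan eigenvectors"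
 shows "EX Z h. finite Z & (ALL z:Z. h z \<in> eigenspace D T z) & g = (SUM z:Z. h z)"
 using assms
proof (induction rule: complex_vector.span_induct_alt)
 case base
 show ?case by (intro exI[of _ "{}"]) simp
next
 case (step c x y)
 then obtain w where w: "x \<in> eigenspace D T w" by blast
 obtain Z h where Z: "finite Z" "ALL z:Z. h z \<in> eigenspace D T z" "y = (SUM z:Z. h z)" using step by blast
 define h' where "h' z = (if z = w then c *\<^sub>C x else 0) + (if z \<in> Z then h z else 0)" for z
 have "h' z \<in> eigenspace D T z" for z using eigenspace_subspace Z(2) w
  by (auto simp: h'_def intro!: complex_vector.subspace_add complex_vector.subspace_scale complex_vector.subspace_0)
 moreover have "(SUM z:insert w Z. h' z) = c *\<^sub>C x + y"
 proof -
  have "(SUM z:insert w Z. if z \<in> Z then h z else 0) = (SUM z:Z. h z)" using Z(1) by (intro sum.mono_neutral_cong_right) auto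
  thus ?thesis using Z by (simp only: h'_def sum.distrib) (simp add: Z(1))
 qed
 ultimately show ?case using Z(1) by (intro exI[of _ "insert w Z"] exI[of _ h']) auto
qed

lemma pp_eq: "pp_subspace S D T = {f \<in> sp0. ALL e>0. EX g:cspan eigenvectors. nm0 (f - g) < e}"
 by (simp add: pp_subspace_def hclosure_def)

lemma pp_sub: "f \<in> pp_subspace S D T ==> f \<in> sp0"
 by (simp add: pp_eq)

lemma eigenvector_pp: "e \<in> cspan eigenvectors ==> e \<in> pp_subspace S D T"
 using eigenvectors_sub by (auto simp: pp_eq intro!: bexI[of _ e])

lemma cont_iff: "f \<in> cont_subspace S D T \<longleftrightarrow> f \<in> sp0 & (ALL e:pp_subspace S D T. ip0 e f = 0)"
 by (simp add: cont_subspace_def)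

text \<open>Orthogonality passes from eigenvectors to their span and, by Cauchy-Schwarz, to its
  closure.\<close>

lemma contI:
 assumes f: "f \<in> sp0" and z: "!!z e. e \<in> eigenspace D T z ==> ip0 e f = 0"
 shows "f \<in> cont_subspace S D T"
 unfolding cont_iff
proof (intro conjI f ballI)
 fix p assume p: "p \<in> pp_subspace S D T"
 note p0 = pp_sub[OF p]
 have span: "g \<in> sp0 & ip0 g f = 0" if "g \<in> cspan eigenvectors" for g using that
 proof (induction rule: complex_vector.span_induct_alt)
  case base
  show ?case using H.q_zero_left[OF f] H.V_zero by blast
 next
  case (step c x y)
  have "x \<in> sp0" using step(1) D_sub by (auto simp: eigenspace_def)
  thus ?case using step z f by (auto simp: H.q_add_left H.q_scale_left H.V_scale H.V_add)
 qed
 have "cmod (ip0 p f) <= 0"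
 proof (rule field_le_epsilon)
  fix e :: real assume e: "e > 0"
  have n: "nm0 f >= 0" by (rule H.nm_nonneg[OF f])
  define d where "d = e / (nm0 f + 1)"
  have d: "d > 0" "d * nm0 f <= e" using e n by (auto simp: d_def field_simps)
  obtain g where g: "g \<in> cspan eigenvectors" "nm0 (p - g) < d" using p d(1) by (auto simp: pp_eq)
  note g0 = eigenvectors_sub[OF g(1)]
  have "ip0 p f = ip0 (p - g) f" using span[OF g(1)] p0 g0 f by (simp add: H.q_diff_left)
  hence "cmod (ip0 p f) <= nm0 (p - g) * nm0 f" using H.cauchy_schwarz[OF H.V_diff[OF p0 g0] f] by simp
  also have "... <= d * nm0 f" using g(2) n by (intro mult_right_mono) auto
  finally show "cmod (ip0 p f) <= 0 + e" using d(2) by simp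
 qed
 thus "ip0 p f = 0" by simp
qed

lemma pp_subspace_csubspace: "csubspace (pp_subspace S D T)"
 unfolding complex_vector.subspace_def
proof (intro conjI ballI allI)
 show "0 \<in> pp_subspace S D T" by (rule eigenvector_pp) (rule complex_vector.span_zero)
 fix x y c assume x: "x \<in> pp_subspace S D T"
 show "x + y \<in> pp_subspace S D T" if y: "y \<in> pp_subspace S D T" unfolding pp_eq
 proof (intro CollectI conjI allI impI)
  show "x + y \<in> sp0" using pp_sub[OF x] pp_sub[OF y] by (rule H.V_add)
  fix e :: real assume "e > 0"
  hence "e / 2 > 0" by simp
  then obtain g h where gh: "g \<in> cspan eigenvectors" "nm0 (x - g) < e / 2"
   "h \<in> cspan eigenvectors" "nm0 (y - h) < e / 2" using x y unfolding pp_eq by blast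
  have "nm0 ((x - g) + (y - h)) <= nm0 (x - g) + nm0 (y - h)" using pp_sub[OF x] pp_sub[OF y] eigenvectors_sub gh(1,3) by (intro H.nm_triangle H.V_diff)
  thus "EX g:cspan eigenvectors. nm0 (x + y - g) < e" using gh by (intro bexI[of _ "g + h"]) (auto simp: algebra_simps intro: complex_vector.span_add)
 qed
 show "c *\<^sub>C x \<in> pp_subspace S D T" unfolding pp_eq
 proof (intro CollectI conjI allI impI)
  show "c *\<^sub>C x \<in> sp0" using pp_sub[OF x] by (rule H.V_scale)
  fix e :: real assume e: "e > 0"
  define d where "d = e / (cmod c + 1)"
  have pos: "cmod c + 1 > 0" by (simp add: add_nonneg_pos)
  hence d1: "d > 0" using e by (simp add: d_def)
  have "cmod c * d < (cmod c + 1) * d" using d1 by (simp add: distrib_right)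
  also have "... = e" using pos by (simp add: d_def)
  finally have d: "d > 0" "cmod c * d < e" using d1 by auto
  obtain g where g: "g \<in> cspan eigenvectors" "nm0 (x - g) < d" using x d(1) unfolding pp_eq by blast
  have "nm0 (c *\<^sub>C x - c *\<^sub>C g) = cmod c * nm0 (x - g)" using pp_sub[OF x] eigenvectors_sub[OF g(1)]
   by (simp add: complex_vector.scale_right_diff_distrib[symmetric] H.nm_scale H.V_diff)
  also have "... <= cmod c * d" using g(2) by (intro mult_left_mono) auto
  finally show "EX g:cspan eigenvectors. nm0 (c *\<^sub>C x - g) < e"
   using g(1) d(2) by (intro bexI[of _ "c *\<^sub>C g"]) (auto intro: complex_vector.span_scale)
 qed
qed

lemma pp_projection:
 assumes y: "y \<in> sp0"
 obtains p where "p \<in> pp_subspace S D T" "y - p \<in> cont_subspace S D T"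
proof -
 have "EX p:pp_subspace S D T. ALL m:pp_subspace S D T. ip0 m (y - p) = 0"
 proof (rule H.projection_exists[OF pp_subspace_csubspace _ _ y])
  show "pp_subspace S D T \<subseteq> sp0" using pp_sub by blast
  fix X f assume X: "range X \<subseteq> pp_subspace S D T" and f: "f \<in> sp0" and lim: "(%i. nm0 (X i - f)) ----> 0"
  show "f \<in> pp_subspace S D T" unfolding pp_eq
  proof (intro CollectI conjI allI impI f)
   fix e :: real assume e: "e > 0"
   have "\<forall>\<^sub>F i in sequentially. nm0 (X i - f) < e / 2" using order_tendstoD(2)[OF lim half_gt_zero[OF e]] .
   then obtain i where i: "nm0 (X i - f) < e / 2" using eventually_happens trivial_limit_sequentially by blast
   have Xi: "X i \<in> pp_subspace S D T" using X by blast
   then obtain g where g: "g \<in> cspan eigenvectors" "nm0 (X i - g) < e / 2" using half_gt_zero[OF e] unfolding pp_eq by blast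
   have "nm0 (f - g) <= nm0 (f - X i) + nm0 (X i - g)" by (rule H.nm_triangle3[OF f pp_sub[OF Xi] eigenvectors_sub[OF g(1)]])
   thus "EX g:cspan eigenvectors. nm0 (f - g) < e" using i g H.nm_commute[OF f pp_sub[OF Xi]] by (intro bexI[of _ g]) auto
  qed
 qed
 then obtain p where p: "p \<in> pp_subspace S D T" "ALL m:pp_subspace S D T. ip0 m (y - p) = 0" by blast
 have "y - p \<in> cont_subspace S D T" using p y pp_sub by (simp add: cont_iff H.V_diff)
 thus thesis using that p(1) by blast
qed

text \<open>On sums of eigenvectors the inverse of T - l costs at most 1 / \<open>\<rho>\<close>
  away from the eigenspace of \<open>l\<close>. It is applied to the test vector \<open>g\<close>
  instead of \<open>p\<close>, which is only a limit of such sums; finally \<open>g\<close>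
  approximates \<open>p\<close> itself.\<close>

lemma pp_gap_estimate:
 assumes gap: "\<rho> > 0" "!!z. z ~= of_real l ==> z \<in> point_spectrum D T ==> \<rho> <= cmod (z - of_real l)"
  and p: "p \<in> pp_subspace S D T" "p \<in> D" and orth: "!!e. e \<in> eigenspace D T (of_real l) ==> ip0 e p = 0"
 shows "\<rho> * nm0 p <= nm0 (shifted (of_real l) p)"
proof -
 define w where "w = shifted (of_real l) p"
 have p0: "p \<in> sp0" and w0: "w \<in> sp0" using pp_sub[OF p(1)] shifted_in[OF p(2)] by (auto simp: w_def)
 have main: "\<rho> * cmod (ip0 g p) <= nm0 g * nm0 w" if g: "g \<in> cspan eigenvectors" for g
 proof -
  obtain Z h where Z: "finite Z" "ALL z:Z. h z \<in> eigenspace D T z" "g = (SUM z:Z. h z)" using span_eigenvectors[OF g] by blast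
  have h0: "h z \<in> sp0" if "z \<in> Z" for z using Z(2) that D_sub by (auto simp: eigenspace_def)
  \<comment> \<open>Each component is divided by the conjugate of z - l, as it stands in the
    antilinear argument; the component at \<open>l\<close> is dropped because \<open>p\<close> is
    orthogonal to it.\<close>
  define k where "k z = (if z = of_real l then 0 else (1 / cnj (z - of_real l)) *\<^sub>C h z)" for z
  have k0: "k z \<in> sp0" if "z \<in> Z" for z using h0[OF that] by (simp add: k_def H.V_scale H.V_zero)
  define g' where "g' = (SUM z:Z. k z)"
  have g'0: "g' \<in> sp0" unfolding g'_def by (intro H.V_sum k0)
  have g0: "g \<in> sp0" using eigenvectors_sub[OF g] .
  have "ip0 (h z) p = ip0 (k z) w" if z: "z \<in> Z" for z
  proof (cases "z = of_real l")
   case True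
   thus ?thesis using orth Z(2) z H.q_zero_left[OF w0] by (auto simp: k_def)
  next
   case False
   have "ip0 (h z) w = (z - of_real l) * ip0 (h z) p" using eigen_ip[OF _ p(2), of "h z" z] Z(2) z by (simp add: w_def)
   thus ?thesis using False h0[OF z] w0 by (simp add: k_def H.q_scale_left)
  qed
  hence eq: "ip0 g p = ip0 g' w" unfolding Z(3) g'_def using h0 k0 p0 w0 by (simp add: H.q_sum_left)
  have pyth: "(nm0 (SUM z:Z. u z))^2 = (SUM z:Z. (nm0 (u z))^2)"
   if u: "!!z. z \<in> Z ==> u z \<in> sp0" and o: "!!z z'. z \<in> Z ==> z' \<in> Z ==> z ~= z' ==> ip0 (u z) (u z') = 0" for u
  proof -
   have "ip0 (SUM z:Z. u z) (SUM z:Z. u z) = (SUM z:Z. \<Sum>z'\<in>Z. ip0 (u z) (u z'))"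
    using u by (simp add: H.q_sum_left H.q_sum_right H.V_sum) (rule sum.swap)
   also have "... = (SUM z:Z. \<Sum>z'\<in>Z. if z = z' then ip0 (u z) (u z') else 0)" by (intro sum.cong refl) (use o in auto)
   also have "... = (SUM z:Z. of_real ((nm0 (u z))^2))" using Z(1) u by (simp add: H.B_self)
   finally have "of_real ((nm0 (SUM z:Z. u z))^2) = (SUM z:Z. of_real ((nm0 (u z))^2) :: complex)" using H.B_self[OF H.V_sum[of Z u 0]] u by simp
   thus ?thesis by (metis of_real_eq_iff of_real_sum)
  qed
  have orth_h: "ip0 (h z) (h z') = 0" if "z \<in> Z" "z' \<in> Z" "z ~= z'" for z z' using eigen_orthogonal Z(2) that by blast
  have orth_k: "ip0 (k z) (k z') = 0" if zz: "z \<in> Z" "z' \<in> Z" "z ~= z'" for z z' using orth_h[OF zz] h0 zz H.V_zero H.q_zero_left H.q_zero_right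
   by (auto simp: k_def H.q_scale_left H.q_scale_right H.V_scale)
  have "\<rho> * nm0 (k z) <= nm0 (h z)" if z: "z \<in> Z" for z
  proof (cases "z = of_real l \<or> h z = 0")
   case True
   thus ?thesis using H.nm_nonneg[OF h0[OF z]] by (auto simp: k_def)
  next
   case False
   hence "z \<in> point_spectrum D T" using Z(2) z by (auto simp: point_spectrum_def)
   hence "\<rho> <= cmod (z - of_real l)" using gap(2) False by blast
   moreover have "nm0 (k z) = nm0 (h z) / cmod (z - of_real l)" using False h0[OF z] by (simp add: k_def H.nm_scale norm_divide del: complex_cnj_diff)
   moreover have "\<rho> * u / v <= u" if "\<rho> <= v" "0 <= u" for u v :: real
    using that gap(1) mult_right_mono[OF that] by (simp add: divide_le_eq mult.commute)
   ultimately show ?thesis using H.nm_nonneg[OF h0[OF z]] by simp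
  qed
  hence "(SUM z:Z. (\<rho> * nm0 (k z))^2) <= (SUM z:Z. (nm0 (h z))^2)" using gap(1) H.nm_nonneg[OF k0] by (intro sum_mono power_mono) auto
  hence "(\<rho> * nm0 g')^2 <= (nm0 g)^2" using pyth[of h, OF h0 orth_h] pyth[of k, OF k0 orth_k]
   by (simp add: Z(3) g'_def power_mult_distrib sum_distrib_left)
  hence "\<rho> * nm0 g' <= nm0 g" using H.nm_nonneg[OF g0] by (rule power2_le_imp_le)
  hence "\<rho> * nm0 g' * nm0 w <= nm0 g * nm0 w" using H.nm_nonneg[OF w0] by (rule mult_right_mono)
  moreover have "\<rho> * cmod (ip0 g p) <= \<rho> * (nm0 g' * nm0 w)" unfolding eq using gap(1) H.cauchy_schwarz[OF g'0 w0] by simp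
  ultimately show ?thesis by (simp add: mult.assoc)
 qed
 show ?thesis
 proof (rule field_le_epsilon)
  fix e :: real assume e: "e > 0"
  show "\<rho> * nm0 p <= nm0 (shifted (of_real l) p) + e"
  proof (cases "nm0 p = 0")
   case True
   thus ?thesis using H.nm_nonneg[OF w0] e by (simp add: w_def)
  next
   case False
   define n where "n = nm0 p"
   have n: "n > 0" using False H.nm_nonneg[OF p0] by (simp add: n_def)
   define w' where "w' = nm0 w"
   have w': "w' >= 0" using H.nm_nonneg[OF w0] by (simp add: w'_def)
   \<comment> \<open>Replacing \<open>p\<close> by \<open>g\<close> costs at most d (w' + \<rho> n)
     in total, which has to stay below n e.\<close>
   define d where "d = n * e / (w' + \<rho> * n + 1)"
   have pos: "w' + \<rho> * n + 1 > 0" using w' n gap(1) by (simp add: add_nonneg_pos)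
   have d: "d > 0" "d * (w' + \<rho> * n + 1) = n * e" using n e pos by (auto simp: d_def)
   obtain g where g: "g \<in> cspan eigenvectors" "nm0 (p - g) < d" using p(1) d(1) unfolding pp_eq by blast
   note g0 = eigenvectors_sub[OF g(1)]
   have gn: "nm0 g <= n + d" using H.nm_triangle[of g 0 "p - g"] H.nm_triangle_diff[of p 0 "p - g"] p0 g0 g(2) by (simp add: H.V_diff n_def)
   have "n^2 = Re (ip0 p p)" using H.nm_sq[OF p0] by (simp add: n_def)
   also have "... = Re (ip0 g p) + Re (ip0 (p - g) p)" using p0 g0 by (simp add: H.q_diff_left)
   also have "... <= cmod (ip0 g p) + nm0 (p - g) * n" using complex_Re_le_cmod[of "ip0 g p"] complex_Re_le_cmod[of "ip0 (p - g) p"]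
     H.cauchy_schwarz[OF H.V_diff[OF p0 g0] p0] by (simp add: n_def)
   also have "... <= cmod (ip0 g p) + d * n" using g(2) n by simp
   finally have "\<rho> * n^2 <= \<rho> * cmod (ip0 g p) + \<rho> * (d * n)" using gap(1) by (simp flip: distrib_left)
   also have "\<rho> * cmod (ip0 g p) <= (n + d) * w'" using main[OF g(1)] mult_right_mono[OF gn w'] by (simp add: w'_def)
   finally have "\<rho> * n^2 <= n * w' + d * (w' + \<rho> * n)" by (simp add: algebra_simps)
   also have "... <= n * w' + n * e" using d by (simp add: algebra_simps)
   finally have "n * (\<rho> * n) <= n * (w' + e)" by (simp add: power2_eq_square algebra_simps)
   thus ?thesis using n by (simp add: n_def w'_def w_def)
  qed
 qed
qed

text \<open>If \<open>l\<close> were outside the continuous spectrum, T - l would be bounded below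
  off the eigenspace of \<open>l\<close>: on the continuous subspace by assumption, on the other
  eigenvectors by the gap. The eigenspace is finite-dimensional, so the weakly null sequence has
  components there that tend to 0, and its norms would tend to 0.\<close>

lemma weyl_embedded:
 fixes b :: "nat => 'v"
 assumes gap: "\<rho> > 0" "!!z. z ~= of_real l ==> z \<in> point_spectrum D T ==> \<rho> <= cmod (z - of_real l)"
  and b: "!!i. i < r ==> b i \<in> eigenspace D T (of_real l)" "!!i j. i < r ==> j < r ==> ip0 (b i) (b j) = (if i = j then 1 else 0)"
  and basis: "!!x. x \<in> eigenspace D T (of_real l) ==> x = (SUM i<r. ip0 (b i) x *\<^sub>C b i)"
  and f: "!!n::nat. f n \<in> D" and lim: "(%n. (nm0 (f n))^2) ----> \<nu>" "\<nu> > 0"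
  and approx: "(%n. nm0 (shifted (of_real l) (f n))) ----> 0"
  and weak: "!!\<phi>. \<phi> \<in> sp0 ==> (%n. ip0 \<phi> (f n)) ----> 0"
 shows "of_real l \<in> cont_spectrum S D T"
proof (rule ccontr)
 define K where "K = cont_subspace S D T"
 assume "of_real l \<notin> cont_spectrum S D T"
 hence bij: "bij_betw (shifted (of_real l)) (D \<inter> K) K"
  and "EX c>0. ALL f:D \<inter> K. c * nm0 f <= nm0 (shifted (of_real l) f)"
  unfolding cont_spectrum_def spectrum_in_def K_def shifted_def[abs_def] by auto
 then obtain c where c: "c > 0" "!!f. f \<in> D ==> f \<in> K ==> c * nm0 f <= nm0 (shifted (of_real l) f)" by blast
 have K0: "x \<in> sp0" and Kpp: "p \<in> pp_subspace S D T ==> ip0 p x = 0" if "x \<in> K" for x p using that by (auto simp: K_def cont_iff)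
 have bD: "b i \<in> D" "b i \<in> sp0" "shifted (of_real l) (b i) = 0" if "i < r" for i using b(1)[OF that] D_sub by (auto simp: eigenspace_def shifted_def)
 \<comment> \<open>The continuous part of (T - l) x has a preimage \<open>k\<close> in the
   continuous subspace. The rest p = x - k is orthogonal to this subspace, as every element of it is
   an image under T - l, so \<open>p\<close> lies in the closed span of the eigenvectors.\<close>
 have estimate: "nm0 x <= (1 / c + 1 / \<rho>) * nm0 (shifted (of_real l) x)"
  if x: "x \<in> D" and orth: "!!e. e \<in> eigenspace D T (of_real l) ==> ip0 e x = 0" for x
 proof -
  define y where "y = shifted (of_real l) x"
  have y0: "y \<in> sp0" by (simp add: y_def shifted_in x)
  obtain y1 where y1: "y1 \<in> pp_subspace S D T" "y - y1 \<in> K" using pp_projection[OF y0] unfolding K_def by blast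
  note y10 = pp_sub[OF y1(1)]
  have split: "(nm0 y)^2 = (nm0 y1)^2 + (nm0 (y - y1))^2" using H.nm_add_sq[OF y10 K0[OF y1(2)], of 1] Kpp[OF y1(2) y1(1)] by (simp add: scaleC_one)
  have y1_le: "nm0 y1 <= nm0 y" and y2_le: "nm0 (y - y1) <= nm0 y"
  proof -
   have "(nm0 y1)^2 <= (nm0 y)^2" "(nm0 (y - y1))^2 <= (nm0 y)^2" using split by simp_all
   thus "nm0 y1 <= nm0 y" "nm0 (y - y1) <= nm0 y" using H.nm_nonneg[OF y0] by (auto intro: power2_le_imp_le)
  qed
  obtain k where k: "k \<in> D" "k \<in> K" "shifted (of_real l) k = y - y1"
  proof -
   have "y - y1 \<in> shifted (of_real l) ` (D \<inter> K)" unfolding bij_betw_imp_surj_on[OF bij] by (rule y1(2))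
   then obtain k where "y - y1 = shifted (of_real l) k" "k \<in> D \<inter> K" by (rule imageE)
   thus thesis by (intro that[of k]) (simp_all only: Int_iff)
  qed
  have ck: "nm0 k <= nm0 y / c" using c(2)[OF k(1,2)] k(3) y2_le c(1) by (simp add: field_simps)
  define p where "p = x - k"
  have p: "p \<in> D" "shifted (of_real l) p = y1" using x k by (auto simp: p_def D_diff shifted_diff y_def)
  have p0: "p \<in> sp0" by (rule D_sub[OF p(1)])
  have pK: "ip0 p k' = 0" if k': "k' \<in> K" for k'
  proof -
   obtain k'' where k'': "k'' \<in> D" "k'' \<in> K" "shifted (of_real l) k'' = k'" proof -
    have "k' \<in> shifted (of_real l) ` (D \<inter> K)" unfolding bij_betw_imp_surj_on[OF bij] by (rule k')
    then obtain k'' where "k' = shifted (of_real l) k''" "k'' \<in> D \<inter> K" by (rule imageE)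
    thus thesis by (intro that[of k'']) (simp_all only: Int_iff)
   qed
   show ?thesis using shifted_adjoint[OF p(1) k''(1), of "of_real l"] k'' p(2) Kpp[OF k''(2) y1(1)] by simp
  qed
  obtain p1 where p1: "p1 \<in> pp_subspace S D T" "p - p1 \<in> K" using pp_projection[OF p0] unfolding K_def by blast
  have "ip0 (p - p1) (p - p1) = 0" using pK[OF p1(2)] Kpp[OF p1(2) p1(1)] H.q_diff_left[OF p0 pp_sub[OF p1(1)] K0[OF p1(2)]] by simp
  hence "p - p1 = 0" using H.definite[OF K0[OF p1(2)]] by force
  hence pp: "p \<in> pp_subspace S D T" using p1(1) by simp
  have "ip0 e p = 0" if e: "e \<in> eigenspace D T (of_real l)" for e
  proof -
   have "e \<in> cspan eigenvectors" using e by (intro complex_vector.span_base) blast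
   hence "ip0 e k = 0" using Kpp[OF k(2)] eigenvector_pp by blast
   moreover have "e \<in> sp0" using e D_sub by (auto simp: eigenspace_def)
   ultimately show ?thesis using orth[OF e] x k(1) by (simp add: p_def H.q_diff_right D_sub)
  qed
  from pp_gap_estimate[OF gap pp p(1) this] have "\<rho> * nm0 p <= nm0 y1" by (simp add: p(2))
  hence "nm0 p <= nm0 y / \<rho>" using y1_le gap(1) by (simp add: field_simps)
  moreover have "nm0 x <= nm0 k + nm0 p" using H.nm_triangle[OF D_sub[OF k(1)] p0] by (simp add: p_def)
  ultimately show ?thesis using ck by (simp add: y_def distrib_right)
 qed
 define proj where "proj n = (SUM i<r. ip0 (b i) (f n) *\<^sub>C b i)" for n
 have projD: "proj n \<in> D" for n unfolding proj_def using D bD by (intro complex_vector.subspace_sum complex_vector.subspace_scale) auto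
 have proj_shifted: "shifted (of_real l) (proj n) = 0" for n
 proof -
  have "proj n \<in> eigenspace D T (of_real l)" unfolding proj_def using b(1)
   by (intro complex_vector.subspace_sum complex_vector.subspace_scale eigenspace_subspace) auto
  thus ?thesis by (simp add: eigenspace_def shifted_def)
 qed
 have orth: "ip0 e (f n - proj n) = 0" if e: "e \<in> eigenspace D T (of_real l)" for e n
 proof -
  have fn: "f n \<in> sp0" and pn: "proj n \<in> sp0" using f projD D_sub by auto
  have bi: "ip0 (b i) (f n - proj n) = 0" if i: "i < r" for i
  proof -
   have "ip0 (b i) (proj n) = (SUM j<r. ip0 (b j) (f n) * ip0 (b i) (b j))" unfolding proj_def by (rule H.q_combination) (use bD i in auto)
   also have "... = (SUM j<r. if i = j then ip0 (b j) (f n) else 0)" using b(2) i by (intro sum.cong) auto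
   also have "... = ip0 (b i) (f n)" using i by simp
   finally show ?thesis using bD(2)[OF i] fn pn by (simp add: H.q_diff_right)
  qed
  have "ip0 (SUM i<r. ip0 (b i) e *\<^sub>C b i) (f n - proj n) = (SUM i<r. ip0 (ip0 (b i) e *\<^sub>C b i) (f n - proj n))"
   using bD fn pn by (intro H.q_sum_left) (auto simp: H.V_scale H.V_diff)
  also have "... = 0" using bD fn pn bi by (intro sum.neutral) (auto simp: H.q_scale_left H.V_diff)
  finally show ?thesis using basis[OF e] by simp
 qed
 have "nm0 (f n) <= (1 / c + 1 / \<rho>) * nm0 (shifted (of_real l) (f n)) + (SUM i<r. cmod (ip0 (b i) (f n)))" for n
 proof -
  have "nm0 (f n - proj n) <= (1 / c + 1 / \<rho>) * nm0 (shifted (of_real l) (f n))"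
   using estimate[OF D_diff[OF f projD] orth, of n] by (simp add: shifted_diff f projD proj_shifted)
  moreover have "nm0 (proj n) <= (SUM i<r. nm0 (ip0 (b i) (f n) *\<^sub>C b i))" unfolding proj_def using bD by (intro H.nm_sum) (auto simp: H.V_scale)
  moreover have "(SUM i<r. nm0 (ip0 (b i) (f n) *\<^sub>C b i)) = (SUM i<r. cmod (ip0 (b i) (f n)))"
  proof (intro sum.cong refl)
   fix i assume "i \<in> {..<r}"
   hence i: "i < r" by simp
   have "(nm0 (b i))^2 = 1" using H.nm_sq[OF bD(2)[OF i]] b(2)[OF i i] by simp
   hence "nm0 (b i) = 1" using H.nm_nonneg[OF bD(2)[OF i]] by (simp add: power2_eq_1_iff)
   thus "nm0 (ip0 (b i) (f n) *\<^sub>C b i) = cmod (ip0 (b i) (f n))" using bD(2)[OF i] by (simp add: H.nm_scale)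
  qed
  moreover have "nm0 (f n) <= nm0 (f n - proj n) + nm0 (proj n)" using H.nm_triangle[of "f n - proj n" 0 "proj n"] f projD D_sub by (simp add: H.V_diff)
  ultimately show ?thesis by linarith
 qed
 moreover have "(%n. (1 / c + 1 / \<rho>) * nm0 (shifted (of_real l) (f n)) + (SUM i<r. cmod (ip0 (b i) (f n)))) ---->
   (1 / c + 1 / \<rho>) * 0 + (SUM i<r. cmod 0)" by (intro tendsto_intros approx weak) (use bD in auto)
 ultimately have "(%n. nm0 (f n)) ----> 0"
  using H.nm_nonneg[OF D_sub[OF f]] by (intro Lim_null_comparison[of "%n. nm0 (f n)"]) (auto intro: always_eventually)
 from tendsto_power[OF this, of 2] have "(%n. (nm0 (f n))^2) ----> 0" by simp
 from LIMSEQ_unique[OF lim(1) this] show False using lim(2) by simp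
qed

end

section \<open>Eigenvalues near the unperturbed one\<close>

text \<open>The mean value inequality is applied to F minus its linear part in \<open>l\<close>,
  whose partial derivative is small near the point by continuity. This gives increments between two
  arbitrary nearby energies, uniformly in \<open>W\<close>.\<close>

lemma partial_derivative_estimate:
 fixes F :: "real \<times> 'x::real_normed_vector => 'b::real_normed_vector"
 assumes U: "open U" "(l0, W0) \<in> U" and F: "Ck_fun (Suc k) U F"
  and d: "(F has_derivative d) (at (l0, W0))" and \<eta>: "\<eta> > 0"
 shows "EX r>0. ALL \<mu> \<mu>' W. \<bar>\<mu> - l0\<bar> < r & \<bar>\<mu>' - l0\<bar> < r & norm (W - W0) < r -->
  norm (F (\<mu>, W) - F (\<mu>', W) - (\<mu> - \<mu>') *\<^sub>R d (1, 0)) <= \<eta> * \<bar>\<mu> - \<mu>'\<bar>"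
proof -
 interpret R: bounding "norm_bnd :: 'b => real => bool" by (rule bounding_norm)
 obtain f' where f': "!!x. x \<in> U ==> (F has_derivative (%h. f' x [h])) (at x)" "Ck norm_bnd k 1 U f'" using Ck_fun_SucD[OF F] by blast
 define g where "g x = f' x [(1, 0)]" for x
 have "Ck norm_bnd k 0 U (%x vs. f' x ((1, 0) # vs))" using R.Ck_fix f'(2) by simp
 hence "Ck_fun k U g" unfolding g_def by (rule Ck_cong[OF U(1), rotated]) simp
 hence cont: "isCont g (l0, W0)" using Ck_fun_isCont U(2) by blast
 have g0: "g (l0, W0) = d (1, 0)" using has_derivative_unique[OF f'(1)[OF U(2)] d] unfolding g_def by metis
 have "\<forall>\<^sub>F x in nhds (l0, W0). dist (g x) (d (1, 0)) < \<eta>"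
  using cont \<eta> unfolding isCont_def tendsto_at_iff_tendsto_nhds g0[symmetric] by (rule tendstoD)
 hence "\<forall>\<^sub>F x in nhds (l0, W0). dist (g x) (d (1, 0)) < \<eta> & x \<in> U" using eventually_nhds_in_open[OF U] by (rule eventually_conj)
 then obtain t where t: "t > 0" "!!x. dist x (l0, W0) < t ==> dist (g x) (d (1, 0)) < \<eta> & x \<in> U" unfolding eventually_nhds_metric by blast
 show ?thesis
 proof (intro exI[of _ "t / 2"] conjI allI impI)
  show "t / 2 > 0" using t by simp
  fix \<mu> \<mu>' W assume a: "\<bar>\<mu> - l0\<bar> < t / 2 & \<bar>\<mu>' - l0\<bar> < t / 2 & norm (W - W0) < t / 2"
  define J where "J = {l0 - t / 2<..<l0 + t / 2}"
  have near: "dist (g (l, W)) (d (1, 0)) < \<eta>" "(l, W) \<in> U" if "l \<in> J" for l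
  proof -
   have "dist (l, W) (l0, W0) <= norm (l - l0) + norm (W - W0)" using norm_Pair_le[of "l - l0" "W - W0"] by (simp add: dist_norm)
   also have "norm (l - l0) < t / 2" using that unfolding J_def real_norm_def by (simp only: greaterThanLessThan_iff) linarith
   finally have "dist (l, W) (l0, W0) < t" using a by simp
   thus "dist (g (l, W)) (d (1, 0)) < \<eta>" "(l, W) \<in> U" using t(2) by auto
  qed
  have "norm ((F (\<mu>, W) - \<mu> *\<^sub>R d (1, 0)) - (F (\<mu>', W) - \<mu>' *\<^sub>R d (1, 0))) <= \<eta> * norm (\<mu> - \<mu>')"
  proof (rule differentiable_bound[of J "%l. F (l, W) - l *\<^sub>R d (1, 0)" "%l h. h *\<^sub>R (g (l, W) - d (1, 0))"])
   show "convex J" by (simp add: J_def)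
   show "\<mu> \<in> J" "\<mu>' \<in> J" using conjunct1[OF a] conjunct1[OF conjunct2[OF a]] unfolding J_def by (simp_all only: greaterThanLessThan_iff) linarith+
   fix l assume l: "l \<in> J"
   have lin: "linear (%h. f' (l, W) [h])" using has_derivative_bounded_linear[OF f'(1)[OF near(2)[OF l]]] bounded_linear.linear by blast
   have "((%l. (l, W)) has_derivative (%h. (h, 0))) (at l)" by (auto intro!: derivative_eq_intros)
   from has_derivative_compose[OF this f'(1)[OF near(2)[OF l]]]
   have "((%l. F (l, W)) has_derivative (%h. f' (l, W) [(h, 0)])) (at l)" .
   moreover have "f' (l, W) [(h, 0)] = h *\<^sub>R g (l, W)" for h using linear_scale[OF lin, of h "(1, 0)"] by (simp add: g_def)
   ultimately have "((%l. F (l, W)) has_derivative (%h. h *\<^sub>R g (l, W))) (at l)" by simp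
   hence "((%l. F (l, W) - l *\<^sub>R d (1, 0)) has_derivative (%h. h *\<^sub>R g (l, W) - h *\<^sub>R d (1, 0))) (at l)"
    by (intro has_derivative_diff has_derivative_scaleR_left has_derivative_ident)
   thus "((%l. F (l, W) - l *\<^sub>R d (1, 0)) has_derivative (%h. h *\<^sub>R (g (l, W) - d (1, 0)))) (at l within J)"
    by (simp add: scaleR_diff_right has_derivative_at_withinI)
   show "onorm (%h. h *\<^sub>R (g (l, W) - d (1, 0))) <= \<eta>" proof (rule onorm_le)
    fix h :: real
    show "norm (h *\<^sub>R (g (l, W) - d (1, 0))) <= \<eta> * norm h" using near(1)[OF l] mult_left_mono[of "norm (g (l, W) - d (1, 0))" \<eta> "\<bar>h\<bar>"]
     by (simp add: dist_norm mult.commute)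
   qed
  qed
  thus "norm (F (\<mu>, W) - F (\<mu>', W) - (\<mu> - \<mu>') *\<^sub>R d (1, 0)) <= \<eta> * \<bar>\<mu> - \<mu>'\<bar>" by (simp add: algebra_simps)
 qed
qed

text \<open>Here \<open>T\<close> is H plus the projection onto the eigenspace and \<open>e\<close>
  a real orthonormal basis of it, so that \<open>l0\<close> is an eigenvalue of H while the
  \<open>e i\<close> belong to the eigenvalue l0 + 1 of \<open>T\<close>.\<close>

locale eigen_setting = real_lap S D T s \<iota> k l0 \<delta> c \<kappa> \<rho>
 for S :: "'v::complex_vector scale" and D T s and \<iota> :: "'x::banach => 'v => 'v" and k l0 \<delta> c \<kappa> \<rho> +
 fixes H :: "'v => 'v" and n :: nat and e :: "nat => 'v"
 assumes H_sa: "selfadjoint S D H"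
  and H_T: "f \<in> D ==> H f = T f - (SUM i<n. ip0 (e i) f *\<^sub>C e i)"
  and e_s: "i < n ==> e i \<in> sps" and e_real: "i < n ==> cj S (e i) = e i"
  and e_ortho: "i < n ==> j < n ==> ip0 (e i) (e j) = (if i = j then 1 else 0)"
  and e_D: "i < n ==> e i \<in> D" and T_e: "i < n ==> T (e i) = of_real (l0 + 1) *\<^sub>C e i"
begin

sublocale HP: perturbation S D H s \<iota>
 by (intro perturbation.intro selfadj.intro selfadj_axioms.intro hscale_axioms H_sa perturbation_axioms.intro s_pos pert)

abbreviation HW :: "'x => 'v => 'v" where "HW W \<equiv> %f. H f + \<iota> W f"

definition Pr :: "'v => 'v" where "Pr f = (SUM i<n. ip0 (e i) f *\<^sub>C e i)"

lemma e_0: "i < n ==> e i \<in> sp0" using e_s sp_s by blast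

lemma Pr_s: "Pr f \<in> sps" unfolding Pr_def by (intro H.V_sum H.V_scale e_s) auto

lemma Pr_0: "Pr f \<in> sp0" using Pr_s sp_s by blast

lemma HW_T: "f \<in> D ==> HW W f = TW W f - Pr f"
 by (simp add: H_T Pr_def)

lemma ip_Pr: "f \<in> sp0 ==> ip0 f (Pr g) = (SUM i<n. ip0 (e i) g * ip0 f (e i))"
 unfolding Pr_def by (rule H.q_combination) (use e_0 in auto)

lemma e_Pr: "i < n ==> ip0 (e i) (Pr g) = ip0 (e i) g"
proof -
 assume i: "i < n"
 have "ip0 (e i) (Pr g) = (SUM j<n. if i = j then ip0 (e j) g else 0)" unfolding ip_Pr[OF e_0[OF i]] using e_ortho i by (intro sum.cong) auto
 thus ?thesis using i by simp
qed

lemma Pr_symmetric: "f \<in> sp0 ==> g \<in> sp0 ==> ip0 (Pr f) g = ip0 (Pr f) (Pr g)"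
 "f \<in> sp0 ==> g \<in> sp0 ==> ip0 f (Pr g) = ip0 (Pr f) (Pr g)"
proof -
 have 1: "ip0 (Pr f) g = ip0 (Pr f) (Pr g)" if f: "f \<in> sp0" and g: "g \<in> sp0" for f g
 proof -
  have "ip0 (Pr f) h = (SUM i<n. cnj (ip0 (e i) f) * ip0 (e i) h)" if "h \<in> sp0" for h
   unfolding Pr_def by (subst H.q_sum_left[OF that]) (auto simp: that e_0 H.V_scale H.q_scale_left)
  thus ?thesis using g Pr_0 e_Pr by simp
 qed
 thus "f \<in> sp0 ==> g \<in> sp0 ==> ip0 (Pr f) g = ip0 (Pr f) (Pr g)" .
 show "ip0 f (Pr g) = ip0 (Pr f) (Pr g)" if "f \<in> sp0" "g \<in> sp0" using 1[OF that(2,1)] H.q_herm[OF that(1) Pr_0] H.q_herm[OF Pr_0 Pr_0, of f g] by simp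
qed

lemma Pr_add: "f \<in> sp0 ==> g \<in> sp0 ==> Pr (f + g) = Pr f + Pr g"
 unfolding Pr_def by (simp add: e_0 H.q_add_right scaleC_add_left sum.distrib)

lemma Pr_scale: "f \<in> sp0 ==> Pr (a *\<^sub>C f) = a *\<^sub>C Pr f"
 unfolding Pr_def by (simp add: e_0 H.q_scale_right complex_vector.scale_sum_right scaleC_scaleC)

lemma Pr_sum: "finite J ==> (!!i. i \<in> J ==> f i \<in> sp0) ==> Pr (SUM i:J. a i *\<^sub>C f i) = (SUM i:J. a i *\<^sub>C Pr (f i))"
proof (induction J rule: finite_induct)
 case empty
 show ?case using Pr_scale[OF H.V_zero, of 0] by simp
qed (simp add: Pr_add Pr_scale H.V_sum H.V_scale)

text \<open>Off the axis the resolvent of an eigenvector is explicit, and the limit is taken in the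
  pairing; the bound on \<open>l\<close> stays clear of the pole at l0 + 1.\<close>

lemma Y_e:
 assumes l: "l \<in> I" "l < l0 + 1" and j: "j < n"
 shows "Y (l, 0) (e j) = of_real (1 / (l0 + 1 - l)) *\<^sub>C e j"
proof -
 define v where "v = of_real (1 / (l0 + 1 - l)) *\<^sub>C e j"
 have v: "v \<in> spm" using e_0[OF j] sp_ms H.V_scale by (simp add: v_def del: of_real_divide)
 note Yin = Y_in[OF U_zero[OF l(1)], of "e j"]
 have "Y (l, 0) (e j) - v = 0"
 proof (rule pairing_separates[of _ s])
  show "Y (l, 0) (e j) - v \<in> spm" using Yin v by (rule H.V_diff)
  fix f assume f: "f \<in> sps"
  have lim1: "((%eps. ip0 f (Rv 0 l eps (e j))) \<longlongrightarrow> pr f (Y (l, 0) (e j))) (at_right 0)"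
   by (rule boundary_limits(1)[OF U_zero[OF l(1)] f e_s[OF j]])
  have lim2: "((%eps. 1 / (of_real (l0 + 1) - Complex l eps) * ip0 f (e j)) \<longlongrightarrow>
    1 / (of_real (l0 + 1) - Complex l 0) * ip0 f (e j)) (at_right 0)" using l(2) by (intro tendsto_intros tendsto_Complex) (auto simp: complex_eq_iff)
  have ev: "\<forall>\<^sub>F eps in at_right 0. 1 / (of_real (l0 + 1) - Complex l eps) * ip0 f (e j) = ip0 f (Rv 0 l eps (e j))"
   using eventually_at_right_less[of "0::real"]
  proof eventually_elim
   case (elim eps)
   define z where "z = Complex l eps"
   have z: "Im z ~= 0" "of_real (l0 + 1) - z ~= 0" using elim by (auto simp: z_def complex_eq_iff)
   have "P.shifted 0 z ((1 / (of_real (l0 + 1) - z)) *\<^sub>C e j) = (1 / (of_real (l0 + 1) - z)) *\<^sub>C P.shifted 0 z (e j)" by (rule P.shifted_scale[OF e_D[OF j]])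
   also have "P.shifted 0 z (e j) = (of_real (l0 + 1) - z) *\<^sub>C e j"
    unfolding P.shifted_def by (simp add: \<iota>_zero T_e[OF j] complex_vector.scale_left_diff_distrib)
   finally have "P.shifted 0 z ((1 / (of_real (l0 + 1) - z)) *\<^sub>C e j) = e j" using z(2) by (simp add: scaleC_scaleC scaleC_one)
   from P.R_unique[OF z(1) D_scale[OF e_D[OF j]] this]
   have "Rv 0 l eps (e j) = (1 / (of_real (l0 + 1) - z)) *\<^sub>C e j" by (simp add: z_def)
   thus ?case using f e_0[OF j] sp_s by (simp add: H.q_scale_right z_def)
  qed
  have "pr f (Y (l, 0) (e j)) = 1 / (of_real (l0 + 1) - Complex l 0) * ip0 f (e j)"
   by (rule tendsto_unique[OF trivial_limit_at_right_real lim1 Lim_transform_eventually[OF lim2 ev]])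
  also have "... = pr f v" using f e_0[OF j] sp_s by (simp add: v_def pairing_0' H.V_scale H.q_scale_right complex_of_real_def[symmetric] complex_eq_iff)
  finally have "pr f (Y (l, 0) (e j) - v) = 0" using pairing_diff_right[OF f Yin v] by simp
  thus "pr (Y (l, 0) (e j) - v) f = 0" using pairing_herm[of f s "Y (l, 0) (e j) - v"] f Yin v by (simp add: H.V_diff)
 qed
 thus ?thesis by (simp add: v_def)
qed

lemma l0_U: "(l0, 0) \<in> U" and l0_I: "l0 \<in> I"
 using \<delta>_pos U_zero by auto

lemma Y_e0: "j < n ==> Y (l0, 0) (e j) = e j"
 using Y_e[OF l0_I, of j] by (simp add: scaleC_one)

lemma pairing_Y_e_derivative:
 assumes f: "f \<in> sps" and j: "j < n"
 obtains d where "((%x. pr f (Y x (e j))) has_derivative d) (at (l0, 0))" "d (1, 0) = ip0 f (e j)"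
  "!!V. d (0, V) = - pr f (Y (l0, 0) (\<iota> V (e j)))"
proof -
 obtain d where d: "((%x. pr f (Y x (e j))) has_derivative d) (at (l0, 0))"
  "!!V. d (0, V) = - pr f (bv (- 1) l0 0 (\<iota> V (bv (- 1) l0 0 (e j))))" by (rule pairing_Y_derivative[OF k_pos f e_s[OF j]]) (rule that; assumption)
 have bv_e: "bv (- 1) l0 0 (e j) = e j" using Y_e0[OF j] by (simp add: Y_def)
 have "d (1, 0) = ip0 f (e j)"
 proof -
  have "((%l. (l, 0 :: 'x)) has_derivative (%h. (h, 0))) (at l0)" by (auto intro!: derivative_eq_intros)
  from has_derivative_compose[OF this d(1)]
  have 1: "((%l. pr f (Y (l, 0) (e j))) has_derivative (%h. d (h, 0))) (at l0)" .
  have "((%l. (1 / (l0 + 1 - l)) *\<^sub>R ip0 f (e j)) has_derivative (%h. h *\<^sub>R ip0 f (e j))) (at l0)"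
   by (auto intro!: derivative_eq_intros simp: power2_eq_square)
  hence 2: "((%l. pr f (Y (l, 0) (e j))) has_derivative (%h. h *\<^sub>R ip0 f (e j))) (at l0)"
  proof (rule has_derivative_transform_within_open)
   show "open (I \<inter> {..<l0 + 1})" by (intro open_Int open_greaterThanLessThan open_lessThan)
   show "l0 \<in> I \<inter> {..<l0 + 1}" using l0_I by simp
   fix l assume "l \<in> I \<inter> {..<l0 + 1}"
   hence "Y (l, 0) (e j) = of_real (1 / (l0 + 1 - l)) *\<^sub>C e j" using Y_e[of l j] j by blast
   thus "(1 / (l0 + 1 - l)) *\<^sub>R ip0 f (e j) = pr f (Y (l, 0) (e j))" using f e_0[OF j] sp_s
    by (simp add: pairing_0' H.V_scale H.q_scale_right scaleR_conv_of_real)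
  qed
  from has_derivative_unique[OF 1 2] have "(%h. d (h, 0)) = (%h. h *\<^sub>R ip0 f (e j))" .
  from fun_cong[OF this, of 1] show ?thesis by simp
 qed
 thus thesis using that[OF d(1)] d(2) unfolding bv_e by (simp add: Y_def)
qed

text \<open>The l-derivative of 1 / (l0 + 1 - l) at \<open>l0\<close> is 1, so the matrix <e_i, Y
  e_j> moves with \<open>l\<close> almost like a multiple of the identity, also for small
  \<open>W\<close>. This is what keeps eigenvalues of H + W apart from each other.\<close>

lemma matrix_estimate:
 assumes \<eta>: "\<eta> > 0"
 shows "EX r>0. ALL i<n. ALL j<n. ALL \<mu> \<mu>' W. \<bar>\<mu> - l0\<bar> < r & \<bar>\<mu>' - l0\<bar> < r & norm W < r -->
  cmod (pr (e i) (Y (\<mu>, W) (e j)) - pr (e i) (Y (\<mu>', W) (e j)) - (\<mu> - \<mu>') *\<^sub>R (if i = j then 1 else 0))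
   <= \<eta> * \<bar>\<mu> - \<mu>'\<bar>"
proof -
 obtain m where m: "k = Suc m" using k_pos by (cases k) auto
 have "EX r>0. ALL \<mu> \<mu>' W. \<bar>\<mu> - l0\<bar> < r & \<bar>\<mu>' - l0\<bar> < r & norm (W - 0) < r -->
  cmod (pr (e i) (Y (\<mu>, W) (e j)) - pr (e i) (Y (\<mu>', W) (e j)) - (\<mu> - \<mu>') *\<^sub>R (if i = j then 1 else 0))
   <= \<eta> * \<bar>\<mu> - \<mu>'\<bar>" if ij: "i < n" "j < n" for i j
 proof -
  obtain d where d: "((%x. pr (e i) (Y x (e j))) has_derivative d) (at (l0, 0))" "d (1, 0) = ip0 (e i) (e j)"
   by (rule pairing_Y_e_derivative[OF e_s[OF ij(1)] ij(2)]) (rule that; assumption)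
  from partial_derivative_estimate[OF open_U l0_U pairing_Y_Ck[OF e_s[OF ij(1)] e_s[OF ij(2)], unfolded m] d(1) \<eta>]
  show ?thesis unfolding d(2) e_ortho[OF ij] .
 qed
 then obtain r where r: "!!i j. i < n ==> j < n ==> r i j > 0"
  "!!i j \<mu> \<mu>' W. i < n ==> j < n ==> \<bar>\<mu> - l0\<bar> < r i j ==> \<bar>\<mu>' - l0\<bar> < r i j ==> norm W < r i j ==>
  cmod (pr (e i) (Y (\<mu>, W) (e j)) - pr (e i) (Y (\<mu>', W) (e j)) - (\<mu> - \<mu>') *\<^sub>R (if i = j then 1 else 0))
   <= \<eta> * \<bar>\<mu> - \<mu>'\<bar>" unfolding diff_zero by metis
 define A where "A = insert 1 ((%(i, j). r i j) ` ({..<n} \<times> {..<n}))"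
 have A: "finite A" "A ~= {}" "!!a. a \<in> A ==> a > 0" using r(1) by (auto simp: A_def)
 have le: "Min A <= r i j" if "i < n" "j < n" for i j using A(1) that by (intro Min_le) (auto simp: A_def)
 show ?thesis
 proof (intro exI[of _ "Min A"] conjI allI impI)
  show "Min A > 0" using A by simp
  fix i j :: nat and \<mu> \<mu>' :: real and W :: 'x assume "i < n" "j < n" "\<bar>\<mu> - l0\<bar> < Min A & \<bar>\<mu>' - l0\<bar> < Min A & norm W < Min A"
  thus "cmod (pr (e i) (Y (\<mu>, W) (e j)) - pr (e i) (Y (\<mu>', W) (e j)) - (\<mu> - \<mu>') *\<^sub>R (if i = j then 1 else 0))
   <= \<eta> * \<bar>\<mu> - \<mu>'\<bar>" using le[of i j] by (intro r(2)) auto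
 qed
qed

text \<open>An eigenvector satisfies (T_W - mu) phi = P_0 phi, so off the axis R P_0 phi differs
  from phi by (z - mu) R phi, which vanishes weakly against H_s. Thus phi is recovered from its
  projection.\<close>

lemma eigenvector_boundary:
 assumes x: "(\<mu>, W) \<in> U" and \<phi>: "\<phi> \<in> eigenspace D (HW W) (of_real \<mu>)" and f: "f \<in> sps"
 shows "pr f (Y (\<mu>, W) (Pr \<phi>)) = ip0 f \<phi>" "pr (Pr \<phi>) (Y (\<mu>, W) f) = ip0 \<phi> f"
proof -
 have \<phi>D: "\<phi> \<in> D" "HW W \<phi> = of_real \<mu> *\<^sub>C \<phi>" using \<phi> by (auto simp: eigenspace_def)
 have \<phi>0: "\<phi> \<in> sp0" using D_sub \<phi>D(1) .
 note f0 = sp_s[OF f]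
 have sh: "P.shifted W z \<phi> = Pr \<phi> - (z - of_real \<mu>) *\<^sub>C \<phi>" for z using \<phi>D HW_T[OF \<phi>D(1), of W] unfolding P.shifted_def
  by (simp add: algebra_simps complex_vector.scale_left_diff_distrib)
 \<comment> \<open>eps |R f| is the square root of eps times eps |R f|^2, and the latter factor
   converges.\<close>
 have small: "((%eps. eps * nm0 (Rv W \<mu> eps f)) \<longlongrightarrow> 0) (at_right 0)"
 proof -
  have "((%eps. eps * (eps * (nm0 (Rv W \<mu> eps f))^2)) \<longlongrightarrow> 0 * Re (q (\<mu>, W) f f)) (at_right 0)"
   by (intro tendsto_intros vertical_limit[OF x f])
  hence "((%eps. sqrt (eps * (eps * (nm0 (Rv W \<mu> eps f))^2))) \<longlongrightarrow> sqrt (0 * Re (q (\<mu>, W) f f))) (at_right 0)"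
   by (rule tendsto_real_sqrt)
  hence "((%eps. sqrt (eps * (eps * (nm0 (Rv W \<mu> eps f))^2))) \<longlongrightarrow> 0) (at_right 0)" by simp
  moreover have "\<forall>\<^sub>F eps in at_right 0. sqrt (eps * (eps * (nm0 (Rv W \<mu> eps f))^2)) = eps * nm0 (Rv W \<mu> eps f)"
   using eventually_at_right_less[of "0::real"]
  proof eventually_elim
   case (elim eps)
   have "eps * (eps * (nm0 (Rv W \<mu> eps f))^2) = (eps * nm0 (Rv W \<mu> eps f))^2" by (simp add: power2_eq_square)
   moreover have "0 <= eps * nm0 (Rv W \<mu> eps f)" using elim H.nm_nonneg[OF P.R_in[of "Complex \<mu> eps", OF _ f0]] by simp
   ultimately show ?case by simp
  qed
  ultimately show ?thesis by (rule Lim_transform_eventually)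
 qed
 \<comment> \<open><f, R f> at conjugate points has conjugate values, so \<open>Im_ip_R\<close>
   gives the same norm; the adjoint in the next estimate needs the conjugate point.\<close>
 have norm_eq: "nm0 (RT W (cnj (Complex \<mu> eps)) f) = nm0 (Rv W \<mu> eps f)" if "eps > 0" for eps
 proof -
  define z where "z = Complex \<mu> eps"
  have z: "Im z ~= 0" "Im (cnj z) ~= 0" "Im z = eps" using that by (auto simp: z_def)
  note r = P.R_in[OF z(1) f0, of W] P.R_in[OF z(2) f0, of W]
  have "ip0 f (RT W (cnj z) f) = cnj (ip0 f (RT W z f))" using P.R_adjoint[OF z(1) f0 f0, of W] H.q_herm[OF r(1) f0] by simp
  hence "(nm0 (RT W (cnj z) f))^2 = (nm0 (RT W z f))^2" using P.Im_ip_R[OF z(1) f0, of W] P.Im_ip_R[OF z(2) f0, of W] z(1) by simp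
  thus ?thesis using H.nm_nonneg r by (simp add: z_def power2_eq_iff_nonneg)
 qed
 have lim: "((%eps. ip0 f (RT W (w eps) (Pr \<phi>))) \<longlongrightarrow> ip0 f \<phi>) (at_right 0)"
  if w: "!!eps. eps > 0 ==> w eps = Complex \<mu> eps \<or> w eps = cnj (Complex \<mu> eps)" for w
 proof (rule LIM_zero_cancel, rule Lim_null_comparison[OF _ tendsto_mult_right_zero[OF small, of "nm0 \<phi>"]])
  show "\<forall>\<^sub>F eps in at_right 0. norm (ip0 f (RT W (w eps) (Pr \<phi>)) - ip0 f \<phi>) <= nm0 \<phi> * (eps * nm0 (Rv W \<mu> eps f))"
   using eventually_at_right_less[of "0::real"]
  proof eventually_elim
   case (elim eps)
   define z where "z = w eps"
   have z: "Im z ~= 0" "Im (cnj z) ~= 0" "cmod (z - of_real \<mu>) = eps" "nm0 (RT W (cnj z) f) = nm0 (Rv W \<mu> eps f)"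
    using w[OF elim] elim norm_eq[OF elim] by (auto simp: z_def cmod_def)
   have "\<phi> = RT W z (Pr \<phi>) - (z - of_real \<mu>) *\<^sub>C RT W z \<phi>"
    using P.R_shifted[OF z(1) \<phi>D(1), of W] Pr_0 \<phi>0 unfolding sh by (simp add: P.R_diff[OF z(1)] P.R_scale[OF z(1)] H.V_scale)
   hence "RT W z (Pr \<phi>) = \<phi> + (z - of_real \<mu>) *\<^sub>C RT W z \<phi>" by (simp add: algebra_simps)
   hence "ip0 f (RT W z (Pr \<phi>)) - ip0 f \<phi> = (z - of_real \<mu>) * ip0 (RT W (cnj z) f) \<phi>"
    using P.R_adjoint[OF z(2) f0 \<phi>0, of W] f0 \<phi>0 P.R_in[OF z(1) \<phi>0] by (simp add: H.q_add_right H.q_scale_right H.V_scale)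
   thus ?case using H.cauchy_schwarz[OF P.R_in[OF z(2) f0, of W] \<phi>0] elim by (simp add: z_def[symmetric] norm_mult z(3,4) mult_ac)
  qed
 qed
 show "pr f (Y (\<mu>, W) (Pr \<phi>)) = ip0 f \<phi>" by (rule tendsto_unique[OF trivial_limit_at_right_real boundary_limits(1)[OF x f Pr_s] lim]) simp
 have "((%eps. cnj (ip0 f (RT W (cnj (Complex \<mu> eps)) (Pr \<phi>)))) \<longlongrightarrow> cnj (ip0 f \<phi>)) (at_right 0)"
  by (intro tendsto_cnj lim) simp
 hence "((%eps. ip0 (Pr \<phi>) (Rv W \<mu> eps f)) \<longlongrightarrow> cnj (ip0 f \<phi>)) (at_right 0)"
 proof (rule Lim_transform_eventually)
  show "\<forall>\<^sub>F eps in at_right 0. cnj (ip0 f (RT W (cnj (Complex \<mu> eps)) (Pr \<phi>))) = ip0 (Pr \<phi>) (Rv W \<mu> eps f)"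
   using eventually_at_right_less[of "0::real"]
  proof eventually_elim
   case (elim eps)
   hence z: "Im (cnj (Complex \<mu> eps)) ~= 0" by simp
   show ?case using P.R_adjoint[OF z Pr_0 f0, of W] H.q_herm[OF P.R_in[OF z Pr_0] f0] by simp
  qed
 qed
 from tendsto_unique[OF trivial_limit_at_right_real boundary_limits(1)[OF x Pr_s f] this]
 show "pr (Pr \<phi>) (Y (\<mu>, W) f) = ip0 \<phi> f" using H.q_herm[OF \<phi>0 f0] by simp
qed

text \<open>By \<open>eigenvector_boundary\<close> a vanishing projection makes phi orthogonal to
  the dense space H_s.\<close>

lemma Pr_eigenvector_nonzero:
 assumes x: "(\<mu>, W) \<in> U" and \<phi>: "\<phi> \<in> eigenspace D (HW W) (of_real \<mu>)" and z: "Pr \<phi> = 0"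
 shows "\<phi> = 0"
proof -
 have \<phi>0: "\<phi> \<in> sp0" using \<phi> D_sub by (auto simp: eigenspace_def)
 have Y0: "Y (\<mu>, W) 0 = 0" using blin_zero[OF bopD(1)[OF Y_bop[OF x]]] .
 have f\<phi>: "ip0 f \<phi> = 0" if "f \<in> sps" for f using eigenvector_boundary(1)[OF x \<phi> that] z Y0 pairing_zero_right[OF that] by simp
 have "nm0 \<phi> <= 0"
 proof (rule field_le_epsilon)
  fix r :: real assume r: "r > 0"
  obtain g where g: "g \<in> sps" "nm0 (\<phi> - g) < r" using dense[OF s_pos \<phi>0 r] by blast
  have "(nm0 \<phi>)^2 = Re (ip0 (\<phi> - g) \<phi>)" using \<phi>0 sp_s[OF g(1)] f\<phi>[OF g(1)] by (simp add: H.nm_sq H.q_diff_left)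
  also have "... <= nm0 (\<phi> - g) * nm0 \<phi>" using H.cauchy_schwarz[OF H.V_diff[OF \<phi>0 sp_s[OF g(1)]] \<phi>0] complex_Re_le_cmod order_trans by blast
  also have "... <= r * nm0 \<phi>" using g(2) H.nm_nonneg[OF \<phi>0] by (intro mult_right_mono) auto
  finally show "nm0 \<phi> <= 0 + r" using H.nm_nonneg[OF \<phi>0] r by (cases "nm0 \<phi> = 0") (auto simp: power2_eq_square)
 qed
 thus ?thesis using H.nm_eq_0[OF \<phi>0] H.nm_nonneg[OF \<phi>0] by simp
qed

end

lemma (in hscale) pairing_combination_right:
 assumes "f \<in> sp S t" "!!i. i \<in> J ==> u i \<in> sp S (- t)"
 shows "pr f (SUM i:J. c i *\<^sub>C u i) = (SUM i:J. c i * pr f (u i))"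
 using assms(2)
proof (induction J rule: infinite_finite_induct)
 case (insert i J)
 thus ?case using assms(1) by (simp add: pairing_add_right[of _ t] pairing_scale_right[of _ t] H.V_scale H.V_sum)
qed (simp_all add: pairing_zero_right[OF assms(1)])

lemma (in hscale) pairing_combination_left:
 assumes "u \<in> sp S (- t)" "!!i. i \<in> J ==> f i \<in> sp S t"
 shows "pr (SUM i:J. c i *\<^sub>C f i) u = (SUM i:J. cnj (c i) * pr (f i) u)"
proof -
 have "pr (SUM i:J. c i *\<^sub>C f i) u = cnj (pr u (SUM i:J. c i *\<^sub>C f i))" using assms by (intro pairing_herm) (auto intro: H.V_sum H.V_scale)
 also have "... = (SUM i:J. cnj (c i) * cnj (pr u (f i)))" using assms by (subst pairing_combination_right[of _ "- t"]) auto
 also have "... = (SUM i:J. cnj (c i) * pr (f i) u)" using pairing_herm[OF assms(2,1)] by (intro sum.cong) auto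
 finally show ?thesis .
qed

lemma (in hscale) blin_combination:
 assumes "T \<in> blin S a b" "!!i. i \<in> J ==> f i \<in> sp S a"
 shows "T (SUM i:J. c i *\<^sub>C f i) = (SUM i:J. c i *\<^sub>C T (f i))"
 using assms(2)
proof (induction J rule: infinite_finite_induct)
 case (insert i J)
 thus ?case using blinD(2,3)[OF assms(1)] by (simp add: H.V_scale H.V_sum)
qed (simp_all add: blin_zero[OF assms(1)])

context eigen_setting
begin

lemma pairing_Pr:
 assumes "x \<in> U"
 shows "pr (Pr f) (Y x (Pr g)) =
  (SUM a<n. SUM b<n. cnj (ip0 (e a) f) * ip0 (e b) g * pr (e a) (Y x (e b)))"
proof -
 have Yb: "Y x \<in> blin S s (- s)" by (rule bopD(1)[OF Y_bop[OF assms]])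
 have "pr (Pr f) (Y x (Pr g)) = (SUM a<n. cnj (ip0 (e a) f) * pr (e a) (Y x (Pr g)))"
  unfolding Pr_def[of f] using e_s blin_in[OF Yb] by (intro pairing_combination_left) auto
 also have "... = (SUM a<n. cnj (ip0 (e a) f) * (SUM b<n. ip0 (e b) g * pr (e a) (Y x (e b))))"
 proof (intro sum.cong refl)
  fix a assume "a \<in> {..<n}"
  have "Y x (Pr g) = (SUM b<n. ip0 (e b) g *\<^sub>C Y x (e b))" unfolding Pr_def using e_s by (intro blin_combination[OF Yb]) auto
  thus "cnj (ip0 (e a) f) * pr (e a) (Y x (Pr g)) =
    cnj (ip0 (e a) f) * (SUM b<n. ip0 (e b) g * pr (e a) (Y x (e b)))"
   using pairing_combination_right[OF e_s, of a "{..<n}" "%b. Y x (e b)"] blin_in[OF Yb] \<open>a \<in> _\<close> by simp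
 qed
 finally show ?thesis by (simp add: sum_distrib_left mult.assoc)
qed

lemma e_norm: "i < n ==> nm0 (e i) = 1"
 using H.nm_sq[OF e_0, of i] e_ortho[of i i] H.nm_nonneg[OF e_0, of i] by (simp add: power2_eq_1_iff)

lemma Pr_span: "Pr f \<in> cspan (e ` {..<n})"
 unfolding Pr_def by (intro complex_vector.span_sum complex_vector.span_scale complex_vector.span_base) auto

text \<open>With boundary values at mu, respectively mu', the pairing of the two projections equals
  <P_0 phi, P_0 xi> both times. The difference is 0, while \<open>matrix_estimate\<close> computes
  it as (mu - mu') <P_0 phi, P_0 xi> up to a small multiple of |mu - mu'|.\<close>

lemma eigen_almost_orthogonal:
 assumes x: "(\<mu>, W) \<in> U" "(\<mu>', W) \<in> U" and ne: "\<mu> ~= \<mu>'"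
  and \<phi>: "\<phi> \<in> eigenspace D (HW W) (of_real \<mu>)" "nm0 (Pr \<phi>) = 1"
  and \<xi>: "\<xi> \<in> eigenspace D (HW W) (of_real \<mu>')" "nm0 (Pr \<xi>) = 1"
  and est: "!!i j. i < n ==> j < n ==>
   cmod (pr (e i) (Y (\<mu>, W) (e j)) - pr (e i) (Y (\<mu>', W) (e j)) - (\<mu> - \<mu>') *\<^sub>R (if i = j then 1 else 0))
   <= \<eta> * \<bar>\<mu> - \<mu>'\<bar>"
 shows "cmod (ip0 (Pr \<phi>) (Pr \<xi>)) <= real n * real n * \<eta>"
proof -
 have z: "\<phi> \<in> sp0" "\<xi> \<in> sp0" using \<phi>(1) \<xi>(1) D_sub by (auto simp: eigenspace_def)
 define c d where "c a = cnj (ip0 (e a) \<phi>)" and "d a = ip0 (e a) \<xi>" for a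
 have cd: "cmod (c a) <= 1" "cmod (d a) <= 1" if a: "a < n" for a
  using H.cauchy_schwarz[OF e_0[OF a] Pr_0, of \<phi>] H.cauchy_schwarz[OF e_0[OF a] Pr_0, of \<xi>] e_Pr[OF a] e_norm[OF a] \<phi>(2) \<xi>(2)
  by (simp_all add: c_def d_def)
 define E where "E a b = pr (e a) (Y (\<mu>, W) (e b)) - pr (e a) (Y (\<mu>', W) (e b)) - (\<mu> - \<mu>') *\<^sub>R (if a = b then 1 else 0)" for a b
 have "pr (Pr \<phi>) (Y (\<mu>, W) (Pr \<xi>)) = pr (Pr \<phi>) (Y (\<mu>', W) (Pr \<xi>))"
  using eigenvector_boundary(2)[OF x(1) \<phi>(1) Pr_s] eigenvector_boundary(1)[OF x(2) \<xi>(1) Pr_s]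
   Pr_symmetric[OF z] by simp
 hence "0 = (SUM a<n. SUM b<n. c a * d b * (pr (e a) (Y (\<mu>, W) (e b)) - pr (e a) (Y (\<mu>', W) (e b))))"
  unfolding pairing_Pr[OF x(1)] pairing_Pr[OF x(2)] by (simp add: c_def d_def right_diff_distrib sum_subtractf)
 also have "... = (SUM a<n. SUM b<n. c a * d b * E a b) + (\<mu> - \<mu>') *\<^sub>R (SUM a<n. c a * d a)"
 proof -
  have "(SUM a<n. SUM b<n. c a * d b * (pr (e a) (Y (\<mu>, W) (e b)) - pr (e a) (Y (\<mu>', W) (e b))))
    = (SUM a<n. SUM b<n. c a * d b * E a b + (if a = b then (\<mu> - \<mu>') *\<^sub>R (c a * d a) else 0))"
   by (intro sum.cong refl) (simp add: E_def right_diff_distrib)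
  thus ?thesis by (simp add: sum.distrib scaleR_sum_right)
 qed
 finally have 0: "(\<mu> - \<mu>') *\<^sub>R (SUM a<n. c a * d a) = - (SUM a<n. SUM b<n. c a * d b * E a b)" by (simp add: eq_neg_iff_add_eq_0 add.commute)
 have "ip0 (Pr \<phi>) (Pr \<xi>) = (SUM a<n. d a * ip0 (Pr \<phi>) (e a))" unfolding ip_Pr[OF Pr_0] by (simp add: d_def)
 also have "... = (SUM a<n. c a * d a)" using H.q_herm[OF Pr_0 e_0] e_Pr by (intro sum.cong refl) (simp add: c_def mult.commute)
 finally have "\<bar>\<mu> - \<mu>'\<bar> * cmod (ip0 (Pr \<phi>) (Pr \<xi>)) = cmod (SUM a<n. SUM b<n. c a * d b * E a b)" using arg_cong[OF 0, of cmod] by simp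
 also have "... <= (SUM a<n. SUM b<n. \<eta> * \<bar>\<mu> - \<mu>'\<bar>)"
 proof (intro order_trans[OF norm_sum] sum_mono)
  fix a b assume ab: "a \<in> {..<n}" "b \<in> {..<n}"
  have "cmod (c a * d b) <= 1 * 1" unfolding norm_mult using cd ab by (intro mult_mono) auto
  from mult_mono[OF this est[of a b]] ab show "cmod (c a * d b * E a b) <= \<eta> * \<bar>\<mu> - \<mu>'\<bar>" by (simp add: norm_mult E_def)
 qed
 also have "... = \<bar>\<mu> - \<mu>'\<bar> * (real n * real n * \<eta>)" by simp
 finally show ?thesis using ne by simp
qed

text \<open>More than n eigenvalues would give n + 1 almost orthonormal projections inside an
  n-dimensional space, against \<open>gram_l1\<close>.\<close>

lemma few_eigenvalues:
 "EX r>0. ALL W. norm W < r --> finite {\<mu>. \<bar>\<mu> - l0\<bar> < r & of_real \<mu> \<in> point_spectrum D (HW W)}"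
proof -
 \<comment> \<open>The Gram matrix of n + 1 vectors is off by n^2 \<eta> per entry, and
   \<open>gram_l1\<close> tolerates 1 / (2 (n + 1)).\<close>
 define N where "N = 2 * real (Suc n) * (real n * real n + 1)"
 define \<eta> where "\<eta> = 1 / N"
 have N: "N > 0" unfolding N_def by (intro mult_pos_pos add_nonneg_pos) auto
 have small: "real (Suc n) * (real n * real n * \<eta>) <= 1 / 2" using N by (simp add: \<eta>_def divide_le_eq) (simp add: N_def algebra_simps)
 have \<eta>: "\<eta> > 0" using N by (simp add: \<eta>_def)
 obtain r where r: "r > 0" and est: "!!i j \<mu> \<mu>' W. i < n ==> j < n ==> \<bar>\<mu> - l0\<bar> < r ==> \<bar>\<mu>' - l0\<bar> < r ==> norm (W :: 'x) < r ==>
  cmod (pr (e i) (Y (\<mu>, W) (e j)) - pr (e i) (Y (\<mu>', W) (e j)) - (\<mu> - \<mu>') *\<^sub>R (if i = j then 1 else 0)) <= \<eta> * \<bar>\<mu> - \<mu>'\<bar>"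
  using matrix_estimate[OF \<eta>] by blast
 define r' where "r' = min r (min \<delta> \<rho>)"
 have "finite {\<mu>. \<bar>\<mu> - l0\<bar> < r' & of_real \<mu> \<in> point_spectrum D (HW W)}" (is "finite ?Z") if W: "norm W < r'" for W :: 'x
 proof (rule conjunct1[OF finite_if_finite_subsets_card_bdd[of ?Z n]])
  fix G assume G: "G \<subseteq> ?Z" "finite G"
  show "card G <= n"
  proof (rule ccontr)
   assume "\<not> card G <= n"
   hence card: "Suc n <= card G" by simp
   obtain h where h: "bij_betw h {0..<card G} G" using ex_bij_betw_nat_finite[OF G(2)] by blast
   have hZ: "h i \<in> ?Z" if "i <= n" for i using bij_betwE[OF h] G(1) card that by auto
   have hU: "(h i, W) \<in> U" if "i <= n" for i using hZ[OF that] W by (auto simp: U_iff r'_def abs_less_iff)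
   have "EX \<phi>. \<phi> \<in> eigenspace D (HW W) (of_real (h i)) & nm0 (Pr \<phi>) = 1" if i: "i <= n" for i proof -
    obtain \<phi> where \<phi>: "\<phi> \<in> eigenspace D (HW W) (of_real (h i))" "\<phi> ~= 0" using hZ[OF i] by (auto simp: point_spectrum_def)
    have pos: "nm0 (Pr \<phi>) > 0" using Pr_eigenvector_nonzero[OF hU[OF i] \<phi>(1)] \<phi>(2) H.nm_nonneg[OF Pr_0] H.nm_eq_0[OF Pr_0] by (metis less_eq_real_def)
    have "\<phi> \<in> sp0" using \<phi>(1) D_sub by (auto simp: eigenspace_def)
    hence "nm0 (Pr (of_real (1 / nm0 (Pr \<phi>)) *\<^sub>C \<phi>)) = 1" using pos by (simp add: Pr_scale H.nm_scale[OF Pr_0] norm_divide)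
    thus ?thesis using complex_vector.subspace_scale[OF HP.P.eigenspace_subspace \<phi>(1)] by blast
   qed
   then obtain \<phi> where \<phi>: "!!i. i <= n ==> \<phi> i \<in> eigenspace D (HW W) (of_real (h i))" "!!i. i <= n ==> nm0 (Pr (\<phi> i)) = 1"
    by metis
   have gram: "cmod (ip0 (Pr (\<phi> i)) (Pr (\<phi> j)) - (if i = j then 1 else 0)) <= real n * real n * \<eta>" if ij: "i < Suc n" "j < Suc n" for i j
   proof (cases "i = j")
    case True
    thus ?thesis using \<phi>(2)[of j] ij \<eta> by (simp add: H.B_self[OF Pr_0])
   next
    case False
    hence "h i ~= h j" using h ij card by (auto simp: bij_betw_def inj_on_def)
    hence "cmod (ip0 (Pr (\<phi> i)) (Pr (\<phi> j))) <= real n * real n * \<eta>"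
     using ij hZ[of i] hZ[of j] W by (intro eigen_almost_orthogonal[of "h i" W "h j"] hU \<phi> est) (auto simp: r'_def)
    thus ?thesis using False by simp
   qed
   obtain a where a: "EX i<=n. a i ~= 0" "(SUM i<=n. a i *\<^sub>C Pr (\<phi> i)) = 0"
    using family_dependent[of "e ` {..<n}" n "%i. Pr (\<phi> i)"] Pr_span card_image_le[of "{..<n}" e] by auto
   have "(SUM j<Suc n. ip0 (Pr (\<phi> i)) (Pr (\<phi> j)) * a j) = 0" if "i < Suc n" for i proof -
    have "ip0 (Pr (\<phi> i)) (SUM i<=n. a i *\<^sub>C Pr (\<phi> i)) = (SUM j<=n. a j * ip0 (Pr (\<phi> i)) (Pr (\<phi> j)))"
     by (rule H.q_combination) (auto intro: Pr_0)
    thus ?thesis unfolding a(2) by (simp add: H.q_zero_right[OF Pr_0] lessThan_Suc_atMost mult.commute)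
   qed
   hence "(SUM i<Suc n. cmod (a i)) <= 0" using gram_l1[OF gram small, of a] by simp
   hence "ALL i:{..<Suc n}. cmod (a i) = 0" by (intro sum_nonneg_eq_0_iff[THEN iffD1] antisym sum_nonneg) auto
   thus False using a(1) by (metis lessThan_iff less_Suc_eq_le norm_eq_zero)
  qed
 qed
 moreover have "r' > 0" using r \<delta>_pos \<rho>_pos by (simp add: r'_def)
 ultimately show ?thesis by blast
qed

text \<open>The projection is injective on the eigenspace, so orthonormal families in it have at
  most \<open>n\<close> members and the exhaustion stops.\<close>

lemma eigen_basis:
 assumes x: "(l, W) \<in> U"
 obtains r :: nat and b where "!!i. i < r ==> b i \<in> eigenspace D (HW W) (of_real l)"
  "!!i j. i < r ==> j < r ==> ip0 (b i) (b j) = (if i = j then 1 else 0)"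
  "!!x. x \<in> eigenspace D (HW W) (of_real l) ==> x = (SUM i<r. ip0 (b i) x *\<^sub>C b i)"
proof -
 define M where "M = eigenspace D (HW W) (of_real l)"
 have M: "csubspace M" "M \<subseteq> sp0" unfolding M_def using HP.P.eigenspace_subspace D_sub by (auto simp: eigenspace_def)
 note sub = complex_vector.subspace_diff[OF M(1)] complex_vector.subspace_scale[OF M(1)] complex_vector.subspace_sum[OF M(1)]
 have bound: "r <= n" if b: "semi_form.ortho (ip0) b r M" for r b
 proof (rule H.ortho_bound[OF b M(2), of "e ` {..<n}" n Pr])
  show "finite (e ` {..<n})" "card (e ` {..<n}) <= n" using card_image_le[of "{..<n}" e] by auto
  show "Pr f \<in> cspan (e ` {..<n})" for f by (rule Pr_span)
  fix c g assume z: "(SUM i<=n. c i *\<^sub>C Pr (b i)) = 0" and bi: "!!i. i <= n ==> b i \<in> M" and g: "g \<in> M"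
  have "(SUM i<=n. c i *\<^sub>C b i) \<in> M" using bi by (intro sub) auto
  moreover have "Pr (SUM i<=n. c i *\<^sub>C b i) = 0" using Pr_sum[of "{..n}" b c] bi M(2) z by auto
  ultimately have "(SUM i<=n. c i *\<^sub>C b i) = 0" using Pr_eigenvector_nonzero[OF x] by (simp add: M_def)
  thus "ip0 g (SUM i<=n. c i *\<^sub>C b i) = 0" using H.q_zero_right g M(2) by auto
 qed
 have M0: "0 \<in> M" by (rule complex_vector.subspace_0[OF M(1)])
 have start: "semi_form.ortho (ip0) (%_. 0) 0 M" by (simp add: H.ortho_def)
 have cl: "x - ip0 b x *\<^sub>C b \<in> M" and sc: "of_real t *\<^sub>C x \<in> M" if "x \<in> M" "b \<in> M" for x b t using sub that by auto
 obtain r b where rb: "semi_form.ortho (ip0) b r M"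
  "!!x. x \<in> M ==> ip0 (x - (SUM i<r. ip0 (b i) x *\<^sub>C b i)) (x - (SUM i<r. ip0 (b i) x *\<^sub>C b i)) = 0"
  by (rule H.orthonormal_exhaustion[OF M(2) cl _ bound start])
   (assumption | rule sc M0 | (rule that; assumption))+
 show thesis
 proof (rule that[of r b])
  show "b i \<in> eigenspace D (HW W) (of_real l)" if "i < r" for i using rb(1) that by (auto simp: H.ortho_def M_def)
  show "ip0 (b i) (b j) = (if i = j then 1 else 0)" if "i < r" "j < r" for i j using rb(1) that by (auto simp: H.ortho_def)
  fix y assume y: "y \<in> eigenspace D (HW W) (of_real l)"
  have "y - (SUM i<r. ip0 (b i) y *\<^sub>C b i) \<in> sp0" using y rb(1) M(2) by (intro H.V_diff H.V_sum H.V_scale) (auto simp: M_def H.ortho_def)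
  hence "y - (SUM i<r. ip0 (b i) y *\<^sub>C b i) = 0" using rb(2)[of y] y H.definite[of _ 0] by (force simp: M_def)
  thus "y = (SUM i<r. ip0 (b i) y *\<^sub>C b i)" by simp
 qed
qed

text \<open>The Weyl sequence of T_W also serves H + W: the two operators differ by a finite-rank
  projection, which sends weakly null sequences to norm-null ones.\<close>

lemma embedded_of_positive:
 assumes x: "(l, W) \<in> U" and g: "g \<in> sps" "Re (q (l, W) g g) > 0" and near: "\<bar>l - l0\<bar> < r"
  and few: "finite {\<mu>. \<bar>\<mu> - l0\<bar> < r & of_real \<mu> \<in> point_spectrum D (HW W)}"
 shows "of_real l \<in> cont_spectrum S D (HW W)"
proof -
 obtain d where d: "d > 0" "!!\<mu>. \<bar>\<mu> - l0\<bar> < r ==> of_real \<mu> \<in> point_spectrum D (HW W) ==> \<mu> ~= l ==> d <= dist l \<mu>"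
  using finite_set_avoid[OF few, of l] by blast
 \<comment> \<open>The distance to the finitely many other eigenvalues within \<open>r\<close> of
   \<open>l0\<close>, or to the end of that interval for all the rest.\<close>
 define gap where "gap = min d (r - \<bar>l - l0\<bar>)"
 have gap: "gap > 0" using d(1) near by (simp add: gap_def)
 have gap': "gap <= cmod (z - of_real l)" if z: "z ~= of_real l" "z \<in> point_spectrum D (HW W)" for z
 proof -
  have "Im z = 0" using z(2) HP.P.eigenvalue_real by (auto simp: point_spectrum_def)
  hence zr: "z = of_real (Re z)" by (simp add: complex_eq_iff)
  hence "cmod (z - of_real l) = \<bar>Re z - l\<bar>" by (metis norm_of_real of_real_diff)
  moreover have "d <= \<bar>Re z - l\<bar>" if "\<bar>Re z - l0\<bar> < r" using d(2)[OF that] z zr by (metis dist_real_def abs_minus_commute)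
  ultimately show ?thesis by (cases "\<bar>Re z - l0\<bar> < r") (auto simp: gap_def min_def)
 qed
 obtain f :: "nat => 'v" where f: "!!n. f n \<in> D" "(%n. (nm0 (f n))^2) ----> Re (q (l, W) g g)"
  "(%n. nm0 (P.shifted W (of_real l) (f n))) ----> 0"
  "!!\<phi>. \<phi> \<in> sp0 ==> (%n. ip0 \<phi> (f n)) ----> 0" by (rule weyl_sequence[OF x g(1)]) (rule that; assumption)
 have approx: "(%n. nm0 (HP.P.shifted W (of_real l) (f n))) ----> 0"
 proof (rule Lim_null_comparison)
  show "(%n'. nm0 (P.shifted W (of_real l) (f n')) + (SUM i<n. cmod (ip0 (e i) (f n')))) ----> 0"
   by (intro tendsto_add_zero f(3) tendsto_null_sum tendsto_norm_zero f(4) e_0) simp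
  have "nm0 (HP.P.shifted W (of_real l) (f n')) <= nm0 (P.shifted W (of_real l) (f n')) + (SUM i<n. cmod (ip0 (e i) (f n')))" for n'
  proof -
   have "HP.P.shifted W (of_real l) (f n') = P.shifted W (of_real l) (f n') - Pr (f n')" using HW_T[OF f(1)[of n'], of W] by (simp add: HP.P.shifted_def P.shifted_def)
   moreover have "nm0 (Pr (f n')) <= (SUM i<n. nm0 (ip0 (e i) (f n') *\<^sub>C e i))" unfolding Pr_def using e_0 by (intro H.nm_sum) (auto intro: H.V_scale)
   moreover have "(SUM i<n. nm0 (ip0 (e i) (f n') *\<^sub>C e i)) = (SUM i<n. cmod (ip0 (e i) (f n')))"
    using e_0 e_norm by (intro sum.cong refl) (simp add: H.nm_scale)
   ultimately show ?thesis using H.nm_triangle_diff[OF P.shifted_in[OF f(1)[of n']] Pr_0, of W "of_real l" "f n'"] by simp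
  qed
  thus "\<forall>\<^sub>F n' in sequentially. norm (nm0 (HP.P.shifted W (of_real l) (f n')))
    <= nm0 (P.shifted W (of_real l) (f n')) + (SUM i<n. cmod (ip0 (e i) (f n')))" using H.nm_nonneg[OF HP.P.shifted_in[OF f(1)]] by (intro always_eventually) simp
 qed
 obtain k :: nat and b where basis:
  "!!i. i < k ==> b i \<in> eigenspace D (HW W) (of_real l)"
  "!!i j. i < k ==> j < k ==> ip0 (b i) (b j) = (if i = j then 1 else 0)"
  "!!x. x \<in> eigenspace D (HW W) (of_real l) ==> x = (SUM i<k. ip0 (b i) x *\<^sub>C b i)" by (rule eigen_basis[OF x]) (rule that; assumption)
 from HP.P.weyl_embedded[where f=f and b=b, OF gap gap' basis f(1,2) g(2) approx f(4)] show ?thesis .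
qed

end

section \<open>Consequences of the constant multiplicity\<close>

lemma (in hscale) real_parts:
 assumes f: "f \<in> sp S t" "0 <= t"
 obtains a b where "cj S a = a" "cj S b = b" "f = a + \<i> *\<^sub>C b"
  "!!M. csubspace M ==> f \<in> M ==> cj S f \<in> M ==> a \<in> M & b \<in> M"
proof (rule that[of "(1/2) *\<^sub>C (f + cj S f)" "(\<i> / 2) *\<^sub>C (cj S f - f)"])
 have cc: "cj S (cj S f) = f" using cj_cj sp_0[OF f(2,1)] by blast
 note [simp] = cj_scale[of _ t] cj_diff[of _ t] cj_add[of _ t] H.V_add H.V_diff H.V_scale cj_in
 show "cj S ((1/2) *\<^sub>C (f + cj S f)) = (1/2) *\<^sub>C (f + cj S f)" using f cc by (simp add: add.commute)
 show "cj S ((\<i> / 2) *\<^sub>C (cj S f - f)) = (\<i> / 2) *\<^sub>C (cj S f - f)" using f cc by simp (simp add: complex_vector.scale_right_diff_distrib)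
 have "(1/2) *\<^sub>C (f + cj S f) + \<i> *\<^sub>C (\<i> / 2) *\<^sub>C (cj S f - f) = (1/2 + 1/2 :: complex) *\<^sub>C f"
  unfolding scaleC_add_left by (simp add: scaleC_scaleC scaleC_add_right complex_vector.scale_right_diff_distrib)
 thus "f = (1/2) *\<^sub>C (f + cj S f) + \<i> *\<^sub>C (\<i> / 2) *\<^sub>C (cj S f - f)" by (simp add: scaleC_one)
qed (intro conjI complex_vector.subspace_scale complex_vector.subspace_add complex_vector.subspace_diff)

locale rank_setting = eigen_setting S D T s \<iota> k l0 \<delta> c \<kappa> \<rho> H n e
 for S :: "'v::complex_vector scale" and D T s and \<iota> :: "'x::banach => 'v => 'v" and k l0 \<delta> c \<kappa> \<rho> H n e +
 fixes m :: nat
 assumes rank: "l \<in> I ==> has_cdim (jump (l, 0) ` sps) m"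
begin

lemma jump_eq: "jump (l, W) = bv (- 1) l W - bv 1 l W"
 by (simp add: jump_def fun_eq_iff Y_def)

lemma jump_blin: "(l, W) \<in> U ==> jump (l, W) \<in> blin S s (- s)"
 unfolding jump_eq by (intro blin_diff_op bopD(1)[OF bv_props(2)]) auto

text \<open>With equal perturbations the last term of \<open>resolvent_difference\<close> drops out,
  so the jump of T_W is the jump of T between two bounded factors and its rank cannot grow.\<close>

lemma jump_span:
 assumes x: "(l, W) \<in> U"
 obtains B where "finite B" "card B <= m" "!!f. f \<in> sps ==> jump (l, W) f \<in> cspan B"
proof -
 have l: "l \<in> I" using x by (simp add: U_iff)
 obtain B where B: "finite B" "card B = m" "cspan B = jump (l, 0) ` sps" using rank[OF l] unfolding has_cdim_def by blast
 have B_in: "b \<in> spm" if "b \<in> B" for b using that complex_vector.span_base[of b B] blinD(1)[OF jump_blin[OF U_zero[OF l]]] unfolding B(3) by auto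
 have A: "A (l, W) \<in> blin S (- s) (- s)" by (rule bopD(1)[OF A_bop[OF x]])
 note bl = bopD(1)[OF bv_props(2)[OF _ x]] bopD(1)[OF bv_props(2)[OF _ U_zero[OF l]]]
 have "bv (- 1) l W - bv 1 l W = ((Id (- s) - (bv (- 1) l W o \<iota> W)) o ((bv (- 1) l 0 - bv 1 l 0) o (Id s - (\<iota> W o bv 1 l W)))) -
   (bv (- 1) l W o ((\<iota> W - \<iota> W) o bv 1 l W))" by (rule resolvent_difference[of _ s "- s"])
   (use bl \<iota>_blin[of W] bv_props(3)[of 1, OF _ x] bv_props(4)[of "-1", OF _ x] in auto)
 from fun_cong[OF this]
 have factor: "jump (l, W) f = A (l, W) (jump (l, 0) (Id s f - \<iota> W (bv 1 l W f)))" for f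
  using blin_zero[OF bl(1), of "- 1"] unfolding jump_eq A_def Wx_def Y_def by simp
 show thesis
 proof (rule that[of "A (l, W) ` B"])
  show "finite (A (l, W) ` B)" "card (A (l, W) ` B) <= m" using B card_image_le by auto
  fix f assume f: "f \<in> sps"
  have "Id s f - \<iota> W (bv 1 l W f) \<in> sps" using f \<iota>_in by (simp add: restrict_to_def H.V_diff)
  hence "jump (l, 0) (Id s f - \<iota> W (bv 1 l W f)) \<in> cspan B" unfolding B(3) by blast
  then obtain u where "jump (l, 0) (Id s f - \<iota> W (bv 1 l W f)) = (SUM b:B. u b *\<^sub>C b)" unfolding complex_vector.span_finite[OF B(1)] by blast
  hence eq: "jump (l, W) f = (SUM b:B. u b *\<^sub>C A (l, W) b)" unfolding factor using blin_combination[OF A, of B "%b. b" u] B_in by simp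
  show "jump (l, W) f \<in> cspan (A (l, W) ` B)" unfolding eq by (intro complex_vector.span_sum complex_vector.span_scale complex_vector.span_base imageI)
 qed
qed

lemma q_vanish:
 assumes x: "(l, W) \<in> U" and f: "f \<in> sps" "g \<in> sps" "jump (l, W) f = 0"
 shows "q (l, W) g f = 0"
 using q_jump[OF x f(2,1)] f by (simp add: pairing_zero_right)

text \<open>By Cauchy-Schwarz a null vector of \<open>q\<close> is in its radical, and H_s separates
  the values of the jump.\<close>

lemma jump_vanish:
 assumes x: "(l, W) \<in> U" and f: "f \<in> sps" "Re (q (l, W) f f) = 0"
 shows "jump (l, W) f = 0"
proof (rule pairing_separates[of _ s])
 interpret Q: semi_form "sps" "q (l, W)" by (rule q_semi_form[OF x])
 show j: "jump (l, W) f \<in> spm" by (rule blin_in[OF jump_blin[OF x]])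
 fix h assume h: "h \<in> sps"
 have "q (l, W) h f = 0" using Q.cauchy_schwarz_sq[OF h f(1)] f(2) by simp
 hence "pr h (jump (l, W) f) = 0" using q_jump[OF x h f(1)] by simp
 thus "pr (jump (l, W) f) h = 0" using pairing_herm[of "jump (l, W) f" "- s" h] h j by simp
qed

lemma rank_bound:
 assumes x: "(l, W) \<in> U" and g: "!!i. i < m ==> g i \<in> sps"
  and gram: "!!i j. i < m ==> j < m ==> cmod (q (l, W) (g i) (g j) - (if i = j then 1 else 0)) <= \<eta>"
  and \<eta>: "real m * \<eta> <= 1 / 2" and f: "f \<in> sps"
 shows "Re (q (l, W) f f) <= 2 * (SUM i<m. cmod (q (l, W) (g i) f))^2"
proof -
 interpret Q: semi_form "sps" "q (l, W)" by (rule q_semi_form[OF x])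
 obtain B where B: "finite B" "card B <= m" "!!f. f \<in> sps ==> jump (l, W) f \<in> cspan B" by (rule jump_span[OF x]) (rule that; assumption)
 show ?thesis by (rule Q.finite_rank_bound[OF B _ _ _ g gram \<eta> f])
   (use blinD(2,3)[OF jump_blin[OF x]] q_vanish[OF x] in auto)
qed

definition reals :: "'v set" where "reals = {f \<in> sps. cj S f = f}"

lemma reals_closed:
 assumes "f \<in> reals" "g \<in> reals"
 shows "of_real t *\<^sub>C f \<in> reals" "f - g \<in> reals" "f + g \<in> reals" "0 \<in> reals"
proof -
 have fg: "f \<in> sps" "g \<in> sps" "cj S f = f" "cj S g = g" using assms by (auto simp: reals_def)
 have r: "of_real t *\<^sub>C f \<in> reals" for t using fg by (simp add: reals_def cj_scale[of _ s] H.V_scale)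
 show "of_real t *\<^sub>C f \<in> reals" "0 \<in> reals" using r[of t] r[of 0] by auto
 show "f - g \<in> reals" "f + g \<in> reals" using fg by (auto simp: reals_def cj_diff[of _ s] cj_add[of _ s] H.V_diff H.V_add)
qed

lemma reals_sum: "(!!i. i \<in> J ==> f i \<in> reals) ==> (SUM i:J. of_real (t i) *\<^sub>C f i) \<in> reals"
proof (induction J rule: infinite_finite_induct)
 case (insert i J)
 thus ?case using reals_closed(3)[OF reals_closed(1)] by simp
qed (auto simp: reals_def H.V_zero cj_diff[of 0 s 0, simplified])

text \<open>The family exhausted among real vectors has at most \<open>m\<close> members by the
  rank. It has at least \<open>m\<close>: remainders are null vectors and have no jump, so the jumps
  of its members span those of all real vectors, and with real and imaginary parts the whole
  range.\<close>

lemma orthonormal_reals: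
 obtains g where "!!i. i < m ==> g i \<in> reals"
  "!!i j. i < m ==> j < m ==> q (l0, 0) (g i) (g j) = (if i = j then 1 else 0)"
proof -
 interpret Q: semi_form "sps" "q (l0, 0)" by (rule q_semi_form[OF l0_U])
 note lin = jump_blin[OF l0_U]
 obtain B where B: "finite B" "card B = m" "\<not> cdependent B" "cspan B = jump (l0, 0) ` sps" using rank[OF l0_I] unfolding has_cdim_def by blast
 have M: "reals \<subseteq> sps" by (auto simp: reals_def)
 have q_real: "q (l0, 0) f g = of_real (Re (q (l0, 0) f g))" if "f \<in> reals" "g \<in> reals" for f g
  using q_real_vectors[OF l0_U, of f g] that by (simp add: reals_def)
 have cl: "x - q (l0, 0) b x *\<^sub>C b \<in> reals" if "x \<in> reals" "b \<in> reals" for x b using q_real[OF that(2,1)] reals_closed that by metis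
 have bound: "r <= m" if b: "Q.ortho b r reals" for r b
 proof (rule Q.ortho_bound[OF b M B(1), of m "jump (l0, 0)"])
  show "card B <= m" "!!f. f \<in> reals ==> jump (l0, 0) f \<in> cspan B" using B M by auto
  fix u g assume z: "(SUM i<=m. u i *\<^sub>C jump (l0, 0) (b i)) = 0" and bi: "!!i. i <= m ==> b i \<in> reals" and g: "g \<in> reals"
  have bs: "b i \<in> sps" if "i \<in> {..m}" for i using bi M that by auto
  have "jump (l0, 0) (SUM i<=m. u i *\<^sub>C b i) = 0" using blin_combination[OF lin, of "{..m}" b u] bs z by simp
  thus "q (l0, 0) g (SUM i<=m. u i *\<^sub>C b i) = 0" using bs g M by (intro q_vanish[OF l0_U]) (auto intro: H.V_sum H.V_scale)
 qed
 have zero: "0 \<in> reals" using reals_sum[of "{}" "%_. 0"] by simp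
 have start: "Q.ortho (%_. 0) 0 reals" by (simp add: Q.ortho_def)
 obtain r b where b: "Q.ortho b r reals"
  "!!x. x \<in> reals ==> q (l0, 0) (x - (SUM i<r. q (l0, 0) (b i) x *\<^sub>C b i)) (x - (SUM i<r. q (l0, 0) (b i) x *\<^sub>C b i)) = 0"
  by (rule Q.orthonormal_exhaustion[OF M cl _ bound start])
   (assumption | rule reals_closed(1)[OF _ zero] | (rule that; assumption))+
 have bM: "b i \<in> reals" if "i < r" for i using b(1) that by (simp add: Q.ortho_def)
 have bs: "b i \<in> sps" if "i < r" for i using bM[OF that] M by auto
 define C where "C = (%i. jump (l0, 0) (b i)) ` {..<r}"
 have real_C: "jump (l0, 0) x \<in> cspan C" if x: "x \<in> reals" for x
 proof -
  define p where "p = (SUM i<r. q (l0, 0) (b i) x *\<^sub>C b i)"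
  have xp: "x \<in> sps" "p \<in> sps" using x M bs by (auto simp: p_def intro!: H.V_sum H.V_scale)
  have "jump (l0, 0) (x - p) = 0" using b(2)[OF x] xp by (intro jump_vanish[OF l0_U]) (simp_all add: H.V_diff p_def)
  hence "jump (l0, 0) x = jump (l0, 0) p" using blin_diff[OF lin xp] by simp
  also have "... = (SUM i<r. q (l0, 0) (b i) x *\<^sub>C jump (l0, 0) (b i))" unfolding p_def using bs by (intro blin_combination[OF lin]) auto
  finally show ?thesis unfolding C_def by (simp only:) (intro complex_vector.span_sum complex_vector.span_scale complex_vector.span_base imageI)
 qed
 have "B \<subseteq> cspan C"
 proof
  fix y assume "y \<in> B"
  hence "y \<in> jump (l0, 0) ` sps" unfolding B(4)[symmetric] by (rule complex_vector.span_base)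
  then obtain f where f: "f \<in> sps" "y = jump (l0, 0) f" by blast
  obtain a d where ad: "cj S a = a" "cj S d = d" "f = a + \<i> *\<^sub>C d" "a \<in> sps" "d \<in> sps"
   using real_parts[OF f(1) less_imp_le[OF s_pos]] H.V f(1) cj_in[OF f(1)] by metis
  hence r: "a \<in> reals" "d \<in> reals" by (auto simp: reals_def)
  have "y = jump (l0, 0) a + \<i> *\<^sub>C jump (l0, 0) d" using blinD(2,3)[OF lin] f(2) ad(3-5) by (simp add: H.V_scale)
  thus "y \<in> cspan C" using real_C r complex_vector.span_add complex_vector.span_scale by metis
 qed
 from complex_vector.independent_span_bound[OF _ B(3) this] have "m <= card C" using B(2) by (simp add: C_def)
 also have "card C <= r" unfolding C_def using card_image_le[of "{..<r}"] by simp
 finally show thesis using that[of b] b(1) by (simp add: Q.ortho_def)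
qed

lemma q_isCont:
 assumes "x \<in> U" "f \<in> sps" "g \<in> sps"
 shows "isCont (%x. q x f g) x"
 unfolding q_def using assms by (intro continuous_intros Ck_fun_isCont[OF pairing_Y_Ck]) auto

text \<open>The Gram matrix of the \<open>g i\<close> is the identity at (l0, 0) and depends
  continuously on the point, so the rank bound holds with the same vectors in a whole
  neighborhood.\<close>

lemma near_rank_bound:
 assumes g: "!!i. i < m ==> g i \<in> reals"
  and ortho: "!!i j. i < m ==> j < m ==> q (l0, 0) (g i) (g j) = (if i = j then 1 else 0)"
 obtains r where "r > 0" "!!l W. \<bar>l - l0\<bar> < r ==> norm W < r ==> (l, W) \<in> U"
  "!!l W f. \<bar>l - l0\<bar> < r ==> norm W < r ==> f \<in> sps ==>
   Re (q (l, W) f f) <= 2 * (SUM i<m. cmod (q (l, W) (g i) f))^2"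
  "!!l W i. \<bar>l - l0\<bar> < r ==> norm W < r ==> i < m ==> Re (q (l, W) (g i) (g i)) > 0"
proof -
 \<comment> \<open>Below 1 / (2 m) for the rank bound and below 1 so that the diagonal of the Gram
   matrix stays positive.\<close>
 define \<eta> where "\<eta> = 1 / (2 * real (Suc m))"
 have \<eta>: "\<eta> > 0" "real m * \<eta> <= 1 / 2" "\<eta> < 1" by (simp_all add: \<eta>_def field_simps)
 have gs: "g i \<in> sps" if "i < m" for i using g[OF that] by (simp add: reals_def)
 have ev: "\<forall>\<^sub>F x in nhds (l0, 0). dist (q x (g i) (g j)) (if i = j then 1 else 0) < \<eta>" if "i < m" "j < m" for i j
  using tendstoD[OF tendsto_at_iff_tendsto_nhds[THEN iffD1, OF q_isCont[OF l0_U gs[OF that(1)] gs[OF that(2)], unfolded isCont_def]] \<eta>(1)] unfolding ortho[OF that] .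
 have "\<forall>\<^sub>F x in nhds (l0, 0). ALL i:{..<m}. ALL j:{..<m}. dist (q x (g i) (g j)) (if i = j then 1 else 0) < \<eta>"
  using ev by (intro eventually_ball_finite ballI) auto
 hence "\<forall>\<^sub>F x in nhds (l0, 0). (ALL i:{..<m}. ALL j:{..<m}. dist (q x (g i) (g j)) (if i = j then 1 else 0) < \<eta>) & x \<in> U"
  using eventually_nhds_in_open[OF open_U l0_U] by (rule eventually_conj)
 then obtain t where t: "t > 0" "!!x i j. dist x (l0, 0) < t ==> i < m ==> j < m ==> dist (q x (g i) (g j)) (if i = j then 1 else 0) < \<eta>"
  "!!x. dist x (l0, 0) < t ==> x \<in> U" unfolding eventually_nhds_metric by blast
 have near: "dist (l, W) (l0, 0) < t" if "\<bar>l - l0\<bar> < t / 2" "norm W < t / 2" for l and W :: 'x using norm_Pair_le[of "l - l0" W] that by (simp add: dist_norm)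
 show thesis
 proof (rule that[of "t / 2"])
  show "t / 2 > 0" using t(1) by simp
  fix l and W :: 'x assume lW: "\<bar>l - l0\<bar> < t / 2" "norm W < t / 2"
  note n = near[OF lW]
  show x: "(l, W) \<in> U" by (rule t(3)[OF n])
  have gram: "cmod (q (l, W) (g i) (g j) - (if i = j then 1 else 0)) < \<eta>" if "i < m" "j < m" for i j using t(2)[OF n that] by (simp add: dist_norm)
  show "Re (q (l, W) f f) <= 2 * (SUM i<m. cmod (q (l, W) (g i) f))^2" if "f \<in> sps" for f
   using gram by (intro rank_bound[OF x gs _ \<eta>(2) that] less_imp_le)
  show "Re (q (l, W) (g i) (g i)) > 0" if "i < m" for i using gram[OF that that] \<eta>(3) abs_Re_le_cmod[of "q (l, W) (g i) (g i) - 1"] by simp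
 qed
qed

end

context rank_setting
begin

text \<open>The equations make \<open>\<psi>\<close> vanish to second order in the form \<open>q (\<mu>, W)\<close> at \<open>\<mu> = l\<close>,
 which keeps the resolvent applied to \<open>\<psi>\<close> bounded on the vertical line over \<open>l\<close>.\<close>

lemma solution_of_equations:
 assumes g: "!!i. i < m ==> g i \<in> reals" and \<psi>: "\<psi> \<in> reals"
  and near: "!!\<mu>. \<bar>\<mu> - l0\<bar> < r ==> (\<mu>, W) \<in> U"
  and bound: "!!\<mu> f. \<bar>\<mu> - l0\<bar> < r ==> f \<in> sps ==>
   Re (q (\<mu>, W) f f) <= 2 * (SUM i<m. cmod (q (\<mu>, W) (g i) f))^2"
  and l: "\<bar>l - l0\<bar> < r" and eqs: "!!i. i < m ==> Im (pr (g i) (Y (l, W) \<psi>)) = 0"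
 shows "Y (l, W) \<psi> \<in> D" "P.shifted W (of_real l) (Y (l, W) \<psi>) = \<psi>" "Re (q (l, W) \<psi> \<psi>) = 0"
proof -
 obtain k' where k': "k = Suc k'" using k_pos by (cases k) auto
 note x = near[OF l]
 interpret Q: semi_form "sps" "q (l, W)" by (rule q_semi_form[OF x])
 have gs: "g i \<in> sps" "cj S (g i) = g i" if "i < m" for i using g[OF that] by (auto simp: reals_def)
 have \<psi>s: "\<psi> \<in> sps" "cj S \<psi> = \<psi>" using \<psi> by (auto simp: reals_def)
 define F where "F i x = pr (g i) (Y x \<psi>)" for i x
 have qF: "q (\<mu>, W) (g i) \<psi> = of_real (Im (F i (\<mu>, W)))" if "i < m" "\<bar>\<mu> - l0\<bar> < r" for i \<mu>
  unfolding F_def by (rule q_real_vectors[OF near[OF that(2)] gs[OF that(1)] \<psi>s])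
 have "Re (q (l, W) \<psi> \<psi>) <= 0" using bound[OF l \<psi>s(1)] qF[OF _ l] eqs by (simp add: F_def)
 thus zero: "Re (q (l, W) \<psi> \<psi>) = 0" using Q.q_nonneg[OF \<psi>s(1)] by simp
 \<comment> \<open>Each equation holds at \<open>l\<close>, so differentiability bounds its left
   side linearly in the distance to \<open>l\<close>; squaring in the rank bound makes
   \<open>q\<close> quadratically small.\<close>
 have "EX L>=0. EX t>0. ALL \<mu>. \<bar>\<mu> - l\<bar> < t --> \<bar>Im (F i (\<mu>, W))\<bar> <= L * \<bar>\<mu> - l\<bar>" if i: "i < m" for i
 proof -
  have Ck: "Ck_fun (Suc k') U (F i)" using pairing_Y_Ck[OF gs(1)[OF i] \<psi>s(1)] unfolding F_def k' .
  obtain f' where f': "!!x. x \<in> U ==> (F i has_derivative (%h. f' x [h])) (at x)" by (rule Ck_fun_SucD[OF Ck]) (rule that)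
  define L where "L = 1 + cmod (f' (l, W) [(1, 0)])"
  obtain t where t: "t > 0" "!!\<mu> \<mu>' W'. \<bar>\<mu> - l\<bar> < t & \<bar>\<mu>' - l\<bar> < t & norm (W' - W) < t ==>
    norm (F i (\<mu>, W') - F i (\<mu>', W') - (\<mu> - \<mu>') *\<^sub>R f' (l, W) [(1, 0)]) <= 1 * \<bar>\<mu> - \<mu>'\<bar>"
   using partial_derivative_estimate[OF open_U x Ck f'[OF x] zero_less_one] by blast
  have "\<bar>Im (F i (\<mu>, W))\<bar> <= L * \<bar>\<mu> - l\<bar>" if \<mu>: "\<bar>\<mu> - l\<bar> < t" for \<mu>
  proof -
   have "\<bar>Im (F i (\<mu>, W))\<bar> = \<bar>Im (F i (\<mu>, W) - F i (l, W))\<bar>" using eqs[OF i] by (simp add: F_def)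
   also have "... <= cmod (F i (\<mu>, W) - F i (l, W))" by (rule abs_Im_le_cmod)
   also have "... <= cmod ((\<mu> - l) *\<^sub>R f' (l, W) [(1, 0)]) + 1 * \<bar>\<mu> - l\<bar>"
    using t(2)[of \<mu> l W] \<mu> t(1) norm_triangle_ineq2[of "F i (\<mu>, W) - F i (l, W)" "(\<mu> - l) *\<^sub>R f' (l, W) [(1, 0)]"] by simp
   also have "... = L * \<bar>\<mu> - l\<bar>" by (simp add: L_def distrib_right)
   finally show ?thesis .
  qed
  moreover have "L >= 0" by (simp add: L_def)
  ultimately show ?thesis using t(1) by blast
 qed
 then obtain L t where Lt: "!!i. i < m ==> L i >= 0" "!!i. i < m ==> t i > 0"
  "!!i \<mu>. i < m ==> \<bar>\<mu> - l\<bar> < t i ==> \<bar>Im (F i (\<mu>, W))\<bar> <= L i * \<bar>\<mu> - l\<bar>" by metis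
 define t0 where "t0 = Min (insert (r - \<bar>l - l0\<bar>) (t ` {..<m}))"
 have t0: "t0 > 0" "t0 <= r - \<bar>l - l0\<bar>" "!!i. i < m ==> t0 <= t i" using l Lt(2) by (auto simp: t0_def)
 define d where "d = t0 / 2"
 \<comment> \<open>The summand 1 gives the strict inequality required by
   \<open>vertical_bound\<close>.\<close>
 define K where "K = 2 * (SUM i<m. L i)^2 + 1"
 have d: "d > 0" "d < t0" using t0(1) by (auto simp: d_def)
 have K: "K > 0" unfolding K_def by (intro add_nonneg_pos) auto
 have d_near: "\<bar>\<mu> - l0\<bar> < r" if "\<bar>\<mu> - l\<bar> <= d" for \<mu> using that d(2) t0(2) by linarith
 have dI: "\<mu> \<in> I" if "\<bar>\<mu> - l\<bar> <= d" for \<mu> using near[OF d_near[OF that]] by (simp add: U_iff)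
 have quad: "Re (q (\<mu>, W) \<psi> \<psi>) < K * (\<mu> - l)^2" if \<mu>: "\<bar>\<mu> - l\<bar> <= d" "\<mu> ~= l" for \<mu>
 proof -
  have "(SUM i<m. cmod (q (\<mu>, W) (g i) \<psi>)) <= (SUM i<m. L i * \<bar>\<mu> - l\<bar>)"
  proof (rule sum_mono)
   fix i assume "i \<in> {..<m}"
   hence i: "i < m" by simp
   have "\<bar>\<mu> - l\<bar> < t i" using \<mu>(1) d(2) t0(3)[OF i] by linarith
   from Lt(3)[OF i this] show "cmod (q (\<mu>, W) (g i) \<psi>) <= L i * \<bar>\<mu> - l\<bar>" unfolding qF[OF i d_near[OF \<mu>(1)]] by simp
  qed
  hence "(SUM i<m. cmod (q (\<mu>, W) (g i) \<psi>))^2 <= ((SUM i<m. L i) * \<bar>\<mu> - l\<bar>)^2"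
   by (intro power_mono) (auto simp: sum_distrib_right sum_nonneg)
  hence "Re (q (\<mu>, W) \<psi> \<psi>) <= 2 * ((SUM i<m. L i) * \<bar>\<mu> - l\<bar>)^2" using bound[OF d_near[OF \<mu>(1)] \<psi>s(1)] by linarith
  also have "... = (K - 1) * (\<mu> - l)^2" by (simp add: K_def power_mult_distrib)
  also have "... < K * (\<mu> - l)^2" using \<mu>(2) by (intro mult_strict_right_mono) auto
  finally show ?thesis .
 qed
 note vertical_bound[OF x \<psi>s(1) d(1) K dI zero quad]
 from regular_solution[OF x \<psi>s(1) this]
 show "Y (l, W) \<psi> \<in> D" "P.shifted W (of_real l) (Y (l, W) \<psi>) = \<psi>" by auto
qed

text \<open>As \<open>e 0\<close> is a null vector of \<open>q\<close>, Cauchy-Schwarz annihilates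
  Im <e_j, u>; together with the real parts this gives P_0 u = e_0, and (T_W - l) u = e_0 becomes
  the eigenvalue equation.\<close>

lemma eigenvalue_of_equations:
 assumes g: "!!i. i < m ==> g i \<in> reals" and n: "n > 0"
  and near: "!!\<mu>. \<bar>\<mu> - l0\<bar> < r ==> (\<mu>, W) \<in> U"
  and bound: "!!\<mu> f. \<bar>\<mu> - l0\<bar> < r ==> f \<in> sps ==>
   Re (q (\<mu>, W) f f) <= 2 * (SUM i<m. cmod (q (\<mu>, W) (g i) f))^2"
  and l: "\<bar>l - l0\<bar> < r" and eqs: "!!i. i < m ==> Im (pr (g i) (Y (l, W) (e 0))) = 0"
  and e_eqs: "!!j. j < n ==> Re (pr (e j) (Y (l, W) (e 0))) = (if j = 0 then 1 else 0)"
 shows "of_real l \<in> point_spectrum D (HW W)"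
proof -
 have er: "e j \<in> reals" if "j < n" for j using e_s e_real that by (simp add: reals_def)
 note x = near[OF l]
 interpret Q: semi_form "sps" "q (l, W)" by (rule q_semi_form[OF x])
 define u where "u = Y (l, W) (e 0)"
 note sol = solution_of_equations[OF g er[OF n] near bound l eqs]
 have u: "u \<in> D" "P.shifted W (of_real l) u = e 0" using sol by (auto simp: u_def)
 have ip_u: "ip0 (e j) u = (if j = 0 then 1 else 0)" if j: "j < n" for j
 proof -
  have "q (l, W) (e j) (e 0) = 0" using Q.cauchy_schwarz_sq[OF e_s[OF j] e_s[OF n]] sol(3) by simp
  hence "Im (pr (e j) u) = 0" using q_real_vectors[OF x e_s[OF j] e_real[OF j] e_s[OF n] e_real[OF n]] by (simp add: u_def)
  hence "pr (e j) u = (if j = 0 then 1 else 0)" using e_eqs[OF j] by (simp add: u_def complex_eq_iff)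
  thus ?thesis using pairing_0'[OF e_s[OF j] D_sub[OF u(1)]] by simp
 qed
 have "Pr u = (SUM j<n. if j = 0 then e 0 else 0)" unfolding Pr_def using ip_u by (intro sum.cong refl) (auto simp: scaleC_one)
 hence "Pr u = e 0" using n by simp
 hence "HW W u = of_real l *\<^sub>C u" using u HW_T[OF u(1), of W] by (simp add: P.shifted_def algebra_simps)
 moreover have "u ~= 0" using ip_u[OF n] H.q_zero_right[OF e_0[OF n]] by auto
 ultimately show ?thesis using u(1) by (auto simp: point_spectrum_def eigenspace_def)
qed

text \<open>Without spectral density near \<open>l0\<close> the resolvent stays bounded on the
  vertical line over \<open>l0\<close>; the bound passes by density from H_s to H and by letting the
  height tend to 0 to T - l0.\<close>

lemma rank_zero_lower_bound:
 assumes m: "m = 0"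
 obtains d where "d > 0" "!!u. u \<in> D ==> d * nm0 u <= nm0 (shifted (of_real l0) u)"
proof -
 obtain r where r: "r > 0" "!!l W. \<bar>l - l0\<bar> < r ==> norm (W :: 'x) < r ==> (l, W) \<in> U"
  "!!l W f. \<bar>l - l0\<bar> < r ==> norm (W :: 'x) < r ==> f \<in> sps ==>
   Re (q (l, W) f f) <= 2 * (SUM i<m. cmod (q (l, W) 0 f))^2" by (rule near_rank_bound[of "%_. 0"]) (auto simp: m)
 define d where "d = r / 2"
 have d: "d > 0" and dr: "\<bar>\<mu> - l0\<bar> < r" if "\<bar>\<mu> - l0\<bar> <= d" for \<mu> using r(1) that by (auto simp: d_def)
 have d: "d > 0" using r(1) by (simp add: d_def)
 have xU: "(\<mu>, 0) \<in> U" if "\<bar>\<mu> - l0\<bar> <= d" for \<mu> using r(2)[OF dr[OF that], of 0] r(1) by simp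
 have q0: "Re (q (\<mu>, 0) f f) = 0" if "\<bar>\<mu> - l0\<bar> <= d" "f \<in> sps" for \<mu> f
  using r(3)[OF dr[OF that(1)] _ that(2), of 0] r(1) semi_form.q_nonneg[OF q_semi_form[OF xU[OF that(1)]] that(2)] by (simp add: m)
 have bound_s: "nm0 (Rv 0 l0 eps f) <= 2 / d * nm0 f" if f: "f \<in> sps" and eps: "eps > 0" for f eps
 proof -
  note f0 = sp_s[OF f]
  have im: "Im (Complex l0 d) ~= 0" "\<bar>Im (Complex l0 d)\<bar> = d" using d by auto
  have "(nm0 (Rv 0 l0 eps f))^2 <= 2 * (nm0 (Rv 0 l0 d f))^2 + z" if z: "z > 0" for z
  proof -
   \<comment> \<open>Since \<open>q\<close> vanishes identically here, any positive K is admissible;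
     this one makes the first term of the bound equal to \<open>z\<close>.\<close>
   have "(nm0 (Rv 0 l0 eps f))^2 <= 16 * (z / (16 * d)) * d + 2 * (nm0 (Rv 0 l0 d f))^2"
    by (rule vertical_bound[OF l0_U f d]) (use z d eps q0 f xU in \<open>auto simp: U_iff\<close>)
   thus ?thesis using d by simp
  qed
  hence "(nm0 (Rv 0 l0 eps f))^2 <= 2 * (nm0 (Rv 0 l0 d f))^2" by (rule field_le_epsilon)
  also have "... <= 4 * (nm0 f / d)^2" using power_mono[OF P.R_bound[OF im(1) f0, of 0, unfolded im(2)] H.nm_nonneg[OF P.R_in[OF im(1) f0, of 0]], of 2]
    zero_le_power2[of "nm0 f / d"] by linarith
  also have "... = (2 / d * nm0 f)^2" by (simp add: power_divide power_mult_distrib)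
  finally show ?thesis using d H.nm_nonneg[OF f0] by (elim power2_le_imp_le) simp
 qed
 have bound_0: "nm0 (Rv 0 l0 eps f) <= 2 / d * nm0 f" if f: "f \<in> sp0" and eps: "eps > 0" for f eps
 proof (rule field_le_epsilon)
  fix z :: real assume z: "z > 0"
  have im: "Im (Complex l0 eps) ~= 0" using eps by simp
  \<comment> \<open>The crude bound 1 / eps enters only the approximation error, for fixed eps; it
    disappears with \<open>z\<close>.\<close>
  define M where "M = 1 / eps + 2 / d"
  have M: "M > 0" using eps d by (simp add: M_def add_pos_pos)
  obtain g where g: "g \<in> sps" "nm0 (f - g) < z / M" using dense[OF s_pos f, of "z / M"] z M by auto
  note g0 = sp_s[OF g(1)]
  have "nm0 (Rv 0 l0 eps f) <= nm0 (Rv 0 l0 eps (f - g)) + nm0 (Rv 0 l0 eps g)"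
   using H.nm_triangle[OF P.R_in[OF im H.V_diff[OF f g0]] P.R_in[OF im g0], of 0 0] by (simp add: P.R_diff[OF im f g0])
  also have "nm0 (Rv 0 l0 eps (f - g)) <= 1 / eps * nm0 (f - g)" using P.R_bound[OF im H.V_diff[OF f g0], of 0] eps by simp
  also have "nm0 (Rv 0 l0 eps g) <= 2 / d * nm0 g" by (rule bound_s[OF g(1) eps])
  also have "2 / d * nm0 g <= 2 / d * (nm0 f + nm0 (f - g))" using H.nm_triangle_diff[OF f H.V_diff[OF f g0]] d by (intro mult_left_mono) auto
  finally have "nm0 (Rv 0 l0 eps f) <= 2 / d * nm0 f + M * nm0 (f - g)" by (simp add: M_def algebra_simps)
  also have "M * nm0 (f - g) <= z" using g(2) M by (simp add: pos_less_divide_eq mult.commute less_imp_le)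
  finally show "nm0 (Rv 0 l0 eps f) <= 2 / d * nm0 f + z" by simp
 qed
 show thesis
 proof (rule that[of "d / 2"])
  show "d / 2 > 0" using d by simp
  fix u assume u: "u \<in> D"
  note u0 = D_sub[OF u]
  define v where "v = shifted (of_real l0) u"
  have v: "v \<in> sp0" unfolding v_def by (rule shifted_in[OF u])
  have step: "nm0 u <= 2 / d * (nm0 v + eps * nm0 u)" if eps: "eps > 0" for eps
  proof -
   have im: "Im (Complex l0 eps) ~= 0" using eps by simp
   have C: "Complex l0 eps = of_real l0 + \<i> * of_real eps" by (simp add: complex_eq_iff)
   have "P.shifted 0 (Complex l0 eps) u = v - (\<i> * of_real eps) *\<^sub>C u"
    unfolding C P.shifted_def shifted_def v_def by (simp add: \<iota>_zero scaleC_add_left)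
   hence "u = Rv 0 l0 eps (v - (\<i> * of_real eps) *\<^sub>C u)" using P.R_shifted[OF im u, of 0] by simp
   hence "nm0 u <= 2 / d * nm0 (v - (\<i> * of_real eps) *\<^sub>C u)" using bound_0[OF H.V_diff[OF v H.V_scale[OF u0]] eps] by metis
   also have "... <= 2 / d * (nm0 v + eps * nm0 u)" using H.nm_triangle_diff[OF v H.V_scale[OF u0], of "\<i> * of_real eps"] d eps u0
    by (intro mult_left_mono) (auto simp: H.nm_scale norm_mult)
   finally show ?thesis .
  qed
  have "nm0 u <= 2 / d * nm0 v"
  proof (rule field_le_epsilon)
   fix z :: real assume z: "z > 0"
   define eps where "eps = z * d / (2 * (nm0 u + 1))"
   have pos: "nm0 u + 1 > 0" using H.nm_nonneg[OF u0] by simp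
   have eps: "eps > 0" using z d pos by (simp add: eps_def)
   have "2 / d * (z * d / (2 * p) * a) = z * (a / p)" if "p > 0" for a p using that d by (simp add: field_simps)
   hence "2 / d * (eps * nm0 u) = z * (nm0 u / (nm0 u + 1))" using pos by (simp only: eps_def)
   also have "... <= z * 1" using z pos by (intro mult_left_mono) auto
   finally show "nm0 u <= 2 / d * nm0 v + z" using step[OF eps] by (simp add: distrib_left)
  qed
  thus "d / 2 * nm0 u <= nm0 (shifted (of_real l0) u)" using d by (simp add: v_def field_simps)
 qed
qed

lemma e_eigen: "i < n ==> e i \<in> eigenspace D H (of_real l0)"
proof -
 assume i: "i < n"
 have "(SUM j<n. ip0 (e j) (e i) *\<^sub>C e j) = (SUM j<n. if j = i then e j else 0)" using e_ortho i by (intro sum.cong refl) (auto simp: scaleC_one)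
 hence "H (e i) = of_real (l0 + 1) *\<^sub>C e i - e i" using H_T[OF e_D[OF i]] T_e[OF i] i by simp
 also have "... = of_real l0 *\<^sub>C e i" by (simp add: scaleC_add_left scaleC_one)
 finally show ?thesis using e_D[OF i] by (simp add: eigenspace_def)
qed

text \<open>For m = 0 the operator T - l0 is bijective and bounded below. On the continuous subspace
  of H the projection vanishes, so there H and T agree and the restriction is bijective too,
  contradicting that \<open>l0\<close> is in the continuous spectrum.\<close>

lemma rank_positive:
 assumes emb: "of_real l0 \<in> cont_spectrum S D H"
 shows "m > 0"
proof (rule ccontr)
 assume "\<not> m > 0"
 hence m: "m = 0" by simp
 obtain d where d: "d > 0" "!!u. u \<in> D ==> d * nm0 u <= nm0 (shifted (of_real l0) u)"
  by (rule rank_zero_lower_bound[OF m]) (rule that; assumption)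
 have inj: "u = 0" if u: "u \<in> D" "shifted (of_real l0) u = 0" for u
 proof -
  have "d * nm0 u <= 0" using d(2)[OF u(1)] u(2) by simp
  hence "nm0 u <= 0" using d(1) by (simp add: mult_le_0_iff)
  thus ?thesis using H.nm_eq_0[OF D_sub[OF u(1)]] H.nm_nonneg[OF D_sub[OF u(1)]] by simp
 qed
 have bij: "bij_betw (shifted (of_real l0)) D (sp0)" by (rule shifted_bij[OF d]) (auto intro: inj)
 have HT: "H u = T u - Pr u" if "u \<in> D" for u using H_T[OF that] by (simp add: Pr_def)
 have Te: "shifted (of_real l0) (e i) = e i" if "i < n" for i using T_e[OF that] by (simp add: shifted_def scaleC_add_left scaleC_one)
 have PrD: "Pr u \<in> D" "shifted (of_real l0) (Pr u) = Pr u" for u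
 proof -
  show D': "Pr u \<in> D" unfolding Pr_def using e_D D by (auto intro!: complex_vector.subspace_sum complex_vector.subspace_scale)
  have "T (Pr u) = (SUM i<n. T (ip0 (e i) u *\<^sub>C e i))" unfolding Pr_def using e_D by (intro T_sum) (auto intro: D_scale)
  also have "... = (SUM i<n. of_real (l0 + 1) *\<^sub>C ip0 (e i) u *\<^sub>C e i)"
   using e_D T_e by (intro sum.cong refl) (simp add: T_scale scaleC_scaleC mult.commute)
  also have "... = of_real (l0 + 1) *\<^sub>C Pr u" unfolding Pr_def complex_vector.scale_sum_right ..
  finally show "shifted (of_real l0) (Pr u) = Pr u" by (simp add: shifted_def scaleC_add_left scaleC_one)
 qed
 \<comment> \<open>Both v and its projection solve the same equation for T - l0, which is injective:
   the eigenspace of H is the range of \<open>Pr\<close>.\<close>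
 have eig: "v = Pr v" if v: "v \<in> eigenspace D H (of_real l0)" for v
 proof -
  have vD: "v \<in> D" "H v = of_real l0 *\<^sub>C v" using v by (auto simp: eigenspace_def)
  have "shifted (of_real l0) v = Pr v" using HT[OF vD(1)] vD(2) by (simp add: shifted_def algebra_simps)
  hence "shifted (of_real l0) (v - Pr v) = 0" using shifted_diff[OF vD(1) PrD(1)] PrD(2) by simp
  from inj[OF D_diff[OF vD(1) PrD(1)] this] show ?thesis by simp
 qed
 define K where "K = cont_subspace S D H"
 have K_eig: "ip0 v f = 0" if "f \<in> K" "v \<in> eigenspace D H z" for f v z
 proof -
  have "v \<in> pp_subspace S D H" using that(2) by (intro HP.eigenvector_pp complex_vector.span_base) auto
  thus ?thesis using that(1) unfolding K_def HP.cont_iff by blast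
 qed
 have K0: "f \<in> sp0" if "f \<in> K" for f using that unfolding K_def HP.cont_iff by blast
 have Pr0: "Pr f = 0" if "!!i. i < n ==> ip0 (e i) f = 0" for f using that by (simp add: Pr_def)
 have PrK: "Pr f = 0" if "f \<in> K" for f using K_eig[OF that e_eigen] by (rule Pr0)
 have eqK: "H f - of_real l0 *\<^sub>C f = shifted (of_real l0) f" if "f \<in> D" "f \<in> K" for f using HT[OF that(1)] PrK[OF that(2)] by (simp add: shifted_def)
 have maps: "shifted (of_real l0) f \<in> K" if f: "f \<in> D" "f \<in> K" for f unfolding K_def
 proof (rule HP.contI[OF shifted_in[OF f(1)]])
  fix z v assume v: "v \<in> eigenspace D H z"
  have "ip0 v (HP.shifted (of_real l0) f) = (z - of_real l0) * ip0 v f" by (rule HP.eigen_ip[OF v f(1)])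
  thus "ip0 v (shifted (of_real l0) f) = 0" using K_eig[OF f(2) v] eqK[OF f] by (simp add: HP.shifted_def)
 qed
 have onto: "EX u. u \<in> D & u \<in> K & shifted (of_real l0) u = y" if y: "y \<in> K" for y
 proof -
  obtain u where u: "u \<in> D" "shifted (of_real l0) u = y" using bij_betw_imp_surj_on[OF bij] K0[OF y] by (metis imageE)
  have eu: "ip0 (e i) u = 0" if i: "i < n" for i using shifted_adjoint[OF e_D[OF i] u(1), of "of_real l0"] Te[OF i] u(2) K_eig[OF y e_eigen[OF i]] by simp
  hence "Pr u = 0" by (rule Pr0)
  hence yu: "y = HP.shifted (of_real l0) u" using u(2) HT[OF u(1)] by (simp add: HP.shifted_def shifted_def)
  have "ip0 v u = 0" if v: "v \<in> eigenspace D H z" for z v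
  proof (cases "z = of_real l0")
   case True
   have "ip0 (Pr v) u = 0" using Pr_symmetric(1)[of v u] \<open>Pr u = 0\<close> v D_sub[OF u(1)] H.q_zero_right[OF Pr_0]
    by (metis (no_types, lifting) D_sub eigenspace_def mem_Collect_eq)
   thus ?thesis using eig v True by metis
  next
   case False
   have "(z - of_real l0) * ip0 v u = 0" using HP.eigen_ip[OF v u(1), of "of_real l0"] K_eig[OF y v] yu by simp
   thus ?thesis using False by simp
  qed
  hence "u \<in> K" unfolding K_def by (rule HP.contI[OF D_sub[OF u(1)]])
  thus ?thesis using u by blast
 qed
 have "bij_betw (%f. H f - of_real l0 *\<^sub>C f) (D \<inter> K) K"
 proof (subst bij_betw_cong[of _ _ "shifted (of_real l0)"])
  show "bij_betw (shifted (of_real l0)) (D \<inter> K) K" using inj_on_subset[OF bij_betw_imp_inj_on[OF bij], of "D \<inter> K"] maps onto by (auto simp: bij_betw_def)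
 qed (use eqK in auto)
 moreover have "ALL f:D \<inter> K. d * nm0 f <= nm0 (H f - of_real l0 *\<^sub>C f)" using d(2) eqK by auto
 ultimately show False using emb d(1) unfolding cont_spectrum_def spectrum_in_def K_def[symmetric] by auto
qed

end

section \<open>Regular level sets in Banach spaces\<close>

text \<open>\<open>p\<close> projects onto the common kernel of the first \<open>\<nu>\<close>
  functionals along the dual vectors found so far. The next functional does not vanish there, as it
  would otherwise be a combination of the others; a normalized vector of this kernel corrects and
  completes the system.\<close>

lemma dual_vectors:
 fixes l :: "nat => 'a::real_vector => real"
 assumes "!!i. i < \<nu> ==> linear (l i)" "!!c. (!!v. (SUM i<\<nu>. c i * l i v) = 0) ==> ALL i<\<nu>. c i = 0"
 shows "EX e. ALL i<\<nu>. ALL j<\<nu>. l i (e j) = (if i = j then 1 else 0)"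
 using assms
proof (induction \<nu>)
 case (Suc \<nu>)
 have "EX e. ALL i<\<nu>. ALL j<\<nu>. l i (e j) = (if i = j then 1 else 0)"
 proof (rule Suc.IH)
  show "linear (l i)" if "i < \<nu>" for i using Suc.prems(1) that by simp
  fix c assume c: "!!v. (SUM i<\<nu>. c i * l i v) = 0"
  have "(SUM i<Suc \<nu>. (if i < \<nu> then c i else 0) * l i v) = (SUM i<\<nu>. c i * l i v)" for v by simp
  thus "ALL i<\<nu>. c i = 0" using Suc.prems(2)[of "%i. if i < \<nu> then c i else 0"] c less_SucI by metis
 qed
 then obtain e where e: "!!i j. i < \<nu> ==> j < \<nu> ==> l i (e j) = (if i = j then 1 else 0)" by blast
 define p where "p v = v - (SUM i<\<nu>. l i v *\<^sub>R e i)" for v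
 have lp: "l j (p v) = l j v - (SUM i<\<nu>. l i v * l j (e i))" if "j < Suc \<nu>" for j v
  using Suc.prems(1)[OF that] by (simp add: p_def linear_diff linear_sum linear_scale)
 have lp0: "l j (p v) = 0" if j: "j < \<nu>" for j v
 proof -
  have "(SUM i<\<nu>. l i v * l j (e i)) = (SUM i<\<nu>. if i = j then l i v else 0)" using e j by (intro sum.cong) auto
  thus ?thesis using lp[of j v] j by simp
 qed
 have "EX v. l \<nu> (p v) ~= 0"
 proof (rule ccontr)
  assume "\<not> (EX v. l \<nu> (p v) ~= 0)"
  hence "(SUM i<Suc \<nu>. (if i < \<nu> then - l \<nu> (e i) else 1) * l i v) = 0" for v using lp[of \<nu> v] by (simp add: sum_negf mult.commute)
  from Suc.prems(2)[OF this] have "(if \<nu> < \<nu> then - l \<nu> (e \<nu>) else 1 :: real) = 0" by blast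
  thus False by simp
 qed
 then obtain v where v: "l \<nu> (p v) ~= 0" by blast
 define w where "w = (1 / l \<nu> (p v)) *\<^sub>R p v"
 have w: "l i w = (if i = \<nu> then 1 else 0)" if "i < Suc \<nu>" for i using Suc.prems(1)[OF that] lp0[of i v] v that by (auto simp: w_def linear_scale less_Suc_eq)
 define e' where "e' j = (if j < \<nu> then e j - l \<nu> (e j) *\<^sub>R w else w)" for j
 have "l i (e' j) = (if i = j then 1 else 0)" if "i < Suc \<nu>" "j < Suc \<nu>" for i j using Suc.prems(1)[OF that(1)] w[OF that(1)] e[of i j] that
  by (auto simp: e'_def linear_diff linear_scale less_Suc_eq)
 thus ?case by blast
qed simp

lemma Ck_fun_sum_scaleR:
 fixes w :: "nat => 'b::real_normed_vector"
 shows "(!!i. i < \<nu> ==> Ck_fun k U (c i)) ==> Ck_fun k U (%x. SUM i<\<nu>. c i x *\<^sub>R w i)"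
proof (induction \<nu>)
 case (Suc \<nu>)
 interpret B: bounding "norm_bnd :: 'b => real => bool" by (rule bounding_norm)
 have "Ck_fun k U (%x. c \<nu> x *\<^sub>R w \<nu>)" by (rule bounded_bilin.Ck_mul[OF B.bounded_bilin_scaleR]) (use Suc.prems[of \<nu>] Ck_fun_const in auto)
 thus ?case using B.Ck_add[OF Suc.IH[OF Suc.prems]] by simp
qed (use Ck_fun_const[of k U 0] in simp)

text \<open>The differentials give coordinates, x = \<pi> x plus the sum of the l i x times e i,
  with \<pi> x in their common kernel \<open>E\<close>. In these the level set is the graph over
  \<open>E\<close> found by \<open>implicit_graph\<close>; cutting it down to \<open>V\<close>
  leaves one chart for all points.\<close>

lemma level_set_manifold:
 fixes F :: "nat => 'a::real_normed_vector => real"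
 assumes U: "open U" "0 \<in> U" and F: "!!i. i < \<nu> ==> Ck_fun (Suc k) U (F i)" "!!i. i < \<nu> ==> F i 0 = 0"
  and l: "!!i. i < \<nu> ==> (F i has_derivative l i) (at 0)"
  and e: "!!i j. i < \<nu> ==> j < \<nu> ==> l i (e j) = (if i = j then 1 else 0)"
 obtains M where "Ck_manifold (Suc k) \<nu> M" "0 \<in> M" "M \<subseteq> U" "!!x i. x \<in> M ==> i < \<nu> ==> F i x = 0"
proof -
 obtain U0 \<eta> c where g: "open U0" "0 \<in> U0" "\<eta> > 0" "ALL i<\<nu>. Ck_fun (Suc k) U0 (c i)"
  "ALL x:U0. ALL i<\<nu>. \<bar>c i x\<bar> < \<eta>"
  "ALL x:U0. ALL t. (ALL i<\<nu>. \<bar>t i\<bar> < \<eta>) --> x + (SUM i<\<nu>. t i *\<^sub>R e i) \<in> U &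
    ((ALL i<\<nu>. F i (x + (SUM i<\<nu>. t i *\<^sub>R e i)) = 0) \<longleftrightarrow> (ALL i<\<nu>. t i = c i x))"
  by (rule implicit_graph[where \<nu> = \<nu> and F = F and l = l and e = e, OF U F l e, THEN exE])
   (assumption+, elim exE conjE, (rule that; assumption))
 have g4: "Ck_fun (Suc k) U0 (c i)" if "i < \<nu>" for i using g(4) that by blast
 have g6: "x + (SUM i<\<nu>. t i *\<^sub>R e i) \<in> U"
  and g7: "(ALL i<\<nu>. F i (x + (SUM i<\<nu>. t i *\<^sub>R e i)) = 0) \<longleftrightarrow> (ALL i<\<nu>. t i = c i x)"
  if "x \<in> U0" "ALL i<\<nu>. \<bar>t i\<bar> < \<eta>" for x t using g(6)[rule_format, OF that(1)] that(2) by auto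
 have bl: "bounded_linear (l i)" if "i < \<nu>" for i using has_derivative_bounded_linear[OF l[OF that]] .
 note lin = bounded_linear.linear[OF bl]
 define \<pi> where "\<pi> x = x - (SUM i<\<nu>. l i x *\<^sub>R e i)" for x
 define V where "V = \<pi> -` U0 \<inter> (\<Inter>i\<in>{..<\<nu>}. {x. \<bar>l i x\<bar> < \<eta>})"
 define M where "M = {x \<in> V. ALL i<\<nu>. F i x = 0}"
 define E where "E = {u. ALL i<\<nu>. l i u = 0}"
 define B where "B = e ` {..<\<nu>}"
 define G where "G u = (SUM i<\<nu>. c i u *\<^sub>R e i)" for u
 have cont: "continuous_on UNIV (l i)" if "i < \<nu>" for i using linear_continuous_on[OF bl[OF that]] .
 have "open V" unfolding V_def
 proof (intro open_Int open_INT ballI)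
  show "open (\<pi> -` U0)" unfolding \<pi>_def using g(1) cont by (intro open_vimage continuous_intros) auto
  show "open {x. \<bar>l i x\<bar> < \<eta>}" if "i \<in> {..<\<nu>}" for i using cont that by (intro open_Collect_less continuous_intros) auto
 qed simp
 have split: "x = \<pi> x + (SUM i<\<nu>. l i x *\<^sub>R e i)" for x by (simp add: \<pi>_def)
 have le: "l j (SUM i<\<nu>. t i *\<^sub>R e i) = t j" if j: "j < \<nu>" for j t
 proof -
  have "l j (SUM i<\<nu>. t i *\<^sub>R e i) = (SUM i<\<nu>. t i * l j (e i))" by (simp add: linear_sum[OF lin[OF j]] linear_scale[OF lin[OF j]])
  also have "... = (SUM i<\<nu>. if i = j then t i else 0)" using e j by (intro sum.cong) auto
  finally show ?thesis using j by simp
 qed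
 have \<pi>E: "\<pi> x \<in> E" for x using le by (simp add: E_def \<pi>_def linear_diff[OF lin])
 have V_iff: "x \<in> V \<longleftrightarrow> \<pi> x \<in> U0 & (ALL i<\<nu>. \<bar>l i x\<bar> < \<eta>)" for x by (auto simp: V_def)
 have M_iff: "x \<in> M \<longleftrightarrow> \<pi> x \<in> U0 & (ALL i<\<nu>. \<bar>l i x\<bar> < \<eta>) & (ALL i<\<nu>. l i x = c i (\<pi> x))" for x
  using g7[of "\<pi> x" "%i. l i x"] split[of x] by (auto simp: M_def V_iff)
 have span_B: "x = (SUM i<\<nu>. l i x *\<^sub>R e i)" if "x \<in> span B" for x
 proof -
  have add: "\<pi> (x + y) = \<pi> x + \<pi> y" and scale: "\<pi> (r *\<^sub>R x) = r *\<^sub>R \<pi> x" for x y r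
   by (simp_all add: \<pi>_def linear_add[OF lin] linear_scale[OF lin] scaleR_add_left sum.distrib scaleR_diff_right scaleR_sum_right)
  have "subspace {x. \<pi> x = 0}" using scale[of 0 0] by (auto simp: subspace_def add scale)
  moreover have "\<pi> (e j) = 0" if "j < \<nu>" for j
  proof -
   have "(SUM i<\<nu>. l i (e j) *\<^sub>R e i) = (SUM i<\<nu>. if i = j then e i else 0)" using e that by (intro sum.cong) auto
   thus ?thesis using that by (simp add: \<pi>_def)
  qed
  ultimately have "span B \<subseteq> {x. \<pi> x = 0}" by (intro span_minimal) (auto simp: B_def)
  thus ?thesis using that by (auto simp: \<pi>_def)
 qed
 have sum_B: "(SUM i<\<nu>. t i *\<^sub>R e i) \<in> span B" for t by (intro span_sum span_scale span_base) (auto simp: B_def)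
 have inj: "inj_on e {..<\<nu>}" using e by (intro inj_onI) (metis lessThan_iff zero_neq_one)
 have "subspace E" using lin by (auto simp: E_def subspace_def linear_0 linear_add linear_scale)
 moreover have "closed E"
 proof -
  have "E = (\<Inter>i\<in>{..<\<nu>}. {x. l i x = 0})" by (auto simp: E_def)
  also have "closed ..." using cont by (intro closed_INT ballI closed_Collect_eq continuous_intros) auto
  finally show ?thesis .
 qed
 moreover have "finite B" "card B = \<nu>" using inj by (auto simp: B_def card_image)
 moreover have "independent B"
 proof (rule independent_if_scalars_zero)
  show "finite B" by (simp add: B_def)
  fix f x assume f: "(SUM b:B. f b *\<^sub>R b) = 0" and "x \<in> B"
  then obtain j where j: "j < \<nu>" "x = e j" by (auto simp: B_def)
  have "(SUM i<\<nu>. f (e i) *\<^sub>R e i) = 0" using f inj by (simp add: B_def sum.reindex)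
  thus "f x = 0" using le[OF j(1), of "%i. f (e i)"] linear_0[OF lin[OF j(1)]] j(2) by simp
 qed
 moreover have "E \<inter> span B = {0}"
 proof -
  have "x = 0" if x: "x \<in> E" "x \<in> span B" for x
  proof -
   have "(SUM i<\<nu>. l i x *\<^sub>R e i) = 0" using x(1) by (intro sum.neutral) (simp add: E_def)
   with span_B[OF x(2)] show ?thesis by (rule trans)
  qed
  thus ?thesis using subspace_0[OF \<open>subspace E\<close>] span_zero by blast
 qed
 moreover have "{u + v | u v. u \<in> E & v \<in> span B} = UNIV"
 proof (intro subset_antisym subset_UNIV subsetI CollectI)
  fix x
  show "EX u v. x = u + v & u \<in> E & v \<in> span B" by (intro exI conjI) (rule split \<pi>E sum_B)+
 qed
 moreover have "openin (top_of_set E) (U0 \<inter> E)" using g(1) by (simp add: openin_open_Int Int_commute)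
 moreover have "G ` (U0 \<inter> E) \<subseteq> span B" using sum_B by (auto simp: G_def)
 moreover have "Ck_on (Suc k) E (U0 \<inter> E) G" unfolding G_def by (intro Ck_fun_imp_Ck_on g(1) Ck_fun_sum_scaleR g4)
 moreover have "M \<inter> V = (%u. u + G u) ` (U0 \<inter> E)"
 proof (intro subset_antisym subsetI)
  fix x assume "x \<in> M \<inter> V"
  hence x: "\<pi> x \<in> U0" "!!i. i < \<nu> ==> l i x = c i (\<pi> x)" by (auto simp: M_iff)
  have "x = \<pi> x + G (\<pi> x)" using split[of x] x(2) by (simp add: G_def)
  thus "x \<in> (%u. u + G u) ` (U0 \<inter> E)" using x(1) \<pi>E by blast
 next
  fix x assume "x \<in> (%u. u + G u) ` (U0 \<inter> E)"
  then obtain u where u: "u \<in> U0" "u \<in> E" "x = u + G u" by blast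
  have lx: "l j x = c j u" if "j < \<nu>" for j using u(2,3) le[OF that] that by (simp add: E_def G_def linear_add[OF lin[OF that]])
  hence "\<pi> x = u" using u(3) by (simp add: \<pi>_def G_def)
  thus "x \<in> M \<inter> V" using lx u(1) g(5) by (simp add: M_iff V_iff)
 qed
 ultimately have chart: "subspace E & closed E & span B = span B & finite B & independent B & card B = \<nu> & E \<inter> span B = {0} &
   {u + v | u v. u \<in> E & v \<in> span B} = UNIV & open V & openin (top_of_set E) (U0 \<inter> E) & G ` (U0 \<inter> E) \<subseteq> span B &
   Ck_on (Suc k) E (U0 \<inter> E) G & M \<inter> V = (%u. u + G u) ` (U0 \<inter> E)" using \<open>open V\<close> by (intro conjI) (assumption | rule refl)+
 show thesis
 proof (rule that[of M])
  show "Ck_manifold (Suc k) \<nu> M" unfolding Ck_manifold_def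
  proof
   fix p assume "p \<in> M"
   hence "p \<in> V" by (simp add: M_def)
   with chart show "EX E F B V U g. subspace E & closed E & F = span B & finite B & independent B & card B = \<nu> &
    E \<inter> F = {0} & {u + v | u v. u \<in> E & v \<in> F} = UNIV & open V & p \<in> V &
    openin (top_of_set E) U & g ` U \<subseteq> F & Ck_on (Suc k) E U g & M \<inter> V = (%u. u + g u) ` U"
    by (intro exI[of _ E] exI[of _ "span B"] exI[of _ B] exI[of _ V] exI[of _ "U0 \<inter> E"] exI[of _ G]) simp
  qed
  have "\<pi> 0 = 0" using lin by (simp add: \<pi>_def linear_0)
  thus "0 \<in> M" using F(2) g(2,3) lin by (simp add: M_def V_iff linear_0)
  show "F i x = 0" if "x \<in> M" "i < \<nu>" for x i using that by (simp add: M_def)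
  show "M \<subseteq> U"
  proof
   fix x assume "x \<in> M"
   hence "\<pi> x + (SUM i<\<nu>. l i x *\<^sub>R e i) \<in> U" by (intro g6) (auto simp: M_iff)
   thus "x \<in> U" using split[of x] by simp
  qed
 qed
qed

section \<open>The manifold of perturbations preserving the eigenvalue\<close>

lemma (in hscale) dense_annihilator:
 assumes G: "G \<in> sp S (- t)" and dense: "dense_in S t (cspan A)" and z: "!!a. a \<in> A ==> pr a G = 0"
  and h: "h \<in> sp S t"
 shows "pr h G = 0"
proof -
 obtain K where K: "K > 0" "!!f g. f \<in> sp S t ==> g \<in> sp S (- t) ==> cmod (pr f g) <= K * hnorm S t f * hnorm S (- t) g"
  using pairing_bound by blast
 have sub: "cspan A \<subseteq> sp S t" using dense by (simp add: dense_in_def)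
 have "csubspace {f \<in> sp S t. pr f G = 0}"
 proof (rule complex_vector.subspaceI)
  show "0 \<in> {f \<in> sp S t. pr f G = 0}" using pairing_scale_left[OF H.V_zero G, of 0] by (simp add: H.V_zero)
 qed (auto simp: pairing_add_left[OF _ _ G] pairing_scale_left[OF _ G] H.V_add H.V_scale)
 hence "cspan A \<subseteq> {f \<in> sp S t. pr f G = 0}" using z sub complex_vector.span_superset by (intro complex_vector.span_minimal) blast+
 hence z': "pr a G = 0" if "a \<in> cspan A" for a using that by auto
 have "cmod (pr h G) <= 0 + x" if x: "x > 0" for x
 proof -
  define y where "y = x / (K * (hnorm S (- t) G + 1))"
  have pos: "K * (hnorm S (- t) G + 1) > 0" using K(1) H.nm_nonneg[OF G] by simp
  hence "y > 0" using x by (simp add: y_def)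
  then obtain a where a: "a \<in> cspan A" "hnorm S t (h - a) < y" using dense h unfolding dense_in_def hclosure_def by blast
  have as: "a \<in> sp S t" using a(1) sub by auto
  have "cmod (pr h G) = cmod (pr (h - a) G)" using pairing_add_left[OF H.V_diff[OF h as] as G] z'[OF a(1)] by simp
  also have "... <= K * hnorm S t (h - a) * hnorm S (- t) G" by (rule K(2)[OF H.V_diff[OF h as] G])
  also have "... <= K * y * (hnorm S (- t) G + 1)" using a(2) K(1) H.nm_nonneg[OF G] H.nm_nonneg[OF H.V_diff[OF h as]] by (intro mult_mono) auto
  also have "... = y * (K * (hnorm S (- t) G + 1))" by simp
  also have "... = x" unfolding y_def by (rule nonzero_eq_divide_eq[THEN iffD1, OF less_imp_neq[OF pos, symmetric] refl])
  finally show ?thesis by simp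
 qed
 hence "cmod (pr h G) <= 0" by (rule field_le_epsilon)
 thus ?thesis by simp
qed

locale dense_setting = rank_setting S D T s \<iota> k l0 \<delta> c \<kappa> \<rho> H n e m
 for S :: "'v::complex_vector scale" and D T s and \<iota> :: "'x::banach => 'v => 'v" and k l0 \<delta> c \<kappa> \<rho> H n e m +
 assumes n_pos: "n > 0" and dense_e: "dense_in S s (cspan {\<iota> W (e 0) | W. True})"
  and embedded: "of_real l0 \<in> cont_spectrum S D H"
begin

lemma e_reals: "j < n ==> e j \<in> reals"
 using e_s e_real by (simp add: reals_def)

lemma ip_reals: "f \<in> reals ==> g \<in> reals ==> ip0 f g = of_real (Re (ip0 f g))"
 using cj_ip[of f g] sp_s by (auto simp: reals_def complex_eq_iff)

lemma \<iota>_reals: "f \<in> reals ==> \<iota> W f \<in> reals"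
 using \<iota>_real[of W] \<iota>_in[of W f] sp_s[of f] unfolding reals_def real_operator_def by force

text \<open>At (l0, 0) the boundary value fixes e_j, so <f, Y e_j> = <f, e_j> is real and has no
  imaginary part.\<close>

lemma q_e: "f \<in> reals ==> j < n ==> q (l0, 0) f (e j) = 0"
 using q_real_vectors[OF l0_U, of f "e j"] e_reals[of j] ip_reals[of f "e j"] Y_e0[of j] pairing_0'[of f "e j"] e_0[of j]
 by (simp add: reals_def complex_eq_iff)

text \<open>The last \<open>m\<close> equations make \<open>jump (l, W) (e 0)\<close> vanish; by the first ones the projection of
 \<open>Y (l, W) (e 0)\<close> is then a multiple of \<open>e 0\<close>.\<close>

definition eqn :: "(nat => 'v) => nat => real \<times> 'x => real" where
 "eqn g i x = (if i < n - 1 then Re (pr (e (Suc i)) (Y x (e 0))) else Im (pr (g (i - (n - 1))) (Y x (e 0))))"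

text \<open>The representer of the differential of the i-th equation: by
  \<open>eqn_derivative\<close> the derivative in direction V is minus the real part of its pairing
  with V e_0. The factor 1 / (2 i) turns the jump into \<open>q\<close>.\<close>

definition dirv :: "(nat => 'v) => nat => 'v" where
 "dirv g i = (if i < n - 1 then e (Suc i) else (1 / (2 * \<i>)) *\<^sub>C jump (l0, 0) (g (i - (n - 1))))"

lemma Ck_fun_bounded_linear:
 assumes L: "bounded_linear (L :: complex => real)" and F: "Ck_fun j V F"
 shows "Ck_fun j V (%x. L (F x))"
proof -
 obtain K where K: "0 <= K" "!!x. norm (L x) <= norm x * K" using bounded_linear.nonneg_bounded[OF L] by blast
 have "bounded_lin norm_bnd norm_bnd L K"
 proof (intro bounded_lin.intro bounded_lin_axioms.intro bounding_norm K(1))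
  show "norm (L x) <= K * a" if "norm x <= a" for x a using K(2)[of x] mult_right_mono[OF that K(1)] by (simp add: mult.commute)
 qed (simp add: linear_add linear_scale bounded_linear.linear[OF L])
 from bounded_lin.Ck_postcompose[OF this F] show ?thesis .
qed

context
 fixes g assumes g: "!!i. i < m ==> g i \<in> reals"
begin

lemma eqn_Ck:
 assumes i: "i < m + n - 1"
 shows "Ck_fun k U (eqn g i)"
proof (cases "i < n - 1")
 case True
 hence eq: "eqn g i = (%x. Re (pr (e (Suc i)) (Y x (e 0))))" by (simp add: eqn_def fun_eq_iff)
 show ?thesis unfolding eq using True n_pos by (intro Ck_fun_bounded_linear[OF bounded_linear_Re] pairing_Y_Ck e_s) auto
next
 case False
 hence eq: "eqn g i = (%x. Im (pr (g (i - (n - 1))) (Y x (e 0))))" by (simp add: eqn_def fun_eq_iff)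
 have "g (i - (n - 1)) \<in> sps" using g[of "i - (n - 1)"] i False by (simp add: reals_def)
 thus ?thesis unfolding eq using n_pos by (intro Ck_fun_bounded_linear[OF bounded_linear_Im] pairing_Y_Ck e_s) auto
qed

lemma dirv_pairing:
 assumes i: "i < m + n - 1"
 shows "f \<in> reals ==> pr f (dirv g i) = of_real (if i < n - 1 then Re (ip0 f (e (Suc i))) else Re (q (l0, 0) f (g (i - (n - 1)))))"
  "dirv g i \<in> spm"
proof -
 show "dirv g i \<in> spm"
 proof (cases "i < n - 1")
  case True
  thus ?thesis using sp_ms[OF e_0[of "Suc i"]] by (simp add: dirv_def)
 next
  case False
  show ?thesis unfolding dirv_def if_not_P[OF False] by (intro H.V_scale blin_in[OF jump_blin[OF l0_U]])
 qed
 assume f: "f \<in> reals"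
 hence fs: "f \<in> sps" by (simp add: reals_def)
 show "pr f (dirv g i) = of_real (if i < n - 1 then Re (ip0 f (e (Suc i))) else Re (q (l0, 0) f (g (i - (n - 1)))))"
 proof (cases "i < n - 1")
  case True
  hence j: "Suc i < n" by simp
  thus ?thesis using True pairing_0'[OF fs e_0[OF j]] ip_reals[OF f e_reals[OF j]] by (simp add: dirv_def)
 next
  case False
  define h where "h = g (i - (n - 1))"
  have h: "h \<in> reals" unfolding h_def using g[of "i - (n - 1)"] False i by simp
  hence hs: "h \<in> sps" by (simp add: reals_def)
  have "pr f ((1 / (2 * \<i>)) *\<^sub>C jump (l0, 0) h) = q (l0, 0) f h"
   unfolding q_jump[OF l0_U fs hs] pairing_scale_right[OF fs blin_in[OF jump_blin[OF l0_U]]] by simp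
  moreover have "q (l0, 0) f h = of_real (Re (q (l0, 0) f h))" using q_real_vectors[OF l0_U, of f h] f h by (simp add: reals_def)
  ultimately show ?thesis using False by (simp only: dirv_def h_def if_False)
 qed
qed

text \<open>The l-derivative is the real or imaginary part of <f, e_0>, zero by orthogonality in the
  first case and by reality in the second; hence the motion of the eigenvalue will not enter.
  Symmetry of \<open>Y\<close> moves the boundary value from V e_0 to \<open>f\<close>.\<close>

lemma eqn_derivative:
 assumes i: "i < m + n - 1"
 obtains d where "(eqn g i has_derivative d) (at (l0, 0))" "d (1, 0) = 0"
  "!!V. d (0, V) = - Re (pr (\<iota> V (e 0)) (dirv g i))" "eqn g i (l0, 0) = 0"
proof -
 define f where "f = (if i < n - 1 then e (Suc i) else g (i - (n - 1)))"
 have f: "f \<in> reals" using e_reals g[of "i - (n - 1)"] i by (auto simp: f_def)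
 hence fs: "f \<in> sps" "cj S f = f" by (auto simp: reals_def)
 obtain d where d: "((%x. pr f (Y x (e 0))) has_derivative d) (at (l0, 0))" "d (1, 0) = ip0 f (e 0)"
  "!!V. d (0, V) = - pr f (Y (l0, 0) (\<iota> V (e 0)))" by (rule pairing_Y_e_derivative[OF fs(1) n_pos]) (rule that; assumption)
 have h: "\<iota> V (e 0) \<in> reals" "\<iota> V (e 0) \<in> sps" "cj S (\<iota> V (e 0)) = \<iota> V (e 0)" for V
  using \<iota>_reals[OF e_reals[OF n_pos]] by (auto simp: reals_def)
 have d0V: "d (0, V) = - pr (\<iota> V (e 0)) (Y (l0, 0) f)" for V using d(3) pairing_Y_symmetric[OF l0_U fs h(2,3)] by simp
 have p0: "pr f (Y (l0, 0) (e 0)) = ip0 f (e 0)" unfolding Y_e0[OF n_pos] by (rule pairing_0'[OF fs(1) e_0[OF n_pos]])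
 show thesis
 proof (cases "i < n - 1")
  case True
  hence j: "Suc i < n" by simp
  have 0: "Re (ip0 f (e 0)) = 0" using e_ortho[OF j n_pos] True by (simp add: f_def)
  show thesis
  proof (rule that[of "%h. Re (d h)"])
   show "(eqn g i has_derivative (%h. Re (d h))) (at (l0, 0))"
    using bounded_linear.has_derivative[OF bounded_linear_Re d(1)] True unfolding eqn_def[abs_def] by (simp add: f_def)
   show "Re (d (1, 0)) = 0" "eqn g i (l0, 0) = 0" using d(2) p0 0 True by (simp_all add: eqn_def f_def)
   show "Re (d (0, V)) = - Re (pr (\<iota> V (e 0)) (dirv g i))" for V using d0V[of V] True Y_e0[OF j] by (simp add: f_def dirv_def)
  qed
 next
  case False
  have 0: "Im (ip0 f (e 0)) = 0" using ip_reals[OF f e_reals[OF n_pos]] by (simp add: complex_eq_iff)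
  show thesis
  proof (rule that[of "%h. Im (d h)"])
   show "(eqn g i has_derivative (%h. Im (d h))) (at (l0, 0))"
    using bounded_linear.has_derivative[OF bounded_linear_Im d(1)] False unfolding eqn_def[abs_def] by (simp add: f_def)
   show "Im (d (1, 0)) = 0" "eqn g i (l0, 0) = 0" using d(2) p0 0 False by (simp_all add: eqn_def f_def)
   show "Im (d (0, V)) = - Re (pr (\<iota> V (e 0)) (dirv g i))" for V using d0V[of V] dirv_pairing(1)[OF i h(1), of V] q_real_vectors[OF l0_U h(2,3) fs] False
    by (simp add: f_def)
  qed
 qed
qed

text \<open>A vanishing combination annihilates all vectors W e_0, hence by density all of H_s. Each
  coefficient is then read off by a real vector \<open>h\<close> that pairs to 1 with its own
  representer and to 0 with the others.\<close>

lemma dirv_independent: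
 assumes ortho: "!!i j. i < m ==> j < m ==> q (l0, 0) (g i) (g j) = (if i = j then 1 else 0)"
  and z: "!!V. (SUM i<m + n - 1. a i * - Re (pr (\<iota> V (e 0)) (dirv g i))) = 0" and i: "i < m + n - 1"
 shows "a i = 0"
proof -
 define G where "G = (SUM i<m + n - 1. of_real (a i) *\<^sub>C dirv g i)"
 have Gin: "G \<in> spm" unfolding G_def using dirv_pairing(2) by (intro H.V_sum H.V_scale) auto
 have pG: "pr f G = of_real (SUM i<m + n - 1. a i * Re (pr f (dirv g i)))" if f: "f \<in> reals" for f
 proof -
  have "pr f G = (SUM i<m + n - 1. of_real (a i) * pr f (dirv g i))"
   unfolding G_def using f dirv_pairing(2) by (intro pairing_combination_right[of _ s]) (auto simp: reals_def)
  also have "... = (SUM i<m + n - 1. of_real (a i * Re (pr f (dirv g i))))" using dirv_pairing(1)[OF _ f] by (intro sum.cong refl) simp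
  finally show ?thesis by simp
 qed
 have zero: "pr h G = 0" if "h \<in> sps" for h
 proof (rule dense_annihilator[OF Gin dense_e _ that])
  fix b assume "b \<in> {\<iota> W (e 0) | W. True}"
  then obtain V where V: "b = \<iota> V (e 0)" by blast
  have "(SUM i<m + n - 1. a i * Re (pr (\<iota> V (e 0)) (dirv g i))) = 0" using z[of V] by (simp add: sum_negf)
  thus "pr b G = 0" using pG[OF \<iota>_reals[OF e_reals[OF n_pos]], of V] by (simp only: V of_real_0)
 qed
 have "EX h:reals. ALL j<m + n - 1. Re (pr h (dirv g j)) = (if j = i then 1 else 0)"
 proof (cases "i < n - 1")
  case True
  hence si: "Suc i < n" by simp
  have "q (l0, 0) (e (Suc i)) (g j) = 0" if "j < m" for j
   using q_e[OF g[OF that] si] semi_form.q_herm[OF q_semi_form[OF l0_U], of "e (Suc i)" "g j"] g[OF that] e_s[OF si] by (simp add: reals_def)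
  thus ?thesis using True si e_ortho[OF si] dirv_pairing(1)[OF _ e_reals[OF si]] by (intro bexI[OF _ e_reals[OF si]]) auto
 next
  case False
  define b where "b = i - (n - 1)"
  have b: "b < m" "i = b + (n - 1)" using False i by (auto simp: b_def)
  \<comment> \<open>Removing the projection makes \<open>h\<close> orthogonal to all e_j and leaves
    its \<open>q\<close>-products with the \<open>g j\<close> unchanged, because \<open>q\<close>
    vanishes on the e_j.\<close>
  define h where "h = g b - (SUM j<n. of_real (Re (ip0 (e j) (g b))) *\<^sub>C e j)"
  have h: "h \<in> reals" unfolding h_def by (intro reals_closed(2) reals_sum g b(1)) (simp add: e_reals)
  have gb: "g b \<in> sps" "g b \<in> sp0" using g[OF b(1)] sp_s by (auto simp: reals_def)
  have h': "h = g b - Pr (g b)" unfolding h_def Pr_def using ip_reals[OF e_reals g[OF b(1)]] by simp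
  have ip_h: "Re (ip0 h (e j)) = 0" if j: "j < n" for j
  proof -
   have "ip0 (e j) h = 0" unfolding h' using H.q_diff_right[OF e_0[OF j] gb(2) Pr_0] e_Pr[OF j] by simp
   thus ?thesis using H.q_herm[of h 0 "e j"] e_0[OF j] gb(2) Pr_0 by (simp add: h' H.V_diff)
  qed
  have q_h: "q (l0, 0) h (g j) = (if j = b then 1 else 0)" if j: "j < m" for j
  proof -
   interpret Q: semi_form "sps" "q (l0, 0)" by (rule q_semi_form[OF l0_U])
   have gj: "g j \<in> sps" using g[OF j] by (simp add: reals_def)
   have "q (l0, 0) (g j) (Pr (g b)) = 0" unfolding Pr_def using Q.q_combination[OF gj e_s, of "{..<n}"] q_e[OF g[OF j]] by simp
   hence "q (l0, 0) (g j) h = (if j = b then 1 else 0)" unfolding h' using Q.q_diff_right[OF gj gb(1) Pr_s] ortho[OF j b(1)] by simp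
   thus ?thesis using Q.q_herm[of h "g j"] gj gb(1) Pr_s by (simp add: h' Q.V_diff)
  qed
  have "Re (pr h (dirv g j)) = (if j = i then 1 else 0)" if j: "j < m + n - 1" for j
   using dirv_pairing(1)[OF j h] ip_h[of "Suc j"] q_h[of "j - (n - 1)"] j b False by auto
  thus ?thesis using h by blast
 qed
 then obtain h where h: "h \<in> reals" "!!j. j < m + n - 1 ==> Re (pr h (dirv g j)) = (if j = i then 1 else 0)" by blast
 have "(SUM j<m + n - 1. a j * Re (pr h (dirv g j))) = (SUM j<m + n - 1. if j = i then a j else 0)" using h(2) by (intro sum.cong) auto
 hence "pr h G = of_real (a i)" using pG[OF h(1)] i by (simp only: sum.delta finite_lessThan lessThan_iff if_True)
 thus ?thesis using zero[of h] h(1) by (simp add: reals_def)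
qed

end

text \<open>The equation of e_0 is solved for the energy, which defines \<open>lam\<close>; the
  remaining m + n - 1 equations on its graph are conditions on W alone. Embeddedness then comes from
  a vector of positive density, which exists since m > 0.\<close>

lemma manifold_exists:
 obtains M Nb N r lam where "Ck_manifold k (m + n - 1) M" "0 \<in> M" "open Nb" "0 \<in> Nb" "Nb \<subseteq> N" "open N" "0 \<in> N" "r > 0"
  "Ck_on k UNIV N lam" "lam 0 = l0" "!!W. W \<in> N ==> \<bar>lam W - l0\<bar> < r"
  "!!W l. W \<in> N ==> \<bar>l - l0\<bar> < r ==> (l, W) \<in> U & (Re (pr (e 0) (Y (l, W) (e 0))) = 1 \<longleftrightarrow> l = lam W)"
  "!!W. W \<in> M ==> W \<in> Nb ==> embedded_eigenvalue S D (HW W) (lam W)"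
proof -
 obtain k' where k': "k = Suc k'" using k_pos by (cases k) auto
 obtain g where g: "!!i. i < m ==> g i \<in> reals"
  "!!i j. i < m ==> j < m ==> q (l0, 0) (g i) (g j) = (if i = j then 1 else 0)" by (rule orthonormal_reals) (rule that; assumption)
 define F where "F x = Re (pr (e 0) (Y x (e 0))) - 1" for x
 note es = e_s[OF n_pos]
 have ee: "ip0 (e 0) (e 0) = 1" using e_ortho[OF n_pos n_pos] by simp
 obtain d where d: "((%x. pr (e 0) (Y x (e 0))) has_derivative d) (at (l0, 0))" "d (1, 0) = ip0 (e 0) (e 0)"
  by (rule pairing_Y_e_derivative[OF es n_pos]) (rule that; assumption)
 have F_d: "(F has_derivative (%h. Re (d h))) (at (l0, 0))"
  using has_derivative_diff[OF bounded_linear.has_derivative[OF bounded_linear_Re d(1)] has_derivative_const[of 1]] unfolding F_def[abs_def] by simp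
 have F_Ck: "Ck_fun (Suc k') U F"
  unfolding F_def[abs_def] using bounding.Ck_diff[OF bounding_norm open_U Ck_fun_bounded_linear[OF bounded_linear_Re pairing_Y_Ck[OF es es]] Ck_fun_const[of k U 1]] k' by simp
 have F0: "F (l0, 0) = 0" using Y_e0[OF n_pos] pairing_0'[OF es e_0[OF n_pos]] ee by (simp add: F_def)
 have F1: "Re (d (1, 0)) > 0" using d(2) ee by simp
 obtain U0 \<eta> \<tau> where impl: "open U0" "(l0, 0 :: 'x) \<in> U0" "\<eta> > 0"
  "!!x t. x \<in> U0 ==> \<bar>t\<bar> < \<eta> ==> x + t *\<^sub>R (1, 0) \<in> U"
  "!!x t. x \<in> U0 ==> \<bar>t\<bar> < \<eta> ==> F (x + t *\<^sub>R (1, 0)) = 0 \<longleftrightarrow> t = \<tau> x"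
  "!!x. x \<in> U0 ==> \<bar>\<tau> x\<bar> < \<eta>" "\<tau> (l0, 0) = 0" "Ck_fun (Suc k') U0 \<tau>"
  by (rule scalar_implicit_function[OF open_U l0_U F_Ck F0 F_d F1]) (rule that; assumption)
 define N where "N = (%W. (l0, W)) -` U0"
 define lam where "lam W = l0 + \<tau> (l0, W)" for W
 have N: "open N" "0 \<in> N" unfolding N_def using impl(1,2) by (auto intro!: open_vimage continuous_intros)
 have shift: "(l0, W) + (l - l0) *\<^sub>R (1, 0) = (l, W)" for l and W :: 'x by simp
 \<comment> \<open>The implicit function lives on the product space and moves along (1, 0); over the
   base point (l0, W) its parameter is l - l0.\<close>
 have unique: "(l, W) \<in> U & (Re (pr (e 0) (Y (l, W) (e 0))) = 1 \<longleftrightarrow> l = lam W)"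
  if "W \<in> N" "\<bar>l - l0\<bar> < \<eta>" for l W using impl(4,5)[of "(l0, W)" "l - l0", unfolded shift] that by (auto simp: N_def lam_def F_def)
 have lam_near: "\<bar>lam W - l0\<bar> < \<eta>" if "W \<in> N" for W using impl(6)[of "(l0, W)"] that by (simp add: N_def lam_def)
 have bl: "bounded_linear (%W :: 'x. (0 :: real, W))" by (intro bounded_linear_Pair bounded_linear_zero bounded_linear_ident)
 have \<tau>_Ck: "Ck_fun k N (%W. \<tau> (l0, W))"
  unfolding k' by (rule bounding.Ck_compose[OF bounding_norm N(1) bl, where \<phi> = "%W. (l0, W)" and c = "(l0, 0)" and g = "%_. 0" and w = 0,
   OF _ _ impl(8) Ck_fun_const]) (auto simp: N_def)
 have lam_Ck: "Ck_fun k N lam" unfolding lam_def[abs_def] by (rule bounding.Ck_add[OF bounding_norm Ck_fun_const \<tau>_Ck])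
 have eqn_lam_Ck: "Ck_fun (Suc k') N (%W. eqn g i (lam W, W))" if i: "i < m + n - 1" for i
 proof -
  have C: "Ck_fun k U (eqn g i)" by (rule eqn_Ck[where g = g, OF g(1) i])
  show ?thesis unfolding k'[symmetric]
   by (rule bounding.Ck_compose[OF bounding_norm N(1) bl, where \<phi> = "%W. (lam W, W)" and c = "(l0, 0)" and g = "%W. \<tau> (l0, W)" and w = "(1, 0)",
    OF _ _ C \<tau>_Ck]) (use unique lam_near in \<open>auto simp: lam_def\<close>)
 qed
 obtain lam' where "!!x. x \<in> N ==> (lam has_derivative (%h. lam' x [h])) (at x)"
  by (rule Ck_fun_SucD[OF lam_Ck[unfolded k']]) (rule that; assumption)
 note lam' = this[OF N(2)]
 have lam0: "lam 0 = l0" by (simp add: lam_def impl(7))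
 define dl where "dl i V = - Re (pr (\<iota> V (e 0)) (dirv g i))" for i V
 have eqn_lam: "((%W. eqn g i (lam W, W)) has_derivative dl i) (at 0)" "eqn g i (lam 0, 0) = 0" if i: "i < m + n - 1" for i
 proof -
  obtain d where d: "(eqn g i has_derivative d) (at (l0, 0))" "d (1, 0) = 0" "!!V. d (0, V) = - Re (pr (\<iota> V (e 0)) (dirv g i))" "eqn g i (l0, 0) = 0"
   by (rule eqn_derivative[where g = g, OF g(1) i]) (assumption | (rule that; assumption))+
  have lin: "linear d" using has_derivative_bounded_linear[OF d(1)] bounded_linear.linear by blast
  have "((%W. (lam W, W)) has_derivative (%h. (lam' 0 [h], h))) (at 0)" by (intro has_derivative_Pair lam' has_derivative_ident)
  from has_derivative_compose[OF this, of "eqn g i" d] d(1)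
  have "((%W. eqn g i (lam W, W)) has_derivative (%h. d (lam' 0 [h], h))) (at 0)" by (simp add: lam0)
  \<comment> \<open>As d (1, 0) = 0, the derivative of \<open>lam\<close> drops out of the chain
    rule.\<close>
  moreover have "d (a, h) = dl i h" for a h using linear_add[OF lin, of "a *\<^sub>R (1, 0)" "(0, h)"] linear_scale[OF lin, of a "(1, 0)"] d(2,3) by (simp add: dl_def)
  ultimately show "((%W. eqn g i (lam W, W)) has_derivative dl i) (at 0)" by (simp add: fun_eq_iff)
  show "eqn g i (lam 0, 0) = 0" using d(4) lam0 by simp
 qed
 have "EX v. ALL i<m + n - 1. ALL j<m + n - 1. dl i (v j) = (if i = j then 1 else 0)"
 proof (rule dual_vectors)
  show "linear (dl i)" if "i < m + n - 1" for i using has_derivative_bounded_linear[OF eqn_lam(1)[OF that]] by (rule bounded_linear.linear)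
  fix c assume "!!V. (SUM i<m + n - 1. c i * dl i V) = 0"
  thus "ALL i<m + n - 1. c i = 0" using dirv_independent[where g = g, OF g, of c] unfolding dl_def by blast
 qed
 then obtain v where v: "!!i j. i < m + n - 1 ==> j < m + n - 1 ==> dl i (v j) = (if i = j then 1 else 0)" by blast
 obtain M where M: "Ck_manifold (Suc k') (m + n - 1) M" "0 \<in> M" "M \<subseteq> N"
  "!!W i. W \<in> M ==> i < m + n - 1 ==> eqn g i (lam W, W) = 0"
  by (rule level_set_manifold[where F = "%i W. eqn g i (lam W, W)" and l = dl and e = v, OF N eqn_lam_Ck eqn_lam(2,1) v])
   (assumption+, (rule that; assumption))
 obtain r1 where r1: "r1 > 0" "!!l W. \<bar>l - l0\<bar> < r1 ==> norm (W :: 'x) < r1 ==> (l, W) \<in> U"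
  "!!l W f. \<bar>l - l0\<bar> < r1 ==> norm (W :: 'x) < r1 ==> f \<in> sps ==>
   Re (q (l, W) f f) <= 2 * (SUM i<m. cmod (q (l, W) (g i) f))^2"
  "!!l W i. \<bar>l - l0\<bar> < r1 ==> norm (W :: 'x) < r1 ==> i < m ==> Re (q (l, W) (g i) (g i)) > 0"
  by (rule near_rank_bound[where g = g, OF g]) (assumption+, (rule that; assumption))
 obtain r2 where r2: "r2 > 0" "!!W :: 'x. norm W < r2 ==> finite {\<mu>. \<bar>\<mu> - l0\<bar> < r2 & of_real \<mu> \<in> point_spectrum D (HW W)}"
  using few_eigenvalues by blast
 \<comment> \<open>\<open>r1\<close> is the range of the rank bound and of the positive density,
   \<open>r2\<close> that of the finiteness of eigenvalues; both constrain W as well as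
   \<open>lam W\<close>.\<close>
 define Nb where "Nb = (N \<inter> lam -` ball l0 (min r1 r2)) \<inter> ball 0 (min r1 r2)"
 have Nb: "open Nb" unfolding Nb_def by (intro open_Int continuous_open_preimage[OF Ck_fun_continuous_on[OF lam_Ck] N(1)] open_ball)
 have NbD: "W \<in> N" "\<bar>lam W - l0\<bar> < r1" "\<bar>lam W - l0\<bar> < r2" "norm W < r1" "norm W < r2" if "W \<in> Nb" for W
  using that by (auto simp: Nb_def dist_real_def)
 show thesis
 proof (rule that[of M Nb N \<eta> lam])
  show "Ck_on k UNIV N lam" using Ck_fun_imp_Ck_on[OF N(1) lam_Ck, of UNIV] by simp
  show "0 \<in> Nb" using N(2) lam0 r1(1) r2(1) by (simp add: Nb_def)
  show "Nb \<subseteq> N" by (auto simp: Nb_def)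
  show "Ck_manifold k (m + n - 1) M" using M(1) k' by simp
  fix W assume W: "W \<in> M" "W \<in> Nb"
  note Wb = NbD[OF W(2)]
  have ps: "of_real (lam W) \<in> point_spectrum D (HW W)"
  proof (rule eigenvalue_of_equations[where g = g, OF g(1) n_pos r1(2)[OF _ Wb(4)] r1(3)[OF _ Wb(4)] Wb(2)])
   show "Im (pr (g i) (Y (lam W, W) (e 0))) = 0" if "i < m" for i proof -
    \<comment> \<open>The equations of the \<open>g i\<close> are stored behind the n - 1 equations
      of e_1, ..., e_(n-1).\<close>
    have a: "i + (n - 1) < m + n - 1" "\<not> i + (n - 1) < n - 1" "i + (n - 1) - (n - 1) = i" using that n_pos by auto
    show ?thesis using M(4)[OF W(1) a(1)] unfolding eqn_def if_not_P[OF a(2)] a(3) .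
   qed
   show "Re (pr (e j) (Y (lam W, W) (e 0))) = (if j = 0 then 1 else 0)" if j: "j < n" for j proof (cases j)
    case 0
    thus ?thesis using unique[OF Wb(1) lam_near[OF Wb(1)]] by simp
   next
    case (Suc i)
    hence a: "i < m + n - 1" "i < n - 1" using j by auto
    show ?thesis using M(4)[OF W(1) a(1)] Suc unfolding eqn_def if_P[OF a(2)] by simp
   qed
  qed
  have m: "0 < m" by (rule rank_positive[OF embedded])
  have "of_real (lam W) \<in> cont_spectrum S D (HW W)" by (rule embedded_of_positive[OF r1(2)[OF Wb(2,4)] _ r1(4)[OF Wb(2,4) m] Wb(3) r2(2)[OF Wb(5)]])
    (use g(1)[OF m] in \<open>simp add: reals_def\<close>)
  thus "embedded_eigenvalue S D (HW W) (lam W)" using ps by (simp add: embedded_eigenvalue_def)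
 qed (use N Nb lam0 lam_near unique impl(3) M(2) in auto)
qed

end

section \<open>Proof of the theorem\<close>

lemma (in hscale) cj_combination:
 assumes "!!i. i \<in> J ==> f i \<in> sp S t"
 shows "cj S (SUM i:J. c i *\<^sub>C f i) = (SUM i:J. cnj (c i) *\<^sub>C cj S (f i))"
 using assms
proof (induction J rule: infinite_finite_induct)
 case (insert i J)
 thus ?case by (simp add: cj_add[of _ t] cj_scale[of _ t] H.V_sum H.V_scale)
qed (use cj_scale[OF H.V_zero, of 0] in simp_all)

lemma (in hscale) Ck_operator_family_subset:
 "Ck_operator_family S a b k J F ==> J' \<subseteq> J ==> Ck_operator_family S a b k J' F"
 unfolding Ck_operator_family_def by (elim exE) (rename_tac Q, rule_tac x = Q in exI, blast)

text \<open>Continuity gives boundedness near \<open>l\<close>; the second real component is a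
  dummy, as the calculus is set up for functions of a pair.\<close>

lemma (in hscale) Ck_operator_family_locally_bounded:
 assumes J: "open J" "l \<in> J" and F: "Ck_operator_family S a b k J F"
 shows "EX d>0. EX C>0. ALL \<mu>. \<bar>\<mu> - l\<bar> < d --> \<mu> \<in> J & bop a b (F \<mu>) C"
proof -
 have reg: "regular_family (bop a b) 0 (fst -` J) (%(x :: real \<times> real) _. F (fst x))" using Ck_regular[OF Ck_operator_family_imp_Ck[OF J(1) F]] .
 hence "\<forall>\<^sub>F y in nhds (l, 0 :: real). bd (bop a b) 0 (%vs :: (real \<times> real) list. F (fst y) - F l) 1"
  unfolding regular_family_def using J(2) by (elim ballE[of _ _ "(l, 0)"]) auto
 moreover obtain K where K: "K >= 0" "bop a b (F l) K" using reg J(2) unfolding regular_family_def bd_def by (elim ballE[of _ _ "(l, 0)"]) auto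
 ultimately have "\<forall>\<^sub>F y in nhds (l, 0 :: real). bop a b (F (fst y)) (1 + K) & y \<in> fst -` J"
 proof (intro eventually_conj eventually_nhds_in_open open_vimage J(1))
  assume ev: "\<forall>\<^sub>F y in nhds (l, 0 :: real). bd (bop a b) 0 (%vs :: (real \<times> real) list. F (fst y) - F l) 1"
  show "\<forall>\<^sub>F y in nhds (l, 0 :: real). bop a b (F (fst y)) (1 + K)" using ev
  proof eventually_elim
   case (elim y)
   hence "bop a b (F (fst y) - F l) 1" by (simp add: bd_def)
   from O.bnd_add[OF this K(2)] show ?case by simp
  qed
 qed (use J(2) in \<open>auto intro: continuous_intros\<close>)
 then obtain d where d: "d > 0" "!!y :: real \<times> real. dist y (l, 0) < d ==> bop a b (F (fst y)) (1 + K) & y \<in> fst -` J"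
  unfolding eventually_nhds_metric by blast
 have "\<mu> \<in> J & bop a b (F \<mu>) (1 + K)" if "\<bar>\<mu> - l\<bar> < d" for \<mu>
  using d(2)[of "(\<mu>, 0)"] that by (simp add: dist_Pair_Pair dist_real_def)
 thus ?thesis using d(1) K(1) by (intro exI[of _ d] conjI exI[of _ "1 + K"]) auto
qed

context selfadj
begin

text \<open>The exhaustion runs over the vectors fixed by the conjugation, whose mutual inner
  products are real, and starts from the given family. Splitting into real and imaginary parts shows
  that the result spans the complex eigenspace, so its length is \<open>n\<close>.\<close>

lemma real_eigenbasis:
 assumes real: "real_operator S D T" and dim: "has_cdim (eigenspace D T (of_real l)) n"
  and start: "!!i. i < r0 ==> b0 i \<in> eigenspace D T (of_real l)" "!!i. i < r0 ==> cj S (b0 i) = b0 i"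
   "!!i j. i < r0 ==> j < r0 ==> ip0 (b0 i) (b0 j) = (if i = j then 1 else 0)"
 obtains e where "r0 <= n" "!!i. i < r0 ==> e i = b0 i" "!!i. i < n ==> e i \<in> eigenspace D T (of_real l)" "!!i. i < n ==> cj S (e i) = e i"
  "!!i j. i < n ==> j < n ==> ip0 (e i) (e j) = (if i = j then 1 else 0)"
  "!!x. x \<in> eigenspace D T (of_real l) ==> x = (SUM i<n. ip0 (e i) x *\<^sub>C e i)"
proof -
 define E where "E = eigenspace D T (of_real l)"
 define M where "M = {f \<in> E. cj S f = f}"
 have E: "csubspace E" "E \<subseteq> sp0" unfolding E_def using eigenspace_subspace D_sub by (auto simp: eigenspace_def)
 note sub = complex_vector.subspace_diff[OF E(1)] complex_vector.subspace_scale[OF E(1)] complex_vector.subspace_0[OF E(1)]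
 have cjE: "cj S f \<in> E" if "f \<in> E" for f using that real cj_scale[OF D_sub, of f "of_real l"] by (simp add: E_def eigenspace_def real_operator_def)
 have M: "M \<subseteq> sp0" using E(2) by (auto simp: M_def)
 have ipr: "ip0 f g = of_real (Re (ip0 f g))" if "f \<in> M" "g \<in> M" for f g using cj_ip[of f g] that M by (auto simp: M_def complex_eq_iff)
 obtain B where B: "finite B" "card B = n" "\<not> cdependent B" "cspan B = E" using dim unfolding has_cdim_def E_def by blast
 have sc: "of_real t *\<^sub>C x \<in> M" if x: "x \<in> M" for x t using x M sub by (auto simp: M_def cj_scale[of _ 0])
 have cl: "x - ip0 b x *\<^sub>C b \<in> M" if x: "x \<in> M" "b \<in> M" for x b
 proof -
  have "ip0 b x *\<^sub>C b \<in> M" using sc[OF x(2)] ipr[OF x(2,1)] by metis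
  thus ?thesis using x M sub by (auto simp: M_def cj_diff[of _ 0] subset_iff)
 qed
 have bound: "r <= n" if b: "semi_form.ortho (ip0) b r M" for r b
 proof (rule H.ortho_bound[OF b M B(1), of n "%f. f"])
  show "card B <= n" "!!f. f \<in> M ==> f \<in> cspan B" using B by (auto simp: M_def)
  fix c g assume "(SUM i<=n. c i *\<^sub>C b i) = 0" "g \<in> M"
  thus "ip0 g (SUM i<=n. c i *\<^sub>C b i) = 0" using H.q_zero_right M by auto
 qed
 have start': "semi_form.ortho (ip0) b0 r0 M" using start by (simp add: H.ortho_def M_def E_def)
 obtain r e where e: "r0 <= r" "!!i. i < r0 ==> e i = b0 i" "semi_form.ortho (ip0) e r M"
  "!!x. x \<in> M ==> ip0 (x - (SUM i<r. ip0 (e i) x *\<^sub>C e i)) (x - (SUM i<r. ip0 (e i) x *\<^sub>C e i)) = 0"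
  by (rule H.orthonormal_exhaustion[OF M cl _ bound start']) (assumption | rule sc | (rule that; assumption))+
 have eM: "e i \<in> M" "e i \<in> sp0" if "i < r" for i using e(3) that M by (auto simp: H.ortho_def)
 have expM: "x = (SUM i<r. ip0 (e i) x *\<^sub>C e i)" if x: "x \<in> M" for x
 proof -
  have "x - (SUM i<r. ip0 (e i) x *\<^sub>C e i) \<in> sp0" using x M eM by (intro H.V_diff H.V_sum H.V_scale) auto
  hence "x - (SUM i<r. ip0 (e i) x *\<^sub>C e i) = 0" using e(4)[OF x] H.definite[of _ 0] by force
  thus ?thesis by simp
 qed
 have expE: "x = (SUM i<r. ip0 (e i) x *\<^sub>C e i)" if x: "x \<in> E" for x
 proof -
  obtain a b where ab: "cj S a = a" "cj S b = b" "x = a + \<i> *\<^sub>C b" "a \<in> E & b \<in> E"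
   using real_parts[of x 0] x E cjE[OF x] by (metis order_refl subsetD)
  hence "a \<in> M" "b \<in> M" by (auto simp: M_def)
  note m = this expM[OF this(1)] expM[OF this(2)]
  have "(SUM i<r. ip0 (e i) x *\<^sub>C e i) = (SUM i<r. ip0 (e i) a *\<^sub>C e i + \<i> *\<^sub>C ip0 (e i) b *\<^sub>C e i)" using eM m(1,2) M unfolding ab(3)
   by (intro sum.cong refl) (simp add: H.q_add_right H.q_scale_right H.V_scale scaleC_add_left scaleC_scaleC subset_iff)
  also have "... = a + \<i> *\<^sub>C b" unfolding sum.distrib complex_vector.scale_sum_right[symmetric] m(3)[symmetric] m(4)[symmetric] ..
  finally show ?thesis using ab(3) by simp
 qed
 have "B \<subseteq> cspan (e ` {..<r})"
 proof
  fix x assume "x \<in> B"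
  hence x: "x \<in> E" using complex_vector.span_base[of x B] B(4) by simp
  have "(SUM i<r. ip0 (e i) x *\<^sub>C e i) \<in> cspan (e ` {..<r})" by (intro complex_vector.span_sum complex_vector.span_scale complex_vector.span_base imageI)
  thus "x \<in> cspan (e ` {..<r})" using expE[OF x] by simp
 qed
 from complex_vector.independent_span_bound[OF _ B(3) this] have "n <= r" using B(2) card_image_le[of "{..<r}" e] by simp
 hence "r = n" using bound[OF e(3)] by simp
 show thesis
 proof (rule that[of e])
  show "x = (SUM i<n. ip0 (e i) x *\<^sub>C e i)" if "x \<in> eigenspace D T (of_real l)" for x using expE that unfolding \<open>r = n\<close> E_def .
  show "ip0 (e i) (e j) = (if i = j then 1 else 0)" if "i < n" "j < n" for i j using e(3) that unfolding \<open>r = n\<close> H.ortho_def by blast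
 qed (use e(1,2) eM \<open>r = n\<close> in \<open>auto simp: M_def E_def\<close>)
qed

text \<open>Because the basis lies in H_s, its coefficients make sense for \<open>f\<close> in H_-s,
  where A evaluates the projection on boundary values.\<close>

lemma eigenproj_eq:
 fixes n :: nat
 assumes e: "!!i. i < n ==> e i \<in> eigenspace D T (of_real l)"
  "!!i j. i < n ==> j < n ==> ip0 (e i) (e j) = (if i = j then 1 else 0)"
  "!!x. x \<in> eigenspace D T (of_real l) ==> x = (SUM i<n. ip0 (e i) x *\<^sub>C e i)"
  and es: "!!i. i < n ==> e i \<in> sp S s" and f: "f \<in> sp S (- s)" and s: "0 <= s"
 shows "eigenproj S D T l f = (SUM i<n. pr (e i) f *\<^sub>C e i)"
proof -
 define E where "E = eigenspace D T (of_real l)"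
 define p where "p = (SUM i<n. pr (e i) f *\<^sub>C e i)"
 have E: "csubspace E" "E \<subseteq> sp0" unfolding E_def using eigenspace_subspace D_sub by (auto simp: eigenspace_def)
 have e0: "e i \<in> sp0" if "i < n" for i using E(2) e(1)[OF that] by (auto simp: E_def)
 have pE: "p \<in> E" unfolding p_def E_def by (intro complex_vector.subspace_sum complex_vector.subspace_scale eigenspace_subspace e) auto
 have ip_p: "ip0 (e i) p = pr (e i) f" if i: "i < n" for i
 proof -
  have "ip0 (e i) p = (SUM j<n. pr (e j) f * ip0 (e i) (e j))" unfolding p_def by (rule H.q_combination) (use e0 i in auto)
  also have "... = (SUM j<n. if i = j then pr (e j) f else 0)" using e(2) i by (intro sum.cong) auto
  finally show ?thesis using i by simp
 qed
 have pp: "pr x p = pr x f" if x: "x \<in> E" for x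
 proof -
  have "pr (SUM i<n. ip0 (e i) x *\<^sub>C e i) f = (SUM i<n. cnj (ip0 (e i) x) * pr (e i) f)" using es by (intro pairing_combination_left[OF f]) auto
  also have "... = (SUM i<n. cnj (ip0 (e i) x) * pr (e i) p)" using ip_p pE E(2) e0 by (intro sum.cong refl) (simp add: pairing_0 subset_iff)
  also have "... = pr (SUM i<n. ip0 (e i) x *\<^sub>C e i) p" using e0 pE E(2) by (intro pairing_combination_left[of _ 0, symmetric]) auto
  finally show ?thesis using e(3) x unfolding E_def by metis
 qed
 show ?thesis unfolding eigenproj_def proj_onto_def E_def[symmetric] p_def[symmetric]
 proof (rule the_equality)
  show "p \<in> E & (ALL x:E. pr x p = pr x f)" using pE pp by blast
  fix p' assume p': "p' \<in> E & (ALL x:E. pr x p' = pr x f)"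
  hence d: "p' - p \<in> E" "p' - p \<in> sp0" "p' \<in> sp0" "p \<in> sp0" using complex_vector.subspace_diff[OF E(1)] pE E(2) by auto
  have "ip0 (p' - p) (p' - p) = 0" using p' pp d(1) pairing_0[OF d(2,3)] pairing_0[OF d(2,4)] by (simp add: H.q_diff_right d)
  thus "p' = p" using H.definite[OF d(2)] by force
 qed
qed

end

theorem theorem3:
  fixes S :: "'v::complex_vector scale"
    and D :: "'v set" and H :: "'v \<Rightarrow> 'v"
    and lam0 s1 s \<delta>\<^sub>1 :: real
    and n k m :: nat
    and \<iota> :: "'x::banach \<Rightarrow> 'v \<Rightarrow> 'v"
    and \<psi>1 :: 'v
  assumes scale: "hilbert_scale S"
    and H: "selfadjoint S D H" "real_operator S D H"
    and eigenvalue: "embedded_eigenvalue S D H lam0"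
    and multiplicity: "has_cdim (eigenspace D H (of_real lam0)) n" "n \<ge> 2"
    and isolated: "complex_of_real lam0 isolated_in point_spectrum D H"
    and regular: "eigenspace D H (of_real lam0) \<subseteq> (\<Inter>t\<in>{0..}. sp S t)"
    and k: "k \<ge> 1"
    and s1: "s1 \<ge> 0"
    and lap: "\<And>t. t > s1 \<Longrightarrow> \<exists>d>0.
          Ck_limiting_absorption S k t D (Hbar S D H lam0) {lam0 - d<..<lam0 + d}"
    and s: "s > s1"
    and \<delta>\<^sub>1: "\<delta>\<^sub>1 > 0"
          "Ck_limiting_absorption S k s D (Hbar S D H lam0) {lam0 - \<delta>\<^sub>1<..<lam0 + \<delta>\<^sub>1}"
    and X: "perturbation_space S s \<iota>"
    and a: "\<And>lam. lam \<in> {lam0 - \<delta>\<^sub>1<..<lam0 + \<delta>\<^sub>1} \<Longrightarrow>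
          has_cdim (spectral_delta S s D (Hbar S D H lam0) lam ` sp S s) m"
    and b: "\<psi>1 \<in> eigenproj S D H lam0 ` sp S 0" "cj S \<psi>1 = \<psi>1"
          "dense_in S s (cspan {\<iota> W \<psi>1 | W. True})"
  shows "\<exists>M Nbhd \<delta> N r lam1.
          Ck_manifold k (m + n - 1) M \<and> 0 \<in> M \<and>
          open Nbhd \<and> 0 \<in> Nbhd \<and> Nbhd \<subseteq> N \<and> \<delta> > 0 \<and>
          eigenvalue_branch S k s D H lam0 \<iota> (of_real (1 / hnorm S 0 \<psi>1) *\<^sub>C \<psi>1) N r lam1 \<and>
          (\<forall>W\<in>M \<inter> Nbhd.
             lam1 W \<in> {lam0 - \<delta><..<lam0 + \<delta>} \<and>
             embedded_eigenvalue S D (\<lambda>f. H f + \<iota> W f) (lam1 W))"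
proof -
 interpret A: selfadj S D H by (intro selfadj.intro selfadj_axioms.intro hscale.intro scale H(1))
 define E where "E = eigenspace D H (of_real lam0)"
 have s0: "s > 0" using s s1 by simp
 have Es: "f \<in> sp S s" if "f \<in> E" for f using regular s0 that unfolding E_def by fastforce
 have ED: "f \<in> D" "H f = of_real lam0 *\<^sub>C f" if "f \<in> E" for f using that by (auto simp: E_def eigenspace_def)
 have \<psi>E: "\<psi>1 \<in> E"
 proof -
  obtain e where e: "!!i. i < n ==> e i \<in> eigenspace D H (of_real lam0)"
   "!!i j. i < n ==> j < n ==> ip S 0 (e i) (e j) = (if i = j then 1 else 0)"
   "!!x. x \<in> eigenspace D H (of_real lam0) ==> x = (SUM i<n. ip S 0 (e i) x *\<^sub>C e i)"
   by (rule A.real_eigenbasis[OF H(2) multiplicity(1), of 0]) (simp_all, (rule that; assumption))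
  obtain f where f: "f \<in> sp S 0" "\<psi>1 = eigenproj S D H lam0 f" using b(1) by blast
  have "\<psi>1 = (SUM i<n. pairing S (e i) f *\<^sub>C e i)" unfolding f(2) by (rule A.eigenproj_eq[where e = e and n = n and s = 0])
    (assumption | rule e | (use e(1) A.D_sub in \<open>auto simp: eigenspace_def\<close>; fail) | simp add: f(1))+
  thus ?thesis unfolding E_def by (simp only:) (intro complex_vector.subspace_sum complex_vector.subspace_scale A.eigenspace_subspace e(1), simp)
 qed
 \<comment> \<open>If it were 0, the zero space would be dense in H_s, forcing H_s and with it the
   eigenspace to be trivial.\<close>
 have \<psi>0: "\<psi>1 ~= 0"
 proof
  assume z: "\<psi>1 = 0"
  have "cspan {\<iota> W \<psi>1 | W. True} \<subseteq> {0}"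
  proof -
   have "{\<iota> W \<psi>1 | W. True} \<subseteq> {0}" using X A.blin_zero unfolding perturbation_space_def z by blast
   thus ?thesis using complex_vector.span_minimal[OF _ complex_vector.subspace_single_0] by blast
  qed
  hence small: "hnorm S s f < e" if "f \<in> sp S s" "e > 0" for f e using b(3) that unfolding dense_in_def hclosure_def by force
  have "f = 0" if f: "f \<in> E" for f
  proof -
   have "hnorm S s f <= 0" using small[OF Es[OF f]] by (meson not_less_iff_gr_or_eq not_le)
   thus ?thesis using A.H.nm_eq_0[OF Es[OF f]] A.H.nm_nonneg[OF Es[OF f]] by simp
  qed
  thus False using eigenvalue unfolding embedded_eigenvalue_def point_spectrum_def E_def by blast
 qed
 have \<psi>s: "\<psi>1 \<in> sp S 0" using A.D_sub[OF ED(1)[OF \<psi>E]] .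
 define \<nu> where "\<nu> = hnorm S 0 \<psi>1"
 have \<nu>: "\<nu> > 0" using A.H.nm_nonneg[OF \<psi>s] A.H.nm_eq_0[OF \<psi>s] \<psi>0 unfolding \<nu>_def by simp
 define \<psi> where "\<psi> = of_real (1 / \<nu>) *\<^sub>C \<psi>1"
 have \<psi>: "\<psi> \<in> eigenspace D H (of_real lam0)" "cj S \<psi> = \<psi>" "ip S 0 \<psi> \<psi> = 1"
 proof -
  show "\<psi> \<in> eigenspace D H (of_real lam0)" unfolding \<psi>_def using \<psi>E unfolding E_def by (rule complex_vector.subspace_scale[OF A.eigenspace_subspace])
  show "cj S \<psi> = \<psi>" unfolding \<psi>_def using b(2) A.cj_scale[OF \<psi>s, of "of_real (1 / \<nu>)"] by simp
  have "hnorm S 0 \<psi> = 1" unfolding \<psi>_def using \<nu> by (simp add: A.H.nm_scale[OF \<psi>s] \<nu>_def[symmetric] norm_divide)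
  thus "ip S 0 \<psi> \<psi> = 1" using A.H.B_self[of \<psi> 0] A.H.V_scale[OF \<psi>s] by (simp add: \<psi>_def)
 qed
 \<comment> \<open>The basis is prolonged from the normalized vector, so that it becomes
   \<open>e 0\<close>.\<close>
 obtain e where e0: "!!i. i < (1::nat) ==> e i = \<psi>" and e: "!!i. i < n ==> e i \<in> eigenspace D H (of_real lam0)"
   "!!i j. i < n ==> j < n ==> ip S 0 (e i) (e j) = (if i = j then 1 else 0)"
   "!!x. x \<in> eigenspace D H (of_real lam0) ==> x = (SUM i<n. ip S 0 (e i) x *\<^sub>C e i)"
  and e_cj: "!!i. i < n ==> cj S (e i) = e i"
  by (rule A.real_eigenbasis[OF H(2) multiplicity(1), of 1 "%_. \<psi>"]) (rule \<psi>(1), rule \<psi>(2), simp add: \<psi>(3), (rule that; assumption))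
 have es: "e i \<in> sp S s" if "i < n" for i using Es e(1)[OF that] by (simp add: E_def)
 have proj_s: "eigenproj S D H lam0 f = (SUM i<n. pairing S (e i) f *\<^sub>C e i)" if "f \<in> sp S (- s)" for f
  by (rule A.eigenproj_eq[where e = e and n = n and s = s]) (assumption | rule e es that less_imp_le[OF s0])+
 have proj_0: "eigenproj S D H lam0 f = (SUM i<n. ip S 0 (e i) f *\<^sub>C e i)" if f: "f \<in> sp S 0" for f
  using proj_s[OF A.sp_neg[OF less_imp_le[OF s0] f]] A.pairing_0[OF A.sp_0[OF less_imp_le[OF s0] es] f] by simp
 let ?T = "Hbar S D H lam0"
 have e00: "e i \<in> sp S 0" if "i < n" for i using A.sp_0[OF less_imp_le[OF s0] es[OF that]] .
 have T_eq: "?T f = H f + (SUM i<n. ip S 0 (e i) f *\<^sub>C e i)" if "f \<in> D" for f using proj_0[OF A.D_sub[OF that]] by (simp add: Hbar_def)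
 have T_e: "?T (e i) = of_real (lam0 + 1) *\<^sub>C e i" if i: "i < n" for i
 proof -
  have ei: "e i \<in> E" unfolding E_def by (rule e(1)[OF i])
  show ?thesis using T_eq[OF ED(1)[OF ei]] ED(2)[OF ei] e(3)[OF e(1)[OF i], symmetric] by (simp add: scaleC_add_left scaleC_one)
 qed
 have T_sa: "selfadjoint S D ?T"
 proof -
  have "selfadjoint S D (%f. H f + eigenproj S D H lam0 f)"
  proof (rule A.selfadjoint_perturbed)
   show "clinear_on (sp S 0) (eigenproj S D H lam0)" unfolding clinear_on_def by (auto simp: proj_0 A.H.V_add A.H.V_scale A.H.q_add_right A.H.q_scale_right e00
      scaleC_add_left sum.distrib complex_vector.scale_sum_right scaleC_scaleC)
   show in0: "eigenproj S D H lam0 f \<in> sp S 0" if "f \<in> sp S 0" for f unfolding proj_0[OF that] using e00 by (intro A.H.V_sum A.H.V_scale) auto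
   fix f g assume f: "f \<in> sp S 0" and g: "g \<in> sp S 0"
   have comb: "ip S 0 x (eigenproj S D H lam0 y) = (SUM i<n. ip S 0 (e i) y * ip S 0 x (e i))"
    if "x \<in> sp S 0" "y \<in> sp S 0" for x y unfolding proj_0[OF that(2)] by (rule A.H.q_combination[OF that(1)]) (use e00 in auto)
   have "ip S 0 (eigenproj S D H lam0 f) g = cnj (SUM i<n. ip S 0 (e i) f * ip S 0 g (e i))" using A.H.q_herm[OF in0[OF f] g] comb[OF g f] by simp
   also have "... = (SUM i<n. cnj (ip S 0 (e i) f) * cnj (ip S 0 g (e i)))" by simp
   also have "... = (SUM i<n. ip S 0 (e i) g * ip S 0 f (e i))" using A.H.q_herm[OF f e00] A.H.q_herm[OF e00 g] by (intro sum.cong refl) (simp add: mult.commute)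
   finally show "ip S 0 (eigenproj S D H lam0 f) g = ip S 0 f (eigenproj S D H lam0 g)" using comb[OF f g] by simp
  qed
  thus ?thesis by (simp add: Hbar_def[abs_def])
 qed
 have T_real: "real_operator S D ?T" unfolding real_operator_def
 proof (intro ballI conjI)
  fix f assume f: "f \<in> D"
  note f0 = A.D_sub[OF f]
  show cD: "cj S f \<in> D" using H(2) f by (simp add: real_operator_def)
  have "cj S (SUM i<n. ip S 0 (e i) f *\<^sub>C e i) = (SUM i<n. cnj (ip S 0 (e i) f) *\<^sub>C cj S (e i))" using e00 by (intro A.cj_combination[of _ _ 0]) auto
  also have "... = (SUM i<n. ip S 0 (e i) (cj S f) *\<^sub>C e i)" using e_cj A.cj_ip[OF e00 f0] by (intro sum.cong refl) (metis lessThan_iff)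
  finally have "cj S (SUM i<n. ip S 0 (e i) f *\<^sub>C e i) = (SUM i<n. ip S 0 (e i) (cj S f) *\<^sub>C e i)" .
  moreover have "(SUM i<n. ip S 0 (e i) f *\<^sub>C e i) \<in> sp S 0" using e00 by (intro A.H.V_sum A.H.V_scale) auto
  ultimately show "?T (cj S f) = cj S (?T f)" using H(2) f A.cj_add[OF A.T_in[OF f]] by (simp add: T_eq cD real_operator_def)
 qed
 interpret P: perturbation S D ?T s \<iota> by (intro perturbation.intro selfadj.intro selfadj_axioms.intro hscale.intro scale T_sa perturbation_axioms.intro s0 X)
 define J where "J = {lam0 - \<delta>\<^sub>1<..<lam0 + \<delta>\<^sub>1}"
 have J: "open J" "lam0 \<in> J" using \<delta>\<^sub>1(1) by (auto simp: J_def)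
 have fam: "Ck_operator_family S s (- s) k J (boundary_value S s D ?T \<sigma>)"
  and bdry: "l \<in> J ==> is_boundary_value S s D ?T \<sigma> l (boundary_value S s D ?T \<sigma> l)" if \<sigma>: "\<sigma> \<in> {1, -1}" for \<sigma> l
 proof -
  show "Ck_operator_family S s (- s) k J (boundary_value S s D ?T \<sigma>)" using \<delta>\<^sub>1(2) \<sigma> unfolding Ck_limiting_absorption_def J_def by blast
  assume "l \<in> J"
  then obtain R where "is_boundary_value S s D ?T \<sigma> l R" using \<delta>\<^sub>1(2) \<sigma> unfolding Ck_limiting_absorption_def J_def by blast
  thus "is_boundary_value S s D ?T \<sigma> l (boundary_value S s D ?T \<sigma> l)" using P.boundary_value_eq[of 0 \<sigma> l R] unfolding P.TW_zero by simp
 qed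
 have "EX d>0. EX C>0. ALL \<mu>. \<bar>\<mu> - lam0\<bar> < d --> \<mu> \<in> J & A.bop s (- s) (boundary_value S s D ?T \<sigma> \<mu>) C" if "\<sigma> \<in> {1, -1}" for \<sigma>
  by (rule A.Ck_operator_family_locally_bounded[OF J fam[OF that]])
 then obtain d C where dC: "!!\<sigma>. \<sigma> \<in> {1, -1} ==> d \<sigma> > 0" "!!\<sigma>. \<sigma> \<in> {1, -1} ==> C \<sigma> > 0"
  "!!\<sigma> \<mu>. \<sigma> \<in> {1, -1} ==> \<bar>\<mu> - lam0\<bar> < d \<sigma> ==> \<mu> \<in> J & A.bop s (- s) (boundary_value S s D ?T \<sigma> \<mu>) (C \<sigma>)"
  for \<sigma> :: real by metis
 define \<delta> where "\<delta> = min (d 1) (d (- 1))"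
 \<comment> \<open>The sum bounds the boundary values for both signs at once.\<close>
 define c where "c = C 1 + C (- 1)"
 have \<delta>: "\<delta> > 0" and c: "c > 0" using dC(1,2)[of 1] dC(1,2)[of "- 1"] by (auto simp: \<delta>_def c_def)
 obtain \<kappa> where \<kappa>: "\<kappa> > 0" "!!W. A.bop (- s) s (\<iota> W) (\<kappa> * norm W)" by (rule P.\<iota>_bound) (rule that; assumption)
 \<comment> \<open>The largest radius with 4 c \<kappa> \<rho> <= 1.\<close>
 define \<rho> where "\<rho> = 1 / (4 * c * \<kappa>)"
 define I where "I = {lam0 - \<delta><..<lam0 + \<delta>}"
 have near: "\<bar>\<mu> - lam0\<bar> < d \<sigma>" if "\<mu> \<in> I" "\<sigma> \<in> {1, -1}" for \<mu> \<sigma>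
  using that by (auto simp: I_def \<delta>_def abs_less_iff)
 have IJ: "I \<subseteq> J" using dC(3)[of 1] near[of _ 1] by auto
 interpret L: lap_nbhd S D ?T s \<iota> k lam0 \<delta> c \<kappa> \<rho>
 proof (intro lap_nbhd.intro P.perturbation_axioms lap_nbhd_axioms.intro \<delta> c \<kappa>)
  show "\<rho> > 0" "4 * c * (\<kappa> * \<rho>) <= 1" using c \<kappa>(1) by (auto simp: \<rho>_def)
  fix \<sigma> l :: real assume \<sigma>: "\<sigma> \<in> {1, -1}" and "l \<in> {lam0 - \<delta><..<lam0 + \<delta>}"
  hence l: "l \<in> I" by (simp add: I_def)
  show "is_boundary_value S s D ?T \<sigma> l (boundary_value S s D ?T \<sigma> l)" using bdry[OF \<sigma>] l IJ by blast
  have "C \<sigma> <= c" using \<sigma> dC(2)[of 1] dC(2)[of "- 1"] by (auto simp: c_def)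
  thus "A.bop s (- s) (boundary_value S s D ?T \<sigma> l) c" using dC(3)[OF \<sigma> near[OF l \<sigma>]] A.bop_mono by blast
 next
  show "Ck_operator_family S s (- s) k {lam0 - \<delta><..<lam0 + \<delta>} (boundary_value S s D ?T (- 1))"
   using A.Ck_operator_family_subset[OF fam[of "- 1"]] IJ by (simp add: I_def)
 qed
 interpret R: real_lap S D ?T s \<iota> k lam0 \<delta> c \<kappa> \<rho> by (intro real_lap.intro L.lap_nbhd_axioms real_lap_axioms.intro T_real k)
 interpret E: eigen_setting S D ?T s \<iota> k lam0 \<delta> c \<kappa> \<rho> H n e
 proof (intro eigen_setting.intro R.real_lap_axioms eigen_setting_axioms.intro H(1) es e_cj e(2) T_e)
  show "H f = ?T f - (SUM i<n. ip S 0 (e i) f *\<^sub>C e i)" if "f \<in> D" for f using T_eq[OF that] by simp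
  show "e i \<in> D" if "i < n" for i using ED(1) e(1)[OF that] by (simp add: E_def)
 qed
 have delta_jump: "spectral_delta S s D ?T l f = (1 / (2 * of_real pi * \<i>)) *\<^sub>C R.jump (l, 0) f" for l f
  by (simp add: spectral_delta_def R.jump_def L.Y_def L.bv_def P.TW_zero)
 have emb: "of_real lam0 \<in> cont_spectrum S D H" using eigenvalue by (simp add: embedded_eigenvalue_def)
 have jump_lin: "R.jump (l, 0) (a *\<^sub>C f) = a *\<^sub>C R.jump (l, 0) f" if "l \<in> I" "f \<in> sp S s" for l a f
 proof -
  have x: "(l, 0) \<in> L.U" using L.U_zero that(1) by (simp add: I_def)
  show ?thesis using A.blinD(3)[OF A.bopD(1)[OF L.bv_props(2)[OF _ x]] that(2), of "- 1" a] A.blinD(3)[OF A.bopD(1)[OF L.bv_props(2)[OF _ x]] that(2), of 1 a]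
   by (simp add: R.jump_def L.Y_def complex_vector.scale_right_diff_distrib)
 qed
 interpret K: rank_setting S D ?T s \<iota> k lam0 \<delta> c \<kappa> \<rho> H n e m
 proof (intro rank_setting.intro E.eigen_setting_axioms rank_setting_axioms.intro)
  fix l assume "l \<in> {lam0 - \<delta><..<lam0 + \<delta>}"
  hence l: "l \<in> I" by (simp add: I_def)
  have "R.jump (l, 0) ` sp S s = spectral_delta S s D ?T l ` sp S s"
  proof (intro subset_antisym image_subsetI)
   fix f assume f: "f \<in> sp S s"
   show "spectral_delta S s D ?T l f \<in> R.jump (l, 0) ` sp S s" unfolding delta_jump using jump_lin[OF l f, symmetric] A.H.V_scale[OF f] by blast
   have "R.jump (l, 0) f = spectral_delta S s D ?T l ((2 * of_real pi * \<i>) *\<^sub>C f)" unfolding delta_jump jump_lin[OF l f] by (simp add: scaleC_scaleC scaleC_one)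
   thus "R.jump (l, 0) f \<in> spectral_delta S s D ?T l ` sp S s" using A.H.V_scale[OF f] by blast
  qed
  moreover have "l \<in> {lam0 - \<delta>\<^sub>1<..<lam0 + \<delta>\<^sub>1}" using IJ l by (auto simp: J_def)
  ultimately show "has_cdim (R.jump (l, 0) ` sp S s) m" using a by simp
 qed
 have e\<psi>: "e 0 = \<psi>" using e0 by simp
 \<comment> \<open>\<open>e 0\<close> is a real multiple of \<open>\<psi>1\<close>, and the
   perturbations form a real vector space, so the factor can be moved into W.\<close>
 have "{\<iota> W (e 0) | W. True} = {\<iota> W \<psi>1 | W. True}"
 proof -
  have sc: "\<iota> W (e 0) = \<iota> ((1 / \<nu>) *\<^sub>R W) \<psi>1" for W
   unfolding e\<psi> \<psi>_def using A.blinD(3)[OF P.\<iota>_blin P.sp_ms[OF \<psi>s], of W "of_real (1 / \<nu>)"] P.\<iota>_scale[of "1 / \<nu>" W] by simp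
  have "\<iota> W \<psi>1 = \<iota> (\<nu> *\<^sub>R W) (e 0)" for W unfolding sc using \<nu> by simp
  thus ?thesis using sc by blast
 qed
 then interpret Z: dense_setting S D ?T s \<iota> k lam0 \<delta> c \<kappa> \<rho> H n e m
  using b(3) multiplicity(2) emb by (intro dense_setting.intro K.rank_setting_axioms dense_setting_axioms.intro) auto
 obtain M Nb N r lam where M: "Ck_manifold k (m + n - 1) M" "0 \<in> M" "open Nb" "0 \<in> Nb" "Nb \<subseteq> N" "open N" "0 \<in> N" "r > 0"
  "Ck_on k UNIV N lam" "lam 0 = lam0" "!!W. W \<in> N ==> \<bar>lam W - lam0\<bar> < r"
  "!!W l. W \<in> N ==> \<bar>l - lam0\<bar> < r ==> (l, W) \<in> L.U & (Re (pairing S (e 0) (L.Y (l, W) (e 0))) = 1 \<longleftrightarrow> l = lam W)"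
  "!!W. W \<in> M ==> W \<in> Nb ==> embedded_eigenvalue S D (%f. H f + \<iota> W f) (lam W)"
  by (rule Z.manifold_exists) (rule that; assumption)
 have n0: "0 < n" using multiplicity(2) by simp
 have interval: "l \<in> {lam0 - r<..<lam0 + r} \<longleftrightarrow> \<bar>l - lam0\<bar> < r" for l by (auto simp: abs_less_iff)
 \<comment> \<open>The two boundary values are adjoint, so on the diagonal their mean is the real
   part of one of them: the defining equation of the branch is the one solved by
   \<open>lam\<close>.\<close>
 have A_eq: "pairing S (e 0) (A_op S s D H lam0 l (\<iota> W) (e 0)) = of_real (Re (pairing S (e 0) (L.Y (l, W) (e 0))))"
  if x: "(l, W) \<in> L.U" for l W
 proof -
  define u where "u = L.bv (- 1) l W (e 0) + L.bv 1 l W (e 0)"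
  have u: "u \<in> sp S (- s)" "L.bv (- 1) l W (e 0) \<in> sp S (- s)" "L.bv 1 l W (e 0) \<in> sp S (- s)"
   unfolding u_def using A.blin_in[OF A.bopD(1)[OF L.bv_props(2)[OF _ x]]] by (auto intro!: A.H.V_add)
  have "eigenproj S D H lam0 (e 0) = e 0" using proj_0[OF e00[OF n0]] e(3)[OF e(1)[OF n0]] by simp
  hence "A_op S s D H lam0 l (\<iota> W) (e 0) = (1 / 2) *\<^sub>C (SUM i<n. pairing S (e i) u *\<^sub>C e i)"
   using proj_s[OF u(1)] by (simp add: A_op_def Let_def u_def L.bv_def)
  moreover have "pairing S (e 0) (SUM i<n. pairing S (e i) u *\<^sub>C e i) = pairing S (e 0) u"
  proof -
   have "pairing S (e 0) (SUM i<n. pairing S (e i) u *\<^sub>C e i) = (SUM i<n. pairing S (e i) u * pairing S (e 0) (e i))"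
    using e00 n0 by (intro A.pairing_combination_right[of _ 0]) auto
   also have "... = (SUM i<n. if i = 0 then pairing S (e i) u else 0)" using e(2)[OF n0] A.pairing_0[OF e00 e00] n0 by (intro sum.cong) auto
   finally show ?thesis using n0 by simp
  qed
  moreover have "pairing S (e 0) u = of_real (2 * Re (pairing S (e 0) (L.Y (l, W) (e 0))))"
   unfolding u_def A.pairing_add_right[OF es[OF n0] u(2,3)] R.boundary_limits(2)[OF x es[OF n0] es[OF n0]]
   by (simp add: L.Y_def complex_add_cnj[symmetric] del: of_real_mult)
  moreover have "(SUM i<n. pairing S (e i) u *\<^sub>C e i) \<in> sp S (- 0)" using e00 by (auto intro!: A.H.V_sum A.H.V_scale)
  ultimately show ?thesis using A.pairing_scale_right[OF e00[OF n0], of "SUM i<n. pairing S (e i) u *\<^sub>C e i" "1 / 2"] by simp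
 qed
 have branch: "eigenvalue_branch S k s D H lam0 \<iota> (e 0) N r lam" unfolding eigenvalue_branch_def interval
 proof (intro conjI ballI)
  fix W l and \<sigma> :: real assume W: "W \<in> N" and l: "l \<in> {lam0 - r<..<lam0 + r}"
  hence x: "(l, W) \<in> L.U" using M(12)[OF W] interval by blast
  show "EX R. is_boundary_value S s D (%g. ?T g + \<iota> W g) \<sigma> l R" if "\<sigma> \<in> {1, - 1}" using L.bv_props(1)[OF that x] by blast
  have "pairing S (e 0) (A_op S s D H lam0 l (\<iota> W) (e 0)) = 1 \<longleftrightarrow> Re (pairing S (e 0) (L.Y (l, W) (e 0))) = 1"
   unfolding A_eq[OF x] by (metis of_real_1 of_real_eq_iff)
  thus "pairing S (e 0) (A_op S s D H lam0 l (\<iota> W) (e 0)) = 1 \<longleftrightarrow> l = lam W" using M(12)[OF W] l interval by blast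
 qed (use M in auto)
 have "ALL W:M \<inter> Nb. lam W \<in> {lam0 - r<..<lam0 + r} & embedded_eigenvalue S D (%f. H f + \<iota> W f) (lam W)"
  unfolding interval using M(5,11,13) by blast
 moreover have "of_real (1 / hnorm S 0 \<psi>1) *\<^sub>C \<psi>1 = e 0" by (simp only: e\<psi> \<psi>_def \<nu>_def)
 ultimately show ?thesis using M(1-8) branch by (intro exI[of _ M] exI[of _ Nb] exI[of _ r] exI[of _ N] exI[of _ lam]) simp
qed

end
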